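(* Let $u=(u^1,\dots,u^N)\in V_2(Q_T)$ be a weak solution in $Q_T$ of the system $$u_t^i-D_\alpha\left(a_{ij}^{\alpha\beta}(z)D_\beta u^j\right)=-\operatorname{div} f^i,\qquad i=1,\dots,N .$$ Let $a_{ij}^{\alpha\beta}\in C(\overline{Q_T})$ satisfy the uniform ellipticity condition $\Lambda^{-1}|\xi|^2\le a_{ij}^{\alpha\beta}(z)\xi^i_\alpha\xi^j_\beta\le\Lambda|\xi|^2$ for all $\xi\in\mathbb{R}^{nN}$ and $z\in Q_T$, where $\Lambda>0$ is a constant, and let $f^i\in L_\varphi^{2,\lambda}(Q_T)$ for $i=1,\dots,N$. Suppose that $\lambda<\gamma<n+2$ and that the function $r\mapsto \frac{r^{\gamma-\lambda}}{\varphi^2(r)}$ is almost increasing. Then $Du\in L_\varphi^{2,\lambda}(Q')$ for every $Q'\subset\subset Q_T$. Moreover, there is a constant $C$, independent of $z_0,\rho,R,u,f$, such that whenever $Q_R(z_0)\subset Q_T$ and $0<\rho\le R$, $$\iint_{Q_\rho(z_0)}|Du|^2\,dz\le C\,\frac{\rho^\lambda\varphi^2(\rho)}{R^\lambda\varphi^2(R)}\iint_{Q_R(z_0)}|Du|^2\,dz+C\,\varphi^2(\rho)\rho^\lambda\|f\|_{L_\varphi^{2,\lambda}(Q_T)}^2 .$$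
   Context: Let $\Omega\subset\mathbb{R}^n$ be a bounded domain, $T>0$, $Q_T=\Omega\times(0,T]$, and let $d$ be the diameter of $Q_T$. Points are written $z=(x,t)$, $z_0=(x_0,t_0)$ with $x,x_0\in\mathbb{R}^n$. Indices $i,j$ run over $1,\dots,N$ and $\alpha,\beta$ over $1,\dots,n$; repeated indices are summed. $D$ denotes the spatial gradient, $D_\alpha=\partial/\partial x_\alpha$, and $\operatorname{div}$ is the spatial divergence. Each $f^i$ is $\mathbb{R}^n$-valued, and $f=(f^1,\dots,f^N)$. $B_R(x_0)=\{x\in\mathbb{R}^n:\|x-x_0\|<R\}$ and $Q_R(z_0)=B_R(x_0)\times(t_0-R^2,t_0]$ (parabolic cylinder with vertex $z_0$). $V_2(Q_T)=\{u: u\in L^\infty(0,T;L^2(\Omega)),\ Du\in L^2(Q_T)\}$. Weak solution is understood in the usual distributional sense: $\iint_{Q_T}\left(-u^i\partial_t\eta^i+a_{ij}^{\alpha\beta}D_\beta u^jD_\alpha\eta^i\right)dz=\iint_{Q_T}f^i\cdot D\eta^i\,dz$ for all $\eta\in C_c^\infty(\Omega\times(0,T);\mathbb{R}^N)$. Generalized parabolic Morrey space: $\varphi$ is a continuous function on $[0,d]$ with $\varphi>0$ on $(0,d]$, and $0\le\lambda\le n+2$. For $Q=Q_T$ or a subset $Q=Q'$ of it, $L_\varphi^{2,\lambda}(Q)$ is the set of $g\in L^2(Q)$ (scalar or vector valued) with $$\|g\|_{L_\varphi^{2,\lambda}(Q)}=\sup_{z_0\in Q,\ 0<\rho\le d}\frac{1}{\varphi(\rho)}\left(\rho^{-\lambda}\iint_{Q\cap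 Q_\rho(z_0)}|g|^2\,dz\right)^{1/2}<\infty .$$ A nonnegative function $h$ on an interval is almost increasing if there is $K_h\ge1$ with $h(s)\le K_h h(t)$ for all $s\le t$ in the interval; here the interval is $(0,d]$. *)

theory Defs
  imports "HOL-Analysis.Analysis"
begin

text \<open>
  Space-time points \<open>z = (x, t)\<close> have type \<open>(real^'n) \<times> real\<close>, so \<open>n = CARD('n)\<close>; the number of
  equations is \<open>N = CARD('m)\<close>. Families \<open>\<xi>\<^sup>i\<^sub>\<alpha>\<close> (the gradient of \<open>u\<close>, the data \<open>f\<close>) are of type
  \<open>real^'n^'m\<close>, with \<open>\<xi> $ i $ \<alpha>\<close> the entry \<open>\<xi>\<^sup>i\<^sub>\<alpha>\<close>; the norm of this type is the Euclidean norm
  of the space of all \<open>\<xi>\<close>, of dimension \<open>n N\<close>.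
\<close>

definition QT :: "(real^'n) set \<Rightarrow> real \<Rightarrow> ((real^'n) \<times> real) set" where
  "QT \<Omega> T = \<Omega> \<times> {0<..T}"

definition cyl :: "(real^'n) \<times> real \<Rightarrow> real \<Rightarrow> ((real^'n) \<times> real) set" where
  "cyl z0 R = ball (fst z0) R \<times> {snd z0 - R\<^sup>2 <.. snd z0}"

definition L2 :: "'a::euclidean_space set \<Rightarrow> ('a \<Rightarrow> 'b::euclidean_space) set" where
  "L2 Q = {g. set_borel_measurable lebesgue Q g \<and>
              set_integrable lebesgue Q (\<lambda>z. (norm (g z))\<^sup>2)}"


subsection \<open>Generalized parabolic Morrey spaces\<close>

text \<open>The number \<open>d\<close> is the diameter of \<open>Q\<^sub>T\<close>, also when \<open>Q\<close> is a smaller set.\<close>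

definition morrey_quotient ::
  "real \<Rightarrow> (real \<Rightarrow> real) \<Rightarrow> ((real^'n) \<times> real) set \<Rightarrow> ((real^'n) \<times> real \<Rightarrow> 'b::euclidean_space)
    \<Rightarrow> (real^'n) \<times> real \<Rightarrow> real \<Rightarrow> real" where
  "morrey_quotient lam \<phi> Q g z0 \<rho> =
     1 / \<phi> \<rho> * sqrt (\<rho> powr (- lam) * (LINT z:Q \<inter> cyl z0 \<rho>|lebesgue. (norm (g z))\<^sup>2))"

definition morrey_space ::
  "real \<Rightarrow> real \<Rightarrow> (real \<Rightarrow> real) \<Rightarrow> ((real^'n) \<times> real) set
    \<Rightarrow> ((real^'n) \<times> real \<Rightarrow> 'b::euclidean_space) set" where
  "morrey_space d lam \<phi> Q =
     {g \<in> L2 Q. bdd_above {morrey_quotient lam \<phi> Q g z0 \<rho> | z0 \<rho>. z0 \<in> Q \<and> 0 < \<rho> \<and> \<rho> \<le> d}}"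

definition morrey_norm ::
  "real \<Rightarrow> real \<Rightarrow> (real \<Rightarrow> real) \<Rightarrow> ((real^'n) \<times> real) set
    \<Rightarrow> ((real^'n) \<times> real \<Rightarrow> 'b::euclidean_space) \<Rightarrow> real" where
  "morrey_norm d lam \<phi> Q g =
     Sup {morrey_quotient lam \<phi> Q g z0 \<rho> | z0 \<rho>. z0 \<in> Q \<and> 0 < \<rho> \<and> \<rho> \<le> d}"

definition almost_increasing_on :: "real set \<Rightarrow> (real \<Rightarrow> real) \<Rightarrow> bool" where
  "almost_increasing_on I h \<longleftrightarrow>
     (\<forall>s\<in>I. 0 \<le> h s) \<and> (\<exists>K\<ge>1. \<forall>s\<in>I. \<forall>t\<in>I. s \<le> t \<longrightarrow> h s \<le> K * h t)"


subsection \<open>Test functions\<close>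

primrec Ck :: "nat \<Rightarrow> ('a::euclidean_space \<Rightarrow> 'b::euclidean_space) \<Rightarrow> bool" where
  "Ck 0 \<eta> \<longleftrightarrow> continuous_on UNIV \<eta>"
| "Ck (Suc k) \<eta> \<longleftrightarrow> (\<forall>z. \<eta> differentiable (at z)) \<and>
     (\<forall>v. Ck k (\<lambda>z. frechet_derivative \<eta> (at z) v))"

text \<open>\<open>C\<^sub>c\<^sup>\<infinity>(U)\<close>, its elements being extended by zero to the whole space.\<close>

definition test_functions :: "'a::euclidean_space set \<Rightarrow> ('a \<Rightarrow> 'b::euclidean_space) set" where
  "test_functions U = {\<eta>. (\<forall>k. Ck k \<eta>) \<and>
     compact (closure {z. \<eta> z \<noteq> 0}) \<and> closure {z. \<eta> z \<noteq> 0} \<subseteq> U}"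

text \<open>Classical derivatives \<open>D\<^sub>\<alpha>\<close> and \<open>\<partial>\<^sub>t\<close>.\<close>

definition Dx :: "'n \<Rightarrow> ((real^'n) \<times> real \<Rightarrow> 'b::euclidean_space) \<Rightarrow> (real^'n) \<times> real \<Rightarrow> 'b" where
  "Dx \<alpha> \<eta> z = frechet_derivative \<eta> (at z) (axis \<alpha> 1, 0)"

definition Dt :: "((real^'n) \<times> real \<Rightarrow> 'b::euclidean_space) \<Rightarrow> (real^'n) \<times> real \<Rightarrow> 'b" where
  "Dt \<eta> z = frechet_derivative \<eta> (at z) (0, 1)"


subsection \<open>The energy space and weak solutions\<close>

definition Linf_L2 :: "(real^'n) set \<Rightarrow> real \<Rightarrow> ((real^'n) \<times> real \<Rightarrow> real^'m) set" where
  "Linf_L2 \<Omega> T = {u. set_borel_measurable lebesgue (QT \<Omega> T) u \<and>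
     (\<exists>M. AE t\<in>{0<..<T} in lebesgue.
        (\<lambda>x. u (x, t)) \<in> L2 \<Omega> \<and> (LINT x:\<Omega>|lebesgue. (norm (u (x, t)))\<^sup>2) \<le> M)}"

definition weak_spatial_gradient ::
  "(real^'n) set \<Rightarrow> real \<Rightarrow> ((real^'n) \<times> real \<Rightarrow> real^'m) \<Rightarrow> ((real^'n) \<times> real \<Rightarrow> real^'n^'m) \<Rightarrow> bool"
  where
  "weak_spatial_gradient \<Omega> T u Du \<longleftrightarrow>
     (\<forall>K. compact K \<and> K \<subseteq> \<Omega> \<times> {0<..<T} \<longrightarrow>
        set_integrable lebesgue K u \<and> set_integrable lebesgue K Du) \<and>
     (\<forall>\<psi>::(real^'n) \<times> real \<Rightarrow> real. \<psi> \<in> test_functions (\<Omega> \<times> {0<..<T}) \<longrightarrow>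
        (\<forall>j \<beta>. (LINT z:QT \<Omega> T|lebesgue. u z $ j * Dx \<beta> \<psi> z) =
               - (LINT z:QT \<Omega> T|lebesgue. Du z $ j $ \<beta> * \<psi> z)))"

text \<open>
  \<open>V2 \<Omega> T u Du\<close>: the function \<open>u\<close> belongs to \<open>V\<^sub>2(Q\<^sub>T)\<close>, and \<open>Du\<close> is its weak spatial gradient
  (which \<open>u\<close> determines up to a null set).
\<close>

definition V2 ::
  "(real^'n) set \<Rightarrow> real \<Rightarrow> ((real^'n) \<times> real \<Rightarrow> real^'m) \<Rightarrow> ((real^'n) \<times> real \<Rightarrow> real^'n^'m) \<Rightarrow> bool"
  where
  "V2 \<Omega> T u Du \<longleftrightarrow>
     u \<in> Linf_L2 \<Omega> T \<and> weak_spatial_gradient \<Omega> T u Du \<and> Du \<in> L2 (QT \<Omega> T)"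

text \<open>The coefficient \<open>a\<close> with upper indices \<open>\<alpha>, \<beta>\<close> and lower indices \<open>i, j\<close> is \<open>a i j \<alpha> \<beta>\<close>.\<close>

definition uniformly_elliptic ::
  "real \<Rightarrow> ((real^'n) \<times> real) set \<Rightarrow> ('m::finite \<Rightarrow> 'm \<Rightarrow> 'n \<Rightarrow> 'n \<Rightarrow> (real^'n) \<times> real \<Rightarrow> real) \<Rightarrow> bool" where
  "uniformly_elliptic \<Lambda> Q a \<longleftrightarrow> (\<forall>\<xi>::real^'n^'m. \<forall>z\<in>Q.
     inverse \<Lambda> * (norm \<xi>)\<^sup>2 \<le> (\<Sum>i\<in>UNIV. \<Sum>j\<in>UNIV. \<Sum>\<alpha>\<in>UNIV. \<Sum>\<beta>\<in>UNIV. a i j \<alpha> \<beta> z * \<xi> $ i $ \<alpha> * \<xi> $ j $ \<beta>) \<and>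
     (\<Sum>i\<in>UNIV. \<Sum>j\<in>UNIV. \<Sum>\<alpha>\<in>UNIV. \<Sum>\<beta>\<in>UNIV. a i j \<alpha> \<beta> z * \<xi> $ i $ \<alpha> * \<xi> $ j $ \<beta>) \<le> \<Lambda> * (norm \<xi>)\<^sup>2)"

text \<open>Weak solutions of \<open>u\<^sub>t - D\<^sub>\<alpha>(a D\<^sub>\<beta>u) = - div f\<close>, where \<open>Du\<close> is the weak spatial gradient of \<open>u\<close>.\<close>

definition weak_solution ::
  "(real^'n) set \<Rightarrow> real \<Rightarrow> ('m::finite \<Rightarrow> 'm \<Rightarrow> 'n \<Rightarrow> 'n \<Rightarrow> (real^'n) \<times> real \<Rightarrow> real)
    \<Rightarrow> ((real^'n) \<times> real \<Rightarrow> real^'n^'m)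
    \<Rightarrow> ((real^'n) \<times> real \<Rightarrow> real^'m) \<Rightarrow> ((real^'n) \<times> real \<Rightarrow> real^'n^'m) \<Rightarrow> bool" where
  "weak_solution \<Omega> T a f u Du \<longleftrightarrow>
     (\<forall>\<eta>::(real^'n) \<times> real \<Rightarrow> real^'m. \<eta> \<in> test_functions (\<Omega> \<times> {0<..<T}) \<longrightarrow>
        (LINT z:QT \<Omega> T|lebesgue.
           - (\<Sum>i\<in>UNIV. u z $ i * Dt \<eta> z $ i)
           + (\<Sum>i\<in>UNIV. \<Sum>j\<in>UNIV. \<Sum>\<alpha>\<in>UNIV. \<Sum>\<beta>\<in>UNIV. a i j \<alpha> \<beta> z * Du z $ j $ \<beta> * Dx \<alpha> \<eta> z $ i))
        = (LINT z:QT \<Omega> T|lebesgue. \<Sum>i\<in>UNIV. \<Sum>\<alpha>\<in>UNIV. f z $ i $ \<alpha> * Dx \<alpha> \<eta> z $ i))"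

end

theory Submission
imports Defs
begin

text \<open>
  Freeze the coefficients and rescale to the unit cylinder. Convolving a weak solution \<open>u\<close> with a kernel
  supported in small positive times gives a smooth solution \<open>U\<close> on a region reaching slightly beyond the top
  of the cylinder. The energy estimate for \<open>U - U(\<cdot> - (y, 0))\<close> bounds the \<open>L\<^sup>2\<close> distance of \<open>DU\<close> from its
  average over small spatial translations by \<open>\<epsilon>\<^sup>2\<close> times the energy plus a multiple of \<open>\<parallel>g\<parallel>\<^sup>2\<close>. The spatial
  derivatives of that average fall on the averaging kernel, are themselves smooth solutions, and are
  therefore bounded by repeated energy estimates; the equation then bounds one time derivative. Narrowing
  the cylinder in each of its \<open>n + 1\<close> directions (the time width being \<open>\<tau>\<^sup>2\<close>) yields the decay \<open>\<tau>\<^sup>n\<^sup>+\<^sup>2\<close>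
  of the energy, uniformly over coefficients with given bounds, and the limit of vanishing mollification
  transfers it to \<open>u\<close>. For variable coefficients the oscillation is moved into the right-hand side
  \<open>g = f + (a(z\<^sub>0) - a) Du\<close>. The resulting inequality
  \<open>E(\<tau>r) \<le> q E(r) + B r\<^sup>\<lambda>\<phi>(r)\<^sup>2\<close> with \<open>q < \<tau>\<^sup>\<gamma>\<close> is iterated using the almost monotonicity of
  \<open>r\<^sup>\<gamma>\<^sup>-\<^sup>\<lambda>/\<phi>\<^sup>2\<close>.
\<close>

subsection \<open>Continuous functions of bounded support\<close>

text \<open>No comparison problem is solved: the constant-coefficient estimate is proved for smooth
  solutions and transferred by mollification, so neither existence theory nor time regularity of
  \<open>u\<close> enters. The obstacle is the right-hand side \<open>g\<close>, which is only
  square integrable: \<open>DU\<close> has no derivative bounds that survive the limit. Hence only a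
  spatial average of \<open>DU\<close> is differentiated. The derivatives of the kernel are paid for
  by multiples of the norm of \<open>g\<close> alone, while the energy of \<open>DU\<close> keeps a
  constant independent of the kernel. This fixes the order of choices: a constant \<open>C\<close>
  from the coefficient bounds and dimensions, then \<tau> with \<open>C\<close> \<tau>^(n+2) well
  below \<tau>^\<gamma>, then the averaging radius, with square at most \<tau>^(n+2), then the
  constant in front of the norm of \<open>g\<close>, then the admissible oscillation of the
  coefficients, and last the largest radius \<open>R0\<close>. Estimates must reach the top of the
  cylinder, where a cutoff cannot vanish; a kernel that looks only into the past leaves room
  \<open>c0\<close> above it. This room shrinks to zero with the kernel, so every constant has to be
  independent of \<open>c0\<close>.\<close>

definition cc :: "('a::euclidean_space \<Rightarrow> real) \<Rightarrow> bool" where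
  "cc F \<longleftrightarrow> continuous_on UNIV F \<and> (\<exists>R. \<forall>z. R < norm z \<longrightarrow> F z = 0)"

lemma ccI: "continuous_on UNIV F \<Longrightarrow> (\<And>z. R < norm z \<Longrightarrow> F z = 0) \<Longrightarrow> cc F"
  unfolding cc_def by blast

lemma cc_continuous: "cc F \<Longrightarrow> continuous_on UNIV F"
  by (simp add: cc_def)

lemma cc_supp:
  assumes "cc F"
  obtains R where "0 < R" "\<And>z. R < norm z \<Longrightarrow> F z = 0"
proof -
  obtain R where R: "\<And>z. R < norm z \<Longrightarrow> F z = 0" using assms unfolding cc_def by blast
  show thesis by (rule that[of "max R 1"]) (auto intro: R)
qed

lemma cc_measurable [measurable_dest]: "cc F \<Longrightarrow> F \<in> borel_measurable borel"
  by (simp add: cc_def borel_measurable_continuous_onI)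

lemma cc_bounded:
  assumes "cc F"
  obtains B where "0 < B" "\<And>z. \<bar>F z\<bar> \<le> B"
proof -
  obtain R where R: "0 < R" "\<And>z. R < norm z \<Longrightarrow> F z = 0" using cc_supp[OF assms] by blast
  have "compact (F ` cball 0 R)"
    by (intro compact_continuous_image continuous_on_subset[OF cc_continuous[OF assms]]) auto
  then obtain B where B: "\<And>y. y \<in> F ` cball 0 R \<Longrightarrow> norm y \<le> B" by (meson bounded_iff compact_imp_bounded)
  show thesis
  proof (rule that[of "max B 1"])
    fix z show "\<bar>F z\<bar> \<le> max B 1"
      using B[of "F z"] R(2)[of z] by (cases "norm z \<le> R") (auto simp: max_def)
  qed auto
qed

lemma cc_uniform:
  assumes "cc F"
  shows "uniformly_continuous_on UNIV F"
proof -
  obtain R where R: "0 < R" "\<And>z. R < norm z \<Longrightarrow> F z = 0" using cc_supp[OF assms] by blast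
  have uc: "uniformly_continuous_on (cball 0 (R+1)) F"
    by (intro compact_uniformly_continuous continuous_on_subset[OF cc_continuous[OF assms]]) auto
  show ?thesis
    unfolding uniformly_continuous_on_def
  proof (intro allI impI)
    fix e :: real assume "0 < e"
    then obtain d where d: "0 < d" "\<And>x y. x \<in> cball 0 (R+1) \<Longrightarrow> y \<in> cball 0 (R+1) \<Longrightarrow> dist y x < d \<Longrightarrow> dist (F y) (F x) < e"
      using uc unfolding uniformly_continuous_on_def by blast
    \<comment> \<open>Two points less than 1 apart lie either both in the ball of radius
      \<open>R + 1\<close> or both outside the support; hence the minimum with 1.\<close>
    show "\<exists>d>0. \<forall>x\<in>UNIV. \<forall>x'\<in>UNIV. dist x' x < d \<longrightarrow> dist (F x') (F x) < e"
    proof (intro exI[of _ "min d 1"] conjI ballI impI)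
      fix x y :: 'a assume xy: "dist y x < min d 1"
      have nn: "norm y \<le> norm x + 1" "norm x \<le> norm y + 1"
        using xy norm_triangle_ineq2[of y x] norm_triangle_ineq2[of x y] by (auto simp: dist_norm norm_minus_commute)
      show "dist (F y) (F x) < e"
      proof (cases "norm x \<le> R + 1 \<and> norm y \<le> R + 1")
        case True then show ?thesis using d(2)[of x y] xy by auto
      next
        case False
        then have "R < norm x" "R < norm y" using nn by auto
        then show ?thesis using R(2) \<open>0 < e\<close> by simp
      qed
    qed (use d in auto)
  qed
qed

lemma integrable_cball_bound:
  fixes F :: "'a::euclidean_space \<Rightarrow> real"
  assumes [measurable]: "F \<in> borel_measurable borel" and "\<And>z. \<bar>F z\<bar> \<le> B * indicator (cball 0 R) z"
  shows "integrable lborel F"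
proof (rule Bochner_Integration.integrable_bound)
  show "integrable lborel (\<lambda>z. B * indicator (cball (0::'a) R) z)"
    using emeasure_lborel_cball_finite[of "0::'a" R]
    by (intro integrable_mult_right integrable_real_indicator) (auto simp: less_top[symmetric])
qed (use assms in \<open>auto intro!: order_trans[OF _ abs_ge_self]\<close>)

lemma cc_integrable [simp, intro]:
  assumes "cc F" shows "integrable lborel F"
proof -
  obtain R where R: "0 < R" "\<And>z. R < norm z \<Longrightarrow> F z = 0" using cc_supp[OF assms] by blast
  obtain B where B: "0 < B" "\<And>z. \<bar>F z\<bar> \<le> B" using cc_bounded[OF assms] by blast
  show ?thesis
    by (rule integrable_cball_bound[of _ B R]) (use assms R B in \<open>auto simp: cc_measurable indicator_def\<close>)
qed

lemma cc_mult_left: "continuous_on UNIV G \<Longrightarrow> cc F \<Longrightarrow> cc (\<lambda>z. G z * F z)"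
  unfolding cc_def by (auto intro!: continuous_intros)

lemma cc_mult_right: "cc F \<Longrightarrow> continuous_on UNIV G \<Longrightarrow> cc (\<lambda>z. F z * G z)"
  unfolding cc_def by (auto intro!: continuous_intros)

lemma cc_mult: "cc F \<Longrightarrow> cc G \<Longrightarrow> cc (\<lambda>z. F z * G z)"
  by (rule cc_mult_right) (auto simp: cc_continuous)

lemma cc_0: "cc (\<lambda>z. 0)" by (auto simp: cc_def)

lemma cc_add: assumes "cc F" "cc G" shows "cc (\<lambda>z. F z + G z)"
proof -
  obtain R where R: "0 < R" "\<And>z. R < norm z \<Longrightarrow> F z = 0" using cc_supp[OF assms(1)] by blast
  obtain S where S: "0 < S" "\<And>z. S < norm z \<Longrightarrow> G z = 0" using cc_supp[OF assms(2)] by blast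
  show ?thesis
  proof (rule ccI[of _ "max R S"])
    show "continuous_on UNIV (\<lambda>z. F z + G z)"
      using assms by (intro continuous_intros cc_continuous)
  qed (use R S in auto)
qed

lemma cc_cmult: "cc F \<Longrightarrow> cc (\<lambda>z. c * F z)"
  by (rule cc_mult_left) auto

lemma cc_uminus: "cc F \<Longrightarrow> cc (\<lambda>z. - F z)"
  using cc_cmult[of F "-1"] by simp

lemma cc_diff: "cc F \<Longrightarrow> cc G \<Longrightarrow> cc (\<lambda>z. F z - G z)"
  using cc_add[OF _ cc_uminus, of F G] by simp

lemma cc_sum: "(\<And>i. i \<in> I \<Longrightarrow> cc (F i)) \<Longrightarrow> cc (\<lambda>z. \<Sum>i\<in>I. F i z)"
  by (induction I rule: infinite_finite_induct) (auto simp: cc_0 cc_add)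

lemma cc_power2: "cc F \<Longrightarrow> cc (\<lambda>z. (F z)\<^sup>2)"
  by (simp add: power2_eq_square cc_mult)

lemma cc_translate: fixes a :: "'a::euclidean_space" assumes "cc F" shows "cc (\<lambda>z. F (z + a))"
proof -
  obtain R where R: "0 < R" "\<And>z. R < norm z \<Longrightarrow> F z = 0" using cc_supp[OF assms] by blast
  show ?thesis
  proof (rule ccI[of _ "R + norm a"])
    show "continuous_on UNIV (\<lambda>z. F (z + a))"
      by (rule continuous_on_compose2[OF cc_continuous[OF assms]]) (auto intro!: continuous_intros)
    fix z :: 'a assume "R + norm a < norm z"
    then have "R < norm (z + a)" using norm_triangle_ineq[of "z + a" "- a"] by simp
    then show "F (z + a) = 0" by (rule R)
  qed
qed

subsection \<open>Changes of variables\<close>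

lemma lborel_integrable_translate:
  fixes f :: "'a::euclidean_space \<Rightarrow> 'b::{banach,second_countable_topology}"
  assumes "integrable lborel f"
  shows "integrable lborel (\<lambda>x. f (x + a))"
proof -
  have "integrable (distr lborel borel ((+) a)) f" using assms by (simp add: lborel_distr_plus)
  then have "integrable lborel (\<lambda>x. f (a + x))" by (subst (asm) integrable_distr_eq) (use assms in auto)
  then show ?thesis by (simp add: add.commute)
qed

lemma lborel_integral_translate:
  fixes f :: "'a::euclidean_space \<Rightarrow> 'b::{banach,second_countable_topology}"
  assumes "f \<in> borel_measurable borel"
  shows "(LINT x|lborel. f (x + a)) = (LINT x|lborel. f x)"
proof -
  have "(LINT x|lborel. f x) = (LINT x|distr lborel borel ((+) a). f x)" by (simp add: lborel_distr_plus)
  also have "\<dots> = (LINT x|lborel. f (a + x))" by (subst integral_distr) (use assms in auto)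
  finally show ?thesis by (simp add: add.commute)
qed

lemma nn_integral_translate:
  fixes f :: "'a::euclidean_space \<Rightarrow> ennreal"
  assumes "f \<in> borel_measurable borel"
  shows "(\<integral>\<^sup>+x. f (x + a) \<partial>lborel) = (\<integral>\<^sup>+x. f x \<partial>lborel)"
proof -
  have "(\<integral>\<^sup>+x. f x \<partial>lborel) = (\<integral>\<^sup>+x. f x \<partial>distr lborel borel ((+) a))" by (simp add: lborel_distr_plus)
  also have "\<dots> = (\<integral>\<^sup>+x. f (a + x) \<partial>lborel)" by (subst nn_integral_distr) (use assms in auto)
  finally show ?thesis by (simp add: add.commute)
qed

lemma lborel_distr_reflect: "distr lborel borel (\<lambda>x. a - x) = (lborel :: 'a::euclidean_space measure)"
  by (subst lborel_affine[of "-1" a]) (auto simp: density_1)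

lemma lborel_integral_reflect:
  fixes f :: "'a::euclidean_space \<Rightarrow> 'b::{banach,second_countable_topology}"
  assumes "f \<in> borel_measurable borel"
  shows "(LINT x|lborel. f (a - x)) = (LINT x|lborel. f x)"
proof -
  have "(LINT x|lborel. f x) = (LINT x|distr lborel borel ((-) a). f x)" by (simp add: lborel_distr_reflect)
  also have "\<dots> = (LINT x|lborel. f (a - x))" by (subst integral_distr) (use assms in auto)
  finally show ?thesis by simp
qed

subsection \<open>Directional derivatives\<close>

text \<open>One-dimensional derivatives along a single vector, with \<open>F'\<close> again
  continuous and of bounded support. The class is stable under products and convolutions, and every
  derivative in it is integrable over the whole space.\<close>

definition dirD :: "'a::euclidean_space \<Rightarrow> ('a \<Rightarrow> real) \<Rightarrow> ('a \<Rightarrow> real) \<Rightarrow> bool" where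
  "dirD v F F' \<longleftrightarrow> cc F \<and> cc F' \<and>
     (\<forall>z. ((\<lambda>s. F (z + s *\<^sub>R v)) has_real_derivative F' z) (at 0))"

lemma dirD_cc: "dirD v F F' \<Longrightarrow> cc F" "dirD v F F' \<Longrightarrow> cc F'"
  by (auto simp: dirD_def)

lemma line_deriv_shift:
  fixes F :: "'a::real_normed_vector \<Rightarrow> real"
  assumes "\<And>z. ((\<lambda>s. F (z + s *\<^sub>R v)) has_real_derivative F' z) (at 0)"
  shows "((\<lambda>s. F (z + s *\<^sub>R v)) has_real_derivative F' (z + s *\<^sub>R v)) (at s)"
proof -
  have "((\<lambda>h. F ((z + s *\<^sub>R v) + (h - s) *\<^sub>R v)) has_real_derivative F' (z + s *\<^sub>R v)) (at s)"
    using DERIV_at_within_shift[of "\<lambda>h. F ((z + s *\<^sub>R v) + (h - s) *\<^sub>R v)"]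
      assms[of "z + s *\<^sub>R v"] DERIV_shift[of "\<lambda>h. F ((z + s *\<^sub>R v) + (h - s) *\<^sub>R v)" "F' (z + s *\<^sub>R v)" 0 s]
    by simp
  then show ?thesis by (simp add: algebra_simps)
qed

lemma dirD_deriv:
  "dirD v F F' \<Longrightarrow> ((\<lambda>s. F (z + s *\<^sub>R v)) has_real_derivative F' (z + s *\<^sub>R v)) (at s)"
  using line_deriv_shift[where F = F and F' = F' and v = v] unfolding dirD_def by blast

lemma dirD_unique: "dirD v F F1 \<Longrightarrow> dirD v F F2 \<Longrightarrow> F1 = F2"
  unfolding dirD_def by (auto intro!: ext DERIV_unique)

lemma dirD_mult: "dirD v F F' \<Longrightarrow> dirD v G G' \<Longrightarrow> dirD v (\<lambda>z. F z * G z) (\<lambda>z. F' z * G z + F z * G' z)"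
  unfolding dirD_def by (auto intro!: cc_mult cc_add derivative_eq_intros)

lemma dirD_diff: "dirD v F F' \<Longrightarrow> dirD v G G' \<Longrightarrow> dirD v (\<lambda>z. F z - G z) (\<lambda>z. F' z - G' z)"
  unfolding dirD_def by (auto intro!: cc_diff derivative_intros)

lemma dirD_cmult: "dirD v F F' \<Longrightarrow> dirD v (\<lambda>z. c * F z) (\<lambda>z. c * F' z)"
  unfolding dirD_def by (auto intro!: cc_cmult DERIV_cmult)

lemma dirD_sum: "(\<And>i. i \<in> I \<Longrightarrow> dirD v (F i) (F' i)) \<Longrightarrow> dirD v (\<lambda>z. \<Sum>i\<in>I. F i z) (\<lambda>z. \<Sum>i\<in>I. F' i z)"
  unfolding dirD_def by (auto intro!: cc_sum DERIV_sum)

lemma dirD_translate: assumes "dirD v F F'" shows "dirD v (\<lambda>z. F (z + a)) (\<lambda>z. F' (z + a))"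
proof -
  have "((\<lambda>s. F ((z + a) + s *\<^sub>R v)) has_real_derivative F' (z + a)) (at 0)" for z
    using assms unfolding dirD_def by blast
  then show ?thesis
    using assms cc_translate[of F a] cc_translate[of F' a] unfolding dirD_def by (simp add: add.assoc add.commute[of a])
qed

text \<open>Mean value inequality for \<open>F\<close> minus a linear function of slope
  \<open>c\<close>. It serves twice: \<open>c = 0\<close> gives a Lipschitz bound,
  \<open>c = F' z\<close> gives differentiability with a uniform rate.\<close>

lemma dirD_increment:
  assumes "dirD v F F'" "\<And>r. \<bar>r\<bar> \<le> \<bar>s\<bar> \<Longrightarrow> \<bar>F' (z + r *\<^sub>R v) - c\<bar> \<le> e"
  shows "\<bar>F (z + s *\<^sub>R v) - F z - s * c\<bar> \<le> \<bar>s\<bar> * e"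
proof -
  have "norm ((\<lambda>r. F (z + r *\<^sub>R v) - r * c) s - (\<lambda>r. F (z + r *\<^sub>R v) - r * c) 0) \<le> e * norm (s - 0)"
  proof (rule field_differentiable_bound[of "{-\<bar>s\<bar>..\<bar>s\<bar>}" _ "\<lambda>r. F' (z + r *\<^sub>R v) - c"])
    fix r assume "r \<in> {-\<bar>s\<bar>..\<bar>s\<bar>}"
    show "((\<lambda>r. F (z + r *\<^sub>R v) - r * c) has_field_derivative F' (z + r *\<^sub>R v) - c) (at r within {-\<bar>s\<bar>..\<bar>s\<bar>})"
      by (auto intro!: derivative_eq_intros has_field_derivative_at_within[OF dirD_deriv[OF assms(1)]])
    show "norm (F' (z + r *\<^sub>R v) - c) \<le> e" using assms \<open>r \<in> _\<close> by auto
  qed (use assms in auto)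
  then show ?thesis by (simp add: algebra_simps)
qed

text \<open>Difference quotients have integral zero by translation invariance and are dominated by a
  multiple of the indicator of one ball, so the limit has integral zero. Applied to products this is
  integration by parts without boundary terms.\<close>

lemma dirD_integral_zero:
  assumes "dirD v F F'"
  shows "(LINT z|lborel. F' z) = 0"
proof -
  have cF: "cc F" "cc F'" using assms by (auto simp: dirD_def)
  obtain R where R: "0 < R" "\<And>z. R < norm z \<Longrightarrow> F z = 0" using cc_supp[OF cF(1)] by blast
  obtain B where B: "0 < B" "\<And>z. \<bar>F' z\<bar> \<le> B" using cc_bounded[OF cF(2)] by blast
  note [measurable] = cc_measurable[OF cF(1)] cc_measurable[OF cF(2)]
  define h where "h n = 1 / real (Suc n)" for n
  have h: "0 < h n" "h n \<le> 1" for n by (auto simp: h_def field_simps)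
  define q where "q n z = (F (z + h n *\<^sub>R v) - F z) / h n" for n z
  have [measurable]: "q n \<in> borel_measurable borel" for n unfolding q_def by measurable
  have "(\<lambda>n. LINT z|lborel. q n z) \<longlonglongrightarrow> (LINT z|lborel. F' z)"
  proof (rule integral_dominated_convergence[where w = "\<lambda>z. B * indicator (cball 0 (R + norm v)) z"])
    show "integrable lborel (\<lambda>z. B * indicator (cball 0 (R + norm v)) z)"
      by (intro integrable_cball_bound[of _ B "R + norm v"])
        (use B in \<open>auto intro!: borel_measurable_times borel_measurable_indicator\<close>)
    show "AE z in lborel. (\<lambda>n. q n z) \<longlonglongrightarrow> F' z"
    proof (rule AE_I2)
      fix z
      have "((\<lambda>s. (F (z + s *\<^sub>R v) - F z) / s) \<longlongrightarrow> F' z) (at 0)"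
        using assms unfolding dirD_def DERIV_def by simp
      moreover have "filterlim h (at 0) sequentially"
        unfolding filterlim_at h_def using LIMSEQ_Suc[OF lim_1_over_n] by auto
      ultimately show "(\<lambda>n. q n z) \<longlonglongrightarrow> F' z" unfolding q_def by (rule filterlim_compose)
    qed
    fix n show "AE z in lborel. norm (q n z) \<le> B * indicator (cball 0 (R + norm v)) z"
    proof (rule AE_I2)
      fix z
      have "\<bar>F (z + h n *\<^sub>R v) - F z - h n * 0\<bar> \<le> \<bar>h n\<bar> * B"
        by (rule dirD_increment[OF assms]) (use h B less_imp_le in \<open>auto\<close>)
      then have 1: "\<bar>q n z\<bar> \<le> B" unfolding q_def using h[of n] by (simp add: abs_mult divide_le_eq mult.commute)
      have 2: "q n z = 0" if "R + norm v < norm z"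
      proof -
        have "norm (h n *\<^sub>R v) \<le> norm v" using h[of n] by (simp add: mult_left_le_one_le)
        then have "R < norm (z + h n *\<^sub>R v)"
          using that norm_triangle_ineq[of "z + h n *\<^sub>R v" "- (h n *\<^sub>R v)"] by simp
        moreover have "R < norm z" using that norm_ge_zero[of v] by linarith
        ultimately show ?thesis using R by (simp add: q_def)
      qed
      show "norm (q n z) \<le> B * indicator (cball 0 (R + norm v)) z"
        using 1 2 by (auto simp: indicator_def)
    qed
  qed measurable
  moreover have "(LINT z|lborel. q n z) = 0" for n
  proof -
    have "(LINT z|lborel. q n z) = ((LINT z|lborel. F (z + h n *\<^sub>R v)) - (LINT z|lborel. F z)) / h n"
      unfolding q_def using cF cc_translate[OF cF(1)] by (simp add: cc_integrable)
    then show ?thesis by (simp add: lborel_integral_translate)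
  qed
  ultimately show ?thesis by (simp add: LIMSEQ_unique tendsto_const)
qed

subsection \<open>Averages and convolutions\<close>

text \<open>Cauchy-Schwarz after splitting the weight as
  \<open>sqrt \<bar>h\<bar> * sqrt \<bar>h\<bar>\<close>. If \<open>h y * q y\<close> is not
  integrable, the Bochner integral on the left is 0 by convention.\<close>

lemma square_integral_le:
  fixes h q :: "'b::euclidean_space \<Rightarrow> real"
  assumes [measurable]: "h \<in> borel_measurable borel" "q \<in> borel_measurable borel"
  shows "ennreal ((LINT y|lborel. h y * q y)\<^sup>2)
    \<le> (\<integral>\<^sup>+y. ennreal \<bar>h y\<bar> \<partial>lborel) * (\<integral>\<^sup>+y. ennreal \<bar>h y\<bar> * ennreal ((q y)\<^sup>2) \<partial>lborel)"
proof (cases "integrable lborel (\<lambda>y. h y * q y)")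
  case True
  have "ennreal ((LINT y|lborel. h y * q y)\<^sup>2) = (ennreal \<bar>LINT y|lborel. h y * q y\<bar>)\<^sup>2"
    by (simp add: ennreal_power)
  also have "\<dots> \<le> (\<integral>\<^sup>+y. ennreal \<bar>h y * q y\<bar> \<partial>lborel)\<^sup>2"
    using integral_norm_bound_ennreal[OF True] by (intro power_mono) auto
  also have "(\<lambda>y. ennreal \<bar>h y * q y\<bar>) = (\<lambda>y. ennreal (sqrt \<bar>h y\<bar>) * ennreal (sqrt \<bar>h y\<bar> * \<bar>q y\<bar>))"
    by (simp add: ennreal_mult[symmetric] abs_mult mult.assoc[symmetric])
  also have "(\<integral>\<^sup>+y. ennreal (sqrt \<bar>h y\<bar>) * ennreal (sqrt \<bar>h y\<bar> * \<bar>q y\<bar>) \<partial>lborel)\<^sup>2 \<le>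
     (\<integral>\<^sup>+y. ennreal (sqrt \<bar>h y\<bar>) ^ 2 \<partial>lborel) * (\<integral>\<^sup>+y. ennreal (sqrt \<bar>h y\<bar> * \<bar>q y\<bar>) ^ 2 \<partial>lborel)"
    by (intro Cauchy_Schwarz_nn_integral) auto
  also have "\<dots> = (\<integral>\<^sup>+y. ennreal \<bar>h y\<bar> \<partial>lborel) * (\<integral>\<^sup>+y. ennreal \<bar>h y\<bar> * ennreal ((q y)\<^sup>2) \<partial>lborel)"
    by (simp add: ennreal_power power_mult_distrib ennreal_mult)
  finally show ?thesis .
qed (simp add: not_integrable_integral_eq)

text \<open>An average has L2 norm at most the mass of the weight times the largest norm among its
  ingredients: Cauchy-Schwarz in \<open>y\<close>, then Tonelli. Nonnegative integrals avoid asking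
  beforehand whether the average is square integrable.\<close>

lemma average_nn_integral_le:
  fixes h :: "'b::euclidean_space \<Rightarrow> real" and q :: "'b \<Rightarrow> 'a::euclidean_space \<Rightarrow> real"
  assumes h: "integrable lborel h"
    and q: "(\<lambda>(y, z). q y z) \<in> borel_measurable (borel \<Otimes>\<^sub>M borel)"
    and S: "S \<in> sets borel"
    and B: "0 \<le> B" "\<And>y. h y \<noteq> 0 \<Longrightarrow> (\<integral>\<^sup>+z. indicator S z * ennreal ((q y z)\<^sup>2) \<partial>lborel) \<le> ennreal B"
  shows "(\<integral>\<^sup>+z. indicator S z * ennreal ((LINT y|lborel. h y * q y z)\<^sup>2) \<partial>lborel)
    \<le> ennreal ((LINT y|lborel. \<bar>h y\<bar>)\<^sup>2 * B)"
proof -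
  note [measurable] = q S
  have [measurable]: "h \<in> borel_measurable borel" using borel_measurable_integrable[OF h] by simp
  define I where "I = (\<integral>\<^sup>+y. ennreal \<bar>h y\<bar> \<partial>lborel)"
  have I: "I = ennreal (LINT y|lborel. \<bar>h y\<bar>)"
    unfolding I_def using h by (intro nn_integral_eq_integral) auto
  have qz [measurable]: "(\<lambda>y. q y z) \<in> borel_measurable borel" for z
    using measurable_compose[OF measurable_Pair2'[of z borel borel] q] by simp
  have "(\<integral>\<^sup>+z. indicator S z * ennreal ((LINT y|lborel. h y * q y z)\<^sup>2) \<partial>lborel)
     \<le> (\<integral>\<^sup>+z. indicator S z * (I * (\<integral>\<^sup>+y. ennreal \<bar>h y\<bar> * ennreal ((q y z)\<^sup>2) \<partial>lborel)) \<partial>lborel)"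
    unfolding I_def by (intro nn_integral_mono mult_left_mono square_integral_le) auto
  also have "\<dots> = I * (\<integral>\<^sup>+z. (\<integral>\<^sup>+y. ennreal \<bar>h y\<bar> * (indicator S z * ennreal ((q y z)\<^sup>2)) \<partial>lborel) \<partial>lborel)"
    by (subst nn_integral_cmult[symmetric])
      (auto simp: nn_integral_cmult[symmetric] mult.left_commute mult.assoc intro!: nn_integral_cong)
  also have "(\<integral>\<^sup>+z. (\<integral>\<^sup>+y. ennreal \<bar>h y\<bar> * (indicator S z * ennreal ((q y z)\<^sup>2)) \<partial>lborel) \<partial>lborel)
      = (\<integral>\<^sup>+y. (\<integral>\<^sup>+z. ennreal \<bar>h y\<bar> * (indicator S z * ennreal ((q y z)\<^sup>2)) \<partial>lborel) \<partial>lborel)"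
    by (rule lborel_pair.Fubini') measurable
  also have "\<dots> = (\<integral>\<^sup>+y. ennreal \<bar>h y\<bar> * (\<integral>\<^sup>+z. indicator S z * ennreal ((q y z)\<^sup>2) \<partial>lborel) \<partial>lborel)"
    by (intro nn_integral_cong nn_integral_cmult) measurable
  also have "\<dots> \<le> (\<integral>\<^sup>+y. ennreal \<bar>h y\<bar> * ennreal B \<partial>lborel)"
  proof (intro nn_integral_mono)
    fix y show "ennreal \<bar>h y\<bar> * (\<integral>\<^sup>+z. indicator S z * ennreal ((q y z)\<^sup>2) \<partial>lborel) \<le> ennreal \<bar>h y\<bar> * ennreal B"
      using B(2)[of y] by (cases "h y = 0") (auto intro: mult_left_mono)
  qed
  also have "\<dots> = I * ennreal B" unfolding I_def by (intro nn_integral_multc) auto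
  also have "I * (I * ennreal B) = ennreal ((LINT y|lborel. \<bar>h y\<bar>)\<^sup>2 * B)"
    unfolding I using B(1) by (simp add: ennreal_mult[symmetric] power2_eq_square mult.assoc integral_nonneg_AE)
  finally show ?thesis by (simp add: mult_left_mono)
qed

definition l2 :: "('a::euclidean_space \<Rightarrow> real) \<Rightarrow> bool" where
  "l2 F \<longleftrightarrow> F \<in> borel_measurable borel \<and> integrable lborel (\<lambda>z. (F z)\<^sup>2)"

definition sqn :: "'a::euclidean_space set \<Rightarrow> ('a \<Rightarrow> real) \<Rightarrow> real" where
  "sqn S F = (LINT z|lborel. indicator S z * (F z)\<^sup>2)"

lemma l2_measurable [measurable_dest]: "l2 F \<Longrightarrow> F \<in> borel_measurable borel"
  by (simp add: l2_def)

lemma cc_l2 [simp, intro]: "cc F \<Longrightarrow> l2 F"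
  unfolding l2_def by (auto simp: cc_measurable cc_power2)

lemma l2_ind: "l2 F \<Longrightarrow> S \<in> sets borel \<Longrightarrow> integrable lborel (\<lambda>z. indicator S z * (F z)\<^sup>2)"
  unfolding l2_def using integrable_real_mult_indicator[of S lborel "\<lambda>z. (F z)\<^sup>2"] by (simp add: mult.commute)

lemma sqn_nonneg: "0 \<le> sqn S F"
  unfolding sqn_def by (intro integral_nonneg_AE) auto

lemma sqn_nn:
  "l2 F \<Longrightarrow> S \<in> sets borel \<Longrightarrow> (\<integral>\<^sup>+z. indicator S z * ennreal ((F z)\<^sup>2) \<partial>lborel) = ennreal (sqn S F)"
  unfolding sqn_def using nn_integral_eq_integral[OF l2_ind, of F S]
  by (simp add: ennreal_mult' ennreal_indicator)

lemma l2_sqn_leI: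
  assumes "F \<in> borel_measurable borel" "S \<in> sets borel" "0 \<le> B"
    "(\<integral>\<^sup>+z. indicator S z * ennreal ((F z)\<^sup>2) \<partial>lborel) \<le> ennreal B"
  shows "sqn S F \<le> B"
proof -
  have "sqn S F = enn2real (\<integral>\<^sup>+z. indicator S z * ennreal ((F z)\<^sup>2) \<partial>lborel)"
    unfolding sqn_def using assms by (subst integral_eq_nn_integral) (auto simp: ennreal_mult' ennreal_indicator)
  also have "\<dots> \<le> B" using assms(3,4) by (metis enn2real_ennreal enn2real_mono ennreal_less_top)
  finally show ?thesis .
qed

lemma l2I:
  assumes "F \<in> borel_measurable borel" "(\<integral>\<^sup>+z. ennreal ((F z)\<^sup>2) \<partial>lborel) \<le> ennreal B"
  shows "l2 F"
  unfolding l2_def using assms by (auto simp: integrable_iff_bounded top.extremum_strict order_le_less_trans)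

lemma sqn_mono_set:
  assumes "l2 F" "S \<in> sets borel" "S' \<in> sets borel" "S \<subseteq> S'" shows "sqn S F \<le> sqn S' F"
  unfolding sqn_def using assms by (intro integral_mono l2_ind) (auto simp: indicator_def)

lemma sqn_cong: "(\<And>z. z \<in> S \<Longrightarrow> F z = G z) \<Longrightarrow> sqn S F = sqn S G"
  unfolding sqn_def by (intro Bochner_Integration.integral_cong) (auto simp: indicator_def)

lemma l2_add: assumes "l2 F" "l2 G" shows "l2 (\<lambda>z. F z + G z)"
proof -
  have "integrable lborel (\<lambda>z. (F z + G z)\<^sup>2)"
  proof (rule Bochner_Integration.integrable_bound)
    show "integrable lborel (\<lambda>z. 2 * (F z)\<^sup>2 + 2 * (G z)\<^sup>2)" using assms by (auto simp: l2_def)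
    show "(\<lambda>z. (F z + G z)\<^sup>2) \<in> borel_measurable lborel" using assms by (auto simp: l2_def)
    have "(F z + G z)\<^sup>2 \<le> 2 * (F z)\<^sup>2 + 2 * (G z)\<^sup>2" for z
      using sum_squares_bound[of "F z" "G z"] by (simp add: power2_sum)
    then show "AE z in lborel. norm ((F z + G z)\<^sup>2) \<le> norm (2 * (F z)\<^sup>2 + 2 * (G z)\<^sup>2)"
      by auto
  qed
  then show ?thesis using assms by (auto simp: l2_def)
qed

lemma l2_cmult: "l2 F \<Longrightarrow> l2 (\<lambda>z. c * F z)"
  by (auto simp: l2_def power_mult_distrib)

lemma l2_diff: "l2 F \<Longrightarrow> l2 G \<Longrightarrow> l2 (\<lambda>z. F z - G z)"
  using l2_add[OF _ l2_cmult[of G "-1"], of F] by simp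

lemma l2_sum: "(\<And>i. i \<in> I \<Longrightarrow> l2 (F i)) \<Longrightarrow> l2 (\<lambda>z. \<Sum>i\<in>I. F i z)"
  by (induction I rule: infinite_finite_induct) (auto simp: l2_add intro: cc_l2 cc_0)

lemma sqn_add:
  assumes "l2 F" "l2 G" "S \<in> sets borel"
  shows "sqn S (\<lambda>z. F z + G z) \<le> 2 * sqn S F + 2 * sqn S G"
proof -
  have "(F z + G z)\<^sup>2 \<le> 2 * (F z)\<^sup>2 + 2 * (G z)\<^sup>2" for z
    using sum_squares_bound[of "F z" "G z"] by (simp add: power2_sum)
  then have "sqn S (\<lambda>z. F z + G z) \<le> (LINT z|lborel. 2 * (indicator S z * (F z)\<^sup>2) + 2 * (indicator S z * (G z)\<^sup>2))"
    unfolding sqn_def using assms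
    by (intro integral_mono l2_ind l2_add Bochner_Integration.integrable_add integrable_mult_right)
      (auto simp: indicator_def)
  also have "\<dots> = 2 * sqn S F + 2 * sqn S G" unfolding sqn_def using assms by (simp add: l2_ind)
  finally show ?thesis .
qed

lemma sqn_cmult: "sqn S (\<lambda>z. c * F z) = c\<^sup>2 * sqn S F"
  unfolding sqn_def by (simp add: power_mult_distrib mult.left_commute[of "indicator S _"] del: integral_mult_right_zero flip: integral_mult_right_zero)

lemma average_sqn_le:
  fixes h :: "'b::euclidean_space \<Rightarrow> real" and q :: "'b \<Rightarrow> 'a::euclidean_space \<Rightarrow> real"
  assumes h: "integrable lborel h"
    and q: "(\<lambda>(y, z). q y z) \<in> borel_measurable (borel \<Otimes>\<^sub>M borel)"
    and S: "S \<in> sets borel"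
    and B: "\<And>y. h y \<noteq> 0 \<Longrightarrow> l2 (q y) \<and> sqn S (q y) \<le> B" "0 \<le> B"
  shows "sqn S (\<lambda>z. LINT y|lborel. h y * q y z) \<le> (LINT y|lborel. \<bar>h y\<bar>)\<^sup>2 * B"
proof (rule l2_sqn_leI)
  have [measurable]: "h \<in> borel_measurable borel" using borel_measurable_integrable[OF h] by simp
  note [measurable] = q
  show "(\<lambda>z. LINT y|lborel. h y * q y z) \<in> borel_measurable borel" by measurable
  show "(\<integral>\<^sup>+z. indicator S z * ennreal ((LINT y|lborel. h y * q y z)\<^sup>2) \<partial>lborel)
    \<le> ennreal ((LINT y|lborel. \<bar>h y\<bar>)\<^sup>2 * B)"
    by (intro average_nn_integral_le h q S B(2)) (use B S in \<open>auto simp: sqn_nn intro!: ennreal_leI\<close>)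
qed (use S B in auto)

text \<open>The map \<open>c\<close> lets one construction cover ordinary convolution
  (\<open>c\<close> the identity) and averaging in space at fixed time
  (\<open>c y = (y, 0)\<close>).\<close>

definition gconv :: "('b::euclidean_space \<Rightarrow> 'a::euclidean_space) \<Rightarrow> ('a \<Rightarrow> real) \<Rightarrow> ('b \<Rightarrow> real) \<Rightarrow> 'a \<Rightarrow> real" where
  "gconv c K h z = (LINT y|lborel. h y * K (z - c y))"

lemma l2_translate: "l2 F \<Longrightarrow> l2 (\<lambda>z. F (z + a))"
  unfolding l2_def by (auto intro: lborel_integrable_translate[where f = "\<lambda>z. (F z)\<^sup>2"] measurable_compose)

lemma sqn_translate: "l2 F \<Longrightarrow> sqn UNIV (\<lambda>z. F (z + a)) = sqn UNIV F"
  unfolding sqn_def l2_def using lborel_integral_translate[of "\<lambda>z. (F z)\<^sup>2" a]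
  by (auto simp: borel_measurable_power)

lemma gconv_l2:
  assumes "l2 K" "integrable lborel h" and [measurable]: "c \<in> borel_measurable borel"
  shows "l2 (gconv c K h)" "sqn UNIV (gconv c K h) \<le> (LINT y|lborel. \<bar>h y\<bar>)\<^sup>2 * sqn UNIV K"
proof -
  note [measurable] = l2_measurable[OF assms(1)]
  have [measurable]: "h \<in> borel_measurable borel" using borel_measurable_integrable[OF assms(2)] by simp
  have q: "l2 (\<lambda>z. K (z - c y)) \<and> sqn UNIV (\<lambda>z. K (z - c y)) \<le> sqn UNIV K" for y
    using l2_translate[OF assms(1), of "- c y"] sqn_translate[OF assms(1), of "- c y"] by simp
  have m: "(\<lambda>(y, z). K (z - c y)) \<in> borel_measurable (borel \<Otimes>\<^sub>M borel)" by measurable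
  show "sqn UNIV (gconv c K h) \<le> (LINT y|lborel. \<bar>h y\<bar>)\<^sup>2 * sqn UNIV K"
    unfolding gconv_def by (intro average_sqn_le assms m q sqn_nonneg) auto
  have "(\<integral>\<^sup>+z. indicator UNIV z * ennreal ((LINT y|lborel. h y * K (z - c y))\<^sup>2) \<partial>lborel)
    \<le> ennreal ((LINT y|lborel. \<bar>h y\<bar>)\<^sup>2 * sqn UNIV K)"
    by (rule average_nn_integral_le[OF assms(2) m _ sqn_nonneg])
      (use q in \<open>auto simp: sqn_nn[where S = UNIV, simplified] intro!: ennreal_leI\<close>)
  then show "l2 (gconv c K h)" unfolding gconv_def by (intro l2I) auto
qed

lemma gconv_integrand:
  assumes "cc K" "integrable lborel h" and [measurable]: "c \<in> borel_measurable borel"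
  shows "integrable lborel (\<lambda>y. h y * K (z - c y))"
proof -
  obtain B where B: "0 < B" "\<And>z. \<bar>K z\<bar> \<le> B" using cc_bounded[OF assms(1)] by blast
  note [measurable] = cc_measurable[OF assms(1)]
  have [measurable]: "h \<in> borel_measurable borel" using borel_measurable_integrable[OF assms(2)] by simp
  show ?thesis
  proof (rule Bochner_Integration.integrable_bound)
    show "integrable lborel (\<lambda>y. B * h y)" using assms by simp
    show "AE y in lborel. norm (h y * K (z - c y)) \<le> norm (B * h y)"
      using B mult_right_mono[OF B(2) abs_ge_zero] by (auto simp: abs_mult mult.commute)
  qed measurable
qed

lemma gconv_cc:
  assumes K: "cc K" and h: "integrable lborel h" "\<And>y. R < norm y \<Longrightarrow> h y = 0" and c: "bounded_linear c"
  shows "cc (gconv c K h)"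
proof -
  have [measurable]: "c \<in> borel_measurable borel"
    by (intro borel_measurable_continuous_onI linear_continuous_on c)
  note int = gconv_integrand[OF K h(1), of c]
  obtain S where S: "0 < S" "\<And>z. S < norm z \<Longrightarrow> K z = 0" using cc_supp[OF K] by blast
  obtain C where C: "0 < C" "\<And>y. norm (c y) \<le> norm y * C" using bounded_linear.pos_bounded[OF c] by blast
  show ?thesis
  proof (rule ccI[of _ "S + \<bar>R\<bar> * C"])
    fix z :: 'a assume z: "S + \<bar>R\<bar> * C < norm z"
    have "h y * K (z - c y) = 0" for y
    proof (cases "R < norm y")
      case False
      have "norm (c y) \<le> \<bar>R\<bar> * C" using False C by (meson abs_ge_self linorder_not_less mult_right_mono order.trans less_imp_le)
      then have "S < norm (z - c y)" using z norm_triangle_ineq2[of z "c y"] by linarith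
      then show ?thesis using S by simp
    qed (use h in simp)
    then have "(\<lambda>y. h y * K (z - c y)) = (\<lambda>y. 0)" by (rule ext)
    then show "gconv c K h z = 0" unfolding gconv_def by simp
  next
    show "continuous_on UNIV (gconv c K h)"
      unfolding continuous_on_iff
    proof (intro ballI allI impI)
      fix z :: 'a and e :: real assume "0 < e"
      define I where "I = (LINT y|lborel. \<bar>h y\<bar>)"
      have I: "0 \<le> I" by (simp add: I_def integral_nonneg_AE)
      obtain d where d: "0 < d" "\<And>x x'. dist x' x < d \<Longrightarrow> dist (K x') (K x) < e / (I + 1)"
        using cc_uniform[OF K] \<open>0 < e\<close> I unfolding uniformly_continuous_on_def
        by (metis UNIV_I add_nonneg_pos divide_pos_pos zero_less_one)
      show "\<exists>d>0. \<forall>x'\<in>UNIV. dist x' z < d \<longrightarrow> dist (gconv c K h x') (gconv c K h z) < e"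
      proof (intro exI[of _ d] conjI ballI impI d(1))
        fix x' assume "dist x' z < d"
        then have dd: "\<bar>K (x' - c y) - K (z - c y)\<bar> \<le> e / (I + 1)" for y
          using d(2)[of "x' - c y" "z - c y"] by (simp add: dist_norm)
        have "\<bar>gconv c K h x' - gconv c K h z\<bar> = \<bar>LINT y|lborel. h y * (K (x' - c y) - K (z - c y))\<bar>"
          unfolding gconv_def using int by (simp add: right_diff_distrib)
        also have "\<dots> \<le> (LINT y|lborel. e / (I + 1) * \<bar>h y\<bar>)"
        proof (rule order_trans[OF integral_abs_bound integral_mono])
          show "integrable lborel (\<lambda>y. \<bar>h y * (K (x' - c y) - K (z - c y))\<bar>)"
            using int[of x'] int[of z] by (auto simp: right_diff_distrib)
          show "\<bar>h y * (K (x' - c y) - K (z - c y))\<bar> \<le> e / (I + 1) * \<bar>h y\<bar>" for y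
            using mult_left_mono[OF dd[of y], of "\<bar>h y\<bar>"] by (simp add: abs_mult mult.commute)
        qed (use h in auto)
        also have "\<dots> = e * (I / (I + 1))" by (simp add: I_def)
        also have "\<dots> < e" using I \<open>0 < e\<close> by (simp add: field_simps)
        finally show "dist (gconv c K h x') (gconv c K h z) < e" by (simp add: dist_real_def)
      qed
    qed
  qed
qed

text \<open>Uniform continuity of \<open>K'\<close> makes the difference quotients of
  \<open>K\<close> converge uniformly, so the derivative falls on \<open>K\<close> alone;
  \<open>h\<close> may be a rough integrable function.\<close>

lemma gconv_dirD:
  assumes K: "dirD v K K'" and h: "integrable lborel h" "\<And>y. R < norm y \<Longrightarrow> h y = 0" and c: "bounded_linear c"
  shows "dirD v (gconv c K h) (gconv c K' h)"
  unfolding dirD_def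
proof (intro conjI allI)
  have cc: "cc K" "cc K'" using K by (auto simp: dirD_def)
  show "cc (gconv c K h)" "cc (gconv c K' h)" using gconv_cc[OF _ h c] cc by auto
  have [measurable]: "c \<in> borel_measurable borel"
    by (intro borel_measurable_continuous_onI linear_continuous_on c)
  note int = gconv_integrand[OF cc(1) h(1), of c] gconv_integrand[OF cc(2) h(1), of c]
  fix z
  define I where "I = (LINT y|lborel. \<bar>h y\<bar>)"
  have I: "0 \<le> I" by (simp add: I_def integral_nonneg_AE)
  show "((\<lambda>s. gconv c K h (z + s *\<^sub>R v)) has_real_derivative gconv c K' h z) (at 0)"
    unfolding DERIV_def
  proof (rule LIM_I)
    fix e :: real assume "0 < e"
    obtain d where d: "0 < d" "\<And>x x'. dist x' x < d \<Longrightarrow> dist (K' x') (K' x) < e / (I + 1)"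
      using cc_uniform[OF cc(2)] \<open>0 < e\<close> I unfolding uniformly_continuous_on_def
      by (metis UNIV_I add_nonneg_pos divide_pos_pos zero_less_one)
    show "\<exists>s>0. \<forall>x. x \<noteq> 0 \<and> norm (x - 0) < s \<longrightarrow>
       norm ((gconv c K h (z + (0 + x) *\<^sub>R v) - gconv c K h (z + 0 *\<^sub>R v)) / x - gconv c K' h z) < e"
    proof (intro exI[of _ "d / (norm v + 1)"] conjI allI impI)
      show "0 < d / (norm v + 1)" using d by (simp add: add_nonneg_pos)
      fix s :: real assume s: "s \<noteq> 0 \<and> norm (s - 0) < d / (norm v + 1)"
      have dd: "\<bar>K ((z - c y) + s *\<^sub>R v) - K (z - c y) - s * K' (z - c y)\<bar> \<le> \<bar>s\<bar> * (e / (I + 1))" for y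
      proof (rule dirD_increment[OF K])
        fix r assume "\<bar>r\<bar> \<le> \<bar>s\<bar>"
        then have "\<bar>r\<bar> * norm v \<le> \<bar>s\<bar> * (norm v + 1)" by (intro mult_mono) auto
        also have "\<dots> < d" using s by (simp add: pos_less_divide_eq add_nonneg_pos)
        finally show "\<bar>K' (z - c y + r *\<^sub>R v) - K' (z - c y)\<bar> \<le> e / (I + 1)"
          using d(2)[of "z - c y + r *\<^sub>R v" "z - c y"] by (simp add: dist_norm)
      qed
      have int3: "integrable lborel (\<lambda>y. h y * (K ((z - c y) + s *\<^sub>R v) - K (z - c y) - s * K' (z - c y)))"
        using int(1)[of "z + s *\<^sub>R v"] int(1)[of z] int(2)[of z]
        by (auto simp: right_diff_distrib diff_add_eq mult.left_commute[of _ s])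
      have "gconv c K h (z + s *\<^sub>R v) - gconv c K h z - s * gconv c K' h z =
         (LINT y|lborel. h y * K (z + s *\<^sub>R v - c y) - h y * K (z - c y) - s * (h y * K' (z - c y)))"
        unfolding gconv_def using int by simp
      also have "\<dots> = (LINT y|lborel. h y * (K ((z - c y) + s *\<^sub>R v) - K (z - c y) - s * K' (z - c y)))"
        by (intro Bochner_Integration.integral_cong) (auto simp: right_diff_distrib diff_add_eq mult.left_commute[of _ s])
      also have "\<bar>\<dots>\<bar> \<le> (LINT y|lborel. \<bar>s\<bar> * (e / (I + 1)) * \<bar>h y\<bar>)"
      proof (rule order_trans[OF integral_abs_bound integral_mono])
        show "\<bar>h y * (K ((z - c y) + s *\<^sub>R v) - K (z - c y) - s * K' (z - c y))\<bar> \<le> \<bar>s\<bar> * (e / (I + 1)) * \<bar>h y\<bar>" for y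
          using mult_left_mono[OF dd[of y], of "\<bar>h y\<bar>"] by (simp add: abs_mult mult.commute)
      qed (use h int3 in auto)
      also have "\<dots> = \<bar>s\<bar> * (e * (I / (I + 1)))" by (simp add: I_def)
      also have "\<dots> < \<bar>s\<bar> * e" using I \<open>0 < e\<close> s by (simp add: field_simps)
      finally have *: "\<bar>gconv c K h (z + s *\<^sub>R v) - gconv c K h z - s * gconv c K' h z\<bar> < \<bar>s\<bar> * e" .
      have "(gconv c K h (z + s *\<^sub>R v) - gconv c K h z) / s - gconv c K' h z =
         (gconv c K h (z + s *\<^sub>R v) - gconv c K h z - s * gconv c K' h z) / s"
        using s by (simp add: field_simps)
      then show "norm ((gconv c K h (z + (0 + s) *\<^sub>R v) - gconv c K h (z + 0 *\<^sub>R v)) / s - gconv c K' h z) < e"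
        using * s by (simp add: pos_divide_less_eq mult.commute)
    qed
  qed
qed

text \<open>Commutativity of convolution, by reflection of the variable. It lets a derivative be
  placed on either factor.\<close>

lemma gconv_id_swap:
  assumes "k \<in> borel_measurable borel" "h \<in> borel_measurable borel"
  shows "gconv (\<lambda>y. y) k h = gconv (\<lambda>y. y) h k"
proof
  fix z
  have "gconv (\<lambda>y. y) k h z = (LINT y|lborel. (\<lambda>y. h y * k (z - y)) (z - y))"
    unfolding gconv_def using assms(1,2)
    by (intro lborel_integral_reflect[symmetric] borel_measurable_times measurable_compose[OF _ assms(1)]) auto
  then show "gconv (\<lambda>y. y) k h z = gconv (\<lambda>y. y) h k z" by (simp add: gconv_def mult.commute)
qed

subsection \<open>Increments along a segment\<close>

lemma dirD_segment_integral:
  assumes "dirD v F F'" "0 \<le> s"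
  shows "(LINT r|lborel. indicator {0..s} r * F' (z + r *\<^sub>R v)) = F (z + s *\<^sub>R v) - F z"
proof -
  have "continuous_on UNIV (\<lambda>r. F' (z + r *\<^sub>R v))"
    by (rule continuous_on_compose2[OF cc_continuous]) (use assms in \<open>auto simp: dirD_def intro!: continuous_intros\<close>)
  then have "(LINT r|lborel. F' (z + r *\<^sub>R v) * indicator {0..s} r) = F (z + s *\<^sub>R v) - F (z + 0 *\<^sub>R v)"
    by (intro integral_FTC_Icc_real[where F = "\<lambda>r. F (z + r *\<^sub>R v)"] assms dirD_deriv[OF assms(1)])
      (auto simp: continuous_on_eq_continuous_at)
  then show ?thesis by (simp add: mult.commute)
qed

text \<open>The increment is the average of \<open>F'\<close> along the segment from
  \<open>z\<close> to \<open>z + v\<close>, hence no larger in L2 than the translates of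
  \<open>F'\<close>.\<close>

lemma dirD_increment_sqn:
  fixes v :: "'a::euclidean_space"
  assumes F: "dirD v F F'" and S: "S \<in> sets borel" and B: "0 \<le> B"
    "\<And>s. 0 \<le> s \<Longrightarrow> s \<le> 1 \<Longrightarrow> sqn S (\<lambda>z. F' (z + s *\<^sub>R v)) \<le> B"
  shows "sqn S (\<lambda>z. F (z + v) - F z) \<le> B"
proof -
  have cF: "cc F'" using F by (simp add: dirD_def)
  note [measurable] = cc_measurable[OF cF]
  have "sqn S (\<lambda>z. LINT r|lborel. indicator {0..1} r * F' (z + r *\<^sub>R v)) \<le> (LINT r|lborel. \<bar>indicator {0..1::real} r :: real\<bar>)\<^sup>2 * B"
  proof (rule average_sqn_le)
    show "l2 (\<lambda>z. F' (z + r *\<^sub>R v)) \<and> sqn S (\<lambda>z. F' (z + r *\<^sub>R v)) \<le> B" if "indicator {0..1::real} r \<noteq> (0::real)" for r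
      using that B(2)[of r] cc_translate[OF cF] by (auto simp: indicator_def split: if_splits)
    show "integrable lborel (indicator {0..1::real} :: real \<Rightarrow> real)"
      by (intro integrable_real_indicator) auto
  qed (use S B in auto)
  moreover have "(LINT r|lborel. indicator {0..1} r * F' (z + r *\<^sub>R v)) = F (z + v) - F z" for z
    using dirD_segment_integral[OF F, of 1 z] by simp
  ultimately show ?thesis by simp
qed

text \<open>A one-dimensional trace inequality: \<open>(F z)\<^sup>2\<close> is at most twice
  \<open>(F (z + s v))\<^sup>2\<close> plus twice the integral of
  \<open>(F' (z + r v))\<^sup>2\<close> over \<open>r\<close> in [0, 1], for every \<open>s\<close>
  in [0, 1]. Averaging over \<open>s\<close> and exchanging integrals, each point of
  \<open>S'\<close> is counted with weight the length of the set of \<open>s\<close> that lead back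
  into \<open>S\<close>. This length is at most \<open>m\<close>, which is the gain when
  \<open>S\<close> is thin in direction \<open>v\<close>.\<close>

lemma slab:
  fixes v :: "'a::euclidean_space"
  assumes F: "dirD v F F'" and S: "S \<in> sets borel" "S' \<in> sets borel"
    and sub: "\<And>z s. z \<in> S \<Longrightarrow> 0 \<le> s \<Longrightarrow> s \<le> 1 \<Longrightarrow> z + s *\<^sub>R v \<in> S'"
    and m: "0 \<le> m" "\<And>z. emeasure lborel {s \<in> {0..1}. z - s *\<^sub>R v \<in> S} \<le> ennreal m"
  shows "sqn S F \<le> 2 * m * (sqn S' F + sqn S' F')"
proof -
  have cF: "cc F" "cc F'" using F by (auto simp: dirD_def)
  note [measurable] = cc_measurable[OF cF(1)] cc_measurable[OF cF(2)] S
  \<comment> \<open>The energy of \<open>G\<close> over \<open>S\<close> averaged along the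
    segments; both terms of the trace inequality reduce to it, for \<open>G = F\<close> and for
    \<open>G = F'\<close>.\<close>
  define Q where "Q G = (\<integral>\<^sup>+s. (\<integral>\<^sup>+z. indicator {0..1} s * (indicator S z * ennreal ((G (z + s *\<^sub>R v))\<^sup>2)) \<partial>lborel) \<partial>lborel)"
    for G :: "'a \<Rightarrow> real"
  have Q: "Q G \<le> ennreal (m * sqn S' G)" if G: "cc G" for G
  proof -
    note [measurable] = cc_measurable[OF G]
    have "Q G = (\<integral>\<^sup>+s. (\<integral>\<^sup>+z. indicator {0..1} s * (indicator S (z - s *\<^sub>R v) * ennreal ((G z)\<^sup>2)) \<partial>lborel) \<partial>lborel)"
      unfolding Q_def
    proof (rule nn_integral_cong)
      fix s :: real
      show "(\<integral>\<^sup>+z. indicator {0..1} s * (indicator S z * ennreal ((G (z + s *\<^sub>R v))\<^sup>2)) \<partial>lborel)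
        = (\<integral>\<^sup>+z. indicator {0..1} s * (indicator S (z - s *\<^sub>R v) * ennreal ((G z)\<^sup>2)) \<partial>lborel)"
        using nn_integral_translate[of "\<lambda>z. indicator {0..1} s * (indicator S (z - s *\<^sub>R v) * ennreal ((G z)\<^sup>2))" "s *\<^sub>R v"]
        by simp
    qed
    also have "\<dots> = (\<integral>\<^sup>+z. (\<integral>\<^sup>+s. indicator {0..1} s * (indicator S (z - s *\<^sub>R v) * ennreal ((G z)\<^sup>2)) \<partial>lborel) \<partial>lborel)"
      by (rule lborel_pair.Fubini'[symmetric]) measurable
    also have "\<dots> \<le> (\<integral>\<^sup>+z. ennreal m * (indicator S' z * ennreal ((G z)\<^sup>2)) \<partial>lborel)"
    proof (rule nn_integral_mono)
      fix z
      have "(\<integral>\<^sup>+s. indicator {0..1} s * (indicator S (z - s *\<^sub>R v) * ennreal ((G z)\<^sup>2)) \<partial>lborel)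
        = (\<integral>\<^sup>+s. (indicator S' z * ennreal ((G z)\<^sup>2)) * indicator {s \<in> {0..1}. z - s *\<^sub>R v \<in> S} s \<partial>lborel)"
        using sub[of "z - s *\<^sub>R v" s for s] by (intro nn_integral_cong) (auto simp: indicator_def)
      also have "\<dots> = (indicator S' z * ennreal ((G z)\<^sup>2)) * emeasure lborel {s \<in> {0..1}. z - s *\<^sub>R v \<in> S}"
      proof (rule nn_integral_cmult_indicator)
        have "{s \<in> {0..1::real}. z - s *\<^sub>R v \<in> S} = {0..1} \<inter> ((\<lambda>s. z - s *\<^sub>R v) -` S \<inter> space borel)" by auto
        also have "\<dots> \<in> sets borel" by (intro sets.Int measurable_sets[OF _ S(1)]) auto
        finally show "{s \<in> {0..1}. z - s *\<^sub>R v \<in> S} \<in> sets lborel" by simp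
      qed
      also have "\<dots> \<le> (indicator S' z * ennreal ((G z)\<^sup>2)) * ennreal m"
        by (intro mult_left_mono m) auto
      finally show "(\<integral>\<^sup>+s. indicator {0..1} s * (indicator S (z - s *\<^sub>R v) * ennreal ((G z)\<^sup>2)) \<partial>lborel)
         \<le> ennreal m * (indicator S' z * ennreal ((G z)\<^sup>2))" by (simp add: mult.commute)
    qed
    also have "\<dots> = ennreal m * ennreal (sqn S' G)"
      using G S by (subst nn_integral_cmult) (auto simp: sqn_nn)
    finally show ?thesis using m by (simp add: ennreal_mult' sqn_nonneg)
  qed
  have pt: "ennreal ((F z)\<^sup>2) \<le> 2 * ennreal ((F (z + s *\<^sub>R v))\<^sup>2)
       + 2 * (\<integral>\<^sup>+r. indicator {0..1} r * ennreal ((F' (z + r *\<^sub>R v))\<^sup>2) \<partial>lborel)" (is "_ \<le> _ + 2 * ?J")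
    if s: "0 \<le> s" "s \<le> 1" for z s
  proof -
    define D where "D = F (z + s *\<^sub>R v) - F z"
    have "ennreal (D\<^sup>2) = ennreal ((LINT r|lborel. indicator {0..s} r * F' (z + r *\<^sub>R v))\<^sup>2)"
      unfolding D_def using dirD_segment_integral[OF F s(1)] by simp
    also have "\<dots> \<le> (\<integral>\<^sup>+r. ennreal \<bar>indicator {0..s} r\<bar> \<partial>lborel) *
        (\<integral>\<^sup>+r. ennreal \<bar>indicator {0..s} r\<bar> * ennreal ((F' (z + r *\<^sub>R v))\<^sup>2) \<partial>lborel)"
      by (intro square_integral_le) measurable
    also have "\<dots> \<le> 1 * ?J"
    proof (intro mult_mono nn_integral_mono)
      show "(\<integral>\<^sup>+r. ennreal \<bar>indicator {0..s} r\<bar> \<partial>lborel) \<le> 1"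
        using s by (simp add: ennreal_indicator)
    qed (use s in \<open>auto simp: indicator_def\<close>)
    finally have DJ: "ennreal (D\<^sup>2) \<le> ?J" by simp
    have "(F z)\<^sup>2 \<le> 2 * (F (z + s *\<^sub>R v))\<^sup>2 + 2 * D\<^sup>2"
      using sum_squares_bound[of "F (z + s *\<^sub>R v)" "- D"] unfolding D_def by (simp add: power2_eq_square algebra_simps)
    then have "ennreal ((F z)\<^sup>2) \<le> ennreal (2 * (F (z + s *\<^sub>R v))\<^sup>2 + 2 * D\<^sup>2)" by (rule ennreal_leI)
    also have "\<dots> = 2 * ennreal ((F (z + s *\<^sub>R v))\<^sup>2) + 2 * ennreal (D\<^sup>2)"
      by (simp add: ennreal_mult')
    finally have "ennreal ((F z)\<^sup>2) \<le> 2 * ennreal ((F (z + s *\<^sub>R v))\<^sup>2) + 2 * ennreal (D\<^sup>2)" .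
    note this
    also have "\<dots> \<le> 2 * ennreal ((F (z + s *\<^sub>R v))\<^sup>2) + 2 * ?J" by (intro add_left_mono mult_left_mono DJ) auto
    finally show ?thesis .
  qed
  have "ennreal (sqn S F) = (\<integral>\<^sup>+s. (\<integral>\<^sup>+z. indicator {0..1::real} s * (indicator S z * ennreal ((F z)\<^sup>2)) \<partial>lborel) \<partial>lborel)"
    using S cF by (subst nn_integral_cmult) (auto simp: sqn_nn nn_integral_multc)
  also have "\<dots> \<le> (\<integral>\<^sup>+s. (\<integral>\<^sup>+z. 2 * (indicator {0..1} s * (indicator S z * ennreal ((F (z + s *\<^sub>R v))\<^sup>2)))
       + 2 * (indicator {0..1} s * (\<integral>\<^sup>+r. indicator {0..1} r * (indicator S z * ennreal ((F' (z + r *\<^sub>R v))\<^sup>2)) \<partial>lborel)) \<partial>lborel) \<partial>lborel)"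
    (is "_ \<le> (\<integral>\<^sup>+s. (\<integral>\<^sup>+z. 2 * ?f s z + 2 * ?g s z \<partial>lborel) \<partial>lborel)")
  proof (intro nn_integral_mono)
    fix s :: real and z
    show "indicator {0..1} s * (indicator S z * ennreal ((F z)\<^sup>2)) \<le> 2 * ?f s z + 2 * ?g s z"
      using pt[of s z] by (auto simp: indicator_def)
  qed
  also have "\<dots> = 2 * Q F + 2 * (\<integral>\<^sup>+s. (\<integral>\<^sup>+z. ?g s z \<partial>lborel) \<partial>lborel)"
    unfolding Q_def by (simp add: nn_integral_add nn_integral_cmult)
  also have "(\<integral>\<^sup>+s. (\<integral>\<^sup>+z. ?g s z \<partial>lborel) \<partial>lborel) =
     (\<integral>\<^sup>+z. (\<integral>\<^sup>+r. indicator {0..1} r * (indicator S z * ennreal ((F' (z + r *\<^sub>R v))\<^sup>2)) \<partial>lborel) \<partial>lborel)"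
    by (simp add: nn_integral_cmult nn_integral_multc)
  also have "\<dots> = Q F'"
    unfolding Q_def by (rule lborel_pair.Fubini') measurable
  also have "2 * Q F + 2 * Q F' \<le> 2 * ennreal (m * sqn S' F) + 2 * ennreal (m * sqn S' F')"
    by (intro add_mono mult_left_mono Q cF) auto
  also have "\<dots> = ennreal (2 * (m * sqn S' F) + 2 * (m * sqn S' F'))"
    using m by (simp add: sqn_nonneg ennreal_mult')
  also have "\<dots> = ennreal (2 * m * (sqn S' F + sqn S' F'))"
    by (simp add: algebra_simps)
  finally show ?thesis using m by (simp add: ennreal_le_iff sqn_nonneg)
qed

lemma cc_translate_minus: "cc F \<Longrightarrow> cc (\<lambda>z. F (z - a))"
  using cc_translate[of F "- a"] by simp

subsection \<open>Averages over the space variable only\<close>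

definition smear :: "('a::euclidean_space \<Rightarrow> real) \<Rightarrow> ('a \<times> 'b::euclidean_space \<Rightarrow> real) \<Rightarrow> 'a \<times> 'b \<Rightarrow> real" where
  "smear \<kappa> H = gconv (\<lambda>y. (y, 0)) H \<kappa>"

lemma bounded_linear_Pair0: "bounded_linear (\<lambda>y. (y, 0))"
  by (intro bounded_linear_Pair bounded_linear_ident bounded_linear_zero)

lemma smear_cc:
  assumes "cc \<kappa>" "cc H" shows "cc (smear \<kappa> H)"
proof -
  obtain R where R: "\<And>y. R < norm y \<Longrightarrow> \<kappa> y = 0" using cc_supp[OF assms(1)] by blast
  show ?thesis unfolding smear_def by (rule gconv_cc[OF assms(2) cc_integrable[OF assms(1)] R bounded_linear_Pair0])
qed

lemma smear_dirD:
  assumes "cc \<kappa>" "dirD v H H'" shows "dirD v (smear \<kappa> H) (smear \<kappa> H')"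
proof -
  obtain R where R: "\<And>y. R < norm y \<Longrightarrow> \<kappa> y = 0" using cc_supp[OF assms(1)] by blast
  show ?thesis unfolding smear_def by (rule gconv_dirD[OF assms(2) cc_integrable[OF assms(1)] R bounded_linear_Pair0])
qed

lemma smear_sqn:
  assumes "cc \<kappa>" "cc H" shows "sqn UNIV (smear \<kappa> H) \<le> (LINT y|lborel. \<bar>\<kappa> y\<bar>)\<^sup>2 * sqn UNIV H"
  unfolding smear_def using assms
  by (intro gconv_l2) (auto intro: borel_measurable_continuous_onI linear_continuous_on bounded_linear_Pair0)

lemma smear_integrand: "cc \<kappa> \<Longrightarrow> cc H \<Longrightarrow> integrable lborel (\<lambda>y. \<kappa> y * H (z - (y, 0)))"
  using gconv_integrand[of H \<kappa> "\<lambda>y. (y, 0)" z] bounded_linear_Pair0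
  by (auto intro: borel_measurable_continuous_onI linear_continuous_on)

lemma smear_cong: "(\<And>y. \<kappa> y \<noteq> 0 \<Longrightarrow> H (z - (y, 0)) = G (z - (y, 0))) \<Longrightarrow> smear \<kappa> H z = smear \<kappa> G z"
  unfolding smear_def gconv_def by (intro Bochner_Integration.integral_cong) auto

lemma smear_sum:
  "cc \<kappa> \<Longrightarrow> (\<And>i. i \<in> I \<Longrightarrow> cc (H i)) \<Longrightarrow> smear \<kappa> (\<lambda>z. \<Sum>i\<in>I. H i z) z = (\<Sum>i\<in>I. smear \<kappa> (H i) z)"
  using smear_integrand[of \<kappa> _ z] unfolding smear_def gconv_def by (simp add: sum_distrib_left Bochner_Integration.integral_sum)

lemma smear_cmult: "smear \<kappa> (\<lambda>z. c * H z) z = c * smear \<kappa> H z"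
  unfolding smear_def gconv_def by (simp add: mult.left_commute[of _ c])

lemma smear_diff: "cc \<kappa> \<Longrightarrow> cc H \<Longrightarrow> cc G \<Longrightarrow> smear \<kappa> (\<lambda>z. H z - G z) z = smear \<kappa> H z - smear \<kappa> G z"
  using smear_integrand[of \<kappa> _ z] unfolding smear_def gconv_def by (simp add: right_diff_distrib)

lemma cc_slice: assumes "cc H" shows "cc (\<lambda>y. H (y, t))"
proof -
  obtain R where R: "0 < R" "\<And>z. R < norm z \<Longrightarrow> H z = 0" using cc_supp[OF assms] by blast
  show ?thesis
  proof (rule ccI[of _ R])
    show "continuous_on UNIV (\<lambda>y. H (y, t))"
      by (rule continuous_on_compose2[OF cc_continuous[OF assms]]) (auto intro!: continuous_intros)
    fix y :: 'a assume "R < norm y"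
    then have "R < norm (y, t)" using norm_fst_le[of y t] by linarith
    then show "H (y, t) = 0" by (rule R)
  qed
qed

lemma smear_slice:
  assumes "cc \<kappa>" "cc H" shows "smear \<kappa> H (x, t) = gconv (\<lambda>y. y) \<kappa> (\<lambda>y. H (y, t)) x"
proof -
  have "smear \<kappa> H (x, t) = gconv (\<lambda>y. y) (\<lambda>y. H (y, t)) \<kappa> x" unfolding smear_def gconv_def by simp
  then show ?thesis using gconv_id_swap[of "\<lambda>y. H (y, t)" \<kappa>] assms by (simp add: cc_measurable cc_slice)
qed

text \<open>On each time slice \<open>smear\<close> is an ordinary convolution, and convolution
  commutes, so a space derivative may fall on the kernel. \<open>H\<close> need not be
  differentiable.\<close>

lemma smear_dirD_kernel:
  assumes \<kappa>: "dirD e \<kappa> \<kappa>'" and H: "cc H"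
  shows "dirD (e, 0) (smear \<kappa> H) (smear \<kappa>' H)"
  unfolding dirD_def
proof (intro conjI allI)
  have cc: "cc \<kappa>" "cc \<kappa>'" using \<kappa> by (auto simp: dirD_def)
  show "cc (smear \<kappa> H)" "cc (smear \<kappa>' H)" using cc H by (auto intro: smear_cc)
  fix z :: "'a \<times> 'b"
  obtain x t where z: "z = (x, t)" by (cases z)
  obtain R where "\<And>y. R < norm y \<Longrightarrow> (\<lambda>y. H (y, t)) y = 0" using cc_supp[OF cc_slice[OF H]] by blast
  then have "dirD e (gconv (\<lambda>y. y) \<kappa> (\<lambda>y. H (y, t))) (gconv (\<lambda>y. y) \<kappa>' (\<lambda>y. H (y, t)))"
    by (intro gconv_dirD[OF \<kappa>] cc_integrable cc_slice H bounded_linear_ident)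
  then show "((\<lambda>s. smear \<kappa> H (z + s *\<^sub>R (e, 0))) has_real_derivative smear \<kappa>' H z) (at 0)"
    unfolding dirD_def z by (simp add: smear_slice cc H)
qed

text \<open>The same function is differentiated in two ways, once through the kernel and once
  through \<open>H\<close>; uniqueness of derivatives identifies the results.\<close>

lemma smear_dirD_swap: "dirD e \<kappa> \<kappa>' \<Longrightarrow> dirD (e, 0) H H' \<Longrightarrow> smear \<kappa>' H = smear \<kappa> H'"
  by (rule dirD_unique[OF smear_dirD_kernel smear_dirD]) (auto simp: dirD_cc)

text \<open>Since the kernel has mass one, the difference between \<open>H\<close> and its average
  is an average of the differences between \<open>H\<close> and its translates.\<close>

lemma smear_minus_sqn:
  assumes \<kappa>: "cc \<kappa>" "(LINT y|lborel. \<kappa> y) = 1" "\<And>y. 0 \<le> \<kappa> y" and H: "cc H" and S: "S \<in> sets borel"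
    and B: "0 \<le> B" "\<And>y. \<kappa> y \<noteq> 0 \<Longrightarrow> sqn S (\<lambda>z. H z - H (z - (y, 0))) \<le> B"
  shows "sqn S (\<lambda>z. H z - smear \<kappa> H z) \<le> B"
proof -
  note [measurable] = cc_measurable[OF H]
  have "sqn S (\<lambda>z. LINT y|lborel. \<kappa> y * (H z - H (z - (y, 0)))) \<le> (LINT y|lborel. \<bar>\<kappa> y\<bar>)\<^sup>2 * B"
  proof (rule average_sqn_le)
    show "(\<lambda>(y, z). H z - H (z - (y, 0))) \<in> borel_measurable (borel \<Otimes>\<^sub>M borel)" by measurable
    fix y assume "\<kappa> y \<noteq> 0"
    then show "l2 (\<lambda>z. H z - H (z - (y, 0))) \<and> sqn S (\<lambda>z. H z - H (z - (y, 0))) \<le> B"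
      using B cc_diff[OF H cc_translate_minus[OF H]] by blast
  qed (use \<kappa> S B in auto)
  moreover have "(LINT y|lborel. \<kappa> y * (H z - H (z - (y, 0)))) = H z - smear \<kappa> H z" for z
    using smear_integrand[OF \<kappa>(1) H, of z] \<kappa> unfolding smear_def gconv_def by (simp add: right_diff_distrib)
  ultimately show ?thesis using \<kappa> by simp
qed

subsection \<open>The energy estimate\<close>

abbreviation ex :: "'n::finite \<Rightarrow> (real^'n) \<times> real" where "ex \<alpha> \<equiv> (axis \<alpha> 1, 0)"
abbreviation et :: "(real^'n::finite) \<times> real" where "et \<equiv> (0, 1)"

text \<open>The vector field whose spatial divergence is the time derivative:
  \<open>u_t - div (A Du) = - div g\<close> reads \<open>u_t = div (A Du - g)\<close>.\<close>

definition flux :: "('m::finite \<Rightarrow> 'm \<Rightarrow> 'n::finite \<Rightarrow> 'n \<Rightarrow> real) \<Rightarrow> ('m \<Rightarrow> 'n \<Rightarrow> real) \<Rightarrow> ('m \<Rightarrow> 'n \<Rightarrow> real) \<Rightarrow> 'm \<Rightarrow> 'n \<Rightarrow> real" where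
  "flux A \<xi> g i \<alpha> = (\<Sum>j\<in>UNIV. \<Sum>\<beta>\<in>UNIV. A i j \<alpha> \<beta> * \<xi> j \<beta>) - g i \<alpha>"

definition nsq :: "('m::finite \<Rightarrow> 'n::finite \<Rightarrow> real) \<Rightarrow> real" where
  "nsq \<xi> = (\<Sum>i\<in>UNIV. \<Sum>\<alpha>\<in>UNIV. (\<xi> i \<alpha>)\<^sup>2)"

text \<open>All constants depend on the coefficients through \<open>l\<close> and \<open>M\<close>
  only and are thus uniform over the points at which the coefficients are frozen.\<close>

definition elliptic :: "real \<Rightarrow> real \<Rightarrow> ('m::finite \<Rightarrow> 'm \<Rightarrow> 'n::finite \<Rightarrow> 'n \<Rightarrow> real) \<Rightarrow> bool" where
  "elliptic l M A \<longleftrightarrow> (\<forall>\<xi>. l * nsq \<xi> \<le> (\<Sum>i\<in>UNIV. \<Sum>\<alpha>\<in>UNIV. \<xi> i \<alpha> * (\<Sum>j\<in>UNIV. \<Sum>\<beta>\<in>UNIV. A i j \<alpha> \<beta> * \<xi> j \<beta>)))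
     \<and> (\<forall>i j \<alpha> \<beta>. \<bar>A i j \<alpha> \<beta>\<bar> \<le> M)"

lemma nsq_nonneg: "0 \<le> nsq \<xi>"
  unfolding nsq_def by (intro sum_nonneg) auto

lemma nsq_component: "(\<xi> i \<alpha>)\<^sup>2 \<le> nsq \<xi>"
proof -
  have "(\<xi> i \<alpha>)\<^sup>2 \<le> (\<Sum>\<alpha>\<in>UNIV. (\<xi> i \<alpha>)\<^sup>2)" by (intro member_le_sum) auto
  also have "\<dots> \<le> nsq \<xi>" unfolding nsq_def
    by (rule member_le_sum[where f = "\<lambda>i. \<Sum>\<alpha>\<in>UNIV. (\<xi> i \<alpha>)\<^sup>2"]) (auto intro: sum_nonneg)
  finally show ?thesis .
qed

lemma flux_sq_le:
  fixes A :: "'m::finite \<Rightarrow> 'm \<Rightarrow> 'n::finite \<Rightarrow> 'n \<Rightarrow> real"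
  assumes "\<And>j \<beta>. \<bar>A i j \<alpha> \<beta>\<bar> \<le> M"
  shows "(flux A \<xi> g i \<alpha>)\<^sup>2 \<le> 2 * (M * real (CARD('m) * CARD('n)))\<^sup>2 * nsq \<xi> + 2 * (g i \<alpha>)\<^sup>2"
proof -
  define S where "S = (\<Sum>j\<in>UNIV. \<Sum>\<beta>\<in>UNIV. A i j \<alpha> \<beta> * \<xi> j \<beta>)"
  have M: "0 \<le> M" using assms[of undefined undefined] by linarith
  have "\<bar>S\<bar> \<le> (\<Sum>j\<in>(UNIV :: 'm set). \<Sum>\<beta>\<in>(UNIV :: 'n set). M * sqrt (nsq \<xi>))"
  proof -
    have t: "\<bar>A i j \<alpha> \<beta> * \<xi> j \<beta>\<bar> \<le> M * sqrt (nsq \<xi>)" for j \<beta>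
    proof -
      have "\<bar>\<xi> j \<beta>\<bar> \<le> sqrt (nsq \<xi>)" using nsq_component[of \<xi> j \<beta>] by (metis real_sqrt_abs real_sqrt_le_mono)
      then show ?thesis unfolding abs_mult using assms M by (intro mult_mono) auto
    qed
    show ?thesis unfolding S_def
      by (rule order_trans[OF sum_abs sum_mono]) (rule order_trans[OF sum_abs sum_mono[OF t]])
  qed
  then have "\<bar>S\<bar> \<le> M * real (CARD('m) * CARD('n)) * sqrt (nsq \<xi>)" by (simp add: mult.commute mult.left_commute)
  then have "S\<^sup>2 \<le> (M * real (CARD('m) * CARD('n)) * sqrt (nsq \<xi>))\<^sup>2"
    using abs_le_square_iff[of S "M * real (CARD('m) * CARD('n)) * sqrt (nsq \<xi>)"] by linarith
  then have 1: "S\<^sup>2 \<le> (M * real (CARD('m) * CARD('n)))\<^sup>2 * nsq \<xi>" by (simp add: power_mult_distrib nsq_nonneg)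
  have "(flux A \<xi> g i \<alpha>)\<^sup>2 \<le> 2 * S\<^sup>2 + 2 * (g i \<alpha>)\<^sup>2"
    unfolding flux_def S_def[symmetric] using sum_squares_bound[of S "- g i \<alpha>"] by (simp add: power2_eq_square algebra_simps)
  with 1 show ?thesis by linarith
qed

lemma young:
  fixes a b e :: real assumes "0 < e" shows "a * b \<le> e * a\<^sup>2 + b\<^sup>2 / (4 * e)"
proof -
  have "0 \<le> (2 * e * a - b)\<^sup>2 / (4 * e)" using assms by auto
  also have "\<dots> = e * a\<^sup>2 + b\<^sup>2 / (4 * e) - a * b" using assms by (simp add: field_simps power2_eq_square)
  finally show ?thesis by simp
qed

text \<open>The integrand of the energy identity, with \<open>p\<close> the cutoff, \<open>q\<close>
  its gradient, \<open>r\<close> its time derivative and \<xi> the gradient of \<open>w\<close>.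
  Young's inequality leaves a mixed term carrying \<open>q\<^sup>2\<close>; the condition
  \<open>(q \<alpha>)\<^sup>2 \<le> c * p\<close> turns it into a multiple of
  \<open>p * nsq \<xi>\<close>, which ellipticity absorbs.\<close>

lemma energy_pointwise:
  fixes A :: "'m::finite \<Rightarrow> 'm \<Rightarrow> 'n::finite \<Rightarrow> 'n \<Rightarrow> real"
  assumes l: "0 < l" and A: "elliptic l M A" and c: "0 < c"
    and p: "0 \<le> p" "p \<le> c" "r \<le> c" "\<And>\<alpha>. (q \<alpha>)\<^sup>2 \<le> c * p"
    and B: "B = 2 * (M * real (CARD('m) * CARD('n)))\<^sup>2 * real (CARD('m) * CARD('n)) + 1"
    and C: "C = c / l + c + 2 * c * l / (4 * B) + real CARD('n) * c * B / l"
  shows "l / 2 * (p * nsq \<xi>) - C * ((\<Sum>i\<in>UNIV. (w i)\<^sup>2) + nsq g)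
    \<le> (\<Sum>i\<in>UNIV. \<Sum>\<alpha>\<in>UNIV. p * \<xi> i \<alpha> * flux A \<xi> g i \<alpha> + q \<alpha> * w i * flux A \<xi> g i \<alpha>)
       - 1/2 * r * (\<Sum>i\<in>UNIV. (w i)\<^sup>2)"
proof -
  have B1: "1 \<le> B" unfolding B by simp
  \<comment> \<open>The Young weight is chosen so that the flux bound, summed over all components,
    costs at most a quarter of \<open>l * p * nsq \<xi>\<close>. Another quarter goes to the product
    of \<xi> and \<open>g\<close>, and half remains. The summand 1 in \<open>B\<close> keeps
    \<open>B\<close> positive when \<open>M = 0\<close>.\<close>
  define e where "e = l / (4 * B)"
  have e: "0 < e" using l B1 by (simp add: e_def)
  define W where "W = (\<Sum>i\<in>UNIV. (w i)\<^sup>2)"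
  have W: "0 \<le> W" unfolding W_def by (intro sum_nonneg) auto
  have S1: "(\<Sum>i\<in>UNIV. \<Sum>\<alpha>\<in>UNIV. p * \<xi> i \<alpha> * flux A \<xi> g i \<alpha>) \<ge> p * (l * nsq \<xi>) - p * (l/4 * nsq \<xi>) - c / l * nsq g"
  proof -
    have 1: "(\<Sum>i\<in>UNIV. \<Sum>\<alpha>\<in>UNIV. \<xi> i \<alpha> * g i \<alpha>) \<le> (\<Sum>i\<in>UNIV. \<Sum>\<alpha>\<in>UNIV. l/4 * (\<xi> i \<alpha>)\<^sup>2 + (g i \<alpha>)\<^sup>2 / l)"
      using young[of "l/4"] l by (intro sum_mono) simp
    also have "\<dots> = l/4 * nsq \<xi> + nsq g / l"
      by (simp add: nsq_def sum.distrib sum_distrib_left sum_divide_distrib)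
    finally have 1: "(\<Sum>i\<in>UNIV. \<Sum>\<alpha>\<in>UNIV. \<xi> i \<alpha> * g i \<alpha>) \<le> l/4 * nsq \<xi> + nsq g / l" .
    have 2: "l * nsq \<xi> \<le> (\<Sum>i\<in>UNIV. \<Sum>\<alpha>\<in>UNIV. \<xi> i \<alpha> * (\<Sum>j\<in>UNIV. \<Sum>\<beta>\<in>UNIV. A i j \<alpha> \<beta> * \<xi> j \<beta>))"
      using A unfolding elliptic_def by blast
    have "(\<Sum>i\<in>UNIV. \<Sum>\<alpha>\<in>UNIV. p * \<xi> i \<alpha> * flux A \<xi> g i \<alpha>) =
      p * ((\<Sum>i\<in>UNIV. \<Sum>\<alpha>\<in>UNIV. \<xi> i \<alpha> * (\<Sum>j\<in>UNIV. \<Sum>\<beta>\<in>UNIV. A i j \<alpha> \<beta> * \<xi> j \<beta>)) - (\<Sum>i\<in>UNIV. \<Sum>\<alpha>\<in>UNIV. \<xi> i \<alpha> * g i \<alpha>))"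
      by (simp add: flux_def sum_distrib_left[of p] sum_subtractf right_diff_distrib mult.assoc)
    also have "\<dots> \<ge> p * (l * nsq \<xi> - (l/4 * nsq \<xi> + nsq g / l))"
      using 1 2 p by (intro mult_left_mono) auto
    finally have 3: "(\<Sum>i\<in>UNIV. \<Sum>\<alpha>\<in>UNIV. p * \<xi> i \<alpha> * flux A \<xi> g i \<alpha>) \<ge> p * (l * nsq \<xi> - (l/4 * nsq \<xi> + nsq g / l))" .
    have "p * (nsq g / l) \<le> c * (nsq g / l)" using p l nsq_nonneg[of g] by (intro mult_right_mono) auto
    moreover have "p * (l * nsq \<xi> - (l/4 * nsq \<xi> + nsq g / l)) = p * (l * nsq \<xi>) - p * (l/4 * nsq \<xi>) - p * (nsq g / l)"
      by (simp add: algebra_simps)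
    moreover have "c / l * nsq g = c * (nsq g / l)" by simp
    ultimately show ?thesis using 3 by linarith
  qed
  have S2: "(\<Sum>i\<in>UNIV. \<Sum>\<alpha>\<in>UNIV. q \<alpha> * w i * flux A \<xi> g i \<alpha>) \<ge>
     - (l/4 * (p * nsq \<xi>) + 2 * c * l / (4 * B) * nsq g + real CARD('n) * c * B / l * W)"
  proof -
    have f: "- (q \<alpha> * w i * flux A \<xi> g i \<alpha>) \<le>
       e * p * (2 * (M * real (CARD('m) * CARD('n)))\<^sup>2 * nsq \<xi>) + e * c * 2 * (g i \<alpha>)\<^sup>2 + c * (w i)\<^sup>2 / (4 * e)" for i \<alpha>
    proof -
      let ?X = "flux A \<xi> g i \<alpha>"
      have "- (q \<alpha> * w i * ?X) = (q \<alpha> * ?X) * (- w i)" by simp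
      also have "\<dots> \<le> (e / c) * (q \<alpha> * ?X)\<^sup>2 + (- w i)\<^sup>2 / (4 * (e / c))" using e c by (intro young) auto
      also have "\<dots> = (e / c) * ((q \<alpha>)\<^sup>2 * ?X\<^sup>2) + c * (w i)\<^sup>2 / (4 * e)" using e c by (simp add: power_mult_distrib field_simps)
      also have "(e / c) * ((q \<alpha>)\<^sup>2 * ?X\<^sup>2) \<le> (e / c) * (c * p * ?X\<^sup>2)"
        using p e c by (intro mult_left_mono mult_right_mono) auto
      also have "\<dots> = e * p * ?X\<^sup>2" using c by simp
      also have "\<dots> \<le> e * p * (2 * (M * real (CARD('m) * CARD('n)))\<^sup>2 * nsq \<xi> + 2 * (g i \<alpha>)\<^sup>2)"
        using A e p unfolding elliptic_def by (intro mult_left_mono flux_sq_le) auto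
      also have "\<dots> \<le> e * p * (2 * (M * real (CARD('m) * CARD('n)))\<^sup>2 * nsq \<xi>) + e * c * 2 * (g i \<alpha>)\<^sup>2"
        using mult_right_mono[OF p(2), of "e * 2 * (g i \<alpha>)\<^sup>2"] e by (simp add: algebra_simps)
      finally show ?thesis by simp
    qed
    have "- (\<Sum>i\<in>UNIV. \<Sum>\<alpha>\<in>UNIV. q \<alpha> * w i * flux A \<xi> g i \<alpha>)
       = (\<Sum>i\<in>UNIV. \<Sum>\<alpha>\<in>UNIV. - (q \<alpha> * w i * flux A \<xi> g i \<alpha>))" by (simp add: sum_negf)
    also have "\<dots> \<le> (\<Sum>i\<in>UNIV. \<Sum>\<alpha>\<in>UNIV. e * p * (2 * (M * real (CARD('m) * CARD('n)))\<^sup>2 * nsq \<xi>) + e * c * 2 * (g i \<alpha>)\<^sup>2 + c * (w i)\<^sup>2 / (4 * e))"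
      by (intro sum_mono f)
    also have "\<dots> = e * p * nsq \<xi> * (B - 1) + e * c * 2 * nsq g + real CARD('n) * c / (4 * e) * W"
      unfolding B nsq_def[of g] W_def
      by (simp add: sum.distrib sum_distrib_left sum_divide_distrib algebra_simps)
    also have "\<dots> \<le> e * p * nsq \<xi> * B + e * c * 2 * nsq g + real CARD('n) * c / (4 * e) * W"
      using e p nsq_nonneg[of \<xi>] by (simp add: mult_left_mono)
    also have "\<dots> = l/4 * (p * nsq \<xi>) + 2 * c * l / (4 * B) * nsq g + real CARD('n) * c * B / l * W"
      unfolding e_def using B1 l by (simp add: field_simps)
    finally show ?thesis by simp
  qed
  have S3: "1/2 * r * W \<le> c * W"
  proof -
    have "1/2 * r \<le> c" using p c by linarith
    then show ?thesis using W by (intro mult_right_mono) auto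
  qed
  have nn: "0 \<le> c / l" "0 \<le> c" "0 \<le> 2 * c * l / (4 * B)" "0 \<le> real CARD('n) * c * B / l"
    using c l B1 by auto
  have "C * (W + nsq g) \<ge> c / l * nsq g + 2 * c * l / (4 * B) * nsq g + real CARD('n) * c * B / l * W + c * W"
    unfolding C using nn W nsq_nonneg[of g] mult_nonneg_nonneg[OF nn(1) W] mult_nonneg_nonneg[OF nn(2) nsq_nonneg[of g]]
      mult_nonneg_nonneg[OF nn(3) W] mult_nonneg_nonneg[OF nn(4) nsq_nonneg[of g]]
    by (simp only: distrib_left distrib_right)
  moreover define N where "N = l * (p * nsq \<xi>)"
  moreover have "p * (l * nsq \<xi>) = N" "p * (l/4 * nsq \<xi>) = N/4" "l/4 * (p * nsq \<xi>) = N/4" "l/2 * (p * nsq \<xi>) = N/2"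
    by (simp_all add: N_def)
  ultimately show ?thesis
    unfolding W_def[symmetric] sum.distrib using S1 S2 S3 by linarith
qed

text \<open>
  \<open>P\<close> and \<open>G\<close> are defined everywhere, but \<open>Dw = P\<close> and \<open>w\<^sub>t = div (A P - G)\<close> hold on \<open>S\<close> only: mollification
  of a function cut off at the boundary of the cylinder solves the system in the interior.
\<close>

definition smooth_sol :: "('m::finite \<Rightarrow> 'm \<Rightarrow> 'n::finite \<Rightarrow> 'n \<Rightarrow> real) \<Rightarrow> ((real^'n) \<times> real) set
    \<Rightarrow> ('m \<Rightarrow> (real^'n) \<times> real \<Rightarrow> real) \<Rightarrow> ('m \<Rightarrow> 'n \<Rightarrow> (real^'n) \<times> real \<Rightarrow> real)
    \<Rightarrow> ('m \<Rightarrow> 'n \<Rightarrow> (real^'n) \<times> real \<Rightarrow> real) \<Rightarrow> bool" where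
  "smooth_sol A S w P G \<longleftrightarrow> (\<exists>wt wx Px Gx.
     (\<forall>i. dirD et (w i) (wt i)) \<and> (\<forall>i \<alpha>. dirD (ex \<alpha>) (w i) (wx i \<alpha>)) \<and>
     (\<forall>\<alpha> j \<beta>. dirD (ex \<alpha>) (P j \<beta>) (Px \<alpha> j \<beta>)) \<and> (\<forall>i \<alpha>. dirD (ex \<alpha>) (G i \<alpha>) (Gx i \<alpha>)) \<and>
     (\<forall>z\<in>S. \<forall>i \<alpha>. wx i \<alpha> z = P i \<alpha> z) \<and>
     (\<forall>z\<in>S. \<forall>i. wt i z = (\<Sum>\<alpha>\<in>UNIV. flux A (\<lambda>j \<beta>. Px \<alpha> j \<beta> z) (\<lambda>i \<alpha>. Gx i \<alpha> z) i \<alpha>)))"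

definition SP :: "'a::euclidean_space set \<Rightarrow> ('m::finite \<Rightarrow> 'n::finite \<Rightarrow> 'a \<Rightarrow> real) \<Rightarrow> real" where
  "SP S P = (\<Sum>i\<in>UNIV. \<Sum>\<alpha>\<in>UNIV. sqn S (P i \<alpha>))"

definition SW :: "'a::euclidean_space set \<Rightarrow> ('m::finite \<Rightarrow> 'a \<Rightarrow> real) \<Rightarrow> real" where
  "SW S w = (\<Sum>i\<in>UNIV. sqn S (w i))"

lemma SP_integral:
  assumes "\<And>i \<alpha>. l2 (P i \<alpha>)" "S \<in> sets borel"
  shows "(LINT z|lborel. indicator S z * nsq (\<lambda>i \<alpha>. P i \<alpha> z)) = SP S P"
    "integrable lborel (\<lambda>z. indicator S z * nsq (\<lambda>i \<alpha>. P i \<alpha> z))"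
  unfolding SP_def sqn_def nsq_def sum_distrib_left
  by (simp_all only: Bochner_Integration.integral_sum Bochner_Integration.integrable_sum l2_ind[OF assms(1) assms(2)])

lemma SW_integral:
  assumes "\<And>i. l2 (w i)" "S \<in> sets borel"
  shows "(LINT z|lborel. indicator S z * (\<Sum>i\<in>UNIV. (w i z)\<^sup>2)) = SW S w"
    "integrable lborel (\<lambda>z. indicator S z * (\<Sum>i\<in>UNIV. (w i z)\<^sup>2))"
  unfolding SW_def sqn_def sum_distrib_left
  by (simp_all only: Bochner_Integration.integral_sum Bochner_Integration.integrable_sum l2_ind[OF assms(1) assms(2)])

lemma flux_dirD:
  assumes "\<And>j \<beta>. dirD v (P j \<beta>) (P' j \<beta>)" "dirD v (G i \<alpha>) (G' i \<alpha>)"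
  shows "dirD v (\<lambda>z. flux A (\<lambda>j \<beta>. P j \<beta> z) (\<lambda>i \<alpha>. G i \<alpha> z) i \<alpha>) (\<lambda>z. flux A (\<lambda>j \<beta>. P' j \<beta> z) (\<lambda>i \<alpha>. G' i \<alpha> z) i \<alpha>)"
  unfolding flux_def by (intro dirD_diff dirD_sum dirD_cmult assms)

text \<open>
  Test the equation with \<open>\<psi> w\<close>; the sign of \<open>\<psi>\<^sub>t\<close> is needed only from above, so \<open>\<psi>\<close> may drop to zero
  arbitrarily fast at the top of the cylinder.
\<close>

lemma energy_estimate:
  fixes A :: "'m::finite \<Rightarrow> 'm \<Rightarrow> 'n::finite \<Rightarrow> 'n \<Rightarrow> real"
  assumes l: "0 < l" and A: "elliptic l M A" and c: "0 < c"
    and sol: "smooth_sol A S w P G"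
    and \<psi>: "dirD et \<psi> \<psi>t" "\<And>\<alpha>. dirD (ex \<alpha>) \<psi> (\<psi>x \<alpha>)" "\<And>z. 0 \<le> \<psi> z" "\<And>z. \<psi> z \<le> c" "\<And>z. \<psi>t z \<le> c"
      "\<And>\<alpha> z. (\<psi>x \<alpha> z)\<^sup>2 \<le> c * \<psi> z"
    and K: "K \<in> sets borel" "K \<subseteq> S" "\<And>z. z \<notin> K \<Longrightarrow> \<psi> z = 0 \<and> \<psi>t z = 0"
    and B: "B = 2 * (M * real (CARD('m) * CARD('n)))\<^sup>2 * real (CARD('m) * CARD('n)) + 1"
    and C: "C = c / l + c + 2 * c * l / (4 * B) + real CARD('n) * c * B / l"
  shows "l / 2 * (LINT z|lborel. \<psi> z * nsq (\<lambda>i \<alpha>. P i \<alpha> z)) \<le> C * (SW K w + SP K G)"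
proof -
  from sol obtain wt wx Px Gx where "\<forall>i. dirD et (w i) (wt i)" "\<forall>i \<alpha>. dirD (ex \<alpha>) (w i) (wx i \<alpha>)"
     "\<forall>\<alpha> j \<beta>. dirD (ex \<alpha>) (P j \<beta>) (Px \<alpha> j \<beta>)" "\<forall>i \<alpha>. dirD (ex \<alpha>) (G i \<alpha>) (Gx i \<alpha>)"
     "\<forall>z\<in>S. \<forall>i \<alpha>. wx i \<alpha> z = P i \<alpha> z"
     "\<forall>z\<in>S. \<forall>i. wt i z = (\<Sum>\<alpha>\<in>UNIV. flux A (\<lambda>j \<beta>. Px \<alpha> j \<beta> z) (\<lambda>i \<alpha>. Gx i \<alpha> z) i \<alpha>)"
    unfolding smooth_sol_def by (elim exE conjE)
  note d = this(1-4)[rule_format] and eqs = this(5,6)[rule_format]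
  define F where "F i \<alpha> z = flux A (\<lambda>j \<beta>. P j \<beta> z) (\<lambda>i \<alpha>. G i \<alpha> z) i \<alpha>" for i \<alpha> z
  define F' where "F' i \<alpha> z = flux A (\<lambda>j \<beta>. Px \<alpha> j \<beta> z) (\<lambda>i \<alpha>. Gx i \<alpha> z) i \<alpha>" for i \<alpha> z
  have dF: "dirD (ex \<alpha>) (F i \<alpha>) (F' i \<alpha>)" for i \<alpha>
    unfolding F_def F'_def by (rule flux_dirD) (rule d)+
  define a where "a z = (\<Sum>i\<in>UNIV. \<psi>t z * (w i z * w i z) + \<psi> z * (wt i z * w i z + w i z * wt i z))" for z
  define b where "b i \<alpha> z = \<psi>x \<alpha> z * (w i z * F i \<alpha> z) + \<psi> z * (wx i \<alpha> z * F i \<alpha> z + w i z * F' i \<alpha> z)" for i \<alpha> z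
  have da: "dirD et (\<lambda>z. \<Sum>i\<in>UNIV. \<psi> z * (w i z * w i z)) a"
    unfolding a_def by (intro dirD_sum dirD_mult \<psi> d)
  have db: "dirD (ex \<alpha>) (\<lambda>z. \<psi> z * (w i z * F i \<alpha> z)) (b i \<alpha>)" for i \<alpha>
    unfolding b_def by (intro dirD_mult \<psi> d dF)
  define E where "E z = (\<Sum>i\<in>UNIV. \<Sum>\<alpha>\<in>UNIV. \<psi> z * P i \<alpha> z * F i \<alpha> z + \<psi>x \<alpha> z * w i z * F i \<alpha> z)
       - 1/2 * \<psi>t z * (\<Sum>i\<in>UNIV. (w i z)\<^sup>2)" for z
  \<comment> \<open>Integration by parts takes the form of writing \<open>E\<close> as a combination
    of directional derivatives of functions of bounded support. The equations are available on
    \<open>K\<close> only; outside, both sides vanish, \<open>\<psi>x\<close> because its square is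
    at most \<open>c * \<psi>\<close>.\<close>
  have E_eq: "E z = (\<Sum>i\<in>UNIV. \<Sum>\<alpha>\<in>UNIV. b i \<alpha> z) - 1/2 * a z" for z
  proof (cases "z \<in> K")
    case True
    then have zS: "z \<in> S" using K by auto
    have b: "(\<Sum>\<alpha>\<in>UNIV. b i \<alpha> z) = (\<Sum>\<alpha>\<in>UNIV. \<psi> z * P i \<alpha> z * F i \<alpha> z + \<psi>x \<alpha> z * w i z * F i \<alpha> z) + \<psi> z * w i z * wt i z" for i
      unfolding b_def eqs(2)[OF zS] eqs(1)[OF zS] F'_def[symmetric]
      by (simp add: sum.distrib sum_distrib_left algebra_simps)
    have a: "a z = \<psi>t z * (\<Sum>i\<in>UNIV. (w i z)\<^sup>2) + 2 * (\<Sum>i\<in>UNIV. \<psi> z * w i z * wt i z)"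
      unfolding a_def by (simp add: sum.distrib sum_distrib_left power2_eq_square algebra_simps)
    show ?thesis unfolding E_def a b by (simp add: sum.distrib algebra_simps)
  next
    case False
    then have "\<psi> z = 0" "\<psi>t z = 0" using K by auto
    moreover have "\<psi>x \<alpha> z = 0" for \<alpha> using \<psi>(6)[of \<alpha> z] \<open>\<psi> z = 0\<close> by simp
    ultimately show ?thesis unfolding E_def a_def b_def by simp
  qed
  have cca: "cc a" "cc (b i \<alpha>)" for i \<alpha> using da db by (auto simp: dirD_def)
  have E_int: "integrable lborel E" "(LINT z|lborel. E z) = 0"
  proof -
    have "E = (\<lambda>z. (\<Sum>i\<in>UNIV. \<Sum>\<alpha>\<in>UNIV. b i \<alpha> z) - 1/2 * a z)" using E_eq by (rule ext)
    then show "integrable lborel E" "(LINT z|lborel. E z) = 0"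
      using cca dirD_integral_zero[OF da] dirD_integral_zero[OF db] by (simp_all add: cc_integrable)
  qed
  have cw: "l2 (w i)" for i using d by (auto simp: dirD_def)
  have cG: "l2 (G i \<alpha>)" for i \<alpha> using d by (auto simp: dirD_def)
  have cP: "cc (P i \<alpha>)" for i \<alpha> using d(3)[of undefined i \<alpha>] by (auto simp: dirD_def)
  have c\<psi>: "cc \<psi>" using \<psi>(1) by (auto simp: dirD_def)
  have int: "integrable lborel (\<lambda>z. \<psi> z * nsq (\<lambda>i \<alpha>. P i \<alpha> z))"
    unfolding nsq_def by (intro cc_integrable cc_mult cc_sum cc_power2 cP c\<psi>)
  note iw = SW_integral[of w K, OF cw K(1)] and iG = SP_integral[of G K, OF cG K(1)]
  have "(LINT z|lborel. l / 2 * (\<psi> z * nsq (\<lambda>i \<alpha>. P i \<alpha> z))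
       - C * (indicator K z * (\<Sum>i\<in>UNIV. (w i z)\<^sup>2) + indicator K z * nsq (\<lambda>i \<alpha>. G i \<alpha> z))) \<le> (LINT z|lborel. E z)"
  proof (intro integral_mono E_int Bochner_Integration.integrable_diff integrable_mult_right Bochner_Integration.integrable_add int iw iG)
    fix z
    show "l / 2 * (\<psi> z * nsq (\<lambda>i \<alpha>. P i \<alpha> z))
       - C * (indicator K z * (\<Sum>i\<in>UNIV. (w i z)\<^sup>2) + indicator K z * nsq (\<lambda>i \<alpha>. G i \<alpha> z)) \<le> E z"
    proof (cases "z \<in> K")
      case True
      then show ?thesis
        unfolding E_def F_def
        using energy_pointwise[OF l A c \<psi>(3)[of z] \<psi>(4)[of z] \<psi>(5)[of z] \<psi>(6)[of _ z] B C, of "\<lambda>i \<alpha>. P i \<alpha> z" "\<lambda>i. w i z" "\<lambda>i \<alpha>. G i \<alpha> z"]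
        by simp
    next
      case False
      then have "\<psi> z = 0" "\<psi>t z = 0" using K by auto
      moreover have "\<psi>x \<alpha> z = 0" for \<alpha> using \<psi>(6)[of \<alpha> z] \<open>\<psi> z = 0\<close> by simp
      ultimately show ?thesis using False unfolding E_def by simp
    qed
  qed
  then show ?thesis using int iw iG E_int by simp
qed

section \<open>Cylinders reaching past the top, and cutoff functions\<close>

text \<open>Times run up to a small \<open>c > 0\<close>, past the top at time 0, so that a cutoff
  may vanish at time \<open>c\<close> and still control everything up to time 0.\<close>

definition Z :: "real \<Rightarrow> real \<Rightarrow> ((real^'n::finite) \<times> real) set" where
  "Z r c = ball 0 r \<times> {-r<..<c}"

lemma Z_borel [simp, measurable]: "Z r c \<in> sets borel"
  unfolding Z_def by (intro borel_open open_Times) auto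

lemma Z_mono: "r \<le> s \<Longrightarrow> c \<le> c' \<Longrightarrow> Z r c \<subseteq> Z s c'"
  unfolding Z_def by auto

text \<open>The squared positive part, a continuously differentiable profile whose squared
  derivative is 4 times itself; this is the origin of the bound on the squared gradient of a cutoff
  by the cutoff.\<close>

definition sqp :: "real \<Rightarrow> real" where "sqp x = (max 0 x)\<^sup>2"

lemma sqp_deriv: "(sqp has_real_derivative 2 * max 0 x) (at x)"
proof (cases "x = 0")
  case True
  have "(\<lambda>h. sqp h / h) \<midarrow>0\<rightarrow> 0"
  proof (rule LIM_I)
    fix r :: real assume "0 < r"
    then show "\<exists>s>0. \<forall>x. x \<noteq> 0 \<and> norm (x - 0) < s \<longrightarrow> norm (sqp x / x - 0) < r"
      by (intro exI[of _ r]) (auto simp: sqp_def max_def power2_eq_square)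
  qed
  then show ?thesis using True by (simp add: DERIV_def sqp_def)
next
  case False
  then consider "x < 0" | "0 < x" by linarith
  then show ?thesis
  proof cases
    case 1
    have "((\<lambda>x. 0) has_real_derivative 0) (at x)" by simp
    then have "(sqp has_real_derivative 0) (at x)"
      by (rule has_field_derivative_transform_within_open[of _ _ _ "{..<0}"]) (use 1 in \<open>auto simp: sqp_def\<close>)
    then show ?thesis using 1 by simp
  next
    case 2
    have "((\<lambda>x. x\<^sup>2) has_real_derivative 2 * x) (at x)" by (auto intro!: derivative_eq_intros)
    then have "(sqp has_real_derivative 2 * x) (at x)"
      by (rule has_field_derivative_transform_within_open[of _ _ _ "{0<..}"]) (use 2 in \<open>auto simp: sqp_def\<close>)
    then show ?thesis using 2 by simp
  qed
qed

lemma sqp_chain: "(f has_real_derivative d) (at s) \<Longrightarrow> ((\<lambda>s. sqp (f s)) has_real_derivative 2 * max 0 (f s) * d) (at s)"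
  using DERIV_chain2[OF sqp_deriv] by blast

lemma sqp_cont: "continuous_on S f \<Longrightarrow> continuous_on S (\<lambda>x. sqp (f x))"
  unfolding sqp_def by (intro continuous_intros)

lemma sqp_nonneg: "0 \<le> sqp x" by (simp add: sqp_def)

lemma sqp_mono: "x \<le> y \<Longrightarrow> sqp x \<le> sqp y"
  unfolding sqp_def by (intro power_mono) auto

lemma sqp_le1: "x \<le> 1 \<Longrightarrow> sqp x \<le> 1"
  using sqp_mono[of x 1] by (simp add: sqp_def)

text \<open>The bounds are independent of \<open>c'\<close> and \<open>c\<close>, although the time
  factor has to fall from 1 to 0 in between: the steep part of its derivative is negative, and
  \<open>\<psi>t\<close> is estimated from above only.\<close>

lemma cutoff:
  assumes rs: "0 < r" "r < s" "s \<le> 1" and c: "0 < c'" "c' < c" "c \<le> 1"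
  obtains \<psi> \<psi>t :: "(real^'n::finite) \<times> real \<Rightarrow> real" and \<psi>x where
    "dirD et \<psi> \<psi>t" "\<And>\<alpha>. dirD (ex \<alpha>) \<psi> (\<psi>x \<alpha>)" "\<And>z. 0 \<le> \<psi> z" "\<And>z. \<psi> z \<le> 64" "\<And>z. \<psi>t z \<le> 64"
    "\<And>\<alpha> z. (\<psi>x \<alpha> z)\<^sup>2 \<le> 64 * \<psi> z" "\<And>z. z \<notin> Z s c \<Longrightarrow> \<psi> z = 0 \<and> \<psi>t z = 0"
    "\<And>z. z \<in> Z r c' \<Longrightarrow> sqp (s\<^sup>2 - r\<^sup>2) * sqp (s - r) \<le> \<psi> z"
proof -
  define X where "X z = sqp (s\<^sup>2 - fst z \<bullet> fst z)" for z :: "(real^'n) \<times> real"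
  define U where "U t = sqp (t + s)" for t
  \<comment> \<open>Equal to 1 up to time \<open>c'\<close> and to 0 from time \<open>c\<close> on.
    Its slope is unbounded as \<open>c'\<close> approaches \<open>c\<close> but never
    positive.\<close>
  define D where "D t = sqp (1 - sqp (t - c') / (c - c')\<^sup>2)" for t
  define U' where "U' t = 2 * max 0 (t + s)" for t :: real
  define D' where "D' t = 2 * max 0 (1 - sqp (t - c') / (c - c')\<^sup>2) * (- (2 * max 0 (t - c') / (c - c')\<^sup>2))" for t
  define X' where "X' \<alpha> z = 2 * max 0 (s\<^sup>2 - fst z \<bullet> fst z) * (- (2 * fst z $ \<alpha>))" for \<alpha> and z :: "(real^'n) \<times> real"
  define \<psi> where "\<psi> z = X z * (U (snd z) * D (snd z))" for z
  define \<psi>t where "\<psi>t z = X z * (U' (snd z) * D (snd z) + U (snd z) * D' (snd z))" for z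
  define \<psi>x where "\<psi>x \<alpha> z = X' \<alpha> z * (U (snd z) * D (snd z))" for \<alpha> z
  have X0: "X z = 0" "X' \<alpha> z = 0" if "s \<le> norm (fst z)" for z \<alpha>
  proof -
    have "s\<^sup>2 \<le> (norm (fst z))\<^sup>2" using that rs by (intro power_mono) auto
    then show "X z = 0" "X' \<alpha> z = 0" by (auto simp: X_def X'_def sqp_def power2_norm_eq_inner)
  qed
  have U0: "U t = 0" "U' t = 0" if "t \<le> - s" for t using that by (auto simp: U_def U'_def sqp_def)
  have D0: "D t = 0" "D' t = 0" if "c \<le> t" for t
  proof -
    have "(c - c')\<^sup>2 \<le> sqp (t - c')" using that c by (auto simp: sqp_def intro!: power_mono)
    then have "1 - sqp (t - c') / (c - c')\<^sup>2 \<le> 0" using c by simp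
    then show "D t = 0" "D' t = 0" by (auto simp: D_def D'_def sqp_def)
  qed
  have zero: "\<psi> z = 0 \<and> \<psi>t z = 0 \<and> \<psi>x \<alpha> z = 0" if "z \<notin> Z s c" for z \<alpha>
  proof -
    have "s \<le> norm (fst z) \<or> snd z \<le> - s \<or> c \<le> snd z"
      using that by (cases z) (auto simp: Z_def not_less)
    then show ?thesis using X0(1)[of z] X0(2)[of z \<alpha>] U0[of "snd z"] D0[of "snd z"] unfolding \<psi>_def \<psi>t_def \<psi>x_def by auto
  qed
  have cont: "continuous_on UNIV \<psi>" "continuous_on UNIV \<psi>t" "continuous_on UNIV (\<psi>x \<alpha>)" for \<alpha>
    unfolding \<psi>_def \<psi>t_def \<psi>x_def X_def U_def D_def U'_def D'_def X'_def
    using c by (auto intro!: continuous_intros sqp_cont)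
  have bdd: "z \<notin> Z s c" if "3 < norm z" for z
  proof
    assume "z \<in> Z s c"
    then have "norm (fst z) < 1" "\<bar>snd z\<bar> \<le> 1" using rs c by (auto simp: Z_def)
    then show False using norm_Pair_le[of "fst z" "snd z"] that by simp
  qed
  have cc: "cc \<psi>" "cc \<psi>t" "cc (\<psi>x \<alpha>)" for \<alpha>
    by (rule ccI[of _ 3], rule cont, use zero[OF bdd] in blast)+
  have b: "0 \<le> X z" "0 \<le> U t" "0 \<le> D t" "X z \<le> 1" "D t \<le> 1" for z t
  proof -
    show "0 \<le> X z" "0 \<le> U t" "0 \<le> D t" by (auto simp: X_def U_def D_def sqp_nonneg)
    have "s\<^sup>2 \<le> 1" using rs by (simp add: power_le_one)
    then show "X z \<le> 1" unfolding X_def using inner_ge_zero[of "fst z"] by (intro sqp_le1) linarith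
    show "D t \<le> 1" unfolding D_def by (intro sqp_le1) (simp add: sqp_nonneg)
  qed
  have UD: "U t * D t \<le> 4" "U' t * D t \<le> 4" "0 \<le> U t * D t" for t
  proof -
    show "0 \<le> U t * D t" using b by simp
    show "U t * D t \<le> 4"
    proof (cases "c \<le> t")
      case False
      then have "U t \<le> 2\<^sup>2" unfolding U_def sqp_def using c rs by (intro power_mono) auto
      then show ?thesis using mult_mono[of "U t" 4 "D t" 1] b by simp
    qed (use D0 in auto)
    show "U' t * D t \<le> 4"
    proof (cases "c \<le> t")
      case False
      then have "U' t \<le> 4" unfolding U'_def using c rs by auto
      then show ?thesis using mult_mono[of "U' t" 4 "D t" 1] b by simp
    qed (use D0 in auto)
  qed
  show thesis
  proof (rule that[of \<psi> \<psi>t \<psi>x])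
    show "dirD et \<psi> \<psi>t"
      unfolding dirD_def
    proof (intro conjI cc allI)
      fix z :: "(real^'n) \<times> real"
      have 1: "((\<lambda>h. U (snd z + h)) has_real_derivative U' (snd z)) (at 0)"
        unfolding U_def U'_def by (rule DERIV_cong[OF sqp_chain]) (auto intro!: derivative_eq_intros)
      have 2: "((\<lambda>h. D (snd z + h)) has_real_derivative D' (snd z)) (at 0)"
        unfolding D_def D'_def by (rule DERIV_cong[OF sqp_chain], rule DERIV_diff[OF DERIV_const DERIV_cdivide[OF sqp_chain]])
           (auto intro!: derivative_eq_intros)
      have 3: "((\<lambda>h. X z * (U (snd z + h) * D (snd z + h))) has_real_derivative \<psi>t z) (at 0)"
        unfolding \<psi>t_def by (rule DERIV_cmult) (rule DERIV_cong[OF DERIV_mult[OF 1 2]], simp add: algebra_simps)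
      then show "((\<lambda>h. \<psi> (z + h *\<^sub>R et)) has_real_derivative \<psi>t z) (at 0)"
        unfolding \<psi>_def X_def by simp
    qed
    show "dirD (ex \<alpha>) \<psi> (\<psi>x \<alpha>)" for \<alpha>
      unfolding dirD_def
    proof (intro conjI cc allI)
      fix z :: "(real^'n) \<times> real"
      have e: "(fst z + h *\<^sub>R axis \<alpha> 1) \<bullet> (fst z + h *\<^sub>R axis \<alpha> 1) = fst z \<bullet> fst z + h * (2 * fst z $ \<alpha>) + h\<^sup>2" for h
      proof -
        have "(a + h *\<^sub>R b) \<bullet> (a + h *\<^sub>R b) = a \<bullet> a + h * (2 * (a \<bullet> b)) + h\<^sup>2 * (b \<bullet> b)" for a b :: "real^'n"
          by (simp add: inner_add_left inner_add_right inner_commute[of b a] power2_eq_square algebra_simps)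
        then show ?thesis by (simp add: inner_axis inner_axis_axis)
      qed
      have "((\<lambda>h. sqp (s\<^sup>2 - (fst z \<bullet> fst z + h * (2 * fst z $ \<alpha>) + h\<^sup>2))) has_real_derivative X' \<alpha> z) (at 0)"
      proof -
        have "((\<lambda>h. s\<^sup>2 - (fst z \<bullet> fst z + h * (2 * fst z $ \<alpha>) + h\<^sup>2)) has_real_derivative - (2 * fst z $ \<alpha>)) (at 0)"
          by (auto intro!: derivative_eq_intros)
        from sqp_chain[OF this] show ?thesis by (simp add: X'_def)
      qed
      then have "((\<lambda>h. X (z + h *\<^sub>R ex \<alpha>) * (U (snd z) * D (snd z))) has_real_derivative X' \<alpha> z * (U (snd z) * D (snd z))) (at 0)"
        unfolding X_def by (intro DERIV_cmult_right) (simp add: e)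
      then show "((\<lambda>h. \<psi> (z + h *\<^sub>R ex \<alpha>)) has_real_derivative \<psi>x \<alpha> z) (at 0)"
        unfolding \<psi>_def \<psi>x_def by simp
    qed
    show "0 \<le> \<psi> z" for z unfolding \<psi>_def using b by simp
    show "\<psi> z \<le> 64" for z
      unfolding \<psi>_def using mult_mono[OF b(4)[of z] UD(1)[of "snd z"] _ UD(3)] by simp
    show "\<psi>t z \<le> 64" for z
    proof -
      have "D' (snd z) \<le> 0" unfolding D'_def by (intro mult_nonneg_nonpos) auto
      then have "U (snd z) * D' (snd z) \<le> 0" using b by (intro mult_nonneg_nonpos) auto
      then have "U' (snd z) * D (snd z) + U (snd z) * D' (snd z) \<le> 4" using UD(2)[of "snd z"] by linarith
      then have "X z * (U' (snd z) * D (snd z) + U (snd z) * D' (snd z)) \<le> X z * 4"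
        using b by (intro mult_left_mono) auto
      then show ?thesis using b(4)[of z] unfolding \<psi>t_def by linarith
    qed
    \<comment> \<open>This bound produces the constant 64: squaring \<open>X'\<close> gives 16 times
      \<open>X\<close> times the squared coordinate, which is at most 1, and \<open>U * D\<close> is
      at most 4.\<close>
    show "(\<psi>x \<alpha> z)\<^sup>2 \<le> 64 * \<psi> z" for \<alpha> z
    proof (cases "s \<le> norm (fst z)")
      case False
      have "\<bar>fst z $ \<alpha>\<bar> \<le> 1" using False rs component_le_norm_cart[of "fst z" \<alpha>] by linarith
      then have x1: "(fst z $ \<alpha>)\<^sup>2 \<le> 1" by (simp add: abs_square_le_1)
      have "(\<psi>x \<alpha> z)\<^sup>2 = 16 * ((fst z $ \<alpha>)\<^sup>2 * (X z * (U (snd z) * D (snd z))\<^sup>2))"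
        unfolding \<psi>x_def X'_def X_def sqp_def by (simp add: power_mult_distrib)
      also have "\<dots> \<le> 16 * (1 * (X z * (4 * (U (snd z) * D (snd z)))))"
        unfolding power2_eq_square[of "U _ * D _"] using x1 b UD
        by (intro mult_left_mono mult_mono) auto
      finally show ?thesis unfolding \<psi>_def by simp
    qed (use X0 b in \<open>simp add: \<psi>x_def \<psi>_def\<close>)
    show "\<psi> z = 0 \<and> \<psi>t z = 0" if "z \<notin> Z s c" for z using zero that by blast
    show "sqp (s\<^sup>2 - r\<^sup>2) * sqp (s - r) \<le> \<psi> z" if "z \<in> Z r c'" for z
    proof -
      have 1: "norm (fst z) < r" "- r < snd z" "snd z < c'" using that by (auto simp: Z_def)
      have "(norm (fst z))\<^sup>2 \<le> r\<^sup>2" using 1 by (intro power_mono) auto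
      then have "sqp (s\<^sup>2 - r\<^sup>2) \<le> X z" unfolding X_def by (intro sqp_mono) (simp add: power2_norm_eq_inner)
      moreover have "sqp (s - r) \<le> U (snd z)" unfolding U_def using 1 by (intro sqp_mono) auto
      moreover have "D (snd z) = 1" unfolding D_def using 1 by (simp add: sqp_def)
      ultimately show ?thesis unfolding \<psi>_def using b by (simp add: mult_mono sqp_nonneg)
    qed
  qed
qed

lemma SP_nonneg: "0 \<le> SP S P" unfolding SP_def by (intro sum_nonneg sqn_nonneg)

lemma smooth_sol_cc:
  assumes "smooth_sol A S w P G" shows "cc (w i)" "cc (P i \<alpha>)" "cc (G i \<alpha>)"
  using assms unfolding smooth_sol_def dirD_def by blast+

text \<open>\<open>C\<close> is fixed before \<open>c'\<close> and \<open>c\<close>, so the estimate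
  persists when the room above the top shrinks to nothing.\<close>

lemma energy_cylinder:
  fixes l M r s :: real
  assumes "0 < l" "0 < r" "r < s" "s \<le> 1"
  shows "\<exists>C>0. \<forall>(A :: 'm::finite \<Rightarrow> 'm \<Rightarrow> 'n::finite \<Rightarrow> 'n \<Rightarrow> real) c' c w P G.
    elliptic l M A \<longrightarrow> 0 < c' \<longrightarrow> c' < c \<longrightarrow> c \<le> 1 \<longrightarrow> smooth_sol A (Z s c) w P G \<longrightarrow>
    SP (Z r c') P \<le> C * (SW (Z s c) w + SP (Z s c) G)"
proof -
  define B where "B = 2 * (M * real (CARD('m) * CARD('n)))\<^sup>2 * real (CARD('m) * CARD('n)) + 1"
  define C where "C = 64 / l + 64 + 2 * 64 * l / (4 * B) + real CARD('n) * 64 * B / l"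
  \<comment> \<open>The lower bound of the cutoff on the smaller cylinder.\<close>
  define b where "b = sqp (s\<^sup>2 - r\<^sup>2) * sqp (s - r)"
  have "1 \<le> B" by (simp add: B_def)
  then have C: "0 < C" unfolding C_def using assms by (intro add_pos_nonneg) auto
  have "r\<^sup>2 < s\<^sup>2" using assms by (intro power_strict_mono) auto
  then have b: "0 < b" unfolding b_def sqp_def using assms by simp
  show ?thesis
  proof (intro exI[of _ "2 * C / (l * b)"] conjI allI impI)
    show "0 < 2 * C / (l * b)" using C b assms by simp
    fix A :: "'m \<Rightarrow> 'm \<Rightarrow> 'n \<Rightarrow> 'n \<Rightarrow> real" and c' c w P G
    assume A: "elliptic l M A" and c: "0 < c'" "c' < c" "c \<le> 1" and sol: "smooth_sol A (Z s c) w P G"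
    obtain \<psi> \<psi>t :: "(real^'n) \<times> real \<Rightarrow> real" and \<psi>x where
     \<psi>: "dirD et \<psi> \<psi>t" "\<And>\<alpha>. dirD (ex \<alpha>) \<psi> (\<psi>x \<alpha>)" "\<And>z. 0 \<le> \<psi> z" "\<And>z. \<psi> z \<le> 64" "\<And>z. \<psi>t z \<le> 64"
     "\<And>\<alpha> z. (\<psi>x \<alpha> z)\<^sup>2 \<le> 64 * \<psi> z" "\<And>z. z \<notin> Z s c \<Longrightarrow> \<psi> z = 0 \<and> \<psi>t z = 0"
     "\<And>z. z \<in> Z r c' \<Longrightarrow> sqp (s\<^sup>2 - r\<^sup>2) * sqp (s - r) \<le> \<psi> z"
      by (rule cutoff[OF assms(2-4) c]) (rule that; assumption)
    have en: "l / 2 * (LINT z|lborel. \<psi> z * nsq (\<lambda>i \<alpha>. P i \<alpha> z)) \<le> C * (SW (Z s c) w + SP (Z s c) G)"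
      by (rule energy_estimate[OF assms(1) A _ sol \<psi>(1-6) Z_borel _ _ B_def C_def]) (use \<psi>(7) in auto)
    have cP: "cc (P i \<alpha>)" for i \<alpha> using smooth_sol_cc[OF sol] by blast
    have c\<psi>: "cc \<psi>" using \<psi>(1) by (auto simp: dirD_def)
    have int: "integrable lborel (\<lambda>z. \<psi> z * nsq (\<lambda>i \<alpha>. P i \<alpha> z))"
      unfolding nsq_def by (intro cc_integrable cc_mult cc_sum cc_power2 cP c\<psi>)
    note iP = SP_integral[of P "Z r c'", OF cc_l2[OF cP] Z_borel]
    have "b * SP (Z r c') P = (LINT z|lborel. b * (indicator (Z r c') z * nsq (\<lambda>i \<alpha>. P i \<alpha> z)))"
      using iP by simp
    also have "\<dots> \<le> (LINT z|lborel. \<psi> z * nsq (\<lambda>i \<alpha>. P i \<alpha> z))"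
    proof (intro integral_mono integrable_mult_right iP int)
      show "b * (indicator (Z r c') z * nsq (\<lambda>i \<alpha>. P i \<alpha> z)) \<le> \<psi> z * nsq (\<lambda>i \<alpha>. P i \<alpha> z)" for z
        using mult_right_mono[OF \<psi>(8)[of z, folded b_def] nsq_nonneg[of "\<lambda>i \<alpha>. P i \<alpha> z"]] \<psi>(3)[of z] nsq_nonneg[of "\<lambda>i \<alpha>. P i \<alpha> z"]
        by (auto simp: indicator_def)
    qed
    finally have "l / 2 * (b * SP (Z r c') P) \<le> l / 2 * (LINT z|lborel. \<psi> z * nsq (\<lambda>i \<alpha>. P i \<alpha> z))"
      using assms(1) by (intro mult_left_mono) auto
    with en have "l / 2 * (b * SP (Z r c') P) \<le> C * (SW (Z s c) w + SP (Z s c) G)" by linarith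
    then show "SP (Z r c') P \<le> 2 * C / (l * b) * (SW (Z s c) w + SP (Z s c) G)"
      using assms(1) b by (simp add: field_simps)
  qed
qed

subsection \<open>Translates and averages of solutions\<close>

lemma smooth_sol_subset: "smooth_sol A S w P G \<Longrightarrow> S' \<subseteq> S \<Longrightarrow> smooth_sol A S' w P G"
  unfolding smooth_sol_def
  by (elim exE conjE, (rule exI)+, (rule conjI, assumption)+, blast)

lemma flux_diff:
  "flux A (\<lambda>j \<beta>. \<xi> j \<beta> - \<xi>' j \<beta>) (\<lambda>i \<alpha>. g i \<alpha> - g' i \<alpha>) i \<alpha> = flux A \<xi> g i \<alpha> - flux A \<xi>' g' i \<alpha>"
  unfolding flux_def by (simp add: right_diff_distrib sum_subtractf)

text \<open>Constant coefficients make the system translation invariant, and linearity allows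
  differences; both equations hold where \<open>z\<close> and its translate lie in
  \<open>S\<close>.\<close>

lemma smooth_sol_translate_diff:
  assumes "smooth_sol A S w P G" "\<And>z. z \<in> S' \<Longrightarrow> z \<in> S \<and> z - a \<in> S"
  shows "smooth_sol A S' (\<lambda>i z. w i z - w i (z - a)) (\<lambda>i \<alpha> z. P i \<alpha> z - P i \<alpha> (z - a)) (\<lambda>i \<alpha> z. G i \<alpha> z - G i \<alpha> (z - a))"
proof -
  from assms(1) obtain wt wx Px Gx where "\<forall>i. dirD et (w i) (wt i)" "\<forall>i \<alpha>. dirD (ex \<alpha>) (w i) (wx i \<alpha>)"
     "\<forall>\<alpha> j \<beta>. dirD (ex \<alpha>) (P j \<beta>) (Px \<alpha> j \<beta>)" "\<forall>i \<alpha>. dirD (ex \<alpha>) (G i \<alpha>) (Gx i \<alpha>)"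
     "\<forall>z\<in>S. \<forall>i \<alpha>. wx i \<alpha> z = P i \<alpha> z"
     "\<forall>z\<in>S. \<forall>i. wt i z = (\<Sum>\<alpha>\<in>UNIV. flux A (\<lambda>j \<beta>. Px \<alpha> j \<beta> z) (\<lambda>i \<alpha>. Gx i \<alpha> z) i \<alpha>)"
    unfolding smooth_sol_def by (elim exE conjE)
  note d = this(1-4)[rule_format] and eqs = this(5,6)[rule_format]
  note T = dirD_translate[where a = "- a", simplified]
  show ?thesis
    unfolding smooth_sol_def
    by (rule exI[of _ "\<lambda>i z. wt i z - wt i (z - a)"], rule exI[of _ "\<lambda>i \<alpha> z. wx i \<alpha> z - wx i \<alpha> (z - a)"],
      rule exI[of _ "\<lambda>\<alpha> j \<beta> z. Px \<alpha> j \<beta> z - Px \<alpha> j \<beta> (z - a)"], rule exI[of _ "\<lambda>i \<alpha> z. Gx i \<alpha> z - Gx i \<alpha> (z - a)"])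
     (use assms(2) in \<open>auto intro!: dirD_diff d T simp: eqs flux_diff sum_subtractf\<close>)
qed

lemma smear_flux:
  assumes "cc \<kappa>" "\<And>j \<beta>. cc (P j \<beta>)" "\<And>i \<alpha>. cc (G i \<alpha>)"
  shows "smear \<kappa> (\<lambda>z. flux A (\<lambda>j \<beta>. P j \<beta> z) (\<lambda>i \<alpha>. G i \<alpha> z) i \<alpha>) z
    = flux A (\<lambda>j \<beta>. smear \<kappa> (P j \<beta>) z) (\<lambda>i \<alpha>. smear \<kappa> (G i \<alpha>) z) i \<alpha>"
  unfolding flux_def
  by (subst smear_diff, (intro assms cc_sum cc_cmult)+, (subst smear_sum, (intro assms cc_sum cc_cmult)+)+, simp add: smear_cmult)

lemma flux_cc:
  assumes "\<And>j \<beta>. cc (P j \<beta>)" "cc (G i \<alpha>)"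
  shows "cc (\<lambda>z. flux A (\<lambda>j \<beta>. P j \<beta> z) (\<lambda>i \<alpha>. G i \<alpha> z) i \<alpha>)"
  unfolding flux_def by (intro cc_diff cc_sum cc_cmult assms)

text \<open>Averaging in space commutes with all derivatives and with the constant matrix
  \<open>A\<close>, and the equations at \<open>z\<close> follow from those at the points
  \<open>z - (y, 0)\<close> reached by the kernel.\<close>

lemma smooth_sol_smear:
  assumes "smooth_sol A S w P G" and \<kappa>: "cc \<kappa>" and S': "\<And>z y. z \<in> S' \<Longrightarrow> \<kappa> y \<noteq> 0 \<Longrightarrow> z - (y, 0) \<in> S"
  shows "smooth_sol A S' (\<lambda>i. smear \<kappa> (w i)) (\<lambda>i \<alpha>. smear \<kappa> (P i \<alpha>)) (\<lambda>i \<alpha>. smear \<kappa> (G i \<alpha>))"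
proof -
  from assms(1) obtain wt wx Px Gx where "\<forall>i. dirD et (w i) (wt i)" "\<forall>i \<alpha>. dirD (ex \<alpha>) (w i) (wx i \<alpha>)"
     "\<forall>\<alpha> j \<beta>. dirD (ex \<alpha>) (P j \<beta>) (Px \<alpha> j \<beta>)" "\<forall>i \<alpha>. dirD (ex \<alpha>) (G i \<alpha>) (Gx i \<alpha>)"
     "\<forall>z\<in>S. \<forall>i \<alpha>. wx i \<alpha> z = P i \<alpha> z"
     "\<forall>z\<in>S. \<forall>i. wt i z = (\<Sum>\<alpha>\<in>UNIV. flux A (\<lambda>j \<beta>. Px \<alpha> j \<beta> z) (\<lambda>i \<alpha>. Gx i \<alpha> z) i \<alpha>)"
    unfolding smooth_sol_def by (elim exE conjE)
  note d = this(1-4)[rule_format] and eqs = this(5,6)[rule_format]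
  have x: "smear \<kappa> (wx i \<alpha>) z = smear \<kappa> (P i \<alpha>) z" if "z \<in> S'" for i \<alpha> z
    by (rule smear_cong) (use S' that in \<open>auto simp: eqs\<close>)
  have cP: "cc (Px \<alpha> j \<beta>)" "cc (Gx i \<alpha>)" for i \<alpha> j \<beta> using d by (auto simp: dirD_def)
  have t: "smear \<kappa> (wt i) z = (\<Sum>\<alpha>\<in>UNIV. flux A (\<lambda>j \<beta>. smear \<kappa> (Px \<alpha> j \<beta>) z) (\<lambda>i \<alpha>. smear \<kappa> (Gx i \<alpha>) z) i \<alpha>)"
    if "z \<in> S'" for i z
  proof -
    have "smear \<kappa> (wt i) z = smear \<kappa> (\<lambda>z. \<Sum>\<alpha>\<in>UNIV. flux A (\<lambda>j \<beta>. Px \<alpha> j \<beta> z) (\<lambda>i \<alpha>. Gx i \<alpha> z) i \<alpha>) z"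
      by (rule smear_cong) (use S' that in \<open>auto simp: eqs\<close>)
    also have "\<dots> = (\<Sum>\<alpha>\<in>UNIV. smear \<kappa> (\<lambda>z. flux A (\<lambda>j \<beta>. Px \<alpha> j \<beta> z) (\<lambda>i \<alpha>. Gx i \<alpha> z) i \<alpha>) z)"
      by (intro smear_sum \<kappa> flux_cc cP)
    also have "\<dots> = (\<Sum>\<alpha>\<in>UNIV. flux A (\<lambda>j \<beta>. smear \<kappa> (Px \<alpha> j \<beta>) z) (\<lambda>i \<alpha>. smear \<kappa> (Gx i \<alpha>) z) i \<alpha>)"
      by (intro sum.cong refl smear_flux \<kappa> cP)
    finally show ?thesis .
  qed
  show ?thesis
    unfolding smooth_sol_def
    by (rule exI[of _ "\<lambda>i. smear \<kappa> (wt i)"], rule exI[of _ "\<lambda>i \<alpha>. smear \<kappa> (wx i \<alpha>)"],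
      rule exI[of _ "\<lambda>\<alpha> j \<beta>. smear \<kappa> (Px \<alpha> j \<beta>)"], rule exI[of _ "\<lambda>i \<alpha>. smear \<kappa> (Gx i \<alpha>)"])
     (auto intro!: smear_dirD \<kappa> d x t)
qed

lemma sum_sq_inner_le: "(\<Sum>\<alpha>\<in>UNIV. y $ \<alpha> * p \<alpha>)\<^sup>2 \<le> (norm (y::real^'n::finite))\<^sup>2 * (\<Sum>\<alpha>\<in>UNIV. (p \<alpha>)\<^sup>2)"
proof -
  have "(norm y)\<^sup>2 = (\<Sum>\<alpha>\<in>UNIV. (y $ \<alpha>)\<^sup>2)"
    by (simp add: power2_norm_eq_inner inner_vec_def) (simp add: power2_eq_square)
  then show ?thesis using Cauchy_Schwarz_ineq_sum[of "\<lambda>\<alpha>. y $ \<alpha>" p UNIV] by simp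
qed

lemma sqn_linear_le:
  fixes y :: "real^'n::finite"
  assumes "\<And>\<alpha>. l2 (P \<alpha>)" "S \<in> sets borel"
  shows "sqn S (\<lambda>z. \<Sum>\<alpha>\<in>UNIV. y $ \<alpha> * P \<alpha> z) \<le> (norm y)\<^sup>2 * (\<Sum>\<alpha>\<in>UNIV. sqn S (P \<alpha>))"
proof -
  have "sqn S (\<lambda>z. \<Sum>\<alpha>\<in>UNIV. y $ \<alpha> * P \<alpha> z) \<le> (LINT z|lborel. (norm y)\<^sup>2 * (\<Sum>\<alpha>\<in>UNIV. indicator S z * (P \<alpha> z)\<^sup>2))"
    unfolding sqn_def
  proof (intro integral_mono integrable_mult_right Bochner_Integration.integrable_sum l2_ind l2_sum l2_cmult assms)
    show "indicator S z * (\<Sum>\<alpha>\<in>UNIV. y $ \<alpha> * P \<alpha> z)\<^sup>2 \<le> (norm y)\<^sup>2 * (\<Sum>\<alpha>\<in>UNIV. indicator S z * (P \<alpha> z)\<^sup>2)" for z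
      using sum_sq_inner_le[of y "\<lambda>\<alpha>. P \<alpha> z"] by (cases "z \<in> S") auto
  qed
  also have "\<dots> = (norm y)\<^sup>2 * (\<Sum>\<alpha>\<in>UNIV. sqn S (P \<alpha>))"
    unfolding sqn_def integral_mult_right_zero
    by (subst Bochner_Integration.integral_sum) (auto intro: l2_ind assms)
  finally show ?thesis .
qed

lemma sqn_diff: "l2 F \<Longrightarrow> l2 G \<Longrightarrow> S \<in> sets borel \<Longrightarrow> sqn S (\<lambda>z. F z - G z) \<le> 2 * sqn S F + 2 * sqn S G"
  using sqn_add[of F "\<lambda>z. - 1 * G z" S] l2_cmult[of G "-1"] sqn_cmult[of S "-1" G] by simp

lemma sqn_translate_minus: "l2 F \<Longrightarrow> sqn UNIV (\<lambda>z. F (z - a)) = sqn UNIV F"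
  using sqn_translate[of F "- a"] by simp

lemma sqn_UNIV: "l2 F \<Longrightarrow> S \<in> sets borel \<Longrightarrow> sqn S F \<le> sqn UNIV F"
  by (rule sqn_mono_set) auto

lemma SP_component: "sqn S (P i \<alpha>) \<le> SP S P"
proof -
  have "sqn S (P i \<alpha>) \<le> (\<Sum>\<alpha>\<in>UNIV. sqn S (P i \<alpha>))" by (intro member_le_sum) (auto simp: sqn_nonneg)
  also have "\<dots> \<le> SP S P" unfolding SP_def
    by (rule member_le_sum[where f = "\<lambda>i. \<Sum>\<alpha>\<in>UNIV. sqn S (P i \<alpha>)"]) (auto intro: sum_nonneg sqn_nonneg)
  finally show ?thesis .
qed

lemma SP_mono: "(\<And>i \<alpha>. sqn S (P i \<alpha>) \<le> c * sqn S' (Q i \<alpha>)) \<Longrightarrow> SP S P \<le> c * SP S' Q"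
  unfolding SP_def sum_distrib_left by (intro sum_mono)

text \<open>\<open>smooth_sol\<close> records derivatives along coordinate axes only, whereas
  comparing translates by an arbitrary vector \<open>y\<close> uses the derivative along
  \<open>y\<close> itself.\<close>

definition grad_dir :: "((real^'n) \<times> real) set \<Rightarrow> ('m::finite \<Rightarrow> (real^'n::finite) \<times> real \<Rightarrow> real) \<Rightarrow> ('m \<Rightarrow> 'n \<Rightarrow> (real^'n) \<times> real \<Rightarrow> real) \<Rightarrow> bool" where
  "grad_dir S U P \<longleftrightarrow> (\<forall>i y. \<exists>F'. dirD (y, 0) (U i) F' \<and> (\<forall>z\<in>S. F' z = (\<Sum>\<alpha>\<in>UNIV. y $ \<alpha> * P i \<alpha> z)))"

lemma Z_shift:
  assumes "z \<in> Z r c" "norm y \<le> s - r" "r \<le> s" shows "z - (y, 0) \<in> Z s c"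
proof -
  have "norm (fst z - y) < s" using assms norm_triangle_ineq4[of "fst z" y] by (auto simp: Z_def)
  then show ?thesis using assms by (cases z) (auto simp: Z_def)
qed

text \<open>The energy estimate for the difference of two translates: its zero-order term is an
  increment of \<open>U\<close> over the vector \<open>y\<close>, hence small of order
  \<open>norm y\<close> in L2, while the data only admit the trivial bound by
  \<open>4 * SP UNIV G\<close>. The radii 3/8, 1/2, 5/8 leave 1/8 for the cutoff and 1/8 for the
  shift.\<close>

lemma translate_estimate:
  fixes l M :: real
  assumes l: "0 < l"
  shows "\<exists>C>0. \<forall>(A :: 'm::finite \<Rightarrow> 'm \<Rightarrow> 'n::finite \<Rightarrow> 'n \<Rightarrow> real) c' c U P G y.
    elliptic l M A \<longrightarrow> 0 < c' \<longrightarrow> c' < c \<longrightarrow> c \<le> 1 \<longrightarrow> smooth_sol A (Z (5/8) c) U P G \<longrightarrow>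
    grad_dir (Z (5/8) c) U P \<longrightarrow> norm y \<le> 1/8 \<longrightarrow>
    SP (Z (3/8) c') (\<lambda>i \<alpha> z. P i \<alpha> z - P i \<alpha> (z - (y, 0))) \<le> C * ((norm y)\<^sup>2 * SP UNIV P + 4 * SP UNIV G)"
proof -
  obtain C where C: "0 < C" "\<And>(A :: 'm \<Rightarrow> 'm \<Rightarrow> 'n \<Rightarrow> 'n \<Rightarrow> real) c' c w P G.
    elliptic l M A \<Longrightarrow> 0 < c' \<Longrightarrow> c' < c \<Longrightarrow> c \<le> 1 \<Longrightarrow> smooth_sol A (Z (1/2) c) w P G \<Longrightarrow>
    SP (Z (3/8) c') P \<le> C * (SW (Z (1/2) c) w + SP (Z (1/2) c) G)"
    using energy_cylinder[of l "3/8" "1/2" M, where 'm = 'm and 'n = 'n] l by (auto simp: Ball_def)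
  show ?thesis
  proof (intro exI[of _ C] conjI allI impI C(1))
    fix A :: "'m \<Rightarrow> 'm \<Rightarrow> 'n \<Rightarrow> 'n \<Rightarrow> real" and c' c U P G and y :: "real^'n"
    assume A: "elliptic l M A" and c: "0 < c'" "c' < c" "c \<le> 1" and sol: "smooth_sol A (Z (5/8) c) U P G"
      and gd: "grad_dir (Z (5/8) c) U P" and y: "norm y \<le> 1/8"
    note cc = smooth_sol_cc[OF sol]
    have "smooth_sol A (Z (1/2) c) (\<lambda>i z. U i z - U i (z - (y,0))) (\<lambda>i \<alpha> z. P i \<alpha> z - P i \<alpha> (z - (y,0))) (\<lambda>i \<alpha> z. G i \<alpha> z - G i \<alpha> (z - (y,0)))"
      by (rule smooth_sol_translate_diff[OF sol]) (use Z_mono[of "1/2" "5/8" c c] Z_shift[of _ "1/2" c y "5/8"] y in auto)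
    note est = C(2)[OF A c this]
    have G: "SP (Z (1/2) c) (\<lambda>i \<alpha> z. G i \<alpha> z - G i \<alpha> (z - (y,0))) \<le> 4 * SP UNIV G"
    proof (rule SP_mono)
      fix i \<alpha>
      have "sqn (Z (1/2) c) (\<lambda>z. G i \<alpha> z - G i \<alpha> (z - (y,0))) \<le> sqn UNIV (\<lambda>z. G i \<alpha> z - G i \<alpha> (z - (y,0)))"
        by (intro sqn_UNIV l2_diff cc_l2 cc cc_translate_minus) auto
      also have "\<dots> \<le> 2 * sqn UNIV (G i \<alpha>) + 2 * sqn UNIV (\<lambda>z. G i \<alpha> (z - (y,0)))"
        by (intro sqn_diff cc_l2 cc cc_translate_minus) auto
      also have "sqn UNIV (\<lambda>z. G i \<alpha> (z - (y,0))) = sqn UNIV (G i \<alpha>)"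
        by (intro sqn_translate_minus cc_l2 cc)
      finally show "sqn (Z (1/2) c) (\<lambda>z. G i \<alpha> z - G i \<alpha> (z - (y,0))) \<le> 4 * sqn UNIV (G i \<alpha>)" by simp
    qed
    \<comment> \<open>The increment is taken along \<open>- y\<close> and measured on the cylinder
      of radius 1/2, so that the whole segment stays where the derivative of \<open>U\<close> is
      given by \<open>P\<close>.\<close>
    have W: "sqn (Z (1/2) c) (\<lambda>z. U i z - U i (z - (y,0))) \<le> (norm y)\<^sup>2 * (\<Sum>\<alpha>\<in>UNIV. sqn UNIV (P i \<alpha>))" for i
    proof -
      obtain F' where F': "dirD (- y, 0) (U i) F'" "\<And>z. z \<in> Z (5/8) c \<Longrightarrow> F' z = (\<Sum>\<alpha>\<in>UNIV. (- y) $ \<alpha> * P i \<alpha> z)"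
        using gd unfolding grad_dir_def by meson
      have "sqn (Z (1/2) c) (\<lambda>z. U i (z + (- y, 0)) - U i z) \<le> (norm y)\<^sup>2 * (\<Sum>\<alpha>\<in>UNIV. sqn UNIV (P i \<alpha>))"
      proof (rule dirD_increment_sqn[OF F'(1)])
        fix s :: real assume s: "0 \<le> s" "s \<le> 1"
        have "norm (s *\<^sub>R y) \<le> 1/8" using s y mult_left_le_one_le[of "norm y" s] by auto
        then have "z + s *\<^sub>R (- y, 0) \<in> Z (5/8) c" if "z \<in> Z (1/2) c" for z
        proof -
          have "z + s *\<^sub>R (- y, 0) = z - (s *\<^sub>R y, 0)" by (cases z) simp
          then show ?thesis
            by (simp only:) (rule Z_shift[OF that], use \<open>norm (s *\<^sub>R y) \<le> 1/8\<close> in auto)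
        qed
        then have "sqn (Z (1/2) c) (\<lambda>z. F' (z + s *\<^sub>R (- y, 0)))
          = sqn (Z (1/2) c) (\<lambda>z. \<Sum>\<alpha>\<in>UNIV. (- y) $ \<alpha> * P i \<alpha> (z + s *\<^sub>R (- y, 0)))"
          by (intro sqn_cong F'(2))
        also have "\<dots> \<le> (norm (- y))\<^sup>2 * (\<Sum>\<alpha>\<in>UNIV. sqn (Z (1/2) c) (\<lambda>z. P i \<alpha> (z + s *\<^sub>R (- y, 0))))"
          by (intro sqn_linear_le cc_l2 cc_translate cc) auto
        also have "\<dots> \<le> (norm y)\<^sup>2 * (\<Sum>\<alpha>\<in>UNIV. sqn UNIV (P i \<alpha>))"
        proof -
          have "sqn (Z (1/2) c) (\<lambda>z. P i \<alpha> (z + s *\<^sub>R (- y, 0))) \<le> sqn UNIV (P i \<alpha>)" for \<alpha>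
            using sqn_UNIV[of "\<lambda>z. P i \<alpha> (z + s *\<^sub>R (- y, 0))" "Z (1/2) c"] sqn_translate[of "P i \<alpha>" "s *\<^sub>R (- y, 0)"]
              cc_l2[OF cc(2)[of i \<alpha>]] cc_l2[OF cc_translate[OF cc(2)[of i \<alpha>], of "s *\<^sub>R (- y, 0)"]] by simp
          then show ?thesis by (auto intro!: mult_left_mono sum_mono)
        qed
        finally show "sqn (Z (1/2) c) (\<lambda>z. F' (z + s *\<^sub>R (- y, 0))) \<le> (norm y)\<^sup>2 * (\<Sum>\<alpha>\<in>UNIV. sqn UNIV (P i \<alpha>))" .
      qed (auto intro!: mult_nonneg_nonneg sum_nonneg sqn_nonneg)
      moreover have "sqn (Z (1/2) c) (\<lambda>z. U i z - U i (z - (y,0))) = sqn (Z (1/2) c) (\<lambda>z. U i (z + (- y, 0)) - U i z)"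
      proof -
        have "z + (- y, 0) = z - (y, 0)" for z :: "(real^'n) \<times> real" by (cases z) simp
        then show ?thesis
          unfolding sqn_def by (intro Bochner_Integration.integral_cong refl) (simp only: power2_commute[of "U i _" "U i (_ - _)"])
      qed
      ultimately show ?thesis by simp
    qed
    have "SW (Z (1/2) c) (\<lambda>i z. U i z - U i (z - (y,0))) \<le> (\<Sum>i\<in>UNIV. (norm y)\<^sup>2 * (\<Sum>\<alpha>\<in>UNIV. sqn UNIV (P i \<alpha>)))"
      unfolding SW_def by (intro sum_mono W)
    also have "\<dots> = (norm y)\<^sup>2 * SP UNIV P" by (simp add: SP_def sum_distrib_left)
    finally show "SP (Z (3/8) c') (\<lambda>i \<alpha> z. P i \<alpha> z - P i \<alpha> (z - (y, 0))) \<le> C * ((norm y)\<^sup>2 * SP UNIV P + 4 * SP UNIV G)"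
      using est G C(1) by (smt (verit) mult_left_mono)
  qed
qed

text \<open>Averages of the translate estimate over the kernel. It is the replacement for second
  derivatives: \<open>P\<close> is close to its average up to a small multiple of its energy,
  whatever the regularity of \<open>G\<close>.\<close>

lemma smear_estimate:
  fixes l M :: real
  assumes l: "0 < l"
  shows "\<exists>C>0. \<forall>(A :: 'm::finite \<Rightarrow> 'm \<Rightarrow> 'n::finite \<Rightarrow> 'n \<Rightarrow> real) c' c U P G \<kappa> \<epsilon>.
    elliptic l M A \<longrightarrow> 0 < c' \<longrightarrow> c' < c \<longrightarrow> c \<le> 1 \<longrightarrow> smooth_sol A (Z (5/8) c) U P G \<longrightarrow>
    grad_dir (Z (5/8) c) U P \<longrightarrow> 0 \<le> \<epsilon> \<longrightarrow> \<epsilon> \<le> 1/8 \<longrightarrow> cc \<kappa> \<longrightarrow> (LINT y|lborel. \<kappa> y) = 1 \<longrightarrow> (\<forall>y. 0 \<le> \<kappa> y) \<longrightarrow>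
    (\<forall>y. \<kappa> y \<noteq> 0 \<longrightarrow> norm y \<le> \<epsilon>) \<longrightarrow>
    SP (Z (3/8) c') (\<lambda>i \<alpha> z. P i \<alpha> z - smear \<kappa> (P i \<alpha>) z) \<le> C * (\<epsilon>\<^sup>2 * SP UNIV P + SP UNIV G)"
proof -
  obtain C where C: "0 < C" "\<And>(A :: 'm \<Rightarrow> 'm \<Rightarrow> 'n \<Rightarrow> 'n \<Rightarrow> real) c' c U P G y.
    elliptic l M A \<Longrightarrow> 0 < c' \<Longrightarrow> c' < c \<Longrightarrow> c \<le> 1 \<Longrightarrow> smooth_sol A (Z (5/8) c) U P G \<Longrightarrow>
    grad_dir (Z (5/8) c) U P \<Longrightarrow> norm y \<le> 1/8 \<Longrightarrow>
    SP (Z (3/8) c') (\<lambda>i \<alpha> z. P i \<alpha> z - P i \<alpha> (z - (y, 0))) \<le> C * ((norm y)\<^sup>2 * SP UNIV P + 4 * SP UNIV G)"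
    using translate_estimate[OF l, of M, where 'm = 'm and 'n = 'n] by (elim exE conjE) blast
  define N where "N = real (CARD('m) * CARD('n))"
  have N: "0 < N" by (simp add: N_def)
  show ?thesis
  proof (intro exI[of _ "N * C * 4"] conjI allI impI)
    show "0 < N * C * 4" using C N by simp
    fix A :: "'m \<Rightarrow> 'm \<Rightarrow> 'n \<Rightarrow> 'n \<Rightarrow> real" and c' c U P G and \<kappa> :: "real^'n \<Rightarrow> real" and \<epsilon> :: real
    assume A: "elliptic l M A" and c: "0 < c'" "c' < c" "c \<le> 1" and sol: "smooth_sol A (Z (5/8) c) U P G"
      and gd: "grad_dir (Z (5/8) c) U P" and e: "0 \<le> \<epsilon>" "\<epsilon> \<le> 1/8" and \<kappa>: "cc \<kappa>" "(LINT y|lborel. \<kappa> y) = 1" "\<forall>y. 0 \<le> \<kappa> y"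
      "\<forall>y. \<kappa> y \<noteq> 0 \<longrightarrow> norm y \<le> \<epsilon>"
    note cc = smooth_sol_cc[OF sol]
    define R where "R = C * (\<epsilon>\<^sup>2 * SP UNIV P + 4 * SP UNIV G)"
    have R: "0 \<le> R" unfolding R_def using C by (intro mult_nonneg_nonneg add_nonneg_nonneg SP_nonneg) auto
    have "sqn (Z (3/8) c') (\<lambda>z. P i \<alpha> z - smear \<kappa> (P i \<alpha>) z) \<le> R" for i \<alpha>
    proof (rule smear_minus_sqn[OF \<kappa>(1,2) _ cc(2) Z_borel R])
      fix y assume "\<kappa> y \<noteq> 0"
      then have y: "norm y \<le> \<epsilon>" using \<kappa> by auto
      have "sqn (Z (3/8) c') (\<lambda>z. P i \<alpha> z - P i \<alpha> (z - (y, 0))) \<le> SP (Z (3/8) c') (\<lambda>i \<alpha> z. P i \<alpha> z - P i \<alpha> (z - (y, 0)))"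
        by (rule SP_component[where P = "\<lambda>i \<alpha> z. P i \<alpha> z - P i \<alpha> (z - (y, 0))"])
      also have "\<dots> \<le> C * ((norm y)\<^sup>2 * SP UNIV P + 4 * SP UNIV G)" by (rule C(2)[OF A c sol gd]) (use y e in auto)
      also have "\<dots> \<le> R" unfolding R_def using y C(1)
        by (intro mult_left_mono add_right_mono mult_right_mono power_mono SP_nonneg) auto
      finally show "sqn (Z (3/8) c') (\<lambda>z. P i \<alpha> z - P i \<alpha> (z - (y, 0))) \<le> R" .
    qed (use \<kappa> in auto)
    then have "SP (Z (3/8) c') (\<lambda>i \<alpha> z. P i \<alpha> z - smear \<kappa> (P i \<alpha>) z) \<le> (\<Sum>i\<in>(UNIV::'m set). \<Sum>\<alpha>\<in>(UNIV::'n set). R)"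
      unfolding SP_def by (intro sum_mono)
    also have "\<dots> = N * R" by (simp add: N_def)
    also have "\<dots> \<le> N * (C * 4 * (\<epsilon>\<^sup>2 * SP UNIV P + SP UNIV G))"
      unfolding R_def using N C SP_nonneg[of UNIV P] SP_nonneg[of UNIV G] mult_nonneg_nonneg[of "\<epsilon>\<^sup>2" "SP UNIV P"]
      by (intro mult_left_mono) (auto simp: mult.assoc)
    finally show "SP (Z (3/8) c') (\<lambda>i \<alpha> z. P i \<alpha> z - smear \<kappa> (P i \<alpha>) z) \<le> N * C * 4 * (\<epsilon>\<^sup>2 * SP UNIV P + SP UNIV G)"
      by (simp add: mult.assoc)
  qed
qed

subsection \<open>Higher derivatives of averaged solutions\<close>

text \<open>Indexed by lists of directions, the head being the derivative taken last; all iterated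
  derivatives of \<open>k []\<close> are thus available under one name.\<close>

definition kernel_family :: "real \<Rightarrow> ('n::finite list \<Rightarrow> real^'n \<Rightarrow> real) \<Rightarrow> bool" where
  "kernel_family \<epsilon> k \<longleftrightarrow> (\<forall>l i. dirD (axis i 1) (k l) (k (i # l))) \<and> (\<forall>l y. k l y \<noteq> 0 \<longrightarrow> norm y \<le> \<epsilon>)"

lemma kernel_family_cc: "kernel_family \<epsilon> k \<Longrightarrow> cc (k l)"
  unfolding kernel_family_def dirD_def by blast

text \<open>Moving the outermost derivative from the kernel to \<open>w\<close> turns
  \<open>w\<close> into \<open>P\<close>. The zero-order term for a list of directions is thereby a
  gradient term for the shorter list, which drives the induction on the order.\<close>

lemma smear_Cons_eq:
  assumes sol: "smooth_sol A S w P G" and k: "kernel_family \<epsilon> k"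
    and z: "\<And>y. norm y \<le> \<epsilon> \<Longrightarrow> z - (y, 0) \<in> S"
  shows "smear (k (\<beta> # l)) (w i) z = smear (k l) (P i \<beta>) z"
proof -
  obtain wx where d: "\<And>i \<alpha>. dirD (ex \<alpha>) (w i) (wx i \<alpha>)" and e: "\<And>z i \<alpha>. z \<in> S \<Longrightarrow> wx i \<alpha> z = P i \<alpha> z"
    using sol unfolding smooth_sol_def by blast
  have "smear (k (\<beta> # l)) (w i) = smear (k l) (wx i \<beta>)"
    using k d unfolding kernel_family_def by (intro smear_dirD_swap) auto
  moreover have "smear (k l) (wx i \<beta>) z = smear (k l) (P i \<beta>) z"
    by (rule smear_cong) (use k z in \<open>auto simp: kernel_family_def e\<close>)
  ultimately show ?thesis by simp
qed

lemma smooth_sol_smear_family: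
  assumes "smooth_sol A (Z (5/8) c) w P G" "kernel_family \<epsilon> k" "\<epsilon> \<le> 1/8"
  shows "smooth_sol A (Z (1/2) c) (\<lambda>i. smear (k l) (w i)) (\<lambda>i \<alpha>. smear (k l) (P i \<alpha>)) (\<lambda>i \<alpha>. smear (k l) (G i \<alpha>))"
proof (rule smooth_sol_smear[OF assms(1) kernel_family_cc[OF assms(2)]])
  fix z :: "(real^'b) \<times> real" and y assume "z \<in> Z (1/2) c" "k l y \<noteq> 0"
  then show "z - (y, 0) \<in> Z (5/8) c"
    using Z_shift[of z "1/2" c y "5/8"] assms(2,3) unfolding kernel_family_def by fastforce
qed

lemma SP_smear_le:
  assumes "cc \<kappa>" "\<And>i \<alpha>. cc (G i \<alpha>)" "(LINT y|lborel. \<bar>\<kappa> y\<bar>)\<^sup>2 \<le> H" "S \<in> sets borel"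
  shows "SP S (\<lambda>i \<alpha>. smear \<kappa> (G i \<alpha>)) \<le> H * SP UNIV G"
proof (rule SP_mono)
  fix i \<alpha>
  have "sqn S (smear \<kappa> (G i \<alpha>)) \<le> sqn UNIV (smear \<kappa> (G i \<alpha>))"
    using assms by (intro sqn_UNIV cc_l2 smear_cc) auto
  also have "\<dots> \<le> (LINT y|lborel. \<bar>\<kappa> y\<bar>)\<^sup>2 * sqn UNIV (G i \<alpha>)" by (rule smear_sqn) (use assms in auto)
  also have "\<dots> \<le> H * sqn UNIV (G i \<alpha>)" by (intro mult_right_mono assms sqn_nonneg)
  finally show "sqn S (smear \<kappa> (G i \<alpha>)) \<le> H * sqn UNIV (G i \<alpha>)" .
qed

text \<open>Each order costs one energy estimate, whose zero-order term is controlled by the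
  previous order. The radii fall from 1/2 towards 1/4, leaving room for every order. The kernel
  norms \<open>H\<close> multiply \<open>G\<close> only: derivatives of \<open>P\<close> are traced
  back to the kernel \<open>k []\<close> of mass at most one, so the factor of
  \<open>SP UNIV P\<close> is the same for all kernels.\<close>

lemma higher_derivatives:
  fixes l M :: real
  assumes l: "0 < l"
  shows "\<exists>C>0. \<forall>(A :: 'm::finite \<Rightarrow> 'm \<Rightarrow> 'n::finite \<Rightarrow> 'n \<Rightarrow> real) c0 c U P G \<epsilon> k H ls.
    elliptic l M A \<longrightarrow> 0 < c \<longrightarrow> c < c0 \<longrightarrow> c0 \<le> 1 \<longrightarrow> smooth_sol A (Z (5/8) c0) U P G \<longrightarrow>
    kernel_family \<epsilon> k \<longrightarrow> \<epsilon> \<le> 1/8 \<longrightarrow> (LINT y|lborel. \<bar>k [] y\<bar>)\<^sup>2 \<le> 1 \<longrightarrow> 0 \<le> H \<longrightarrow>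
    (\<forall>ls. length ls \<le> j \<longrightarrow> (LINT y|lborel. \<bar>k ls y\<bar>)\<^sup>2 \<le> H) \<longrightarrow> length ls = j \<longrightarrow>
    SP (Z (1/4 + 1 / (4 * (real j + 1))) c) (\<lambda>i \<alpha>. smear (k ls) (P i \<alpha>)) \<le> C * (SP UNIV P + H * SP UNIV G)"
proof (induction j)
  case 0
  show ?case
  proof (intro exI[of _ 1] conjI allI impI)
    fix A :: "'m \<Rightarrow> 'm \<Rightarrow> 'n \<Rightarrow> 'n \<Rightarrow> real" and c0 c U P G \<epsilon> and k :: "'n list \<Rightarrow> real^'n \<Rightarrow> real" and H :: real and ls :: "'n list"
    assume sol: "smooth_sol A (Z (5/8) c0) U P G" and k: "kernel_family \<epsilon> k" "(LINT y|lborel. \<bar>k [] y\<bar>)\<^sup>2 \<le> 1"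
      and H: "0 \<le> H" and ls: "length ls = 0"
    have "SP (Z (1/4 + 1 / (4 * (real 0 + 1))) c) (\<lambda>i \<alpha>. smear (k ls) (P i \<alpha>)) \<le> 1 * SP UNIV P"
      by (rule SP_smear_le) (use ls k smooth_sol_cc[OF sol] kernel_family_cc[OF k(1)] in auto)
    then show "SP (Z (1/4 + 1 / (4 * (real 0 + 1))) c) (\<lambda>i \<alpha>. smear (k ls) (P i \<alpha>)) \<le> 1 * (SP UNIV P + H * SP UNIV G)"
      by (rule order_trans) (use mult_nonneg_nonneg[OF H SP_nonneg[of UNIV G]] in simp)
  qed simp
next
  case (Suc j)
  define r where "r = 1/4 + 1 / (4 * (real (Suc j) + 1))"
  define s where "s = 1/4 + 1 / (4 * (real j + 1))"
  have rs: "0 < r" "r < s" "s \<le> 1/2" unfolding r_def s_def by (auto simp: field_simps add_pos_nonneg)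
  obtain C where C: "0 < C" "\<And>(A :: 'm \<Rightarrow> 'm \<Rightarrow> 'n \<Rightarrow> 'n \<Rightarrow> real) c0 c U P G \<epsilon> k H ls.
    elliptic l M A \<Longrightarrow> 0 < c \<Longrightarrow> c < c0 \<Longrightarrow> c0 \<le> 1 \<Longrightarrow> smooth_sol A (Z (5/8) c0) U P G \<Longrightarrow>
    kernel_family \<epsilon> k \<Longrightarrow> \<epsilon> \<le> 1/8 \<Longrightarrow> (LINT y|lborel. \<bar>k [] y\<bar>)\<^sup>2 \<le> 1 \<Longrightarrow> 0 \<le> H \<Longrightarrow>
    (\<forall>ls. length ls \<le> j \<longrightarrow> (LINT y|lborel. \<bar>k ls y\<bar>)\<^sup>2 \<le> H) \<Longrightarrow> length ls = j \<Longrightarrow>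
    SP (Z s c) (\<lambda>i \<alpha>. smear (k ls) (P i \<alpha>)) \<le> C * (SP UNIV P + H * SP UNIV G)"
    using Suc.IH unfolding s_def by (elim exE conjE) blast
  obtain E where E: "0 < E" "\<And>(A :: 'm \<Rightarrow> 'm \<Rightarrow> 'n \<Rightarrow> 'n \<Rightarrow> real) c' c w P G.
    elliptic l M A \<Longrightarrow> 0 < c' \<Longrightarrow> c' < c \<Longrightarrow> c \<le> 1 \<Longrightarrow> smooth_sol A (Z s c) w P G \<Longrightarrow>
    SP (Z r c') P \<le> E * (SW (Z s c) w + SP (Z s c) G)"
    using energy_cylinder[of l r s M, where 'm = 'm and 'n = 'n] l rs by (auto simp: Ball_def)
  show ?case
  proof (intro exI[of _ "E * (C + 1)"] conjI allI impI)
    show "0 < E * (C + 1)" using C E by simp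
    fix A :: "'m \<Rightarrow> 'm \<Rightarrow> 'n \<Rightarrow> 'n \<Rightarrow> real" and c0 c U P G \<epsilon> and k :: "'n list \<Rightarrow> real^'n \<Rightarrow> real" and H :: real and ls :: "'n list"
    assume A: "elliptic l M A" and c: "0 < c" "c < c0" "c0 \<le> 1" and sol: "smooth_sol A (Z (5/8) c0) U P G"
      and k: "kernel_family \<epsilon> k" "\<epsilon> \<le> 1/8" "(LINT y|lborel. \<bar>k [] y\<bar>)\<^sup>2 \<le> 1"
      and H: "0 \<le> H" "\<forall>ls. length ls \<le> Suc j \<longrightarrow> (LINT y|lborel. \<bar>k ls y\<bar>)\<^sup>2 \<le> H" and ls: "length ls = Suc j"
    obtain \<beta> l' where l': "ls = \<beta> # l'" "length l' = j" using ls by (cases ls) auto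
    \<comment> \<open>Each estimate loses a little time at the top; the midpoint divides the loss
      between the induction hypothesis and the present step.\<close>
    define c1 where "c1 = (c + c0) / 2"
    have c1: "c < c1" "c1 < c0" "c1 \<le> 1" "0 < c1" using c by (auto simp: c1_def)
    have sub: "Z s c1 \<subseteq> Z (1/2) c0" using rs c1 by (intro Z_mono) auto
    have "smooth_sol A (Z s c1) (\<lambda>i. smear (k ls) (U i)) (\<lambda>i \<alpha>. smear (k ls) (P i \<alpha>)) (\<lambda>i \<alpha>. smear (k ls) (G i \<alpha>))"
      by (rule smooth_sol_subset[OF smooth_sol_smear_family[OF sol k(1,2)] sub])
    from E(2)[OF A c(1) c1(1,3) this]
    have "SP (Z r c) (\<lambda>i \<alpha>. smear (k ls) (P i \<alpha>)) \<le> E * (SW (Z s c1) (\<lambda>i. smear (k ls) (U i)) + SP (Z s c1) (\<lambda>i \<alpha>. smear (k ls) (G i \<alpha>)))" .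
    also have "\<dots> \<le> E * (C * (SP UNIV P + H * SP UNIV G) + H * SP UNIV G)"
    proof (intro mult_left_mono add_mono)
      have "SW (Z s c1) (\<lambda>i. smear (k ls) (U i)) = (\<Sum>i\<in>UNIV. sqn (Z s c1) (smear (k l') (P i \<beta>)))"
        unfolding SW_def
      proof (intro sum.cong refl sqn_cong)
        fix i and z :: "(real^'n) \<times> real" assume "z \<in> Z s c1"
        then have "z \<in> Z (1/2) c0" using sub by auto
        then show "smear (k ls) (U i) z = smear (k l') (P i \<beta>) z"
          unfolding l'(1) by (intro smear_Cons_eq[OF sol k(1)] Z_shift) (use k in auto)
      qed
      also have "\<dots> \<le> SP (Z s c1) (\<lambda>i \<alpha>. smear (k l') (P i \<alpha>))"
        unfolding SP_def
        by (intro sum_mono member_le_sum[where f = "\<lambda>\<beta>. sqn (Z s c1) (smear (k l') (P _ \<beta>))"]) (auto simp: sqn_nonneg)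
      also have "\<dots> \<le> C * (SP UNIV P + H * SP UNIV G)"
        by (rule C(2)[OF A c1(4,2) c(3) sol k H(1) _ l'(2)]) (use H in auto)
      finally show "SW (Z s c1) (\<lambda>i. smear (k ls) (U i)) \<le> C * (SP UNIV P + H * SP UNIV G)" .
      show "SP (Z s c1) (\<lambda>i \<alpha>. smear (k ls) (G i \<alpha>)) \<le> H * SP UNIV G"
        by (rule SP_smear_le) (use ls H smooth_sol_cc[OF sol] kernel_family_cc[OF k(1)] in auto)
    qed (use E in auto)
    also have "\<dots> \<le> E * ((C + 1) * (SP UNIV P + H * SP UNIV G))"
      using E SP_nonneg[of UNIV P] by (intro mult_left_mono) (auto simp: algebra_simps)
    finally show "SP (Z (1/4 + 1 / (4 * (real (Suc j) + 1))) c) (\<lambda>i \<alpha>. smear (k ls) (P i \<alpha>)) \<le> E * (C + 1) * (SP UNIV P + H * SP UNIV G)"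
      unfolding r_def by (simp add: mult.assoc)
  qed
qed

lemma sum_sq_le: "(\<Sum>\<alpha>\<in>(UNIV::'n::finite set). p \<alpha>)\<^sup>2 \<le> real CARD('n) * (\<Sum>\<alpha>\<in>UNIV. (p \<alpha> :: real)\<^sup>2)"
  using Cauchy_Schwarz_ineq_sum[of "\<lambda>_. 1" p UNIV] by simp

text \<open>The equation expresses the time derivative by space derivatives of the flux, and these
  are again moved onto the kernel. One time derivative thus costs one further space derivative of
  the averaged \<open>P\<close> and \<open>G\<close>.\<close>

lemma time_derivative_bound:
  fixes A :: "'m::finite \<Rightarrow> 'm \<Rightarrow> 'n::finite \<Rightarrow> 'n \<Rightarrow> real"
  assumes A: "elliptic l M A" and sol: "smooth_sol A (Z (5/8) c0) U P G" and k: "kernel_family \<epsilon> k" "\<epsilon> \<le> 1/8"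
    and S: "S \<in> sets borel" "S \<subseteq> Z (1/2) c0" and M: "B = 2 * (M * real (CARD('m) * CARD('n)))\<^sup>2"
    and b: "\<And>\<alpha>. SP S (\<lambda>i \<beta>. smear (k (\<alpha> # ls)) (P i \<beta>)) \<le> b" "\<And>\<alpha>. SP S (\<lambda>i \<beta>. smear (k (\<alpha> # ls)) (G i \<beta>)) \<le> b"
  shows "\<exists>ft. dirD et (smear (k ls) (U i)) ft \<and> sqn S ft \<le> real CARD('n) * real CARD('n) * ((B + 2) * b)"
proof -
  from sol obtain wt wx Px Gx where "\<forall>i. dirD et (U i) (wt i)" "\<forall>i \<alpha>. dirD (ex \<alpha>) (U i) (wx i \<alpha>)"
     "\<forall>\<alpha> j \<beta>. dirD (ex \<alpha>) (P j \<beta>) (Px \<alpha> j \<beta>)" "\<forall>i \<alpha>. dirD (ex \<alpha>) (G i \<alpha>) (Gx i \<alpha>)"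
     "\<forall>z\<in>Z (5/8) c0. \<forall>i \<alpha>. wx i \<alpha> z = P i \<alpha> z"
     "\<forall>z\<in>Z (5/8) c0. \<forall>i. wt i z = (\<Sum>\<alpha>\<in>UNIV. flux A (\<lambda>j \<beta>. Px \<alpha> j \<beta> z) (\<lambda>i \<alpha>. Gx i \<alpha> z) i \<alpha>)"
    unfolding smooth_sol_def by (elim exE conjE)
  note d = this(1-4)[rule_format] and eqs = this(5,6)[rule_format]
  note ck = kernel_family_cc[OF k(1)]
  have cP: "cc (Px \<alpha> j \<beta>)" "cc (Gx i \<alpha>)" for i \<alpha> j \<beta> using d by (auto simp: dirD_def)
  note cc = smooth_sol_cc[OF sol]
  have swP: "smear (k ls) (Px \<alpha> j \<beta>) = smear (k (\<alpha> # ls)) (P j \<beta>)" for \<alpha> j \<beta>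
    using k(1) d(3) unfolding kernel_family_def by (intro smear_dirD_swap[symmetric]) auto
  have swG: "smear (k ls) (Gx j \<alpha>) = smear (k (\<alpha> # ls)) (G j \<alpha>)" for \<alpha> j
    using k(1) d(4) unfolding kernel_family_def by (intro smear_dirD_swap[symmetric]) auto
  define X where "X \<alpha> z = flux A (\<lambda>j \<beta>. smear (k (\<alpha> # ls)) (P j \<beta>) z) (\<lambda>j \<beta>. smear (k (\<alpha> # ls)) (G j \<beta>) z) i \<alpha>" for \<alpha> z
  have eq: "smear (k ls) (wt i) z = (\<Sum>\<alpha>\<in>UNIV. X \<alpha> z)" if z: "z \<in> S" for z
  proof -
    have "smear (k ls) (wt i) z = smear (k ls) (\<lambda>z. \<Sum>\<alpha>\<in>UNIV. flux A (\<lambda>j \<beta>. Px \<alpha> j \<beta> z) (\<lambda>i \<alpha>. Gx i \<alpha> z) i \<alpha>) z"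
    proof (rule smear_cong)
      fix y assume "k ls y \<noteq> 0"
      then have "norm y \<le> 5/8 - 1/2" using k unfolding kernel_family_def by fastforce
      then have "z - (y, 0) \<in> Z (5/8) c0" using z S by (intro Z_shift[of z "1/2"]) auto
      then show "wt i (z - (y, 0)) = (\<Sum>\<alpha>\<in>UNIV. flux A (\<lambda>j \<beta>. Px \<alpha> j \<beta> (z - (y, 0))) (\<lambda>i \<alpha>. Gx i \<alpha> (z - (y, 0))) i \<alpha>)"
        by (rule eqs)
    qed
    also have "\<dots> = (\<Sum>\<alpha>\<in>UNIV. smear (k ls) (\<lambda>z. flux A (\<lambda>j \<beta>. Px \<alpha> j \<beta> z) (\<lambda>i \<alpha>. Gx i \<alpha> z) i \<alpha>) z)"
      by (intro smear_sum ck flux_cc cP)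
    also have "\<dots> = (\<Sum>\<alpha>\<in>UNIV. flux A (\<lambda>j \<beta>. smear (k ls) (Px \<alpha> j \<beta>) z) (\<lambda>i \<alpha>. smear (k ls) (Gx i \<alpha>) z) i \<alpha>)"
      by (intro sum.cong refl smear_flux ck cP)
    also have "\<dots> = (\<Sum>\<alpha>\<in>UNIV. X \<alpha> z)"
      unfolding swP swG X_def flux_def by simp
    finally show ?thesis .
  qed
  have M0: "0 \<le> B" unfolding M by simp
  have lX: "l2 (X \<alpha>)" for \<alpha>
    unfolding X_def by (intro cc_l2 flux_cc smear_cc ck cc)
  have X: "sqn S (X \<alpha>) \<le> (B + 2) * b" for \<alpha>
  proof -
    have cP': "l2 (smear (k (\<alpha> # ls)) (P i \<beta>))" "l2 (smear (k (\<alpha> # ls)) (G i \<beta>))" for i \<beta>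
      by (auto intro!: cc_l2 smear_cc ck cc)
    note iP = SP_integral[of "\<lambda>i \<beta>. smear (k (\<alpha> # ls)) (P i \<beta>)" S, OF cP'(1) S(1)]
    have "sqn S (X \<alpha>) \<le> (LINT z|lborel. B * (indicator S z * nsq (\<lambda>i \<beta>. smear (k (\<alpha> # ls)) (P i \<beta>) z))
       + 2 * (indicator S z * (smear (k (\<alpha> # ls)) (G i \<alpha>) z)\<^sup>2))"
      unfolding sqn_def
    proof (intro integral_mono l2_ind lX S Bochner_Integration.integrable_add integrable_mult_right iP cP')
      fix z
      have "(X \<alpha> z)\<^sup>2 \<le> B * nsq (\<lambda>i \<beta>. smear (k (\<alpha> # ls)) (P i \<beta>) z) + 2 * (smear (k (\<alpha> # ls)) (G i \<alpha>) z)\<^sup>2"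
        unfolding X_def M by (rule flux_sq_le) (use A in \<open>auto simp: elliptic_def\<close>)
      then show "indicator S z * (X \<alpha> z)\<^sup>2 \<le> B * (indicator S z * nsq (\<lambda>i \<beta>. smear (k (\<alpha> # ls)) (P i \<beta>) z))
       + 2 * (indicator S z * (smear (k (\<alpha> # ls)) (G i \<alpha>) z)\<^sup>2)" by (auto simp: indicator_def)
    qed
    also have "\<dots> = B * SP S (\<lambda>i \<beta>. smear (k (\<alpha> # ls)) (P i \<beta>)) + 2 * sqn S (smear (k (\<alpha> # ls)) (G i \<alpha>))"
      using iP l2_ind[OF cP'(2) S(1)] unfolding sqn_def by simp
    also have "\<dots> \<le> B * b + 2 * b"
      using b(1)[of \<alpha>] order_trans[OF SP_component[of S "\<lambda>i \<beta>. smear (k (\<alpha> # ls)) (G i \<beta>)" i \<alpha>] b(2)] M0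
      by (intro add_mono mult_left_mono) auto
    finally show ?thesis by (simp add: algebra_simps)
  qed
  have "sqn S (smear (k ls) (wt i)) = sqn S (\<lambda>z. \<Sum>\<alpha>\<in>UNIV. X \<alpha> z)" by (rule sqn_cong) (rule eq)
  also have "\<dots> \<le> (LINT z|lborel. real CARD('n) * (\<Sum>\<alpha>\<in>UNIV. indicator S z * (X \<alpha> z)\<^sup>2))"
    unfolding sqn_def
  proof (intro integral_mono integrable_mult_right Bochner_Integration.integrable_sum l2_ind l2_sum lX S)
    show "indicator S z * (\<Sum>\<alpha>\<in>UNIV. X \<alpha> z)\<^sup>2 \<le> real CARD('n) * (\<Sum>\<alpha>\<in>UNIV. indicator S z * (X \<alpha> z)\<^sup>2)" for z
      using sum_sq_le[of "\<lambda>\<alpha>. X \<alpha> z"] by (cases "z \<in> S") auto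
  qed
  also have "\<dots> = real CARD('n) * (\<Sum>\<alpha>\<in>UNIV. sqn S (X \<alpha>))"
    unfolding sqn_def integral_mult_right_zero
    by (subst Bochner_Integration.integral_sum) (auto intro: l2_ind lX S)
  also have "\<dots> \<le> real CARD('n) * (\<Sum>\<alpha>\<in>(UNIV::'n set). (B + 2) * b)"
    by (intro mult_left_mono sum_mono X) auto
  finally have "sqn S (smear (k ls) (wt i)) \<le> real CARD('n) * real CARD('n) * ((B + 2) * b)" by simp
  then show ?thesis using smear_dirD[OF ck d(1)] by blast
qed

section \<open>Decay of the energy on narrow cylinders\<close>

lemma dirD_scale:
  assumes "dirD v F F'" shows "dirD (a *\<^sub>R v) F (\<lambda>z. a * F' z)"
  unfolding dirD_def
proof (intro conjI allI)
  show "cc F" "cc (\<lambda>z. a * F' z)" using assms by (auto simp: dirD_def intro: cc_cmult)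
  fix z
  have "((\<lambda>s. F (z + s *\<^sub>R v)) has_real_derivative F' z) (at (0 * a))" using assms by (simp add: dirD_def)
  moreover have "((\<lambda>s. s * a) has_real_derivative a) (at 0)" by (auto intro!: derivative_eq_intros)
  ultimately have "((\<lambda>s. F (z + (s * a) *\<^sub>R v)) has_real_derivative F' z * a) (at 0)"
    by (rule DERIV_chain2[where f = "\<lambda>s. F (z + s *\<^sub>R v)" and g = "\<lambda>s. s * a"])
  then show "((\<lambda>s. F (z + s *\<^sub>R (a *\<^sub>R v))) has_real_derivative a * F' z) (at 0)" by (simp add: mult.commute)
qed

definition qcyl :: "real \<Rightarrow> ((real^'n::finite) \<times> real) set" where
  "qcyl \<tau> = ball 0 \<tau> \<times> {- \<tau>\<^sup>2<..0}"

text \<open>The intermediate sets between a wide cylinder and a narrow one: coordinates in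
  \<open>A\<close> already have width \<tau>, the others still have the fixed width
  \<open>w\<close>, and time is narrow throughout.\<close>

definition nbox :: "real \<Rightarrow> real \<Rightarrow> 'n set \<Rightarrow> ((real^'n::finite) \<times> real) set" where
  "nbox \<tau> w A = {z. (\<forall>i. \<bar>fst z $ i\<bar> < (if i \<in> A then \<tau> else w)) \<and> - \<tau>\<^sup>2 < snd z \<and> snd z \<le> 0}"

lemma borel_Times: "A \<in> sets borel \<Longrightarrow> B \<in> sets borel \<Longrightarrow> A \<times> B \<in> sets (borel :: ('a::second_countable_topology \<times> 'b::second_countable_topology) measure)"
  by (simp add: borel_prod[symmetric])

lemma qcyl_borel [simp, measurable]: "qcyl \<tau> \<in> sets borel"
  unfolding qcyl_def by (intro borel_Times) auto

lemma nbox_borel [simp, measurable]: "nbox \<tau> w A \<in> sets borel"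
proof -
  have "nbox \<tau> w A = {x. \<forall>i. \<bar>x $ i\<bar> < (if i \<in> A then \<tau> else w)} \<times> {- \<tau>\<^sup>2<..0}"
    by (auto simp: nbox_def)
  moreover have "open {x::real^'a. \<forall>i. \<bar>x $ i\<bar> < (if i \<in> A then \<tau> else w)}"
  proof -
    have "{x::real^'a. \<forall>i. \<bar>x $ i\<bar> < (if i \<in> A then \<tau> else w)} = (\<Inter>i. {x. \<bar>x $ i\<bar> < (if i \<in> A then \<tau> else w)})" by (auto simp only:)
    then show ?thesis by (auto intro!: open_INT open_Collect_less continuous_intros)
  qed
  ultimately show ?thesis by (simp add: borel_Times)
qed

lemma slab_measure:
  assumes "0 < h" "{s \<in> {0..1::real}. P s} \<subseteq> {a - h..a + h}"
  shows "emeasure lborel {s \<in> {0..1::real}. P s} \<le> ennreal (2 * h)"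
proof -
  have "emeasure lborel {s \<in> {0..1::real}. P s} \<le> emeasure lborel {a - h..a + h}"
    by (rule emeasure_mono) (use assms in auto)
  then show ?thesis using assms by simp
qed

text \<open>Each of the \<open>n + 1\<close> directions in which the cylinder is narrow contributes its width.\<close>

lemma slabs:
  fixes f ft :: "'n::finite list \<Rightarrow> (real^'n) \<times> real \<Rightarrow> real"
  assumes f: "\<And>l i. dirD (ex i) (f l) (f (i # l))" "\<And>l. l \<noteq> [] \<Longrightarrow> length l \<le> CARD('n) + 1 \<Longrightarrow> dirD et (f l) (ft l)"
    and b: "\<And>l. l \<noteq> [] \<Longrightarrow> length l \<le> CARD('n) + 1 \<Longrightarrow> sqn (Z (1/4) c) (f l) \<le> b"
      "\<And>l. l \<noteq> [] \<Longrightarrow> length l \<le> CARD('n) + 1 \<Longrightarrow> sqn (Z (1/4) c) (ft l) \<le> b"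
    and c: "0 < c" and w: "w = 1 / (4 * real CARD('n))" and \<tau>: "0 < \<tau>" "\<tau> \<le> w / 2"
  shows "sqn (qcyl \<tau>) (f [\<beta>]) \<le> 64 * (16 / w) ^ CARD('n) * \<tau> ^ (CARD('n) + 2) * b"
proof -
  have n: "1 \<le> real CARD('n)" by (simp add: Suc_leI)
  have w0: "0 < w" "w \<le> 1/4" unfolding w using n by (auto simp: field_simps)
  have \<tau>8: "\<tau>\<^sup>2 \<le> 1/8 * (1/8)" unfolding power2_eq_square using \<tau> w0 by (intro mult_mono) auto
  have b0: "0 \<le> b" using order_trans[OF sqn_nonneg b(1)[of "[\<beta>]"]] by simp
  \<comment> \<open>The width \<open>w = 1 / (4 n)\<close> makes the box fit into the ball of radius
    1/4, by the comparison of the Euclidean norm with the sum of the coordinates.\<close>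
  have inZ: "x \<in> Z (1/4) c" if "\<And>i. \<bar>fst x $ i\<bar> < w" "- (1/4) < snd x" "snd x \<le> 0" for x :: "(real^'n) \<times> real"
  proof -
    have "norm (fst x) \<le> (\<Sum>i\<in>UNIV. \<bar>fst x $ i\<bar>)" by (rule norm_le_l1_cart)
    also have "\<dots> < (\<Sum>i\<in>(UNIV::'n set). w)" by (intro sum_strict_mono that) auto
    also have "\<dots> = 1/4" unfolding w using n by simp
    finally show ?thesis using that c by (cases x) (auto simp: Z_def)
  qed
  \<comment> \<open>Narrowing one more coordinate uses one more derivative, so the length of the
    list and the number of narrowed coordinates share the budget \<open>n + 1\<close>.\<close>
  have main: "\<forall>l. l \<noteq> [] \<longrightarrow> length l + card A \<le> CARD('n) + 1 \<longrightarrow>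
      sqn (nbox \<tau> w A) (f l) \<le> 64 * \<tau>\<^sup>2 * (16 * \<tau> / w) ^ card A * b" for A :: "'n set"
  proof (induction A rule: infinite_finite_induct)
    case empty
    show ?case
    proof (intro allI impI)
      fix l :: "'n list" assume l0: "l \<noteq> []" "length l + card ({} :: 'n set) \<le> CARD('n) + 1"
      then have l: "l \<noteq> []" "length l \<le> CARD('n) + 1" by auto
      \<comment> \<open>Time is narrowed first. The vector points backwards, away from the top, and
        has length 1/8, so that it stays in \<open>Z (1/4) c\<close>. The admissible parameters lie
        within \<open>8 * \<tau>\<^sup>2\<close> of one value.\<close>
      have "sqn (nbox \<tau> w {}) (f l) \<le> 2 * (2 * (8 * \<tau>\<^sup>2)) * (sqn (Z (1/4) c) (f l) + sqn (Z (1/4) c) (\<lambda>z. (- (1/8)) * ft l z))"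
      proof (rule slab[OF dirD_scale[OF f(2)[OF l]] nbox_borel Z_borel])
        fix z :: "(real^'n) \<times> real" and s :: real assume z: "z \<in> nbox \<tau> w {}" and s: "0 \<le> s" "s \<le> 1"
        have "\<bar>fst z $ i\<bar> < w" for i using z by (auto simp: nbox_def)
        then show "z + s *\<^sub>R (- (1/8)) *\<^sub>R et \<in> Z (1/4) c"
          using z s \<tau>8 by (intro inZ) (auto simp: nbox_def)
      next
        fix z :: "(real^'n) \<times> real"
        show "emeasure lborel {s \<in> {0..1}. z - s *\<^sub>R (- (1/8)) *\<^sub>R et \<in> nbox \<tau> w {}} \<le> ennreal (2 * (8 * \<tau>\<^sup>2))"
          by (rule slab_measure[where a = "- 8 * snd z"]) (use \<tau> in \<open>auto simp: nbox_def\<close>)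
      qed auto
      also have "\<dots> \<le> 2 * (2 * (8 * \<tau>\<^sup>2)) * (b + b)"
        using b[OF l] b0 unfolding sqn_cmult
        by (intro mult_left_mono add_mono) (auto simp: power2_eq_square)
      also have "\<dots> = 64 * \<tau>\<^sup>2 * (16 * \<tau> / w) ^ card ({} :: 'n set) * b" by simp
      finally show "sqn (nbox \<tau> w {}) (f l) \<le> 64 * \<tau>\<^sup>2 * (16 * \<tau> / w) ^ card ({} :: 'n set) * b" .
    qed
  next
    case (insert i A)
    show ?case
    proof (intro allI impI)
      fix l :: "'n list" assume l: "l \<noteq> []" "length l + card (insert i A) \<le> CARD('n) + 1"
      have cA: "card (insert i A) = Suc (card A)" using insert by simp
      have "card (insert i A) \<ge> 1" using cA by simp
      \<comment> \<open>A shift by \<open>w / 2\<close> from a slab of half-width at most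
        \<open>w / 2\<close> stays within width \<open>w\<close>. The parameters fill an interval of
        half-length \<open>2 * \<tau> / w\<close>, and the two terms of \<open>slab\<close> together
        give the factor \<open>16 * \<tau> / w\<close>.\<close>
      have "sqn (nbox \<tau> w (insert i A)) (f l) \<le> 2 * (2 * (2 * \<tau> / w)) * (sqn (nbox \<tau> w A) (f l) + sqn (nbox \<tau> w A) (\<lambda>z. (w / 2) * f (i # l) z))"
      proof (rule slab[OF dirD_scale[OF f(1)] nbox_borel nbox_borel])
        fix z :: "(real^'n) \<times> real" and s :: real assume z: "z \<in> nbox \<tau> w (insert i A)" and s: "0 \<le> s" "s \<le> 1"
        have "\<bar>fst (z + s *\<^sub>R (w / 2) *\<^sub>R ex i) $ j\<bar> < (if j \<in> A then \<tau> else w)" for j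
        proof (cases "j = i")
          case True
          have "\<bar>fst z $ i\<bar> < \<tau>" using z by (auto simp: nbox_def split: if_splits)
          moreover have "\<bar>s * (w / 2)\<bar> \<le> w / 2" using s w0 mult_left_le_one_le[of "w/2" s] by simp
          ultimately have "\<bar>fst z $ i + s * (w / 2)\<bar> < w" using \<tau> by linarith
          then show ?thesis using True insert(2) by (simp add: axis_def)
        next
          case False
          then show ?thesis using z by (auto simp: nbox_def axis_def split: if_splits)
        qed
        then show "z + s *\<^sub>R (w / 2) *\<^sub>R ex i \<in> nbox \<tau> w A" using z by (auto simp: nbox_def)
      next
        fix z :: "(real^'n) \<times> real"
        show "emeasure lborel {s \<in> {0..1}. z - s *\<^sub>R (w / 2) *\<^sub>R ex i \<in> nbox \<tau> w (insert i A)} \<le> ennreal (2 * (2 * \<tau> / w))"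
        proof (rule slab_measure[where a = "2 * fst z $ i / w"])
          show "{s \<in> {0..1}. z - s *\<^sub>R (w / 2) *\<^sub>R ex i \<in> nbox \<tau> w (insert i A)} \<subseteq> {2 * fst z $ i / w - 2 * \<tau> / w..2 * fst z $ i / w + 2 * \<tau> / w}"
          proof safe
            fix s assume "z - s *\<^sub>R (w / 2) *\<^sub>R ex i \<in> nbox \<tau> w (insert i A)"
            then have "\<bar>fst (z - s *\<^sub>R (w / 2) *\<^sub>R ex i) $ i\<bar> < \<tau>" unfolding nbox_def by (auto split: if_splits)
            then have "\<bar>fst z $ i - s * (w / 2)\<bar> < \<tau>" by (simp add: axis_def)
            then show "s \<in> {2 * fst z $ i / w - 2 * \<tau> / w..2 * fst z $ i / w + 2 * \<tau> / w}"
              using w0 by (auto simp: field_simps abs_less_iff)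
          qed
        qed (use \<tau> w0 in auto)
      qed (use \<tau> w0 in auto)
      also have "\<dots> \<le> 2 * (2 * (2 * \<tau> / w)) * (sqn (nbox \<tau> w A) (f l) + sqn (nbox \<tau> w A) (f (i # l)))"
      proof -
        have "(w / 2)\<^sup>2 \<le> 1" using w0 by (simp add: power_le_one)
        then have "(w / 2)\<^sup>2 * sqn (nbox \<tau> w A) (f (i # l)) \<le> sqn (nbox \<tau> w A) (f (i # l))"
          by (intro mult_left_le_one_le) (auto simp: sqn_nonneg)
        then show ?thesis unfolding sqn_cmult using \<tau> w0 by (intro mult_left_mono) auto
      qed
      also have "\<dots> \<le> 2 * (2 * (2 * \<tau> / w)) * (64 * \<tau>\<^sup>2 * (16 * \<tau> / w) ^ card A * b + 64 * \<tau>\<^sup>2 * (16 * \<tau> / w) ^ card A * b)"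
        using insert(3) l cA \<tau> w0 by (intro mult_left_mono add_mono) auto
      also have "\<dots> = 64 * \<tau>\<^sup>2 * (16 * \<tau> / w) ^ card (insert i A) * b" unfolding cA by simp
      finally show "sqn (nbox \<tau> w (insert i A)) (f l) \<le> 64 * \<tau>\<^sup>2 * (16 * \<tau> / w) ^ card (insert i A) * b" .
    qed
  qed (simp)
  have "qcyl \<tau> \<subseteq> nbox \<tau> w (UNIV :: 'n set)"
  proof
    fix z :: "(real^'n) \<times> real" assume "z \<in> qcyl \<tau>"
    then have "norm (fst z) < \<tau>" "- \<tau>\<^sup>2 < snd z" "snd z \<le> 0" by (auto simp: qcyl_def)
    then show "z \<in> nbox \<tau> w UNIV"
      using order.strict_trans1[OF component_le_norm_cart[of "fst z"]] by (auto simp: nbox_def)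
  qed
  then have "sqn (qcyl \<tau>) (f [\<beta>]) \<le> sqn (nbox \<tau> w UNIV) (f [\<beta>])"
    using f(1)[of undefined "[\<beta>]"] by (intro sqn_mono_set) (auto simp: dirD_def)
  also have "\<dots> \<le> 64 * \<tau>\<^sup>2 * (16 * \<tau> / w) ^ CARD('n) * b" using main[of UNIV] by auto
  also have "\<dots> = 64 * (16 / w) ^ CARD('n) * \<tau> ^ (CARD('n) + 2) * b"
    by (simp add: power_add power_mult_distrib power_divide power2_eq_square)
  finally show ?thesis .
qed

subsection \<open>Test functions\<close>

lemma Ck_cont: "Ck k f \<Longrightarrow> continuous_on UNIV f"
  by (cases k) (auto intro!: differentiable_imp_continuous_on simp: differentiable_on_def differentiable_at_withinI)

lemma Ck_mono: "Ck (Suc k) f \<Longrightarrow> Ck k f"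
proof (induction k arbitrary: f)
  case 0 then show ?case using Ck_cont[of "Suc 0" f] by simp
next
  case (Suc k)
  then have "Ck k (\<lambda>z. frechet_derivative f (at z) v)" for v by (simp del: Ck.simps(1))
  then show ?case using Suc.prems by simp
qed

lemma Ck_const: "Ck k (\<lambda>z. c)"
proof (induction k arbitrary: c)
  case (Suc k)
  have "frechet_derivative (\<lambda>z::'a. c) (at z) v = 0" for z v by (simp add: frechet_derivative_const)
  then show ?case using Suc[of 0] by simp
qed simp

lemma frechet_derivative_eqI: "(f has_derivative f') (at x) \<Longrightarrow> frechet_derivative f (at x) = f'"
  using frechet_derivative_at by metis

lemma has_frechet: "f differentiable (at x) \<Longrightarrow> (f has_derivative frechet_derivative f (at x)) (at x)"
  using frechet_derivative_works by blast

lemma Ck_add: "Ck k f \<Longrightarrow> Ck k g \<Longrightarrow> Ck k (\<lambda>z. f z + g z)"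
proof (induction k arbitrary: f g)
  case 0 then show ?case by (simp add: continuous_on_add)
next
  case (Suc k)
  have "frechet_derivative (\<lambda>z. f z + g z) (at z) v = frechet_derivative f (at z) v + frechet_derivative g (at z) v" for z v
    using Suc.prems by (subst frechet_derivative_eqI[OF has_derivative_add[OF has_frechet has_frechet]]) auto
  then show ?case using Suc by auto
qed

lemma Ck_linear: "bounded_linear L \<Longrightarrow> Ck k f \<Longrightarrow> Ck k (\<lambda>z. L (f z))"
proof (induction k arbitrary: f)
  case 0 then show ?case by (simp add: bounded_linear.continuous_on)
next
  case (Suc k)
  have "(\<lambda>z. L (f z)) differentiable (at z)"
       "frechet_derivative (\<lambda>z. L (f z)) (at z) v = L (frechet_derivative f (at z) v)" for z v
    using bounded_linear.has_derivative[OF Suc.prems(1) has_frechet[of f z]] Suc.prems(2)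
    by (auto simp: differentiable_def dest: frechet_derivative_eqI)
  then show ?case using Suc by auto
qed

lemma Ck_affine:
  assumes L: "bounded_linear L" shows "Ck k f \<Longrightarrow> Ck k (\<lambda>z. f (a + L z))"
proof (induction k arbitrary: f)
  case 0
  then show ?case using linear_continuous_on[OF L, of UNIV]
    by (auto intro!: continuous_intros continuous_on_compose2[of UNIV f])
next
  case (Suc k)
  have d: "((\<lambda>z. f (a + L z)) has_derivative (\<lambda>v. frechet_derivative f (at (a + L z)) (L v))) (at z)" for z
  proof -
    have "((\<lambda>z. a + L z) has_derivative L) (at z)"
      using has_derivative_add[OF has_derivative_const bounded_linear_imp_has_derivative[OF L]] by simp
    from has_derivative_compose[OF this has_frechet[of f "a + L z"]] show ?thesis using Suc.prems by simp
  qed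
  then have "(\<lambda>z. f (a + L z)) differentiable (at z)"
       "frechet_derivative (\<lambda>z. f (a + L z)) (at z) v = frechet_derivative f (at (a + L z)) (L v)" for z v
    using frechet_derivative_eqI[OF d[of z]] d[of z] by (auto simp: differentiable_def)
  moreover have "Ck k (\<lambda>z. frechet_derivative f (at (a + L z)) (L v))" for v
    using Suc.IH[of "\<lambda>z. frechet_derivative f (at z) (L v)"] Suc.prems by simp
  ultimately show ?case by simp
qed

lemma Ck_mult: fixes f g :: "'a::euclidean_space \<Rightarrow> real"
  shows "Ck k f \<Longrightarrow> Ck k g \<Longrightarrow> Ck k (\<lambda>z. f z * g z)"
proof (induction k arbitrary: f g)
  case 0 then show ?case by (simp add: continuous_on_mult)
next
  case (Suc k)
  have d: "((\<lambda>z. f z * g z) has_derivative (\<lambda>v. f z * frechet_derivative g (at z) v + frechet_derivative f (at z) v * g z)) (at z)" for z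
    using Suc.prems by (intro has_derivative_mult has_frechet) auto
  then have "(\<lambda>z. f z * g z) differentiable (at z)"
       "frechet_derivative (\<lambda>z. f z * g z) (at z) v = f z * frechet_derivative g (at z) v + frechet_derivative f (at z) v * g z" for z v
    using frechet_derivative_eqI[OF d[of z]] d[of z] by (auto simp: differentiable_def)
  then show ?case using Suc.prems Suc.IH Ck_mono[OF Suc.prems(1)] Ck_mono[OF Suc.prems(2)] by (auto intro!: Ck_add)
qed

lemma Ck_prod: "(\<And>i. i \<in> I \<Longrightarrow> Ck k (f i)) \<Longrightarrow> Ck k (\<lambda>z. \<Prod>i\<in>I. f i z :: real)"
  by (induction I rule: infinite_finite_induct) (auto intro: Ck_const Ck_mult simp del: Ck.simps)

section \<open>Smooth bump functions\<close>

text \<open>The classical flat function exp(-1/x) with the powers of 1/x that its derivatives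
  produce. Differentiation maps this family into its own linear span, so smoothness follows by
  induction for all \<open>j\<close> simultaneously.\<close>

definition expinv :: "nat \<Rightarrow> real \<Rightarrow> real" where
  "expinv j x = (if 0 < x then (1 / x) ^ j * exp (- (1 / x)) else 0)"

lemma expinv_tendsto: "(expinv j \<longlongrightarrow> 0) (at 0)"
proof -
  have "((\<lambda>x. inverse x ^ j / exp (inverse x)) \<longlongrightarrow> 0) (at_right (0::real))"
    by (rule filterlim_compose[OF tendsto_power_div_exp_0 filterlim_inverse_at_top_right])
  then have "(expinv j \<longlongrightarrow> 0) (at_right 0)"
    by (rule Lim_transform_eventually) (auto simp: eventually_at_filter expinv_def exp_minus field_simps)
  moreover have "(expinv j \<longlongrightarrow> 0) (at_left 0)"
    by (rule Lim_transform_eventually[OF tendsto_const]) (auto simp: eventually_at_filter expinv_def)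
  ultimately show ?thesis by (simp add: filterlim_split_at)
qed

lemma expinv_deriv: "(expinv j has_real_derivative expinv (j + 2) x - real j * expinv (j + 1) x) (at x)"
proof -
  consider "x = 0" | "x < 0" | "0 < x" by linarith
  then show ?thesis
  proof cases
    case 1
    \<comment> \<open>At the origin the difference quotient is the next member of the family, so
      differentiability there reduces to its limit.\<close>
    have "(\<lambda>h. expinv j h / h) = expinv (j + 1)" by (auto simp: expinv_def fun_eq_iff)
    then have "(\<lambda>h. (expinv j (0 + h) - expinv j 0) / h) \<midarrow>0\<rightarrow> 0" using expinv_tendsto[of "j + 1"] by (simp add: expinv_def)
    then show ?thesis using 1 by (simp add: DERIV_def expinv_def)
  next
    case 2
    have "((\<lambda>x. 0) has_real_derivative 0) (at x)" by simp
    then have "(expinv j has_real_derivative 0) (at x)"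
      by (rule has_field_derivative_transform_within_open[of _ _ _ "{..<0}"]) (use 2 in \<open>auto simp: expinv_def\<close>)
    then show ?thesis using 2 by (simp add: expinv_def)
  next
    case 3
    have "((\<lambda>x. (1 / x) ^ j * exp (- (1 / x))) has_real_derivative
       (1 / x) ^ (j + 2) * exp (- (1 / x)) - real j * ((1 / x) ^ (j + 1) * exp (- (1 / x)))) (at x)"
    proof -
      have 1: "((\<lambda>x. 1 / x) has_real_derivative - ((1 / x)\<^sup>2)) (at x)"
        using 3 by (auto intro!: derivative_eq_intros simp: power2_eq_square field_simps)
      have 2: "((\<lambda>x. exp (- (1 / x))) has_real_derivative exp (- (1 / x)) * (1 / x)\<^sup>2) (at x)"
        using DERIV_chain2[OF DERIV_exp DERIV_minus[OF 1]] by simp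
      have 3: "real j * (y ^ (j - Suc 0) * y\<^sup>2) = real j * y ^ (j + 1)" for y :: real
        by (cases j) (auto simp: power2_eq_square)
      show ?thesis
        by (rule DERIV_cong[OF DERIV_mult[OF DERIV_power[OF 1, of j] 2]])
          (use 3[of "1 / x"] in \<open>simp add: algebra_simps power_add power2_eq_square\<close>)
    qed
    then have "(expinv j has_real_derivative
       (1 / x) ^ (j + 2) * exp (- (1 / x)) - real j * ((1 / x) ^ (j + 1) * exp (- (1 / x)))) (at x)"
      by (rule has_field_derivative_transform_within_open[of _ _ _ "{0<..}"]) (use 3 in \<open>auto simp: expinv_def\<close>)
    then show ?thesis using 3 by (simp add: expinv_def)
  qed
qed

lemma Ck_expinv: "Ck k (expinv j)"
proof (induction k arbitrary: j)
  case 0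
  show ?case using DERIV_isCont[OF expinv_deriv] by (simp add: continuous_at_imp_continuous_on)
next
  case (Suc k)
  have "expinv j differentiable (at z)" for z
    using expinv_deriv[of j z] unfolding has_field_derivative_def differentiable_def by blast
  moreover have "frechet_derivative (expinv j) (at z) v = v * (expinv (j + 2) z + (- real j) * expinv (j + 1) z)" for z v
    using frechet_derivative_eqI[OF expinv_deriv[of j z, unfolded has_field_derivative_def]] by (simp add: mult.commute)
  then have "(\<lambda>z. frechet_derivative (expinv j) (at z) v) = (\<lambda>z. v * (expinv (j + 2) z + (- real j) * expinv (j + 1) z))" for v
    by (intro ext)
  moreover have "Ck k (\<lambda>z. v * (expinv (j + 2) z + (- real j) * expinv (j + 1) z))" for v
    by (intro Ck_mult Ck_add Ck_const Suc)
  ultimately show ?case using expinv_deriv[of j] unfolding Ck.simps(2) has_field_derivative_def differentiable_def by metis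
qed

lemma test_functions_mono: "U \<subseteq> V \<Longrightarrow> test_functions U \<subseteq> test_functions V"
  unfolding test_functions_def by auto

text \<open>A product over the faces of a small box of the flat function of the distance to each
  face, normalised. It is positive exactly inside the box, which is why the integral does not
  vanish.\<close>

lemma bump_exists:
  fixes U :: "'a::euclidean_space set"
  assumes "open U" "U \<noteq> {}"
  obtains \<kappa> :: "'a \<Rightarrow> real" where "\<kappa> \<in> test_functions U" "\<And>z. 0 \<le> \<kappa> z" "(LINT z|lborel. \<kappa> z) = 1"
proof -
  obtain x where "x \<in> U" using assms by auto
  obtain a b where ab: "cbox a b \<subseteq> U" "x \<in> box a b" by (rule open_contains_cbox[OF assms(1) \<open>x \<in> U\<close>])
  define f where "f z = (\<Prod>i\<in>Basis. expinv 0 (- (a \<bullet> i) + z \<bullet> i) * expinv 0 (b \<bullet> i + - (z \<bullet> i)))" for z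
  have Ckf: "Ck k f" for k
    unfolding f_def
    by (intro Ck_prod Ck_mult Ck_affine[where f = "expinv 0"] Ck_expinv bounded_linear_inner_left bounded_linear_minus)
  have pos: "0 < expinv 0 s \<longleftrightarrow> 0 < s" "0 \<le> expinv 0 s" "expinv 0 s \<noteq> 0 \<longleftrightarrow> 0 < s" for s by (auto simp: expinv_def)
  have f0: "0 \<le> f z" for z unfolding f_def by (intro prod_nonneg mult_nonneg_nonneg ballI pos(2))
  have supp: "f z \<noteq> 0 \<Longrightarrow> z \<in> box a b" for z
    unfolding f_def by (auto simp: pos(3) mem_box)
  have cl: "closure {z. f z \<noteq> 0} \<subseteq> cbox a b"
    using closure_mono[of "{z. f z \<noteq> 0}" "cbox a b"] supp box_subset_cbox[of a b] by auto
  have comp: "compact (closure {z. f z \<noteq> 0})"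
  proof -
    have "bounded {z. f z \<noteq> 0}" using bounded_subset[OF bounded_box[of a b], of "{z. f z \<noteq> 0}"] supp by auto
    then show ?thesis by (simp add: compact_closure)
  qed
  have cont: "continuous_on UNIV f" using Ck_cont Ckf by blast
  obtain R where R: "\<And>z. z \<in> cbox a b \<Longrightarrow> norm z \<le> R" using bounded_cbox[of a b] unfolding bounded_iff by blast
  have ccf: "cc f" by (rule ccI[OF cont, of R]) (use supp R box_subset_cbox[of a b] in fastforce)
  define I where "I = (LINT z|lborel. f z)"
  have "0 < I"
  proof -

    have "I \<noteq> 0"
    proof
      assume "I = 0"
      then have "AE z in lborel. f z = 0"
        unfolding I_def using integral_nonneg_eq_0_iff_AE[OF cc_integrable[OF ccf]] f0 by simp
      moreover have "f z \<noteq> 0" if "z \<in> box a b" for z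
        unfolding f_def using that by (auto simp: pos(3) mem_box)
      ultimately have "AE z in lborel. z \<notin> box a b" by auto
      then have "emeasure lborel (box a b) = 0" using AE_iff_null_sets[of "box a b" lborel] by auto
      moreover have "emeasure lborel (box a b) = (\<Prod>i\<in>Basis. (b - a) \<bullet> i)"
        using ab(2) by (intro emeasure_lborel_box) (force simp: mem_box)
      moreover have "0 < (\<Prod>i\<in>Basis. (b - a) \<bullet> i)" using ab(2) by (intro prod_pos) (force simp: mem_box inner_diff_left)
      ultimately show False by (metis ennreal_eq_0_iff not_less)
    qed
    moreover have "0 \<le> I" unfolding I_def using f0 by (intro integral_nonneg_AE) auto
    ultimately show ?thesis by simp
  qed
  show thesis
  proof (rule that[of "\<lambda>z. (1 / I) * f z"])
    have eq: "{z. 1 / I * f z \<noteq> 0} = {z. f z \<noteq> 0}" using \<open>0 < I\<close> by auto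
    show "(\<lambda>z. (1 / I) * f z) \<in> test_functions U"
    proof -
      have "Ck k (\<lambda>z. 1 / I * f z)" for k by (intro Ck_mult Ck_const Ckf)
      then show ?thesis unfolding test_functions_def mem_Collect_eq eq using comp cl ab by blast
    qed
    show "0 \<le> 1 / I * f z" for z using f0 \<open>0 < I\<close> by simp
    show "(LINT z|lborel. 1 / I * f z) = 1" using \<open>0 < I\<close> by (simp add: I_def[symmetric])
  qed
qed

definition tfd :: "'a::euclidean_space \<Rightarrow> ('a \<Rightarrow> real) \<Rightarrow> 'a \<Rightarrow> real" where
  "tfd v k z = frechet_derivative k (at z) v"

text \<open>Off the closed support the function is locally zero, so its derivatives vanish there
  too.\<close>

lemma tfd_test:
  assumes "k \<in> test_functions U" shows "tfd v k \<in> test_functions U"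
proof -
  have C: "Ck j k" for j using assms by (simp add: test_functions_def)
  have "Ck j (tfd v k)" for j using C[of "Suc j"] unfolding tfd_def[abs_def] by simp
  moreover have "closure {z. tfd v k z \<noteq> 0} \<subseteq> closure {z. k z \<noteq> 0}"
  proof (rule closure_minimal)
    show "{z. tfd v k z \<noteq> 0} \<subseteq> closure {z. k z \<noteq> 0}"
    proof (rule ccontr)
      assume "\<not> ?thesis"
      then obtain z where z: "tfd v k z \<noteq> 0" "z \<in> - closure {z. k z \<noteq> 0}" by auto
      have "((\<lambda>z. 0) has_derivative (\<lambda>v. 0)) (at z)" by simp
      then have "(k has_derivative (\<lambda>v. 0)) (at z)"
        by (rule has_derivative_transform_within_open[of _ _ _ _ "- closure {z. k z \<noteq> 0}"])
          (use z closure_subset[of "{z. k z \<noteq> 0}"] in auto)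
      then show False using z(1) frechet_derivative_eqI unfolding tfd_def by fastforce
    qed
  qed simp
  ultimately show ?thesis using assms unfolding test_functions_def
    by (auto simp: compact_closure intro: bounded_subset[OF _ closure_subset] simp del: Ck.simps)
       (meson bounded_closure bounded_subset closure_subset compact_closure compact_imp_bounded order_trans)
qed

lemma test_cc: assumes "k \<in> test_functions U" shows "cc k"
proof -
  have "bounded (closure {z. k z \<noteq> 0})" using assms by (auto simp: test_functions_def compact_imp_bounded)
  then obtain R where R: "\<And>z. z \<in> closure {z. k z \<noteq> 0} \<Longrightarrow> norm z \<le> R" unfolding bounded_iff by blast
  show ?thesis
  proof (rule ccI[of _ R])
    show "continuous_on UNIV k" using assms Ck_cont[of 0 k] by (simp add: test_functions_def del: Ck.simps)
    show "k z = 0" if "R < norm z" for z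
      using R[of z] that closure_subset[of "{z. k z \<noteq> 0}"] by auto
  qed
qed

lemma test_has_derivative:
  assumes "k \<in> test_functions U" shows "(k has_derivative (\<lambda>v. tfd v k z)) (at z)"
proof -
  have "Ck (Suc 0) k" using assms unfolding test_functions_def by blast
  then show ?thesis using has_frechet[of k z] by (simp add: tfd_def[abs_def])
qed

lemma test_dirD: assumes "k \<in> test_functions U" shows "dirD v k (tfd v k)"
  unfolding dirD_def
proof (intro conjI allI)
  show "cc k" "cc (tfd v k)" using assms test_cc tfd_test by blast+
  fix z
  have "((\<lambda>s. z + s *\<^sub>R v) has_derivative (\<lambda>s. s *\<^sub>R v)) (at 0)" by (auto intro!: derivative_eq_intros)
  from has_derivative_compose[OF this, of k "\<lambda>v. tfd v k z"] test_has_derivative[OF assms, of z]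
  have "((\<lambda>s. k (z + s *\<^sub>R v)) has_derivative (\<lambda>s. tfd (s *\<^sub>R v) k z)) (at 0)" by simp
  moreover have "tfd (s *\<^sub>R v) k z = tfd v k z * s" for s
    using linear_scale[OF has_derivative_linear[OF test_has_derivative[OF assms, of z]], of s v] by simp
  ultimately show "((\<lambda>s. k (z + s *\<^sub>R v)) has_real_derivative tfd v k z) (at 0)"
    by (simp add: has_field_derivative_def)
qed

lemma tfd_linear:
  assumes "k \<in> test_functions U"
  shows "tfd (\<Sum>i\<in>I. c i *\<^sub>R v i) k z = (\<Sum>i\<in>I. c i * tfd (v i) k z)"
  using linear_sum[OF has_derivative_linear[OF test_has_derivative[OF assms, of z]], of "\<lambda>i. c i *\<^sub>R v i" I]
    linear_scale[OF has_derivative_linear[OF test_has_derivative[OF assms, of z]]] by simp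

primrec kfam :: "(real^'n::finite \<Rightarrow> real) \<Rightarrow> 'n list \<Rightarrow> real^'n \<Rightarrow> real" where
  "kfam \<kappa> [] = \<kappa>"
| "kfam \<kappa> (i # l) = tfd (axis i 1) (kfam \<kappa> l)"

lemma kfam_test: "\<kappa> \<in> test_functions U \<Longrightarrow> kfam \<kappa> l \<in> test_functions U"
  by (induction l) (auto intro: tfd_test)

lemma kfam_kernel_family:
  assumes "\<kappa> \<in> test_functions (ball 0 \<epsilon>)" shows "kernel_family \<epsilon> (kfam \<kappa>)"
  unfolding kernel_family_def
proof (intro conjI allI impI)
  show "dirD (axis i 1) (kfam \<kappa> l) (kfam \<kappa> (i # l))" for i l
    using test_dirD[OF kfam_test[OF assms]] by simp
  fix l y assume "kfam \<kappa> l y \<noteq> 0"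
  then have "y \<in> ball 0 \<epsilon>" using kfam_test[OF assms, of l] closure_subset[of "{z. kfam \<kappa> l z \<noteq> 0}"]
    unfolding test_functions_def by auto
  then show "norm y \<le> \<epsilon>" by simp
qed

subsection \<open>Decay for smooth solutions\<close>

lemma SP_add_le:
  assumes "\<And>i \<alpha>. l2 (P i \<alpha>)" "\<And>i \<alpha>. l2 (Q i \<alpha>)" "S \<in> sets borel"
  shows "SP S P \<le> 2 * SP S (\<lambda>i \<alpha> z. P i \<alpha> z - Q i \<alpha> z) + 2 * SP S Q"
proof -
  have "sqn S (P i \<alpha>) \<le> 2 * sqn S (\<lambda>z. P i \<alpha> z - Q i \<alpha> z) + 2 * sqn S (Q i \<alpha>)" for i \<alpha>
    using sqn_add[OF l2_diff[OF assms(1)[of i \<alpha>] assms(2)[of i \<alpha>]] assms(2)[of i \<alpha>] assms(3)] by simp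
  then have "SP S P \<le> (\<Sum>i\<in>UNIV. \<Sum>\<alpha>\<in>UNIV. 2 * sqn S (\<lambda>z. P i \<alpha> z - Q i \<alpha> z) + 2 * sqn S (Q i \<alpha>))"
    unfolding SP_def by (intro sum_mono)
  also have "\<dots> = 2 * SP S (\<lambda>i \<alpha> z. P i \<alpha> z - Q i \<alpha> z) + 2 * SP S Q"
    unfolding SP_def by (simp add: sum.distrib sum_distrib_left)
  finally show ?thesis .
qed

lemma SP_mono_set:
  assumes "\<And>i \<alpha>. l2 (P i \<alpha>)" "S \<in> sets borel" "S' \<in> sets borel" "S \<subseteq> S'" shows "SP S P \<le> SP S' P"
  unfolding SP_def by (intro sum_mono sqn_mono_set assms)

text \<open>\<open>slabs\<close> is applied to the averages of \<open>U\<close>, one of whose first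
  derivatives is the average of \<open>P\<close>. Lists of length up to \<open>n + 1\<close> occur
  there, and their time derivatives involve one more space derivative; hence the order
  \<open>n + 2\<close> in the condition on the kernels.\<close>

lemma average_decay:
  fixes l M :: real
  assumes l: "0 < l"
  shows "\<exists>C>0. \<forall>\<tau> (A :: 'm::finite \<Rightarrow> 'm \<Rightarrow> 'n::finite \<Rightarrow> 'n \<Rightarrow> real) c0 U P G \<epsilon> k H.
    0 < \<tau> \<longrightarrow> \<tau> \<le> 1 / (8 * real CARD('n)) \<longrightarrow>
    elliptic l M A \<longrightarrow> 0 < c0 \<longrightarrow> c0 \<le> 1 \<longrightarrow> smooth_sol A (Z (5/8) c0) U P G \<longrightarrow>
    kernel_family \<epsilon> k \<longrightarrow> \<epsilon> \<le> 1/8 \<longrightarrow> (LINT y|lborel. \<bar>k [] y\<bar>)\<^sup>2 \<le> 1 \<longrightarrow> 0 \<le> H \<longrightarrow>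
    (\<forall>ls. length ls \<le> CARD('n) + 2 \<longrightarrow> (LINT y|lborel. \<bar>k ls y\<bar>)\<^sup>2 \<le> H) \<longrightarrow>
    SP (qcyl \<tau>) (\<lambda>i \<alpha>. smear (k []) (P i \<alpha>)) \<le> C * \<tau> ^ (CARD('n) + 2) * (SP UNIV P + H * SP UNIV G)"
proof -
  let ?n = "CARD('n)"
  have "\<forall>j. \<exists>C>0. \<forall>(A :: 'm::finite \<Rightarrow> 'm \<Rightarrow> 'n::finite \<Rightarrow> 'n \<Rightarrow> real) c0 c U P G \<epsilon> k H ls.
    elliptic l M A \<longrightarrow> 0 < c \<longrightarrow> c < c0 \<longrightarrow> c0 \<le> 1 \<longrightarrow> smooth_sol A (Z (5/8) c0) U P G \<longrightarrow>
    kernel_family \<epsilon> k \<longrightarrow> \<epsilon> \<le> 1/8 \<longrightarrow> (LINT y|lborel. \<bar>k [] y\<bar>)\<^sup>2 \<le> 1 \<longrightarrow> 0 \<le> H \<longrightarrow>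
    (\<forall>ls. length ls \<le> j \<longrightarrow> (LINT y|lborel. \<bar>k ls y\<bar>)\<^sup>2 \<le> H) \<longrightarrow> length ls = j \<longrightarrow>
    SP (Z (1/4 + 1 / (4 * (real j + 1))) c) (\<lambda>i \<alpha>. smear (k ls) (P i \<alpha>)) \<le> C * (SP UNIV P + H * SP UNIV G)"
    (is "\<forall>j. \<exists>C>0. ?Q j C")
    using higher_derivatives[OF l, of M, where 'm = 'm and 'n = 'n] by blast
  then obtain Cj :: "nat \<Rightarrow> real" where Cj0: "\<forall>j. 0 < Cj j \<and> ?Q j (Cj j)"
    by (rule exE[OF choice])
  have Cj1: "0 < Cj j" for j by (rule conjunct1[OF spec[OF Cj0]])
  have "?Q j (Cj j)" for j by (rule conjunct2[OF spec[OF Cj0]])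
  note Cj = Cj1 this[rule_format]
  \<comment> \<open>One constant dominating those of all orders up to \<open>n + 2\<close>.\<close>
  define C0 where "C0 = 1 + (\<Sum>j\<le>?n + 2. Cj j)"
  have C0: "1 \<le> C0" "\<And>j. j \<le> ?n + 2 \<Longrightarrow> Cj j \<le> C0"
  proof -
    have "0 \<le> (\<Sum>j\<le>?n + 2. Cj j)" by (intro sum_nonneg order.strict_implies_order[OF Cj(1)])
    then show "1 \<le> C0" by (simp add: C0_def)
    show "Cj j \<le> C0" if "j \<le> ?n + 2" for j
    proof -
      have "Cj j \<le> (\<Sum>j\<le>?n + 2. Cj j)"
        using that order.strict_implies_order[OF Cj(1)] by (intro member_le_sum) auto
      then show ?thesis by (simp add: C0_def)
    qed
  qed
  define B where "B = 2 * (M * real (CARD('m) * CARD('n)))\<^sup>2"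
  define D where "D = (1 + real ?n * real ?n * (B + 2)) * C0"
  have B: "0 \<le> B" by (simp add: B_def)
  have D: "C0 \<le> D" "real ?n * real ?n * ((B + 2) * C0) \<le> D" unfolding D_def using C0(1) B by (auto simp: algebra_simps)
  define w where "w = 1 / (4 * real ?n)"
  define C where "C = real (CARD('m) * ?n) * (64 * (16 / w) ^ ?n * D)"
  show ?thesis
  proof (intro exI[of _ C] conjI allI impI)
    show "0 < C" unfolding C_def w_def using D C0 by auto
    fix \<tau> and A :: "'m \<Rightarrow> 'm \<Rightarrow> 'n \<Rightarrow> 'n \<Rightarrow> real" and c0 U P G \<epsilon> and k :: "'n list \<Rightarrow> real^'n \<Rightarrow> real" and H :: real
    assume \<tau>: "0 < \<tau>" "\<tau> \<le> 1 / (8 * real ?n)"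
      and A: "elliptic l M A" and c: "0 < c0" "c0 \<le> 1" and sol: "smooth_sol A (Z (5/8) c0) U P G"
      and k: "kernel_family \<epsilon> k" "\<epsilon> \<le> 1/8" "(LINT y|lborel. \<bar>k [] y\<bar>)\<^sup>2 \<le> 1"
      and H: "0 \<le> H" "\<forall>ls. length ls \<le> ?n + 2 \<longrightarrow> (LINT y|lborel. \<bar>k ls y\<bar>)\<^sup>2 \<le> H"
    define E where "E = SP UNIV P + H * SP UNIV G"
    have E: "0 \<le> E" "H * SP UNIV G \<le> E" unfolding E_def using H SP_nonneg[of UNIV P] SP_nonneg[of UNIV G] by auto
    note ck = kernel_family_cc[OF k(1)] and cc = smooth_sol_cc[OF sol]
    \<comment> \<open>Half of the room above the top suffices, because only times up to 0 matter for
      \<open>qcyl \<tau>\<close>.\<close>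
    define c1 where "c1 = c0 / 2"
    have c1: "0 < c1" "c1 < c0" using c by (auto simp: c1_def)
    have est: "SP (Z (1/4) c1) (\<lambda>i \<alpha>. smear (k ls) (P i \<alpha>)) \<le> C0 * E" if "length ls \<le> ?n + 2" for ls
    proof -
      have "SP (Z (1/4) c1) (\<lambda>i \<alpha>. smear (k ls) (P i \<alpha>)) \<le> SP (Z (1/4 + 1 / (4 * (real (length ls) + 1))) c1) (\<lambda>i \<alpha>. smear (k ls) (P i \<alpha>))"
        by (intro SP_mono_set cc_l2 smear_cc ck cc Z_borel Z_mono) auto
      also have "\<dots> \<le> Cj (length ls) * E" unfolding E_def
        by (rule Cj(2)[OF A c1 c(2) sol k H(1)]) (use H that in auto)
      also have "\<dots> \<le> C0 * E" using C0(2)[OF that] E by (intro mult_right_mono) auto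
      finally show ?thesis .
    qed
    have estG: "SP (Z (1/4) c1) (\<lambda>i \<alpha>. smear (k ls) (G i \<alpha>)) \<le> C0 * E" if "length ls \<le> ?n + 2" for ls
    proof -
      have "SP (Z (1/4) c1) (\<lambda>i \<alpha>. smear (k ls) (G i \<alpha>)) \<le> H * SP UNIV G"
        by (rule SP_smear_le) (use ck cc H that in auto)
      also have "\<dots> \<le> C0 * E" using E C0(1) mult_right_mono[of 1 C0 E] by linarith
      finally show ?thesis .
    qed
    have sub: "Z (1/4) c1 \<subseteq> Z (1/2) c0" using c1 by (intro Z_mono) auto
    have Ueq: "smear (k (\<beta> # l')) (U i) z = smear (k l') (P i \<beta>) z" if "z \<in> Z (1/4) c1" for \<beta> l' i z
      by (rule smear_Cons_eq[OF sol k(1)]) (use k sub that in \<open>auto intro!: Z_shift[of z "1/2" c0]\<close>)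
    have comp: "sqn (qcyl \<tau>) (smear (k []) (P i \<beta>)) \<le> 64 * (16 / w) ^ ?n * \<tau> ^ (?n + 2) * (D * E)" for i \<beta>
    proof -
      have "\<exists>ft. dirD et (smear (k ls) (U i)) ft \<and> sqn (Z (1/4) c1) ft \<le> real ?n * real ?n * ((B + 2) * (C0 * E))"
        if "length ls \<le> ?n + 1" for ls
        by (rule time_derivative_bound[OF A sol k(1,2) Z_borel sub B_def]) (use est estG that in auto)
      then obtain ft where ft: "\<And>ls. length ls \<le> ?n + 1 \<Longrightarrow> dirD et (smear (k ls) (U i)) (ft ls)"
         "\<And>ls. length ls \<le> ?n + 1 \<Longrightarrow> sqn (Z (1/4) c1) (ft ls) \<le> real ?n * real ?n * ((B + 2) * (C0 * E))"
        by metis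
      have "sqn (qcyl \<tau>) (smear (k [\<beta>]) (U i)) \<le> 64 * (16 / w) ^ ?n * \<tau> ^ (?n + 2) * (D * E)"
      proof (rule slabs[where f = "\<lambda>ls. smear (k ls) (U i)" and ft = ft and c = c1 and w = w])
        show "dirD (ex ia) (smear (k ls) (U i)) (smear (k (ia # ls)) (U i))" for ls ia
          using k(1) unfolding kernel_family_def by (intro smear_dirD_kernel cc) auto
        show "sqn (Z (1/4) c1) (smear (k ls) (U i)) \<le> D * E" if ls: "ls \<noteq> []" "length ls \<le> ?n + 1" for ls
        proof -
          obtain a l' where l': "ls = a # l'" using ls by (cases ls) auto
          have "sqn (Z (1/4) c1) (smear (k ls) (U i)) = sqn (Z (1/4) c1) (smear (k l') (P i a))"
            unfolding l' by (intro sqn_cong Ueq)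
          also have "\<dots> \<le> SP (Z (1/4) c1) (\<lambda>i \<alpha>. smear (k l') (P i \<alpha>))"
            by (rule SP_component[where P = "\<lambda>i \<alpha>. smear (k l') (P i \<alpha>)"])
          also have "\<dots> \<le> C0 * E" using ls l' by (intro est) auto
          also have "\<dots> \<le> D * E" using D E by (intro mult_right_mono) auto
          finally show ?thesis .
        qed
        show "sqn (Z (1/4) c1) (ft ls) \<le> D * E" if ls: "ls \<noteq> []" "length ls \<le> ?n + 1" for ls
          using order_trans[OF ft(2)[OF ls(2)], of "D * E"] mult_right_mono[OF D(2) E(1)] by (simp add: mult.assoc)
        show "w = 1 / (4 * real ?n)" by (rule w_def)
        show "\<tau> \<le> w / 2" using \<tau> by (simp add: w_def)
      qed (use ft \<tau> c1 in auto)
      moreover have "sqn (qcyl \<tau>) (smear (k [\<beta>]) (U i)) = sqn (qcyl \<tau>) (smear (k []) (P i \<beta>))"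
      proof (intro sqn_cong Ueq)
        fix z :: "(real^'n) \<times> real" assume z: "z \<in> qcyl \<tau>"
        have "1 \<le> real ?n" by (simp add: Suc_leI)
        then have t: "\<tau> \<le> 1/8" using \<tau>(2) order_trans[of \<tau> "1 / (8 * real ?n)" "1/8"] by (simp add: field_simps)
        then have "\<tau>\<^sup>2 \<le> 1/8 * (1/8)" unfolding power2_eq_square using \<tau> by (intro mult_mono) auto
        then show "z \<in> Z (1/4) c1" using z t c1 by (auto simp: qcyl_def Z_def)
      qed
      ultimately show ?thesis by simp
    qed
    have "SP (qcyl \<tau>) (\<lambda>i \<alpha>. smear (k []) (P i \<alpha>)) \<le> (\<Sum>i\<in>(UNIV::'m set). \<Sum>\<alpha>\<in>(UNIV::'n set). 64 * (16 / w) ^ ?n * \<tau> ^ (?n + 2) * (D * E))"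
      unfolding SP_def by (intro sum_mono comp)
    also have "\<dots> = C * \<tau> ^ (?n + 2) * E" by (simp add: C_def)
    finally show "SP (qcyl \<tau>) (\<lambda>i \<alpha>. smear (k []) (P i \<alpha>)) \<le> C * \<tau> ^ (?n + 2) * (SP UNIV P + H * SP UNIV G)"
      by (simp add: E_def)
  qed
qed

text \<open>\<open>P\<close> is split into its average and the deviation from it. The quantifiers
  matter: \<open>C\<close> precedes \<tau>, whereas the kernel, whose derivatives grow as its radius
  shrinks, is chosen after \<tau> and burdens only \<open>C'\<close>.\<close>

lemma decay_smooth:
  fixes l M :: real
  assumes l: "0 < l"
  shows "\<exists>C>0. \<forall>\<tau>. 0 < \<tau> \<longrightarrow> \<tau> \<le> 1 / (8 * real CARD('n)) \<longrightarrow> (\<exists>C'>0. \<forall>(A :: 'm::finite \<Rightarrow> 'm \<Rightarrow> 'n::finite \<Rightarrow> 'n \<Rightarrow> real) c0 U P G.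
    elliptic l M A \<longrightarrow> 0 < c0 \<longrightarrow> c0 \<le> 1 \<longrightarrow> smooth_sol A (Z (5/8) c0) U P G \<longrightarrow> grad_dir (Z (5/8) c0) U P \<longrightarrow>
    SP (qcyl \<tau>) P \<le> C * \<tau> ^ (CARD('n) + 2) * SP UNIV P + C' * SP UNIV G)"
proof -
  let ?n = "CARD('n)"
  obtain C1 where C1: "0 < C1" "\<And>\<tau> (A :: 'm::finite \<Rightarrow> 'm \<Rightarrow> 'n::finite \<Rightarrow> 'n \<Rightarrow> real) c0 U P G \<epsilon> k H.
    0 < \<tau> \<Longrightarrow> \<tau> \<le> 1 / (8 * real CARD('n)) \<Longrightarrow>
    elliptic l M A \<Longrightarrow> 0 < c0 \<Longrightarrow> c0 \<le> 1 \<Longrightarrow> smooth_sol A (Z (5/8) c0) U P G \<Longrightarrow>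
    kernel_family \<epsilon> k \<Longrightarrow> \<epsilon> \<le> 1/8 \<Longrightarrow> (LINT y|lborel. \<bar>k [] y\<bar>)\<^sup>2 \<le> 1 \<Longrightarrow> 0 \<le> H \<Longrightarrow>
    (\<forall>ls. length ls \<le> CARD('n) + 2 \<longrightarrow> (LINT y|lborel. \<bar>k ls y\<bar>)\<^sup>2 \<le> H) \<Longrightarrow>
    SP (qcyl \<tau>) (\<lambda>i \<alpha>. smear (k []) (P i \<alpha>)) \<le> C1 * \<tau> ^ (CARD('n) + 2) * (SP UNIV P + H * SP UNIV G)"
    using average_decay[OF l, of M, where 'm = 'm and 'n = 'n] by (elim exE conjE) blast
  obtain C2 where C2: "0 < C2" "\<And>(A :: 'm::finite \<Rightarrow> 'm \<Rightarrow> 'n::finite \<Rightarrow> 'n \<Rightarrow> real) c' c U P G \<kappa> \<epsilon>.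
    elliptic l M A \<Longrightarrow> 0 < c' \<Longrightarrow> c' < c \<Longrightarrow> c \<le> 1 \<Longrightarrow> smooth_sol A (Z (5/8) c) U P G \<Longrightarrow>
    grad_dir (Z (5/8) c) U P \<Longrightarrow> 0 \<le> \<epsilon> \<Longrightarrow> \<epsilon> \<le> 1/8 \<Longrightarrow> cc \<kappa> \<Longrightarrow> (LINT y|lborel. \<kappa> y) = 1 \<Longrightarrow> (\<forall>y. 0 \<le> \<kappa> y) \<Longrightarrow>
    (\<forall>y. \<kappa> y \<noteq> 0 \<longrightarrow> norm y \<le> \<epsilon>) \<Longrightarrow>
    SP (Z (3/8) c') (\<lambda>i \<alpha> z. P i \<alpha> z - smear \<kappa> (P i \<alpha>) z) \<le> C2 * (\<epsilon>\<^sup>2 * SP UNIV P + SP UNIV G)"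
    using smear_estimate[OF l, of M, where 'm = 'm and 'n = 'n] by (elim exE conjE) blast
  show ?thesis
  proof (rule exI[of _ "2 * C2 + 2 * C1"], intro conjI allI impI)
    show "0 < 2 * C2 + 2 * C1" using C1 C2 by simp
    fix \<tau> :: real assume \<tau>: "0 < \<tau>" "\<tau> \<le> 1 / (8 * real ?n)"
    have "1 \<le> real ?n" by (simp add: Suc_leI)
    then have t8: "\<tau> \<le> 1/8" using \<tau>(2) order_trans[of \<tau> "1 / (8 * real ?n)" "1/8"] by (simp add: field_simps)
    define p where "p = \<tau> ^ (?n + 2)"
    have p: "0 < p" "p \<le> 1" unfolding p_def using \<tau> t8 by (auto intro!: power_le_one simp del: power_Suc power_Suc2 add_2_eq_Suc')
    \<comment> \<open>With \<open>p \<le> 1\<close> this gives both the radius bound 1/8 and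
      \<open>\<epsilon>\<^sup>2 \<le> p\<close>, so the deviation from the average decays like
      \<tau>^(n+2) as well.\<close>
    define \<epsilon> where "\<epsilon> = p / 8"
    have e: "0 < \<epsilon>" "\<epsilon> \<le> 1/8" "\<epsilon>\<^sup>2 \<le> p"
    proof -
      show "0 < \<epsilon>" "\<epsilon> \<le> 1/8" using p by (auto simp: \<epsilon>_def)
      have "\<epsilon>\<^sup>2 \<le> 1 * p" unfolding power2_eq_square \<epsilon>_def using p by (intro mult_mono) auto
      then show "\<epsilon>\<^sup>2 \<le> p" by simp
    qed
    obtain \<kappa> :: "real^'n \<Rightarrow> real" where \<kappa>: "\<kappa> \<in> test_functions (ball 0 \<epsilon>)" "\<And>z. 0 \<le> \<kappa> z" "(LINT z|lborel. \<kappa> z) = 1"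
      using bump_exists[of "ball (0::real^'n) \<epsilon>"] e(1) by auto
    note fam = kfam_kernel_family[OF \<kappa>(1)]
    \<comment> \<open>A sum over the finitely many lists of directions of length at most
      \<open>n + 2\<close>. It depends on the kernel and hence on \<tau>, but not on the
      solution.\<close>
    define H where "H = (\<Sum>ls\<in>{ls. set ls \<subseteq> (UNIV::'n set) \<and> length ls \<le> ?n + 2}. (LINT y|lborel. \<bar>kfam \<kappa> ls y\<bar>)\<^sup>2)"
    have fin: "finite {ls. set ls \<subseteq> (UNIV::'n set) \<and> length ls \<le> ?n + 2}" by (intro finite_lists_length_le) auto
    have H: "0 \<le> H" "\<forall>ls. length ls \<le> ?n + 2 \<longrightarrow> (LINT y|lborel. \<bar>kfam \<kappa> ls y\<bar>)\<^sup>2 \<le> H"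
    proof -
      show "0 \<le> H" unfolding H_def by (intro sum_nonneg) auto
      show "\<forall>ls. length ls \<le> ?n + 2 \<longrightarrow> (LINT y|lborel. \<bar>kfam \<kappa> ls y\<bar>)\<^sup>2 \<le> H"
        unfolding H_def by (intro allI impI member_le_sum fin) auto
    qed
    have k1: "(LINT y|lborel. \<bar>kfam \<kappa> [] y\<bar>)\<^sup>2 \<le> 1" using \<kappa> by simp
    show "\<exists>C'>0. \<forall>(A :: 'm \<Rightarrow> 'm \<Rightarrow> 'n \<Rightarrow> 'n \<Rightarrow> real) c0 U P G.
      elliptic l M A \<longrightarrow> 0 < c0 \<longrightarrow> c0 \<le> 1 \<longrightarrow> smooth_sol A (Z (5/8) c0) U P G \<longrightarrow> grad_dir (Z (5/8) c0) U P \<longrightarrow>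
      SP (qcyl \<tau>) P \<le> (2 * C2 + 2 * C1) * \<tau> ^ (?n + 2) * SP UNIV P + C' * SP UNIV G"
    proof (intro exI[of _ "2 * C2 + 2 * C1 * p * H"] conjI allI impI)
      show "0 < 2 * C2 + 2 * C1 * p * H" using C1 C2 p H by (intro add_pos_nonneg) auto
      fix A :: "'m \<Rightarrow> 'm \<Rightarrow> 'n \<Rightarrow> 'n \<Rightarrow> real" and c0 U P G
      assume A: "elliptic l M A" and c: "0 < c0" "c0 \<le> 1" and sol: "smooth_sol A (Z (5/8) c0) U P G" and gd: "grad_dir (Z (5/8) c0) U P"
      note cc = smooth_sol_cc[OF sol]
      have c\<kappa>: "cc \<kappa>" using test_cc \<kappa>(1) by blast
      have 1: "SP (qcyl \<tau>) (\<lambda>i \<alpha> z. P i \<alpha> z - smear \<kappa> (P i \<alpha>) z) \<le> C2 * (p * SP UNIV P + SP UNIV G)"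
      proof -
        have "\<tau>\<^sup>2 \<le> 1/8 * (1/8)" unfolding power2_eq_square using \<tau> t8 by (intro mult_mono) auto
        then have "qcyl \<tau> \<subseteq> (Z (3/8) (c0/2) :: ((real^'n) \<times> real) set)" using t8 c by (auto simp: qcyl_def Z_def)
        then have "SP (qcyl \<tau>) (\<lambda>i \<alpha> z. P i \<alpha> z - smear \<kappa> (P i \<alpha>) z) \<le> SP (Z (3/8) (c0/2)) (\<lambda>i \<alpha> z. P i \<alpha> z - smear \<kappa> (P i \<alpha>) z)"
          by (intro SP_mono_set cc_l2 cc_diff smear_cc cc c\<kappa>) auto
        also have "\<dots> \<le> C2 * (\<epsilon>\<^sup>2 * SP UNIV P + SP UNIV G)"
          by (rule C2(2)[OF A _ _ c(2) sol gd _ e(2) c\<kappa> \<kappa>(3)])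
            (use c e \<kappa> kfam_kernel_family[OF \<kappa>(1)] in \<open>auto simp: kernel_family_def dest: spec[of _ "[]"]\<close>)
        also have "\<dots> \<le> C2 * (p * SP UNIV P + SP UNIV G)"
          using C2(1) e(3) by (intro mult_left_mono add_right_mono mult_right_mono SP_nonneg) auto
        finally show ?thesis .
      qed
      have 2: "SP (qcyl \<tau>) (\<lambda>i \<alpha>. smear \<kappa> (P i \<alpha>)) \<le> C1 * p * (SP UNIV P + H * SP UNIV G)"
        using C1(2)[OF \<tau> A c sol fam e(2) k1 H] by (simp add: p_def)
      have "SP (qcyl \<tau>) P \<le> 2 * SP (qcyl \<tau>) (\<lambda>i \<alpha> z. P i \<alpha> z - smear \<kappa> (P i \<alpha>) z) + 2 * SP (qcyl \<tau>) (\<lambda>i \<alpha>. smear \<kappa> (P i \<alpha>))"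
        by (intro SP_add_le cc_l2 smear_cc cc c\<kappa>) auto
      also have "\<dots> \<le> 2 * (C2 * (p * SP UNIV P + SP UNIV G)) + 2 * (C1 * p * (SP UNIV P + H * SP UNIV G))"
        using 1 2 by linarith
      also have "\<dots> = (2 * C2 + 2 * C1) * \<tau> ^ (?n + 2) * SP UNIV P + (2 * C2 + 2 * C1 * p * H) * SP UNIV G"
        unfolding p_def by (simp add: algebra_simps)
      finally show "SP (qcyl \<tau>) P \<le> (2 * C2 + 2 * C1) * \<tau> ^ (?n + 2) * SP UNIV P + (2 * C2 + 2 * C1 * p * H) * SP UNIV G" .
    qed
  qed
qed

subsection \<open>Mollification of a weak solution on the unit cylinder\<close>

text \<open>Open at the top, unlike \<open>cyl\<close>: test functions have compact support in an
  open set, and the missing slice is a null set.\<close>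

definition unit_cyl :: "((real^'n::finite) \<times> real) set" where
  "unit_cyl = ball 0 1 \<times> {-1<..<0}"

text \<open>
  Weak solutions on the unit cylinder, extended by zero so that they can be convolved; the choice of
  Borel representatives makes every integral one over \<open>lborel\<close>.
\<close>

definition unit_sol :: "('m::finite \<Rightarrow> 'm \<Rightarrow> 'n::finite \<Rightarrow> 'n \<Rightarrow> real) \<Rightarrow> ('m \<Rightarrow> (real^'n) \<times> real \<Rightarrow> real)
    \<Rightarrow> ('m \<Rightarrow> 'n \<Rightarrow> (real^'n) \<times> real \<Rightarrow> real) \<Rightarrow> ('m \<Rightarrow> 'n \<Rightarrow> (real^'n) \<times> real \<Rightarrow> real) \<Rightarrow> bool" where
  "unit_sol A u Du g \<longleftrightarrow>
     (\<forall>i. integrable lborel (u i)) \<and> (\<forall>i \<alpha>. l2 (Du i \<alpha>)) \<and> (\<forall>i \<alpha>. l2 (g i \<alpha>)) \<and>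
     (\<forall>z. z \<notin> unit_cyl \<longrightarrow> (\<forall>i \<alpha>. u i z = 0 \<and> Du i \<alpha> z = 0 \<and> g i \<alpha> z = 0)) \<and>
     (\<forall>\<psi>\<in>test_functions unit_cyl. \<forall>i \<alpha>.
        (LINT z|lborel. u i z * tfd (ex \<alpha>) \<psi> z) = - (LINT z|lborel. Du i \<alpha> z * \<psi> z)) \<and>
     (\<forall>\<psi>\<in>test_functions unit_cyl. \<forall>i. (LINT z|lborel. u i z * tfd et \<psi> z)
        = (\<Sum>\<alpha>\<in>UNIV. LINT z|lborel. flux A (\<lambda>j \<beta>. Du j \<beta> z) (\<lambda>i \<alpha>. g i \<alpha> z) i \<alpha> * tfd (ex \<alpha>) \<psi> z))"

lemma l2_bounded_integrable:
  fixes F :: "'a::euclidean_space \<Rightarrow> real"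
  assumes F: "l2 F" "\<And>z. R < norm z \<Longrightarrow> F z = 0" shows "integrable lborel F"
proof (rule Bochner_Integration.integrable_bound)
  show "integrable lborel (\<lambda>z. indicator (cball (0::'a) R) z + (F z)\<^sup>2)"
    using F(1) emeasure_lborel_cball_finite[of "0::'a" R] unfolding l2_def
    by (intro Bochner_Integration.integrable_add integrable_real_indicator) (auto simp: less_top[symmetric])
  show "AE z in lborel. norm (F z) \<le> norm (indicator (cball 0 R) z + (F z)\<^sup>2)"
  proof (rule AE_I2)
    fix z
    have "\<bar>F z\<bar> \<le> 1 + (F z)\<^sup>2" using sum_squares_bound[of 1 "\<bar>F z\<bar>"] by (simp add: power2_eq_square)
    then show "norm (F z) \<le> norm (indicator (cball 0 R) z + (F z)\<^sup>2)"
      using F(2)[of z] by (auto simp: indicator_def not_le)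
  qed
qed (use F in \<open>auto simp: l2_def\<close>)

text \<open>These are the test functions which, inserted in the weak formulation, give the equation
  of the convolution at the point \<open>z\<close>; the reflection accounts for the sign.\<close>

lemma test_functions_reflect:
  fixes k :: "'a::euclidean_space \<Rightarrow> real"
  assumes k: "k \<in> test_functions V" and U: "\<And>y. y \<in> V \<Longrightarrow> z - y \<in> U"
  shows "(\<lambda>y. k (z - y)) \<in> test_functions U" "tfd v (\<lambda>y. k (z - y)) y = - tfd v k (z - y)"
proof -
  have C: "Ck j (\<lambda>y. k (z + - y))" for j
    by (rule Ck_affine[OF bounded_linear_minus[OF bounded_linear_ident]]) (use k in \<open>auto simp: test_functions_def\<close>)
  define K where "K = closure {y. k y \<noteq> 0}"
  have K: "compact K" "K \<subseteq> V" using k by (auto simp: K_def test_functions_def)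
  have cK: "compact ((\<lambda>y. z - y) ` K)" by (intro compact_continuous_image continuous_intros K)
  have "{y. k (z - y) \<noteq> 0} \<subseteq> (\<lambda>y. z - y) ` K"
  proof
    fix y assume "y \<in> {y. k (z - y) \<noteq> 0}"
    then have "z - y \<in> K" using closure_subset[of "{y. k y \<noteq> 0}"] by (auto simp: K_def)
    then show "y \<in> (\<lambda>y. z - y) ` K" by (intro image_eqI[of _ _ "z - y"]) auto
  qed
  then have "closure {y. k (z - y) \<noteq> 0} \<subseteq> (\<lambda>y. z - y) ` K" using cK by (intro closure_minimal compact_imp_closed)
  moreover from this have "compact (closure {y. k (z - y) \<noteq> 0})"
    using cK by (meson closed_closure compact_imp_bounded bounded_subset compact_eq_bounded_closed)
  ultimately show "(\<lambda>y. k (z - y)) \<in> test_functions U"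
    using C K U unfolding test_functions_def by (auto simp del: Ck.simps)
  have "((\<lambda>y. z - y) has_derivative (\<lambda>v. - v)) (at y)" by (auto intro!: derivative_eq_intros)
  from has_derivative_compose[OF this test_has_derivative[OF k]]
  have "((\<lambda>y. k (z - y)) has_derivative (\<lambda>v. tfd (- v) k (z - y))) (at y)" .
  then have "tfd v (\<lambda>y. k (z - y)) y = tfd (- v) k (z - y)" unfolding tfd_def[of v] by (simp add: frechet_derivative_eqI)
  also have "\<dots> = - tfd v k (z - y)"
    using linear_neg[OF has_derivative_linear[OF test_has_derivative[OF k, of "z - y"]], of v] by simp
  finally show "tfd v (\<lambda>y. k (z - y)) y = - tfd v k (z - y)" .
qed

lemma unit_cyl_bounded: "2 < norm z \<Longrightarrow> z \<notin> unit_cyl"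
  using norm_Pair_le[of "fst z" "snd z"] by (auto simp: unit_cyl_def)

abbreviation conv :: "('a::euclidean_space \<Rightarrow> real) \<Rightarrow> ('a \<Rightarrow> real) \<Rightarrow> 'a \<Rightarrow> real" where
  "conv k h \<equiv> gconv (\<lambda>y. y) k h"

text \<open>The kernel samples \<open>u\<close> only at times earlier by at least \<open>c0\<close>,
  so the convolution solves the system at all times below \<open>c0\<close>, beyond the top of the
  cylinder on which \<open>u\<close> is known.\<close>

lemma conv_smooth_sol:
  fixes u :: "'m::finite \<Rightarrow> (real^'n::finite) \<times> real \<Rightarrow> real"
  assumes sol: "unit_sol A u Du g"
    and k: "k \<in> test_functions (ball 0 (1/8) \<times> {0<..<1/8})"
  shows "\<exists>c0>0. c0 \<le> 1 \<and> smooth_sol A (Z (5/8) c0) (\<lambda>i. conv k (u i)) (\<lambda>i \<alpha>. conv k (Du i \<alpha>)) (\<lambda>i \<alpha>. conv k (g i \<alpha>))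
    \<and> grad_dir (Z (5/8) c0) (\<lambda>i. conv k (u i)) (\<lambda>i \<alpha>. conv k (Du i \<alpha>))"
proof -
  define K where "K = closure {y. k y \<noteq> 0}"
  have K: "compact K" "K \<subseteq> ball 0 (1/8) \<times> {0<..<1/8}" using k by (auto simp: K_def test_functions_def)
  have K0: "k y \<noteq> 0 \<Longrightarrow> y \<in> K" for y using closure_subset[of "{y. k y \<noteq> 0}"] by (auto simp: K_def)
  \<comment> \<open>The earliest time in the support of the kernel, positive by compactness; 1 if
    the kernel vanishes identically.\<close>
  obtain c0 where c0: "0 < c0" "c0 \<le> 1" "\<And>y. y \<in> K \<Longrightarrow> c0 \<le> snd y"
  proof (cases "K = {}")
    case False
    have "compact (snd ` K)" by (intro compact_continuous_image continuous_intros K)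
    then obtain s where s: "s \<in> snd ` K" "\<And>t. t \<in> snd ` K \<Longrightarrow> s \<le> t" using compact_attains_inf[of "snd ` K"] False by auto
    then have "0 < s" "s < 1/8" using K by auto
    then show ?thesis using s(2) by (intro that[of s]) auto
  qed (use that[of 1] in auto)
  \<comment> \<open>Regarding \<open>k\<close> as a test function on its own support
    \<open>K\<close>, the reflected function is admissible as soon as \<open>z - y\<close> lies in
    the cylinder for \<open>y\<close> in \<open>K\<close>.\<close>
  have kK: "k \<in> test_functions (K :: ((real^'n) \<times> real) set)" using k K by (auto simp: test_functions_def K_def)
  have shift: "z - y \<in> unit_cyl" if z: "z \<in> Z (5/8) c0" and y: "y \<in> K" for z y :: "(real^'n) \<times> real"
  proof -
    have "norm (fst y) < 1/8" "snd y < 1/8" using y K by auto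
    moreover have "norm (fst z) < 5/8" "- (5/8) < snd z" "snd z < c0" using z by (auto simp: Z_def)
    moreover have "norm (fst z - fst y) \<le> norm (fst z) + norm (fst y)" by (rule norm_triangle_ineq4)
    ultimately show ?thesis using c0(3)[OF y] by (auto simp: unit_cyl_def minus_prod_def)
  qed
  have int: "integrable lborel (u i)" "l2 (Du i \<alpha>)" "l2 (g i \<alpha>)" for i \<alpha> using sol unfolding unit_sol_def by auto
  have sup: "u i z = 0" "Du i \<alpha> z = 0" "g i \<alpha> z = 0" if "2 < norm z" for i \<alpha> z
  proof -
    have "\<forall>z. z \<notin> unit_cyl \<longrightarrow> (\<forall>i \<alpha>. u i z = 0 \<and> Du i \<alpha> z = 0 \<and> g i \<alpha> z = 0)"
      using sol unfolding unit_sol_def by (elim conjE)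
    then show "u i z = 0" "Du i \<alpha> z = 0" "g i \<alpha> z = 0" using unit_cyl_bounded[OF that] by blast+
  qed
  have intD: "integrable lborel (Du i \<alpha>)" "integrable lborel (g i \<alpha>)" for i \<alpha>
    using l2_bounded_integrable[of _ 2] int sup by blast+
  have dc: "dirD v (conv k h) (conv (tfd v k) h)" if "integrable lborel h" "\<And>z. 2 < norm z \<Longrightarrow> h z = 0" for v h
    by (rule gconv_dirD[OF test_dirD[OF k] that bounded_linear_ident])
  have W1: "conv (tfd (ex \<alpha>) k) (u i) z = conv k (Du i \<alpha>) z" if z: "z \<in> Z (5/8) c0" for i \<alpha> z
  proof -
    note r = test_functions_reflect[OF kK shift[OF z]]
    have "(LINT y|lborel. u i y * tfd (ex \<alpha>) (\<lambda>y. k (z - y)) y) = - (LINT y|lborel. Du i \<alpha> y * k (z - y))"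
      using sol r(1) unfolding unit_sol_def by blast
    then show ?thesis unfolding gconv_def by (simp add: r(2))
  qed
  have W2: "conv (tfd et k) (u i) z = (\<Sum>\<alpha>\<in>UNIV. flux A (\<lambda>j \<beta>. conv (tfd (ex \<alpha>) k) (Du j \<beta>) z) (\<lambda>i \<alpha>. conv (tfd (ex \<alpha>) k) (g i \<alpha>) z) i \<alpha>)"
    if z: "z \<in> Z (5/8) c0" for i z
  proof -
    note r = test_functions_reflect[OF kK shift[OF z]]
    have kd: "cc (tfd (ex \<alpha>) k)" for \<alpha> using test_cc tfd_test k by blast
    note gi = gconv_integrand[OF kd intD(1) measurable_ident] gconv_integrand[OF kd intD(2) measurable_ident]
    have "(LINT y|lborel. u i y * tfd et (\<lambda>y. k (z - y)) y)
       = (\<Sum>\<alpha>\<in>UNIV. LINT y|lborel. flux A (\<lambda>j \<beta>. Du j \<beta> y) (\<lambda>i \<alpha>. g i \<alpha> y) i \<alpha> * tfd (ex \<alpha>) (\<lambda>y. k (z - y)) y)"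
      using sol r(1) unfolding unit_sol_def by blast
    then have "conv (tfd et k) (u i) z = (\<Sum>\<alpha>\<in>UNIV. LINT y|lborel. flux A (\<lambda>j \<beta>. Du j \<beta> y) (\<lambda>i \<alpha>. g i \<alpha> y) i \<alpha> * tfd (ex \<alpha>) k (z - y))"
      unfolding gconv_def by (simp add: r(2) sum_negf)
    also have "\<dots> = (\<Sum>\<alpha>\<in>UNIV. flux A (\<lambda>j \<beta>. conv (tfd (ex \<alpha>) k) (Du j \<beta>) z) (\<lambda>i \<alpha>. conv (tfd (ex \<alpha>) k) (g i \<alpha>) z) i \<alpha>)"
    proof (intro sum.cong refl)
      fix \<alpha>
      have "(LINT y|lborel. flux A (\<lambda>j \<beta>. Du j \<beta> y) (\<lambda>i \<alpha>. g i \<alpha> y) i \<alpha> * tfd (ex \<alpha>) k (z - y))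
        = (LINT y|lborel. (\<Sum>j\<in>UNIV. \<Sum>\<beta>\<in>UNIV. A i j \<alpha> \<beta> * (Du j \<beta> y * tfd (ex \<alpha>) k (z - y))) - g i \<alpha> y * tfd (ex \<alpha>) k (z - y))"
        unfolding flux_def by (simp add: left_diff_distrib sum_distrib_right mult.assoc)
      also have "\<dots> = (\<Sum>j\<in>UNIV. \<Sum>\<beta>\<in>UNIV. A i j \<alpha> \<beta> * (LINT y|lborel. Du j \<beta> y * tfd (ex \<alpha>) k (z - y))) - (LINT y|lborel. g i \<alpha> y * tfd (ex \<alpha>) k (z - y))"
        using gi by simp
      finally show "(LINT y|lborel. flux A (\<lambda>j \<beta>. Du j \<beta> y) (\<lambda>i \<alpha>. g i \<alpha> y) i \<alpha> * tfd (ex \<alpha>) k (z - y))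
        = flux A (\<lambda>j \<beta>. conv (tfd (ex \<alpha>) k) (Du j \<beta>) z) (\<lambda>i \<alpha>. conv (tfd (ex \<alpha>) k) (g i \<alpha>) z) i \<alpha>"
        unfolding flux_def gconv_def .
    qed
    finally show ?thesis .
  qed
  have "smooth_sol A (Z (5/8) c0) (\<lambda>i. conv k (u i)) (\<lambda>i \<alpha>. conv k (Du i \<alpha>)) (\<lambda>i \<alpha>. conv k (g i \<alpha>))"
    unfolding smooth_sol_def
    by (rule exI[of _ "\<lambda>i. conv (tfd et k) (u i)"], rule exI[of _ "\<lambda>i \<alpha>. conv (tfd (ex \<alpha>) k) (u i)"],
      rule exI[of _ "\<lambda>\<alpha> j \<beta>. conv (tfd (ex \<alpha>) k) (Du j \<beta>)"], rule exI[of _ "\<lambda>i \<alpha>. conv (tfd (ex \<alpha>) k) (g i \<alpha>)"])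
      (auto intro!: dc int intD sup W1 W2)
  moreover have "grad_dir (Z (5/8) c0) (\<lambda>i. conv k (u i)) (\<lambda>i \<alpha>. conv k (Du i \<alpha>))"
    unfolding grad_dir_def
  proof (intro allI)
    fix i and y :: "real^'n"
    show "\<exists>F'. dirD (y, 0) (conv k (u i)) F' \<and> (\<forall>z\<in>Z (5/8) c0. F' z = (\<Sum>\<alpha>\<in>UNIV. y $ \<alpha> * conv k (Du i \<alpha>) z))"
    proof (intro exI conjI ballI)
      show "dirD (y, 0) (conv k (u i)) (conv (tfd (y, 0) k) (u i))" by (intro dc int sup)
      fix z :: "(real^'n) \<times> real" assume z: "z \<in> Z (5/8) c0"
      have "(y, 0::real) = (\<Sum>\<alpha>\<in>UNIV. y $ \<alpha> *\<^sub>R ex \<alpha>)"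
        by (simp add: prod_eq_iff fst_sum snd_sum vec_eq_iff axis_def if_distrib cong: if_cong)
      then have t: "tfd (y, 0) k x = (\<Sum>\<alpha>\<in>UNIV. y $ \<alpha> * tfd (ex \<alpha>) k x)" for x
        using tfd_linear[OF k, of "\<lambda>\<alpha>. y $ \<alpha>" ex UNIV x] by simp
      have kd: "cc (tfd (ex \<alpha>) k)" for \<alpha> using test_cc tfd_test k by blast
      have "conv (tfd (y, 0) k) (u i) z = (LINT x|lborel. (\<Sum>\<alpha>\<in>UNIV. y $ \<alpha> * (u i x * tfd (ex \<alpha>) k (z - x))))"
        unfolding gconv_def t by (simp add: sum_distrib_left mult.left_commute)
      also have "\<dots> = (\<Sum>\<alpha>\<in>UNIV. y $ \<alpha> * conv (tfd (ex \<alpha>) k) (u i) z)"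
        unfolding gconv_def using gconv_integrand[OF kd int(1) measurable_ident] by simp
      finally show "conv (tfd (y, 0) k) (u i) z = (\<Sum>\<alpha>\<in>UNIV. y $ \<alpha> * conv k (Du i \<alpha>) z)"
        using W1[OF z] by simp
    qed
  qed
  ultimately show ?thesis using c0 by blast
qed

subsection \<open>Convergence of mollifications\<close>

text \<open>A measurable function is an almost everywhere limit of continuous ones. Truncating the
  values at a level \<open>m\<close> and cutting off outside a ball provides a dominating function,
  so this limit holds in L2; the truncation error of \<open>h\<close> itself is small for large
  \<open>m\<close>.\<close>

lemma cc_dense:
  fixes h :: "'a::euclidean_space \<Rightarrow> real"
  assumes h: "l2 h" "\<And>z. R < norm z \<Longrightarrow> h z = 0" and e: "0 < e"
  shows "\<exists>f. cc f \<and> sqn UNIV (\<lambda>z. h z - f z) < e"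
proof -
  note [measurable] = l2_measurable[OF h(1)]
  define T where "T m x = max (- real m) (min (real m) x)" for m x
  have T: "\<bar>T m x\<bar> \<le> real m" "\<bar>x - T m x\<bar> \<le> \<bar>x\<bar>" "T m 0 = 0" for m x by (auto simp: T_def)
  have Tm [measurable]: "(\<lambda>z. T m (F z)) \<in> borel_measurable borel" if [measurable]: "F \<in> borel_measurable borel" for m and F :: "'a \<Rightarrow> real"
    unfolding T_def by measurable
  have "(\<lambda>m. LINT z|lborel. (h z - T m (h z))\<^sup>2) \<longlonglongrightarrow> (LINT z|(lborel :: 'a measure). (0::real))"
  proof (rule integral_dominated_convergence[where w = "\<lambda>z. (h z)\<^sup>2"])
    show "integrable lborel (\<lambda>z. (h z)\<^sup>2)" using h by (simp add: l2_def)
    show "AE z in lborel. (\<lambda>m. (h z - T m (h z))\<^sup>2) \<longlonglongrightarrow> 0"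
    proof (rule AE_I2)
      fix z
      obtain N where N: "\<bar>h z\<bar> \<le> real N" using real_arch_simple by blast
      have "T m (h z) = h z" if "N \<le> m" for m
      proof -
        have "\<bar>h z\<bar> \<le> real m" using N that by (meson of_nat_le_iff order_trans)
        then show ?thesis by (auto simp: T_def)
      qed
      then show "(\<lambda>m. (h z - T m (h z))\<^sup>2) \<longlonglongrightarrow> 0"
        by (intro tendsto_eventually eventually_sequentiallyI[of N]) auto
    qed
    show "AE z in lborel. norm ((h z - T m (h z))\<^sup>2) \<le> (h z)\<^sup>2" for m
      using T(2)[of "h _" m] by (auto simp: abs_le_square_iff)
  qed measurable
  then have "\<forall>\<^sub>F m in sequentially. (LINT z|lborel. (h z - T m (h z))\<^sup>2) < e / 4"
    using e by (intro order_tendstoD(2)) auto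
  then obtain m where m: "(LINT z|lborel. (h z - T m (h z))\<^sup>2) < e / 4" by (auto simp: eventually_sequentially)
  have "h measurable_on UNIV" using measurable_completion[of h lborel borel]
    by (intro lebesgue_measurable_imp_measurable_on_real) auto
  then obtain N G where N: "negligible N" and G: "\<And>n. continuous_on UNIV (G n)" "\<And>z. z \<notin> N \<Longrightarrow> (\<lambda>n. G n z) \<longlonglongrightarrow> h z"
    unfolding measurable_on_def by auto
  \<comment> \<open>A continuous cutoff, equal to 1 on the ball of radius
    \<open>\<bar>R\<bar>\<close> where \<open>h\<close> may be nonzero.\<close>
  define \<theta> where "\<theta> z = max 0 (min 1 (\<bar>R\<bar> + 1 - norm z))" for z :: 'a
  have \<theta>: "0 \<le> \<theta> z" "\<theta> z \<le> 1" "norm z \<le> \<bar>R\<bar> \<Longrightarrow> \<theta> z = 1" "\<bar>R\<bar> + 1 \<le> norm z \<Longrightarrow> \<theta> z = 0" for z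
    by (auto simp: \<theta>_def)
  define f where "f n z = \<theta> z * T m (G n z)" for n z
  have ccf: "cc (f n)" for n
  proof (rule ccI[of _ "\<bar>R\<bar> + 1"])
    show "continuous_on UNIV (f n)" unfolding f_def \<theta>_def T_def by (intro continuous_intros G)
  qed (use \<theta> in \<open>auto simp: f_def\<close>)
  note [measurable] = cc_measurable[OF ccf]
  have hR: "h z = 0" if "\<bar>R\<bar> < norm z" for z using h(2)[of z] that by auto
  have lim: "(\<lambda>n. LINT z|lborel. (T m (h z) - f n z)\<^sup>2) \<longlonglongrightarrow> (LINT z|(lborel :: 'a measure). (0::real))"
  proof (rule integral_dominated_convergence[where w = "\<lambda>z. (2 * real m)\<^sup>2 * indicator (cball (0::'a) (\<bar>R\<bar> + 1)) z"])
    show "integrable lborel (\<lambda>z. (2 * real m)\<^sup>2 * indicator (cball (0::'a) (\<bar>R\<bar> + 1)) z)"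
      by (rule integrable_cball_bound[of _ "(2 * real m)\<^sup>2" "\<bar>R\<bar> + 1"])
        (auto intro!: borel_measurable_times borel_measurable_indicator)
    have "AE z in lebesgue. z \<notin> N" using N by (simp add: AE_not_in negligible_iff_null_sets)
    then have ae: "AE z in lborel. z \<notin> N" by (simp add: AE_completion_iff)
    show "AE z in lborel. (\<lambda>n. (T m (h z) - f n z)\<^sup>2) \<longlonglongrightarrow> 0"
      using ae
    proof eventually_elim
      case (elim z)
      have "(\<lambda>n. T m (G n z)) \<longlonglongrightarrow> T m (h z)" unfolding T_def by (intro tendsto_intros G(2) elim)
      then have "(\<lambda>n. f n z) \<longlonglongrightarrow> \<theta> z * T m (h z)" unfolding f_def by (intro tendsto_intros)
      moreover have "\<theta> z * T m (h z) = T m (h z)" using \<theta>(3)[of z] hR[of z] T(3) by (cases "norm z \<le> \<bar>R\<bar>") auto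
      ultimately have "(\<lambda>n. T m (h z) - f n z) \<longlonglongrightarrow> T m (h z) - T m (h z)" by (intro tendsto_intros) simp
      then show "(\<lambda>n. (T m (h z) - f n z)\<^sup>2) \<longlonglongrightarrow> 0" using tendsto_power[of _ 0 _ 2] by simp
    qed
    show "AE z in lborel. norm ((T m (h z) - f n z)\<^sup>2) \<le> (2 * real m)\<^sup>2 * indicator (cball 0 (\<bar>R\<bar> + 1)) z" for n
    proof (rule AE_I2)
      fix z :: 'a
      show "norm ((T m (h z) - f n z)\<^sup>2) \<le> (2 * real m)\<^sup>2 * indicator (cball 0 (\<bar>R\<bar> + 1)) z"
      proof (cases "norm z \<le> \<bar>R\<bar> + 1")
        case True
        have "\<bar>f n z\<bar> \<le> 1 * real m" unfolding f_def abs_mult using \<theta>[of z] T(1)[of m] by (intro mult_mono) auto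
        then have "\<bar>T m (h z) - f n z\<bar> \<le> 2 * real m" using T(1)[of m "h z"] by linarith
        then have "(T m (h z) - f n z)\<^sup>2 \<le> (2 * real m)\<^sup>2" using abs_le_square_iff[of "T m (h z) - f n z" "2 * real m"] by simp
        then show ?thesis using True by simp
      next
        case False
        then show ?thesis using hR[of z] \<theta>(4)[of z] T(3) by (simp add: f_def)
      qed
    qed
  qed measurable
  then have "\<forall>\<^sub>F n in sequentially. (LINT z|lborel. (T m (h z) - f n z)\<^sup>2) < e / 4"
    using e by (intro order_tendstoD(2)) auto
  then obtain n where n: "(LINT z|lborel. (T m (h z) - f n z)\<^sup>2) < e / 4" by (auto simp: eventually_sequentially)
  have lT: "l2 (\<lambda>z. T m (h z))"
  proof -
    have "integrable lborel (\<lambda>z. (T m (h z))\<^sup>2)"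
    proof (rule Bochner_Integration.integrable_bound)
      show "integrable lborel (\<lambda>z. (h z)\<^sup>2)" using h by (simp add: l2_def)
      have "\<bar>T m x\<bar> \<le> \<bar>x\<bar>" for x by (auto simp: T_def)
      then show "AE z in lborel. norm ((T m (h z))\<^sup>2) \<le> norm ((h z)\<^sup>2)" by (auto simp: abs_le_square_iff)
    qed measurable
    then show ?thesis by (simp add: l2_def)
  qed
  have "sqn UNIV (\<lambda>z. (h z - T m (h z)) + (T m (h z) - f n z)) \<le> 2 * sqn UNIV (\<lambda>z. h z - T m (h z)) + 2 * sqn UNIV (\<lambda>z. T m (h z) - f n z)"
    by (intro sqn_add l2_diff h lT cc_l2 ccf) auto
  also have "\<dots> < e" using m n unfolding sqn_def by simp
  finally show ?thesis using ccf[of n] by auto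
qed

lemma mollify_l2:
  fixes h :: "'a::euclidean_space \<Rightarrow> real"
  assumes h: "l2 h" "\<And>z. R < norm z \<Longrightarrow> h z = 0" and e: "0 < e"
  shows "\<exists>\<sigma>>0. \<forall>k. cc k \<longrightarrow> (\<forall>y. 0 \<le> k y) \<longrightarrow> (LINT y|lborel. k y) = 1 \<longrightarrow> (\<forall>y. k y \<noteq> 0 \<longrightarrow> norm y < \<sigma>) \<longrightarrow>
    sqn UNIV (\<lambda>z. h z - conv k h z) \<le> e"
proof -
  obtain f where f: "cc f" "sqn UNIV (\<lambda>z. h z - f z) < e / 16" using cc_dense[OF h, where e = "e/16"] e by auto
  obtain S where S: "0 < S" "\<And>z. S < norm z \<Longrightarrow> f z = 0" using cc_supp[OF f(1)] by blast
  define V where "V = measure lborel (cball (0::'a) (S + 1))"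
  have V: "0 \<le> V" by (simp add: V_def)
  \<comment> \<open>The modulus of continuity is tuned to the volume \<open>V\<close> of the ball
    containing the supports of \<open>f\<close> and its small translates; \<open>V + 1\<close>
    avoids a division by zero.\<close>
  define \<eta> where "\<eta> = sqrt (e / (16 * (V + 1)))"
  have eta: "0 < \<eta>" "\<eta>\<^sup>2 * V \<le> e / 16"
  proof -
    show "0 < \<eta>" unfolding \<eta>_def using e V by simp
    have "\<eta>\<^sup>2 = e / (16 * (V + 1))" unfolding \<eta>_def using e V by simp
    then have "\<eta>\<^sup>2 * (V + 1) = e / 16" using V by (simp add: field_simps)
    moreover have "\<eta>\<^sup>2 * V \<le> \<eta>\<^sup>2 * (V + 1)" by (intro mult_left_mono) auto
    ultimately show "\<eta>\<^sup>2 * V \<le> e / 16" by simp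
  qed
  obtain d where d: "0 < d" "\<And>x x'. dist x' x < d \<Longrightarrow> dist (f x') (f x) < \<eta>"
    using cc_uniform[OF f(1)] eta(1) unfolding uniformly_continuous_on_def by (metis UNIV_I)
  show ?thesis
  proof (intro exI[of _ "min d 1"] conjI allI impI)
    show "0 < min d 1" using d by simp
    fix k :: "'a \<Rightarrow> real" assume k: "cc k" "\<forall>y. 0 \<le> k y" "(LINT y|lborel. k y) = 1" "\<forall>y. k y \<noteq> 0 \<longrightarrow> norm y < min d 1"
    have ik: "integrable lborel k" using k by simp
    have k1: "(LINT y|lborel. \<bar>k y\<bar>) = 1" using k by simp
    note [measurable] = cc_measurable[OF f(1)] l2_measurable[OF h(1)]
    have ckf: "conv k f z = (LINT y|lborel. k y * f (z - y))" for z
      using gconv_id_swap[of k f] k(1) f(1) by (simp add: cc_measurable gconv_def)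
    have ckh: "conv k h = gconv (\<lambda>y. y) h k" using gconv_id_swap[of k h] k(1) by (simp add: cc_measurable)
    have 1: "sqn UNIV (\<lambda>z. LINT y|lborel. k y * (f z - f (z - y))) \<le> (LINT y|lborel. \<bar>k y\<bar>)\<^sup>2 * (\<eta>\<^sup>2 * V)"
    proof (rule average_sqn_le[OF ik])
      show "(\<lambda>(y, z). f z - f (z - y)) \<in> borel_measurable (borel \<Otimes>\<^sub>M borel)" by measurable
      fix y assume y: "k y \<noteq> 0"
      have l: "l2 (\<lambda>z. f z - f (z - y))" by (intro cc_l2 cc_diff f cc_translate_minus)
      have "sqn UNIV (\<lambda>z. f z - f (z - y)) \<le> (LINT z|(lborel :: 'a measure). \<eta>\<^sup>2 * indicator (cball 0 (S + 1)) z)"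
        unfolding sqn_def
      proof (intro integral_mono l2_ind l)
        show "integrable lborel (\<lambda>z. \<eta>\<^sup>2 * indicator (cball (0::'a) (S + 1)) z)"
          by (rule integrable_cball_bound[of _ "\<eta>\<^sup>2" "S + 1"])
            (auto intro!: borel_measurable_times borel_measurable_indicator)
        fix z
        have ny: "norm y < d" "norm y < 1" using k(4) y by auto
        show "indicator UNIV z * (f z - f (z - y))\<^sup>2 \<le> \<eta>\<^sup>2 * indicator (cball 0 (S + 1)) z"
        proof (cases "norm z \<le> S + 1")
          case True
          have "\<bar>f z - f (z - y)\<bar> \<le> \<eta>" using d(2)[of z "z - y"] ny by (simp add: dist_norm)
          then have "(f z - f (z - y))\<^sup>2 \<le> \<eta>\<^sup>2" using abs_le_square_iff[of "f z - f (z - y)" \<eta>] by simp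
          then show ?thesis using True by simp
        next
          case False
          then have "S < norm z" "S < norm (z - y)" using norm_triangle_ineq2[of z y] ny by auto
          then show ?thesis using S(2) False by simp
        qed
      qed auto
      also have "\<dots> = \<eta>\<^sup>2 * V"
        unfolding V_def by simp
      finally show "l2 (\<lambda>z. f z - f (z - y)) \<and> sqn UNIV (\<lambda>z. f z - f (z - y)) \<le> \<eta>\<^sup>2 * V" using l by simp
    qed (use V in auto)
    have 2: "(LINT y|lborel. k y * (f z - f (z - y))) = f z - conv k f z" for z
    proof -
      have "integrable lborel (\<lambda>y. k y * f (z - y))" by (rule gconv_integrand[OF f(1) ik]) simp
      then show ?thesis using k ik by (simp add: ckf right_diff_distrib)
    qed
    have A: "sqn UNIV (\<lambda>z. f z - conv k f z) \<le> e / 16" using 1 eta(2) by (simp add: 2 k1)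
    have B: "conv k f z - conv k h z = gconv (\<lambda>y. y) (\<lambda>x. f x - h x) k z" for z
    proof -
      have "integrable lborel (\<lambda>y. f y * k (z - y))" by (rule gconv_integrand[OF k(1) cc_integrable[OF f(1)]]) simp
      moreover have "integrable lborel (\<lambda>y. h y * k (z - y))"
        by (rule gconv_integrand[OF k(1) l2_bounded_integrable[OF h]]) auto
      ultimately have "conv k f z - conv k h z = conv k (\<lambda>x. f x - h x) z" unfolding gconv_def by (simp add: left_diff_distrib)
      then show ?thesis using gconv_id_swap[of k "\<lambda>x. f x - h x"] k(1) by (simp add: cc_measurable)
    qed
    have lfh: "l2 (\<lambda>x. f x - h x)" by (intro l2_diff cc_l2 f h)
    have sfh: "sqn UNIV (\<lambda>x. f x - h x) < e / 16" using f(2) unfolding sqn_def by (simp add: power2_commute)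
    have C: "l2 (gconv (\<lambda>y. y) (\<lambda>x. f x - h x) k)" "sqn UNIV (gconv (\<lambda>y. y) (\<lambda>x. f x - h x) k) \<le> e / 16"
    proof -
      show "l2 (gconv (\<lambda>y. y) (\<lambda>x. f x - h x) k)" by (rule gconv_l2[OF lfh ik]) simp
      have "sqn UNIV (gconv (\<lambda>y. y) (\<lambda>x. f x - h x) k) \<le> (LINT y|lborel. \<bar>k y\<bar>)\<^sup>2 * sqn UNIV (\<lambda>x. f x - h x)"
        by (rule gconv_l2[OF lfh ik]) simp
      then show "sqn UNIV (gconv (\<lambda>y. y) (\<lambda>x. f x - h x) k) \<le> e / 16" using sfh by (simp add: k1)
    qed
    have lcf: "l2 (\<lambda>z. f z - conv k f z)"
    proof -
      have "l2 (gconv (\<lambda>y. y) f k)" by (rule gconv_l2[OF cc_l2[OF f(1)] ik]) simp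
      then have "l2 (conv k f)" using gconv_id_swap[of k f] k(1) f(1) by (simp add: cc_measurable)
      then show ?thesis by (rule l2_diff[OF cc_l2[OF f(1)]])
    qed
    \<comment> \<open>Three errors: the approximation of \<open>h\<close>, the mollification of the
      continuous \<open>f\<close>, and the mollified approximation error, which is no larger than
      the first because the kernel has mass one. Their weights 2, 4 and 4 explain the fraction
      1/16.\<close>
    have eq: "h z - conv k h z = (h z - f z) + ((f z - conv k f z) + gconv (\<lambda>y. y) (\<lambda>x. f x - h x) k z)" for z
      using B[of z] by simp
    have "sqn UNIV (\<lambda>z. h z - conv k h z) \<le> 2 * sqn UNIV (\<lambda>z. h z - f z) + 2 * sqn UNIV (\<lambda>z. (f z - conv k f z) + gconv (\<lambda>y. y) (\<lambda>x. f x - h x) k z)"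
      unfolding eq by (intro sqn_add l2_diff l2_add cc_l2 f h lcf C) auto
    moreover have "sqn UNIV (\<lambda>z. (f z - conv k f z) + gconv (\<lambda>y. y) (\<lambda>x. f x - h x) k z)
       \<le> 2 * sqn UNIV (\<lambda>z. f z - conv k f z) + 2 * sqn UNIV (gconv (\<lambda>y. y) (\<lambda>x. f x - h x) k)"
      by (intro sqn_add lcf C) auto
    ultimately show "sqn UNIV (\<lambda>z. h z - conv k h z) \<le> e" using A C(2) f(2) e by linarith
  qed
qed

lemma SP_conv_le:
  assumes k: "cc k" "\<And>y. 0 \<le> k y" "(LINT y|lborel. k y) = 1" and h: "\<And>i \<alpha>. l2 (h i \<alpha>)"
  shows "SP UNIV (\<lambda>i \<alpha>. conv k (h i \<alpha>)) \<le> SP UNIV h"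
proof -
  have "sqn UNIV (conv k (h i \<alpha>)) \<le> 1 * sqn UNIV (h i \<alpha>)" for i \<alpha>
  proof -
    have "conv k (h i \<alpha>) = gconv (\<lambda>y. y) (h i \<alpha>) k"
      using gconv_id_swap[of k "h i \<alpha>"] k(1) h by (simp add: cc_measurable l2_measurable)
    moreover have "sqn UNIV (gconv (\<lambda>y. y) (h i \<alpha>) k) \<le> (LINT y|lborel. \<bar>k y\<bar>)\<^sup>2 * sqn UNIV (h i \<alpha>)"
      by (rule gconv_l2[OF h cc_integrable[OF k(1)]]) simp
    ultimately show ?thesis using k by simp
  qed
  then show ?thesis using SP_mono[of UNIV "\<lambda>i \<alpha>. conv k (h i \<alpha>)" 1 UNIV h] by simp
qed

text \<open>Convolution with a kernel of mass one does not increase the norms on the right, and on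
  the left it converges in L2. The limit is legitimate because \<open>C\<close> and
  \<open>C'\<close> do not depend on the \<open>c0\<close> that comes with each kernel. Both
  constants double through the splitting of the square.\<close>

lemma decay_weak:
  fixes l M :: real
  assumes l: "0 < l"
  shows "\<exists>C>0. \<forall>\<tau>. 0 < \<tau> \<longrightarrow> \<tau> \<le> 1 / (8 * real CARD('n)) \<longrightarrow> (\<exists>C'>0. \<forall>(A :: 'm::finite \<Rightarrow> 'm \<Rightarrow> 'n::finite \<Rightarrow> 'n \<Rightarrow> real) u Du g.
    elliptic l M A \<longrightarrow> unit_sol A u Du g \<longrightarrow>
    SP (qcyl \<tau>) Du \<le> C * \<tau> ^ (CARD('n) + 2) * SP UNIV Du + C' * SP UNIV g)"
proof -
  let ?n = "CARD('n)"
  obtain C where C: "0 < C" "\<And>\<tau>. 0 < \<tau> \<Longrightarrow> \<tau> \<le> 1 / (8 * real CARD('n)) \<Longrightarrow> (\<exists>C'>0. \<forall>(A :: 'm::finite \<Rightarrow> 'm \<Rightarrow> 'n::finite \<Rightarrow> 'n \<Rightarrow> real) c0 U P G.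
    elliptic l M A \<longrightarrow> 0 < c0 \<longrightarrow> c0 \<le> 1 \<longrightarrow> smooth_sol A (Z (5/8) c0) U P G \<longrightarrow> grad_dir (Z (5/8) c0) U P \<longrightarrow>
    SP (qcyl \<tau>) P \<le> C * \<tau> ^ (CARD('n) + 2) * SP UNIV P + C' * SP UNIV G)"
    using decay_smooth[OF l, of M, where 'm = 'm and 'n = 'n] by (elim exE conjE) blast
  show ?thesis
  proof (rule exI[of _ "2 * C"], intro conjI allI impI)
    show "0 < 2 * C" using C by simp
    fix \<tau> :: real assume \<tau>: "0 < \<tau>" "\<tau> \<le> 1 / (8 * real ?n)"
    obtain C' where C': "0 < C'" "\<And>(A :: 'm::finite \<Rightarrow> 'm \<Rightarrow> 'n::finite \<Rightarrow> 'n \<Rightarrow> real) c0 U P G.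
      elliptic l M A \<Longrightarrow> 0 < c0 \<Longrightarrow> c0 \<le> 1 \<Longrightarrow> smooth_sol A (Z (5/8) c0) U P G \<Longrightarrow> grad_dir (Z (5/8) c0) U P \<Longrightarrow>
      SP (qcyl \<tau>) P \<le> C * \<tau> ^ (CARD('n) + 2) * SP UNIV P + C' * SP UNIV G"
      using C(2)[OF \<tau>] by (elim exE conjE) blast
    show "\<exists>C'>0. \<forall>(A :: 'm \<Rightarrow> 'm \<Rightarrow> 'n \<Rightarrow> 'n \<Rightarrow> real) u Du g. elliptic l M A \<longrightarrow> unit_sol A u Du g \<longrightarrow>
      SP (qcyl \<tau>) Du \<le> 2 * C * \<tau> ^ (CARD('n) + 2) * SP UNIV Du + C' * SP UNIV g"
    proof (rule exI[of _ "2 * C'"], intro conjI allI impI)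
      show "0 < 2 * C'" using C' by simp
      fix A :: "'m \<Rightarrow> 'm \<Rightarrow> 'n \<Rightarrow> 'n \<Rightarrow> real" and u Du g
      assume A: "elliptic l M A" and sol: "unit_sol A u Du g"
      have l2: "l2 (Du i \<alpha>)" "l2 (g i \<alpha>)" for i \<alpha> using sol unfolding unit_sol_def by auto
      have sup: "Du i \<alpha> z = 0" if "2 < norm z" for i \<alpha> z
      proof -
        have "\<forall>z. z \<notin> unit_cyl \<longrightarrow> (\<forall>i \<alpha>. u i z = 0 \<and> Du i \<alpha> z = 0 \<and> g i \<alpha> z = 0)"
          using sol unfolding unit_sol_def by (elim conjE)
        then show ?thesis using unit_cyl_bounded[OF that] by blast
      qed
      define N where "N = real (CARD('m) * ?n)"
      have N: "0 < N" by (simp add: N_def)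
      show "SP (qcyl \<tau>) Du \<le> 2 * C * \<tau> ^ (?n + 2) * SP UNIV Du + 2 * C' * SP UNIV g"
      proof (rule field_le_epsilon)
        fix e' :: real assume "0 < e'"
        define e where "e = e' / (2 * N)"
        have e: "0 < e" unfolding e_def using N \<open>0 < e'\<close> by simp
        have "\<exists>\<sigma>>0. \<forall>k. cc k \<longrightarrow> (\<forall>y. 0 \<le> k y) \<longrightarrow> (LINT y|lborel. k y) = 1 \<longrightarrow> (\<forall>y. k y \<noteq> 0 \<longrightarrow> norm y < \<sigma>) \<longrightarrow>
          sqn UNIV (\<lambda>z. Du (fst p) (snd p) z - conv k (Du (fst p) (snd p)) z) \<le> e"
          (is "\<exists>\<sigma>>0. ?Q p \<sigma>") for p
          by (rule mollify_l2[OF l2(1) sup e])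
        then have "\<forall>p. \<exists>\<sigma>>0. ?Q p \<sigma>" by (rule allI)
        then obtain \<sigma> where sig: "\<forall>p. 0 < \<sigma> p \<and> ?Q p (\<sigma> p)" by (rule exE[OF choice])
        have sig1: "0 < \<sigma> p" for p by (rule conjunct1[OF spec[OF sig]])
        have "?Q p (\<sigma> p)" for p by (rule conjunct2[OF spec[OF sig]])
        note \<sigma> = sig1 this[rule_format]
        define s where "s = Min (insert (1/8) (range \<sigma>))"
        have s: "0 < s" "s \<le> 1/8" "\<And>p. s \<le> \<sigma> p"
        proof -
          show "0 < s" "s \<le> 1/8" unfolding s_def using \<sigma>(1) by auto
          show "s \<le> \<sigma> p" for p unfolding s_def by (rule Min_le) auto
        qed
        \<comment> \<open>A set of small radius in positive times; it is nonempty because its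
          closure touches the origin from above.\<close>
        define V where "V = (ball 0 s \<inter> (ball 0 (1/8) \<times> {0<..<1/8}) :: ((real^'n) \<times> real) set)"
        have "open V" unfolding V_def by (intro open_Int open_Times) auto
        moreover have "(0, s / 2) \<in> V" using s by (auto simp: V_def norm_Pair)
        ultimately have "open V" "V \<noteq> {}" by auto
        have "\<exists>k::(real^'n) \<times> real \<Rightarrow> real. k \<in> test_functions V \<and> (\<forall>z. 0 \<le> k z) \<and> (LINT z|lborel. k z) = 1"
          by (rule bump_exists[OF \<open>open V\<close> \<open>V \<noteq> {}\<close>]) auto
        then obtain k :: "(real^'n) \<times> real \<Rightarrow> real" where k: "k \<in> test_functions V" "\<And>z. 0 \<le> k z" "(LINT z|lborel. k z) = 1"
          by blast
        have ck: "cc k" using test_cc k by blast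
        have kV: "k y \<noteq> 0 \<Longrightarrow> norm y < s" for y
          using k(1) closure_subset[of "{z. k z \<noteq> 0}"] unfolding test_functions_def V_def by auto
        have "k \<in> test_functions (ball 0 (1/8) \<times> {0<..<1/8})"
          using k(1) test_functions_mono[of V "ball 0 (1/8) \<times> {0<..<1/8}"] by (auto simp: V_def)
        then obtain c0 where c0: "0 < c0" "c0 \<le> 1"
          "smooth_sol A (Z (5/8) c0) (\<lambda>i. conv k (u i)) (\<lambda>i \<alpha>. conv k (Du i \<alpha>)) (\<lambda>i \<alpha>. conv k (g i \<alpha>))"
          "grad_dir (Z (5/8) c0) (\<lambda>i. conv k (u i)) (\<lambda>i \<alpha>. conv k (Du i \<alpha>))"
          using conv_smooth_sol[OF sol] by blast
        have lc: "l2 (conv k (Du i \<alpha>))" for i \<alpha> using smooth_sol_cc(2)[OF c0(3)] by auto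
        have 1: "SP (qcyl \<tau>) (\<lambda>i \<alpha>. conv k (Du i \<alpha>)) \<le> C * \<tau> ^ (?n + 2) * SP UNIV Du + C' * SP UNIV g"
        proof -
          have "SP (qcyl \<tau>) (\<lambda>i \<alpha>. conv k (Du i \<alpha>)) \<le> C * \<tau> ^ (?n + 2) * SP UNIV (\<lambda>i \<alpha>. conv k (Du i \<alpha>)) + C' * SP UNIV (\<lambda>i \<alpha>. conv k (g i \<alpha>))"
            by (rule C'(2)[OF A c0])
          also have "\<dots> \<le> C * \<tau> ^ (?n + 2) * SP UNIV Du + C' * SP UNIV g"
            using C(1) C'(1) \<tau> by (intro add_mono mult_left_mono SP_conv_le ck k l2) auto
          finally show ?thesis .
        qed
        have 2: "SP (qcyl \<tau>) (\<lambda>i \<alpha> z. Du i \<alpha> z - conv k (Du i \<alpha>) z) \<le> N * e"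
        proof -
          have "sqn (qcyl \<tau>) (\<lambda>z. Du i \<alpha> z - conv k (Du i \<alpha>) z) \<le> e" for i \<alpha>
          proof -
            have "sqn (qcyl \<tau>) (\<lambda>z. Du i \<alpha> z - conv k (Du i \<alpha>) z) \<le> sqn UNIV (\<lambda>z. Du i \<alpha> z - conv k (Du i \<alpha>) z)"
              by (intro sqn_UNIV l2_diff l2 lc) auto
            also have "\<dots> \<le> e"
            proof -
              have "norm y < \<sigma> (i, \<alpha>)" if "k y \<noteq> 0" for y using kV[OF that] s(3)[of "(i, \<alpha>)"] by linarith
              from \<sigma>(2)[OF ck k(2) k(3) this] show ?thesis by simp
            qed
            finally show ?thesis .
          qed
          then have "SP (qcyl \<tau>) (\<lambda>i \<alpha> z. Du i \<alpha> z - conv k (Du i \<alpha>) z) \<le> (\<Sum>i\<in>(UNIV::'m set). \<Sum>\<alpha>\<in>(UNIV::'n set). e)"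
            unfolding SP_def by (intro sum_mono)
          then show ?thesis by (simp add: N_def)
        qed
        have "SP (qcyl \<tau>) Du \<le> 2 * SP (qcyl \<tau>) (\<lambda>i \<alpha> z. Du i \<alpha> z - conv k (Du i \<alpha>) z) + 2 * SP (qcyl \<tau>) (\<lambda>i \<alpha>. conv k (Du i \<alpha>))"
          by (intro SP_add_le l2 lc) auto
        also have "\<dots> \<le> 2 * (N * e) + 2 * (C * \<tau> ^ (?n + 2) * SP UNIV Du + C' * SP UNIV g)" by (intro add_mono mult_left_mono 1 2) auto
        also have "2 * (N * e) = e'" unfolding e_def using N by simp
        finally show "SP (qcyl \<tau>) Du \<le> 2 * C * \<tau> ^ (?n + 2) * SP UNIV Du + 2 * C' * SP UNIV g + e'" by (simp add: algebra_simps)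
      qed
    qed
  qed
qed

subsection \<open>Rescaling to the unit cylinder\<close>

definition Phi :: "real^'n::finite \<Rightarrow> real \<Rightarrow> real \<Rightarrow> (real^'n) \<times> real \<Rightarrow> (real^'n) \<times> real" where
  "Phi x0 t1 r y = (x0 + r *\<^sub>R fst y, t1 + r\<^sup>2 * snd y)"

definition Psi :: "real^'n::finite \<Rightarrow> real \<Rightarrow> real \<Rightarrow> (real^'n) \<times> real \<Rightarrow> (real^'n) \<times> real" where
  "Psi x0 t1 r z = ((1 / r) *\<^sub>R (fst z - x0), (1 / r\<^sup>2) * (snd z - t1))"

lemma Psi_Phi: "r \<noteq> 0 \<Longrightarrow> Psi x0 t1 r (Phi x0 t1 r y) = y"
  by (simp add: Psi_def Phi_def)

lemma Phi_Psi: "r \<noteq> 0 \<Longrightarrow> Phi x0 t1 r (Psi x0 t1 r z) = z"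
  by (simp add: Psi_def Phi_def)

lemma Phi_continuous: "continuous_on S (Phi x0 t1 r)"
  unfolding Phi_def by (intro continuous_intros)

lemma Phi_measurable [measurable]: "Phi x0 t1 r \<in> borel_measurable borel"
  by (rule borel_measurable_continuous_onI[OF Phi_continuous])

text \<open>The Jacobian is r^(n+2). It stays anonymous because it multiplies every term of the
  identities and estimates in which it occurs and cancels.\<close>

lemma Phi_lborel:
  fixes x0 :: "real^'n::finite"
  assumes r: "0 < r"
  shows "\<exists>c>0. \<forall>F::(real^'n) \<times> real \<Rightarrow> real. F \<in> borel_measurable borel \<longrightarrow>
    (LINT z|lborel. F z) = c * (LINT y|lborel. F (Phi x0 t1 r y)) \<and>
    (integrable lborel F \<longleftrightarrow> integrable lborel (\<lambda>y. F (Phi x0 t1 r y)))"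
proof -
  define c where "c j = (if j = (0, 1) then r\<^sup>2 else r)" for j :: "(real^'n) \<times> real"
  have c0: "0 < c j" for j using r by (simp add: c_def)
  have T: "(x0, t1) + (\<Sum>j\<in>Basis. (c j * (x \<bullet> j)) *\<^sub>R j) = Phi x0 t1 r x" for x
  proof (rule euclidean_eqI)
    fix b :: "(real^'n) \<times> real" assume b: "b \<in> Basis"
    have "((x0, t1) + (\<Sum>j\<in>Basis. (c j * (x \<bullet> j)) *\<^sub>R j)) \<bullet> b = (x0, t1) \<bullet> b + c b * (x \<bullet> b)"
      using b by (simp add: inner_add_left inner_sum_left inner_Basis if_distrib cong: if_cong)
    also have "\<dots> = Phi x0 t1 r x \<bullet> b"
      using b unfolding Basis_prod_def c_def Phi_def by (auto simp: inner_prod_def inner_add_left nonzero_Basis)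
    finally show "((x0, t1) + (\<Sum>j\<in>Basis. (c j * (x \<bullet> j)) *\<^sub>R j)) \<bullet> b = Phi x0 t1 r x \<bullet> b" .
  qed
  define C where "C = (\<Prod>j\<in>Basis. \<bar>c j\<bar>)"
  have C: "0 < C" unfolding C_def using c0 by (intro prod_pos) (auto simp: less_imp_neq[symmetric] intro: less_imp_neq)
  have lb: "lborel = density (distr lborel borel (Phi x0 t1 r)) (\<lambda>_. ennreal C)"
    using lborel_affine_euclidean[of c "(x0, t1)"] c0 unfolding T C_def by (metis less_irrefl)
  show ?thesis
  proof (intro exI[of _ C] conjI allI impI C)
    fix F :: "(real^'n) \<times> real \<Rightarrow> real" assume F [measurable]: "F \<in> borel_measurable borel"
    have "(LINT z|lborel. F z) = (LINT z|density (distr lborel borel (Phi x0 t1 r)) (\<lambda>_. ennreal C). F z)"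
      by (subst lb) simp
    also have "\<dots> = C * (LINT y|lborel. F (Phi x0 t1 r y))"
      using C by (subst integral_density) (auto simp: integral_distr)
    finally show "(LINT z|lborel. F z) = C * (LINT y|lborel. F (Phi x0 t1 r y))" .
    have "integrable lborel F \<longleftrightarrow> integrable (density (distr lborel borel (Phi x0 t1 r)) (\<lambda>_. ennreal C)) F"
      by (subst lb) simp
    also have "\<dots> \<longleftrightarrow> integrable lborel (\<lambda>y. F (Phi x0 t1 r y))"
      using C by (subst integrable_density) (auto simp: integrable_distr_eq)
    finally show "integrable lborel F \<longleftrightarrow> integrable lborel (\<lambda>y. F (Phi x0 t1 r y))" .
  qed
qed

definition ocyl :: "(real^'n::finite) \<times> real \<Rightarrow> real \<Rightarrow> ((real^'n) \<times> real) set" where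
  "ocyl z0 R = ball (fst z0) R \<times> {snd z0 - R\<^sup>2 <..< snd z0}"

lemma ocyl_borel [simp, measurable]: "ocyl z0 R \<in> sets borel"
  unfolding ocyl_def by (intro borel_open open_Times) auto

lemma Phi_ocyl:
  assumes r: "0 < r" and \<tau>: "0 < \<tau>" "\<tau> \<le> 1"
  shows "Phi x0 t1 r y \<in> ocyl (x0, t1) (\<tau> * r) \<longleftrightarrow> y \<in> qcyl \<tau> \<inter> unit_cyl"
proof -
  have "norm (r *\<^sub>R fst y) < \<tau> * r \<longleftrightarrow> norm (fst y) < \<tau>" using r by (simp add: mult.commute)
  moreover have "t1 - (\<tau> * r)\<^sup>2 < t1 + r\<^sup>2 * snd y \<longleftrightarrow> - \<tau>\<^sup>2 < snd y"
  proof -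
    have "t1 - (\<tau> * r)\<^sup>2 < t1 + r\<^sup>2 * snd y \<longleftrightarrow> r\<^sup>2 * (- \<tau>\<^sup>2) < r\<^sup>2 * snd y" by (simp add: power_mult_distrib mult.commute)
    also have "\<dots> \<longleftrightarrow> - \<tau>\<^sup>2 < snd y" using r by (subst mult_less_cancel_left_pos) auto
    finally show ?thesis .
  qed
  moreover have "t1 + r\<^sup>2 * snd y < t1 \<longleftrightarrow> snd y < 0" using r by (simp add: mult_less_0_iff)
  moreover have "\<tau>\<^sup>2 \<le> 1" using \<tau> by (simp add: power_le_one)
  ultimately show ?thesis using \<tau> by (cases y) (auto simp: Phi_def ocyl_def qcyl_def unit_cyl_def dist_norm)
qed

lemma unit_cyl_qcyl: "unit_cyl \<subseteq> qcyl 1"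
  by (auto simp: unit_cyl_def qcyl_def)

lemma Phi_ocyl1: "0 < r \<Longrightarrow> Phi x0 t1 r y \<in> ocyl (x0, t1) r \<longleftrightarrow> y \<in> unit_cyl"
  using Phi_ocyl[of r 1 x0 t1 y] unit_cyl_qcyl by auto

lemma tf_Psi:
  fixes \<psi> :: "(real^'n::finite) \<times> real \<Rightarrow> real"
  assumes r: "0 < r" and \<psi>: "\<psi> \<in> test_functions unit_cyl"
  shows "(\<lambda>z. \<psi> (Psi x0 t1 r z)) \<in> test_functions (ocyl (x0, t1) r)"
    "tfd (ex \<alpha>) (\<lambda>z. \<psi> (Psi x0 t1 r z)) z = (1 / r) * tfd (ex \<alpha>) \<psi> (Psi x0 t1 r z)"
    "tfd et (\<lambda>z. \<psi> (Psi x0 t1 r z)) z = (1 / r\<^sup>2) * tfd et \<psi> (Psi x0 t1 r z)"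
proof -
  define L where "L z = ((1 / r) *\<^sub>R fst z, (1 / r\<^sup>2) * snd z)" for z :: "(real^'n) \<times> real"
  define a where "a = Psi x0 t1 r 0"
  have L: "bounded_linear L" unfolding L_def
    by (intro bounded_linear_Pair bounded_linear_scaleR_right[THEN bounded_linear_compose] bounded_linear_mult_right[THEN bounded_linear_compose] bounded_linear_fst bounded_linear_snd)
  have Psi: "Psi x0 t1 r z = a + L z" for z by (simp add: Psi_def a_def L_def algebra_simps diff_divide_distrib)
  have Ck: "Ck k (\<lambda>z. \<psi> (Psi x0 t1 r z))" for k
    unfolding Psi by (rule Ck_affine[OF L]) (use \<psi> in \<open>auto simp: test_functions_def\<close>)
  define K where "K = closure {y. \<psi> y \<noteq> 0}"
  have K: "compact K" "K \<subseteq> unit_cyl" using \<psi> by (auto simp: K_def test_functions_def)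
  have cK: "compact (Phi x0 t1 r ` K)" by (intro compact_continuous_image Phi_continuous K)
  have "{z. \<psi> (Psi x0 t1 r z) \<noteq> 0} \<subseteq> Phi x0 t1 r ` K"
  proof
    fix z assume "z \<in> {z. \<psi> (Psi x0 t1 r z) \<noteq> 0}"
    then have "Psi x0 t1 r z \<in> K" using closure_subset[of "{y. \<psi> y \<noteq> 0}"] by (auto simp: K_def)
    then show "z \<in> Phi x0 t1 r ` K" using r by (intro image_eqI[of _ _ "Psi x0 t1 r z"]) (auto simp: Phi_Psi)
  qed
  then have cl: "closure {z. \<psi> (Psi x0 t1 r z) \<noteq> 0} \<subseteq> Phi x0 t1 r ` K" using cK by (intro closure_minimal compact_imp_closed)
  then have "compact (closure {z. \<psi> (Psi x0 t1 r z) \<noteq> 0})"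
    using cK by (meson closed_closure compact_imp_bounded bounded_subset compact_eq_bounded_closed)
  moreover have "Phi x0 t1 r ` K \<subseteq> ocyl (x0, t1) r" using K Phi_ocyl1[OF r] by blast
  ultimately show "(\<lambda>z. \<psi> (Psi x0 t1 r z)) \<in> test_functions (ocyl (x0, t1) r)"
    using Ck cl unfolding test_functions_def mem_Collect_eq by blast
  have "((\<lambda>z. a + L z) has_derivative L) (at z)"
    using has_derivative_add[OF has_derivative_const bounded_linear_imp_has_derivative[OF L]] by simp
  from has_derivative_compose[OF this test_has_derivative[OF \<psi>]]
  have "((\<lambda>z. \<psi> (Psi x0 t1 r z)) has_derivative (\<lambda>v. tfd (L v) \<psi> (Psi x0 t1 r z))) (at z)" unfolding Psi .
  then have d: "tfd v (\<lambda>z. \<psi> (Psi x0 t1 r z)) z = tfd (L v) \<psi> (Psi x0 t1 r z)" for v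
    unfolding tfd_def[of v] by (simp add: frechet_derivative_eqI)
  have s: "tfd (c *\<^sub>R v) \<psi> y = c * tfd v \<psi> y" for c v y
    using linear_scale[OF has_derivative_linear[OF test_has_derivative[OF \<psi>, of y]], of c v] by simp
  have "L (ex \<alpha>) = (1 / r) *\<^sub>R ex \<alpha>" "L et = (1 / r\<^sup>2) *\<^sub>R et" by (auto simp: L_def)
  then show "tfd (ex \<alpha>) (\<lambda>z. \<psi> (Psi x0 t1 r z)) z = (1 / r) * tfd (ex \<alpha>) \<psi> (Psi x0 t1 r z)"
    "tfd et (\<lambda>z. \<psi> (Psi x0 t1 r z)) z = (1 / r\<^sup>2) * tfd et \<psi> (Psi x0 t1 r z)"
    unfolding d by (simp_all only: s)
qed

section \<open>Borel representatives and component test functions\<close>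

lemma integral_lebesgue_eq:
  fixes F F' :: "'a::euclidean_space \<Rightarrow> real"
  assumes "AE z in lborel. F z = F' z" "F' \<in> borel_measurable borel"
  shows "(LINT z|lebesgue. F z) = (LINT z|lborel. F' z)" "integrable lebesgue F \<longleftrightarrow> integrable lborel F'"
proof -
  have F': "F' \<in> borel_measurable lebesgue" using assms(2) by (intro measurable_completion) simp
  have ae: "AE z in lebesgue. F z = F' z" using assms(1) by (simp add: AE_completion_iff)
  then have "AE z in lebesgue. F' z = F z" by (auto simp: eq_commute)
  then have F: "F \<in> borel_measurable lebesgue" by (rule borel_measurable_AE[OF F'])
  have "(LINT z|lebesgue. F z) = (LINT z|lebesgue. F' z)" by (rule integral_cong_AE[OF F F' ae])
  then show "(LINT z|lebesgue. F z) = (LINT z|lborel. F' z)" using assms(2) by (simp add: integral_completion)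
  have "integrable lebesgue F \<longleftrightarrow> integrable lebesgue F'" by (rule integrable_cong_AE[OF F F' ae])
  then show "integrable lebesgue F \<longleftrightarrow> integrable lborel F'" using assms(2) by (simp add: integrable_completion)
qed

text \<open>A Lebesgue measurable function agrees almost everywhere with a Borel one; multiplying
  the latter by the indicator again makes it vanish everywhere outside \<open>S\<close>, as
  \<open>unit_sol\<close> demands.\<close>

lemma borel_version:
  fixes h :: "'a::euclidean_space \<Rightarrow> real"
  assumes h: "(\<lambda>z. indicator S z * h z) \<in> borel_measurable lebesgue" and S: "S \<in> sets borel"
  obtains b where "b \<in> borel_measurable borel" "AE z in lborel. indicator S z * h z = b z" "\<And>z. z \<notin> S \<Longrightarrow> b z = 0"
proof -
  obtain b where b: "b \<in> borel_measurable lborel" "AE z in lborel. indicator S z * h z = b z"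
    using completion_ex_borel_measurable_real[OF h] by blast
  show thesis
  proof (rule that[of "\<lambda>z. indicator S z * b z"])
    show "(\<lambda>z. indicator S z * b z) \<in> borel_measurable borel" using b S by simp
    show "AE z in lborel. indicator S z * h z = indicator S z * b z"
      using b(2) by eventually_elim (auto simp: indicator_def split: if_splits)
  qed auto
qed

lemma borel_versions:
  fixes h :: "'k \<Rightarrow> 'l \<Rightarrow> 'a::euclidean_space \<Rightarrow> real"
  assumes h: "\<And>i j. (\<lambda>z. indicator S z * h i j z) \<in> borel_measurable lebesgue" and S: "S \<in> sets borel"
  obtains b where "\<And>i j. b i j \<in> borel_measurable borel" "\<And>i j. AE z in lborel. indicator S z * h i j z = b i j z"
    "\<And>i j z. z \<notin> S \<Longrightarrow> b i j z = 0"
proof -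
  define Q where "Q i j b \<longleftrightarrow> b \<in> borel_measurable borel \<and> (AE z in lborel. indicator S z * h i j z = b z) \<and> (\<forall>z. z \<notin> S \<longrightarrow> b z = 0)" for i j b
  define b where "b i j = (SOME b. Q i j b)" for i j
  have "\<exists>b. Q i j b" for i j
    unfolding Q_def by (rule borel_version[OF h[of i j] S]) blast
  then have "Q i j (b i j)" for i j unfolding b_def by (rule someI_ex)
  then show thesis by (intro that[of b]) (auto simp: Q_def)
qed

lemma norm_sq_matrix: "(norm (X :: real^'n::finite^'m::finite))\<^sup>2 = nsq (\<lambda>i \<alpha>. X $ i $ \<alpha>)"
  unfolding nsq_def power2_norm_eq_inner inner_vec_def by (simp add: power2_eq_square)

lemma matrix_component_measurable:
  assumes "set_borel_measurable M Q (F :: 'a \<Rightarrow> real^'n::finite^'m::finite)"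
  shows "(\<lambda>z. indicator Q z * F z $ i $ \<alpha>) \<in> borel_measurable M"
proof -
  have "continuous_on UNIV (\<lambda>X :: real^'n^'m. X $ i $ \<alpha>)" by (intro continuous_intros)
  then have "(\<lambda>X :: real^'n^'m. X $ i $ \<alpha>) \<in> borel_measurable borel" by (rule borel_measurable_continuous_onI)
  from measurable_compose[OF assms[unfolded set_borel_measurable_def] this] show ?thesis by simp
qed

text \<open>Vector-valued test functions with one nonzero component isolate a single equation of the
  system.\<close>

lemma axis_test:
  fixes \<Psi> :: "(real^'n::finite) \<times> real \<Rightarrow> real"
  assumes \<Psi>: "\<Psi> \<in> test_functions U"
  shows "(\<lambda>z. \<Psi> z *\<^sub>R axis i (1::real)) \<in> (test_functions U :: ((real^'n) \<times> real \<Rightarrow> real^'m::finite) set)"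
    "Dx \<alpha> (\<lambda>z. \<Psi> z *\<^sub>R axis i (1::real) :: real^'m) z = tfd (ex \<alpha>) \<Psi> z *\<^sub>R axis i 1"
    "Dt (\<lambda>z. \<Psi> z *\<^sub>R axis i (1::real) :: real^'m) z = tfd et \<Psi> z *\<^sub>R axis i 1"
proof -
  have L: "bounded_linear (\<lambda>x::real. x *\<^sub>R (axis i 1 :: real^'m))" by (rule bounded_linear_scaleR_left)
  have "axis i (1::real) \<noteq> (0 :: real^'m)" by (simp add: axis_eq_0_iff)
  then have "{z. \<Psi> z *\<^sub>R axis i (1::real) \<noteq> (0 :: real^'m)} = {z. \<Psi> z \<noteq> 0}" by simp
  then show "(\<lambda>z. \<Psi> z *\<^sub>R axis i (1::real)) \<in> (test_functions U :: ((real^'n) \<times> real \<Rightarrow> real^'m::finite) set)"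
  proof -
    assume e: "{z. \<Psi> z *\<^sub>R axis i (1::real) \<noteq> (0 :: real^'m)} = {z. \<Psi> z \<noteq> 0}"
    have "Ck k (\<lambda>z. \<Psi> z *\<^sub>R (axis i (1::real) :: real^'m))" for k
      by (rule Ck_linear[OF L]) (use \<Psi> in \<open>simp add: test_functions_def\<close>)
    then show ?thesis using \<Psi> unfolding test_functions_def mem_Collect_eq e by blast
  qed
  have "frechet_derivative (\<lambda>z. \<Psi> z *\<^sub>R axis i (1::real) :: real^'m) (at z) = (\<lambda>v. tfd v \<Psi> z *\<^sub>R axis i 1)"
    using bounded_linear.has_derivative[OF L test_has_derivative[OF \<Psi>, of z]] by (rule frechet_derivative_eqI)
  then show "Dx \<alpha> (\<lambda>z. \<Psi> z *\<^sub>R axis i (1::real) :: real^'m) z = tfd (ex \<alpha>) \<Psi> z *\<^sub>R axis i 1"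
    "Dt (\<lambda>z. \<Psi> z *\<^sub>R axis i (1::real) :: real^'m) z = tfd et \<Psi> z *\<^sub>R axis i 1"
    unfolding Dx_def Dt_def by auto
qed

lemma sum_axis: "(\<Sum>i\<in>UNIV. f i * (c *\<^sub>R axis k (1::real) :: real^'m::finite) $ i) = f k * c"
proof -
  have "f i * (c *\<^sub>R axis k (1::real) :: real^'m) $ i = (if i = k then f k * c else 0)" for i by (simp add: axis_def)
  then show ?thesis by simp
qed

lemma integrable_mult_cc:
  assumes "integrable lborel h" "cc k" shows "integrable lborel (\<lambda>z. h z * k z)"
proof -
  obtain B where B: "0 < B" "\<And>z. \<bar>k z\<bar> \<le> B" using cc_bounded[OF assms(2)] by blast
  show ?thesis
  proof (rule Bochner_Integration.integrable_bound)
    show "integrable lborel (\<lambda>z. B * h z)" using assms by simp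
    show "AE z in lborel. norm (h z * k z) \<le> norm (B * h z)"
      using B mult_right_mono[OF B(2) abs_ge_zero] by (auto simp: abs_mult mult.commute)
    show "(\<lambda>z. h z * k z) \<in> borel_measurable lborel"
      using borel_measurable_integrable[OF assms(1)] cc_measurable[OF assms(2)] by simp
  qed
qed

lemma test_zero: "k \<in> test_functions U \<Longrightarrow> z \<notin> U \<Longrightarrow> k z = 0"
  using closure_subset[of "{z. k z \<noteq> 0}"] unfolding test_functions_def by auto

text \<open>The solution is restricted to the cylinder, its coefficients are frozen and it is
  rescaled to unit size. The closed cylinder has to lie in \<Omega> \<times> (0, T), since
  \<open>u\<close> is known to be integrable on compact subsets only. The perturbation enters
  through the oscillation \<omega>, each of the \<open>N\<close> components of \<open>g\<close>
  contributing \<open>2 * (\<omega> * N)\<^sup>2\<close> times the energy.\<close>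

lemma one_cylinder:
  fixes Du f :: "(real^'n::finite) \<times> real \<Rightarrow> real^'n^'m::finite" and u :: "(real^'n) \<times> real \<Rightarrow> real^'m"
  assumes r: "0 < r" and \<tau>: "0 < \<tau>" "\<tau> \<le> 1" and K: "cball x0 r \<times> {t1 - r\<^sup>2..t1} \<subseteq> \<Omega> \<times> {0<..<T}"
    and wg: "weak_spatial_gradient \<Omega> T u Du" and L2D: "Du \<in> L2 (QT \<Omega> T)" and L2f: "f \<in> L2 (QT \<Omega> T)"
    and ws: "weak_solution \<Omega> T a f u Du"
    and a: "\<And>i j \<alpha> \<beta>. continuous_on (ocyl (x0, t1) r) (a i j \<alpha> \<beta>)"
    and \<omega>: "\<And>i j \<alpha> \<beta> z. z \<in> ocyl (x0, t1) r \<Longrightarrow> \<bar>a i j \<alpha> \<beta> z - A0 i j \<alpha> \<beta>\<bar> \<le> \<omega>"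
    and D: "0 \<le> D2" "\<And>u Du g. unit_sol A0 u Du g \<Longrightarrow> SP (qcyl \<tau>) Du \<le> D1 * SP UNIV Du + D2 * SP UNIV g"
    and N: "N = real (CARD('m) * CARD('n))"
  shows "(LINT z:ocyl (x0, t1) (\<tau> * r)|lebesgue. (norm (Du z))\<^sup>2)
    \<le> (D1 + D2 * (2 * N * (\<omega> * N)\<^sup>2)) * (LINT z:ocyl (x0, t1) r|lebesgue. (norm (Du z))\<^sup>2)
      + 2 * D2 * (LINT z:ocyl (x0, t1) r|lebesgue. (norm (f z))\<^sup>2)"
proof -
  define S where "S = ocyl (x0, t1) r"
  have S: "S \<in> sets borel" by (simp add: S_def)
  have SK: "S \<subseteq> cball x0 r \<times> {t1 - r\<^sup>2..t1}" by (auto simp: S_def ocyl_def)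
  have SO: "S \<subseteq> \<Omega> \<times> {0<..<T}" using SK K by blast
  have SQ: "S \<subseteq> QT \<Omega> T" using SO by (auto simp: QT_def)
  obtain B where B: "\<And>z. z \<in> S \<Longrightarrow> norm z \<le> B"
  proof -
    have "bounded (cball x0 r \<times> {t1 - r\<^sup>2..t1})" by (intro bounded_Times bounded_cball bounded_closed_interval)
    then have "bounded S" by (rule bounded_subset[OF _ SK])
    then show ?thesis using that unfolding bounded_iff by blast
  qed
  have nS: "z \<notin> S" if "B < norm z" for z using B[of z] that by auto
  have mul: "(\<lambda>z. indicator S z * F z) \<in> borel_measurable lebesgue"
    if "(\<lambda>z. indicator Q z * F z) \<in> borel_measurable lebesgue" "S \<subseteq> Q" for F :: "(real^'n) \<times> real \<Rightarrow> real" and Q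
  proof -
    have "(\<lambda>z. indicator S z * (indicator Q z * F z)) \<in> borel_measurable lebesgue"
      by (rule borel_measurable_times[OF borel_measurable_indicator that(1)]) (use S in auto)
    moreover have "(\<lambda>z. indicator S z * (indicator Q z * F z)) = (\<lambda>z. indicator S z * F z)"
      using that(2) by (auto simp: indicator_def fun_eq_iff)
    ultimately show ?thesis by simp
  qed
  have uK: "set_integrable lebesgue (cball x0 r \<times> {t1 - r\<^sup>2..t1}) u"
  proof -
    have "compact (cball x0 r \<times> {t1 - r\<^sup>2..t1})" by (intro compact_Times compact_cball compact_Icc)
    then show ?thesis using wg K unfolding weak_spatial_gradient_def by blast
  qed
  have uS: "integrable lebesgue (\<lambda>z. indicator S z * u z $ i)" for i
  proof -
    have "set_integrable lebesgue S u"
      by (rule set_integrable_subset[OF uK _ SK]) (use S in auto)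
    then have "integrable lebesgue (\<lambda>z. (indicator S z *\<^sub>R u z) $ i)"
      unfolding set_integrable_def by (rule integrable_bounded_linear[OF bounded_linear_vec_nth])
    then show ?thesis by simp
  qed
  \<comment> \<open>The selection lemma works for doubly indexed families; the index of type
    \<open>unit\<close> is a dummy.\<close>
  obtain hU' :: "'m \<Rightarrow> unit \<Rightarrow> (real^'n) \<times> real \<Rightarrow> real" where hU': "\<And>i j. hU' i j \<in> borel_measurable borel" "\<And>i j. AE z in lborel. indicator S z * u z $ i = hU' i j z"
    "\<And>i j z. z \<notin> S \<Longrightarrow> hU' i j z = 0"
    by (rule borel_versions[of S "\<lambda>i (j::unit) z. u z $ i", OF borel_measurable_integrable[OF uS] S]) (rule that; assumption)
  define hU where "hU i = hU' i ()" for i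
  have hU: "\<And>i. hU i \<in> borel_measurable borel" "\<And>i. AE z in lborel. indicator S z * u z $ i = hU i z"
    "\<And>i z. z \<notin> S \<Longrightarrow> hU i z = 0" using hU' by (auto simp: hU_def)
  have iU: "integrable lborel (hU i)" for i using integral_lebesgue_eq(2)[OF hU(2,1)] uS by blast
  have mD: "(\<lambda>z. indicator S z * Du z $ i $ \<alpha>) \<in> borel_measurable lebesgue" for i \<alpha>
    using L2D by (intro mul[OF _ SQ] matrix_component_measurable) (auto simp: L2_def)
  have mf: "(\<lambda>z. indicator S z * f z $ i $ \<alpha>) \<in> borel_measurable lebesgue" for i \<alpha>
    using L2f by (intro mul[OF _ SQ] matrix_component_measurable) (auto simp: L2_def)
  have ma: "(\<lambda>z. indicator S z * a i j \<alpha> \<beta> z) \<in> borel_measurable lebesgue" for i j \<alpha> \<beta>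
  proof -
    have "(\<lambda>z. indicator S z *\<^sub>R a i j \<alpha> \<beta> z) \<in> borel_measurable borel"
      by (rule borel_measurable_continuous_on_indicator[OF S]) (use a in \<open>simp add: S_def\<close>)
    then have "(\<lambda>z. indicator S z * a i j \<alpha> \<beta> z) \<in> borel_measurable lborel" by simp
    then show ?thesis by (rule measurable_completion)
  qed
  obtain hD :: "'m \<Rightarrow> 'n \<Rightarrow> (real^'n) \<times> real \<Rightarrow> real" where hD: "\<And>i \<alpha>. hD i \<alpha> \<in> borel_measurable borel" "\<And>i \<alpha>. AE z in lborel. indicator S z * Du z $ i $ \<alpha> = hD i \<alpha> z"
    "\<And>i \<alpha> z. z \<notin> S \<Longrightarrow> hD i \<alpha> z = 0"
    by (rule borel_versions[of S "\<lambda>i \<alpha> z. Du z $ i $ \<alpha>", OF mD S]) (rule that; assumption)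
  obtain hf :: "'m \<Rightarrow> 'n \<Rightarrow> (real^'n) \<times> real \<Rightarrow> real" where hf: "\<And>i \<alpha>. hf i \<alpha> \<in> borel_measurable borel" "\<And>i \<alpha>. AE z in lborel. indicator S z * f z $ i $ \<alpha> = hf i \<alpha> z"
    "\<And>i \<alpha> z. z \<notin> S \<Longrightarrow> hf i \<alpha> z = 0"
    by (rule borel_versions[of S "\<lambda>i \<alpha> z. f z $ i $ \<alpha>", OF mf S]) (rule that; assumption)
  \<comment> \<open>Chosen so that \<open>A0 Du - g = a Du - f\<close>: the weak equation is
    unchanged, but its leading part has constant coefficients.\<close>
  define g where "g i \<alpha> z = f z $ i $ \<alpha> + (\<Sum>j\<in>UNIV. \<Sum>\<beta>\<in>UNIV. (A0 i j \<alpha> \<beta> - a i j \<alpha> \<beta> z) * Du z $ j $ \<beta>)" for i \<alpha> z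
  have mg: "(\<lambda>z. indicator S z * g i \<alpha> z) \<in> borel_measurable lebesgue" for i \<alpha>
  proof -
    have "(\<lambda>z. indicator S z * g i \<alpha> z) = (\<lambda>z. indicator S z * f z $ i $ \<alpha>
       + (\<Sum>j\<in>UNIV. \<Sum>\<beta>\<in>UNIV. (A0 i j \<alpha> \<beta> - indicator S z * a i j \<alpha> \<beta> z) * (indicator S z * Du z $ j $ \<beta>)))"
      by (auto simp: g_def indicator_def fun_eq_iff)
    then show ?thesis using mf mD ma by (simp add: borel_measurable_add borel_measurable_sum borel_measurable_diff borel_measurable_times)
  qed
  obtain hg :: "'m \<Rightarrow> 'n \<Rightarrow> (real^'n) \<times> real \<Rightarrow> real" where hg: "\<And>i \<alpha>. hg i \<alpha> \<in> borel_measurable borel" "\<And>i \<alpha>. AE z in lborel. indicator S z * g i \<alpha> z = hg i \<alpha> z"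
    "\<And>i \<alpha> z. z \<notin> S \<Longrightarrow> hg i \<alpha> z = 0"
    by (rule borel_versions[of S "\<lambda>i \<alpha> z. g i \<alpha> z", OF mg S]) (rule that; assumption)
  \<comment> \<open>One common null set for all indices, so that the integrands can afterwards be
    compared pointwise.\<close>
  have AE_all: "AE z in lborel. (z \<in> S \<longrightarrow> (\<forall>i \<alpha>. u z $ i = hU i z \<and> Du z $ i $ \<alpha> = hD i \<alpha> z \<and> f z $ i $ \<alpha> = hf i \<alpha> z \<and> g i \<alpha> z = hg i \<alpha> z))"
  proof -
    have "AE z in lborel. \<forall>i\<in>UNIV. \<forall>\<alpha>\<in>UNIV. indicator S z * u z $ i = hU i z \<and> indicator S z * Du z $ i $ \<alpha> = hD i \<alpha> z
       \<and> indicator S z * f z $ i $ \<alpha> = hf i \<alpha> z \<and> indicator S z * g i \<alpha> z = hg i \<alpha> z"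
      by (subst AE_finite_all, simp, intro ballI, subst AE_finite_all, simp, intro ballI)
        (use hU(2) hD(2) hf(2) hg(2) in \<open>auto simp: AE_conj_iff\<close>)
    then show ?thesis by eventually_elim (auto simp: indicator_def split: if_splits)
  qed
  have sqI: "integrable lborel (\<lambda>z. (b z)\<^sup>2)"
    if F: "set_integrable lebesgue (QT \<Omega> T) (\<lambda>z. (norm (F z))\<^sup>2)" and b: "b \<in> borel_measurable borel" "AE z in lborel. indicator S z * F z $ i $ \<alpha> = b z"
    for F :: "(real^'n) \<times> real \<Rightarrow> real^'n^'m" and b i \<alpha>
  proof -
    have ae: "AE z in lborel. (indicator S z * F z $ i $ \<alpha>)\<^sup>2 = (b z)\<^sup>2" using b(2) by eventually_elim simp
    have mb: "(\<lambda>z. (b z)\<^sup>2) \<in> borel_measurable lebesgue" using b(1) by (intro measurable_completion) simp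
    have "integrable lebesgue (\<lambda>z. (b z)\<^sup>2)"
    proof (rule Bochner_Integration.integrable_bound[OF F[unfolded set_integrable_def] mb])
      have "AE z in lebesgue. indicator S z * F z $ i $ \<alpha> = b z" using b(2) by (simp add: AE_completion_iff)
      then show "AE z in lebesgue. norm ((b z)\<^sup>2) \<le> norm (indicator (QT \<Omega> T) z *\<^sub>R (norm (F z))\<^sup>2)"
      proof eventually_elim
        case (elim z)
        have "(F z $ i $ \<alpha>)\<^sup>2 \<le> (norm (F z))\<^sup>2" unfolding norm_sq_matrix by (rule nsq_component)
        then have "(indicator S z * F z $ i $ \<alpha>)\<^sup>2 \<le> indicator (QT \<Omega> T) z * (norm (F z))\<^sup>2"
          using SQ by (auto simp: indicator_def)
        then show ?case using elim by simp
      qed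
    qed
    then show ?thesis using b(1) by (simp add: integrable_completion)
  qed
  have lD: "l2 (hD i \<alpha>)" for i \<alpha> unfolding l2_def using sqI[OF _ hD(1,2)] hD(1) L2D by (auto simp: L2_def)
  have lf: "l2 (hf i \<alpha>)" for i \<alpha> unfolding l2_def using sqI[OF _ hf(1,2)] hf(1) L2f by (auto simp: L2_def)
  have g_le: "AE z in lborel. (hg i \<alpha> z)\<^sup>2 \<le> 2 * (\<omega> * N)\<^sup>2 * nsq (\<lambda>i \<alpha>. hD i \<alpha> z) + 2 * (hf i \<alpha> z)\<^sup>2" for i \<alpha>
    using AE_all
  proof eventually_elim
    case (elim z)
    show ?case
    proof (cases "z \<in> S")
      case True
      have d: "Du z $ j $ \<beta> = hD j \<beta> z" "f z $ j $ \<beta> = hf j \<beta> z" "g j \<beta> z = hg j \<beta> z" for j \<beta>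
        using elim True by blast+
      have e: "hg i \<alpha> z = hf i \<alpha> z + (\<Sum>j\<in>UNIV. \<Sum>\<beta>\<in>UNIV. (A0 i j \<alpha> \<beta> - a i j \<alpha> \<beta> z) * hD j \<beta> z)"
        using d(3)[of i \<alpha>, symmetric] unfolding g_def d(1,2) .
      \<comment> \<open>Written as a flux with matrix \<open>a - A0\<close>, so that the general
        bound for fluxes applies with \<omega> in place of \<open>M\<close>.\<close>
      have "hg i \<alpha> z = - flux (\<lambda>i j \<alpha> \<beta>. a i j \<alpha> \<beta> z - A0 i j \<alpha> \<beta>) (\<lambda>j \<beta>. hD j \<beta> z) (\<lambda>i \<alpha>. hf i \<alpha> z) i \<alpha>"
        unfolding e flux_def by (simp add: left_diff_distrib sum_subtractf)
      then have "(hg i \<alpha> z)\<^sup>2 = (flux (\<lambda>i j \<alpha> \<beta>. a i j \<alpha> \<beta> z - A0 i j \<alpha> \<beta>) (\<lambda>j \<beta>. hD j \<beta> z) (\<lambda>i \<alpha>. hf i \<alpha> z) i \<alpha>)\<^sup>2" by simp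
      also have "\<dots> \<le> 2 * (\<omega> * N)\<^sup>2 * nsq (\<lambda>i \<alpha>. hD i \<alpha> z) + 2 * (hf i \<alpha> z)\<^sup>2"
        unfolding N by (rule flux_sq_le) (use \<omega> True in \<open>auto simp: S_def\<close>)
      finally show ?thesis .
    qed (auto simp: hg(3) intro!: add_nonneg_nonneg mult_nonneg_nonneg nsq_nonneg)
  qed
  note inD = SP_integral[of hD UNIV, OF lD]
  have inD': "integrable lborel (\<lambda>z. nsq (\<lambda>i \<alpha>. hD i \<alpha> z))" "(LINT z|lborel. nsq (\<lambda>i \<alpha>. hD i \<alpha> z)) = SP UNIV hD"
    using inD by auto
  have ihg: "integrable lborel (\<lambda>z. 2 * (\<omega> * N)\<^sup>2 * nsq (\<lambda>i \<alpha>. hD i \<alpha> z) + 2 * (hf i \<alpha> z)\<^sup>2)" for i \<alpha>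
    using inD' lf unfolding l2_def by auto
  have lg: "l2 (hg i \<alpha>)" for i \<alpha>
  proof -
    have "integrable lborel (\<lambda>z. (hg i \<alpha> z)\<^sup>2)"
      by (rule Bochner_Integration.integrable_bound[OF ihg[of i \<alpha>]]) (use hg(1) g_le[of i \<alpha>] in auto)
    then show ?thesis using hg(1) by (simp add: l2_def)
  qed
  have SPg: "SP UNIV hg \<le> 2 * N * (\<omega> * N)\<^sup>2 * SP UNIV hD + 2 * SP UNIV hf"
  proof -
    have "sqn UNIV (hg i \<alpha>) \<le> 2 * (\<omega> * N)\<^sup>2 * SP UNIV hD + 2 * sqn UNIV (hf i \<alpha>)" for i \<alpha>
    proof -
      have "sqn UNIV (hg i \<alpha>) \<le> (LINT z|lborel. 2 * (\<omega> * N)\<^sup>2 * nsq (\<lambda>i \<alpha>. hD i \<alpha> z) + 2 * (hf i \<alpha> z)\<^sup>2)"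
        unfolding sqn_def by (rule integral_mono_AE[OF l2_ind[OF lg] ihg]) (use g_le[of i \<alpha>] in auto)
      also have "\<dots> = 2 * (\<omega> * N)\<^sup>2 * SP UNIV hD + 2 * sqn UNIV (hf i \<alpha>)"
        using inD' lf unfolding l2_def sqn_def by simp
      finally show ?thesis .
    qed
    then have "SP UNIV hg \<le> (\<Sum>i\<in>UNIV. \<Sum>\<alpha>\<in>UNIV. 2 * (\<omega> * N)\<^sup>2 * SP UNIV hD + 2 * sqn UNIV (hf i \<alpha>))"
      unfolding SP_def[of UNIV hg] by (intro sum_mono)
    also have "\<dots> = 2 * N * (\<omega> * N)\<^sup>2 * SP UNIV hD + 2 * SP UNIV hf"
      unfolding SP_def[of UNIV hf] N by (simp add: sum.distrib sum_distrib_left)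
    finally show ?thesis .
  qed
  obtain c where c: "0 < c" "\<And>F::(real^'n) \<times> real \<Rightarrow> real. F \<in> borel_measurable borel \<Longrightarrow> (LINT z|lborel. F z) = c * (LINT y|lborel. F (Phi x0 t1 r y))"
    "\<And>F::(real^'n) \<times> real \<Rightarrow> real. F \<in> borel_measurable borel \<Longrightarrow> integrable lborel F \<longleftrightarrow> integrable lborel (\<lambda>y. F (Phi x0 t1 r y))"
    using Phi_lborel[OF r, of x0 t1] by metis
  have sup: "h (Phi x0 t1 r y) = 0" if "\<And>z. z \<notin> S \<Longrightarrow> h z = 0" "y \<notin> unit_cyl" for h :: "(real^'n) \<times> real \<Rightarrow> real" and y
    using that Phi_ocyl1[OF r, of x0 t1 y] by (auto simp: S_def)
  have l2Phi: "l2 (\<lambda>y. h (Phi x0 t1 r y))" if "l2 h" for h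
    using that c(3)[of "\<lambda>z. (h z)\<^sup>2"] unfolding l2_def by auto
  \<comment> \<open>The factor 1/r on \<open>u\<close> makes the gradient of the rescaled function
    exactly the rescaled \<open>Du\<close>; under parabolic scaling the time derivative and the
    divergence of the flux then carry the same power of \<open>r\<close>.\<close>
  have "unit_sol A0 (\<lambda>i y. hU i (Phi x0 t1 r y) / r) (\<lambda>i \<alpha> y. hD i \<alpha> (Phi x0 t1 r y)) (\<lambda>i \<alpha> y. hg i \<alpha> (Phi x0 t1 r y))"
    unfolding unit_sol_def
  proof (intro conjI allI impI ballI)
    show "integrable lborel (\<lambda>y. hU i (Phi x0 t1 r y) / r)" for i using c(3)[OF hU(1)] iU by auto
    show "l2 (\<lambda>y. hD i \<alpha> (Phi x0 t1 r y))" "l2 (\<lambda>y. hg i \<alpha> (Phi x0 t1 r y))" for i \<alpha> using l2Phi lD lg by auto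
    show "hU i (Phi x0 t1 r y) / r = 0" "hD i \<alpha> (Phi x0 t1 r y) = 0" "hg i \<alpha> (Phi x0 t1 r y) = 0" if "y \<notin> unit_cyl" for y i \<alpha>
      using sup[OF hU(3) that] sup[OF hD(3) that] sup[OF hg(3) that] by auto
  next
    fix \<psi> :: "(real^'n) \<times> real \<Rightarrow> real" assume \<psi>: "\<psi> \<in> test_functions unit_cyl"
    define P where "P z = \<psi> (Psi x0 t1 r z)" for z
    have P: "P \<in> test_functions S" unfolding P_def[abs_def] S_def by (rule tf_Psi(1)[OF r \<psi>])
    have PO: "P \<in> test_functions (\<Omega> \<times> {0<..<T})" using P test_functions_mono[OF SO] by blast
    have Px: "tfd (ex \<alpha>) P (Phi x0 t1 r y) = (1 / r) * tfd (ex \<alpha>) \<psi> y" for \<alpha> y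
      unfolding P_def[abs_def] tf_Psi(2)[OF r \<psi>] using r by (simp add: Psi_Phi)
    have Pt: "tfd et P (Phi x0 t1 r y) = (1 / r\<^sup>2) * tfd et \<psi> y" for y
      unfolding P_def[abs_def] tf_Psi(3)[OF r \<psi>] using r by (simp add: Psi_Phi)
    have P0: "P (Phi x0 t1 r y) = \<psi> y" for y using r by (simp add: P_def Psi_Phi)
    have ccP: "cc P" "cc (tfd v P)" for v using test_cc P tfd_test by blast+
    have z0: "P z = 0" "tfd v P z = 0" if "z \<notin> S" for z v using test_zero[OF P that] test_zero[OF tfd_test[OF P] that] by auto
    fix i
    {
      fix \<alpha>
      have "(LINT z:QT \<Omega> T|lebesgue. u z $ i * Dx \<alpha> P z) = - (LINT z:QT \<Omega> T|lebesgue. Du z $ i $ \<alpha> * P z)"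
        using wg PO unfolding weak_spatial_gradient_def by blast
      moreover have "(LINT z:QT \<Omega> T|lebesgue. u z $ i * Dx \<alpha> P z) = (LINT z|lborel. hU i z * tfd (ex \<alpha>) P z)"
        unfolding set_lebesgue_integral_def
      proof (rule integral_lebesgue_eq(1))
        show "AE z in lborel. indicator (QT \<Omega> T) z *\<^sub>R (u z $ i * Dx \<alpha> P z) = hU i z * tfd (ex \<alpha>) P z"
          using AE_all
        proof eventually_elim
          case (elim z)
          then show ?case using z0(2)[of z "ex \<alpha>"] SQ by (cases "z \<in> S") (auto simp: Dx_def tfd_def)
        qed
        show "(\<lambda>z. hU i z * tfd (ex \<alpha>) P z) \<in> borel_measurable borel" using hU(1) cc_measurable[OF ccP(2)] by (intro borel_measurable_times)
      qed
      moreover have "(LINT z:QT \<Omega> T|lebesgue. Du z $ i $ \<alpha> * P z) = (LINT z|lborel. hD i \<alpha> z * P z)"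
        unfolding set_lebesgue_integral_def
      proof (rule integral_lebesgue_eq(1))
        show "AE z in lborel. indicator (QT \<Omega> T) z *\<^sub>R (Du z $ i $ \<alpha> * P z) = hD i \<alpha> z * P z"
          using AE_all
        proof eventually_elim
          case (elim z)
          then show ?case using z0(1)[of z] SQ by (cases "z \<in> S") auto
        qed
        show "(\<lambda>z. hD i \<alpha> z * P z) \<in> borel_measurable borel" using hD(1) cc_measurable[OF ccP(1)] by (intro borel_measurable_times)
      qed
      ultimately have "(LINT z|lborel. hU i z * tfd (ex \<alpha>) P z) = - (LINT z|lborel. hD i \<alpha> z * P z)" by simp
      then have "c * (LINT y|lborel. hU i (Phi x0 t1 r y) * tfd (ex \<alpha>) P (Phi x0 t1 r y)) = - (c * (LINT y|lborel. hD i \<alpha> (Phi x0 t1 r y) * P (Phi x0 t1 r y)))"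
        using c(2)[of "\<lambda>z. hU i z * tfd (ex \<alpha>) P z"] c(2)[of "\<lambda>z. hD i \<alpha> z * P z"] hU(1) hD(1) cc_measurable[OF ccP(1)] cc_measurable[OF ccP(2)]
        by simp
      then show "(LINT y|lborel. hU i (Phi x0 t1 r y) / r * tfd (ex \<alpha>) \<psi> y) = - (LINT y|lborel. hD i \<alpha> (Phi x0 t1 r y) * \<psi> y)"
      proof -
        assume e: "c * (LINT y|lborel. hU i (Phi x0 t1 r y) * tfd (ex \<alpha>) P (Phi x0 t1 r y)) = - (c * (LINT y|lborel. hD i \<alpha> (Phi x0 t1 r y) * P (Phi x0 t1 r y)))"
        have "(LINT y|lborel. hU i (Phi x0 t1 r y) / r * tfd (ex \<alpha>) \<psi> y) = (LINT y|lborel. hU i (Phi x0 t1 r y) * ((1 / r) * tfd (ex \<alpha>) \<psi> y))"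
          by (rule Bochner_Integration.integral_cong) simp_all
        moreover have "c * (LINT y|lborel. hU i (Phi x0 t1 r y) * ((1 / r) * tfd (ex \<alpha>) \<psi> y)) = c * (- (LINT y|lborel. hD i \<alpha> (Phi x0 t1 r y) * \<psi> y))"
          using e unfolding Px P0 mult_minus_right .
        ultimately show ?thesis using c(1) by (simp only: mult_cancel_left) auto
      qed
    }
    {
      define F where "F \<alpha> z = flux A0 (\<lambda>j \<beta>. hD j \<beta> z) (\<lambda>i \<alpha>. hg i \<alpha> z) i \<alpha>" for \<alpha> z
      have lF: "l2 (F \<alpha>)" for \<alpha> unfolding F_def flux_def by (intro l2_diff l2_sum l2_cmult lD lg)
      have F0: "F \<alpha> z = 0" if "z \<notin> S" for \<alpha> z using that by (simp add: F_def flux_def hD(3) hg(3))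
      have iF: "integrable lborel (F \<alpha>)" for \<alpha> by (rule l2_bounded_integrable[OF lF, of B]) (use F0 nS in auto)
      have ihf: "integrable lborel (hf i \<alpha>)" for \<alpha> by (rule l2_bounded_integrable[OF lf, of B]) (use hf(3) nS in auto)
      note tx = axis_test[OF PO, where i = i]
      \<comment> \<open>The weak formulation tested with the rescaled test function in component
        \<open>i\<close> only.\<close>
      have "(LINT z:QT \<Omega> T|lebesgue.
           - (\<Sum>k\<in>UNIV. u z $ k * Dt (\<lambda>z. P z *\<^sub>R axis i 1 :: real^'m) z $ k)
           + (\<Sum>k\<in>UNIV. \<Sum>j\<in>UNIV. \<Sum>\<alpha>\<in>UNIV. \<Sum>\<beta>\<in>UNIV. a k j \<alpha> \<beta> z * Du z $ j $ \<beta> * Dx \<alpha> (\<lambda>z. P z *\<^sub>R axis i 1 :: real^'m) z $ k))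
        = (LINT z:QT \<Omega> T|lebesgue. \<Sum>k\<in>UNIV. \<Sum>\<alpha>\<in>UNIV. f z $ k $ \<alpha> * Dx \<alpha> (\<lambda>z. P z *\<^sub>R axis i 1 :: real^'m) z $ k)"
        using ws tx(1) unfolding weak_solution_def by blast
      moreover have "(LINT z:QT \<Omega> T|lebesgue.
           - (\<Sum>k\<in>UNIV. u z $ k * Dt (\<lambda>z. P z *\<^sub>R axis i 1 :: real^'m) z $ k)
           + (\<Sum>k\<in>UNIV. \<Sum>j\<in>UNIV. \<Sum>\<alpha>\<in>UNIV. \<Sum>\<beta>\<in>UNIV. a k j \<alpha> \<beta> z * Du z $ j $ \<beta> * Dx \<alpha> (\<lambda>z. P z *\<^sub>R axis i 1 :: real^'m) z $ k))
        = (LINT z|lborel. - (hU i z * tfd et P z) + (\<Sum>\<alpha>\<in>UNIV. F \<alpha> z * tfd (ex \<alpha>) P z + hf i \<alpha> z * tfd (ex \<alpha>) P z))"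
        unfolding set_lebesgue_integral_def
      proof (rule integral_lebesgue_eq(1))
        show "AE z in lborel. indicator (QT \<Omega> T) z *\<^sub>R (- (\<Sum>k\<in>UNIV. u z $ k * Dt (\<lambda>z. P z *\<^sub>R axis i 1 :: real^'m) z $ k)
           + (\<Sum>k\<in>UNIV. \<Sum>j\<in>UNIV. \<Sum>\<alpha>\<in>UNIV. \<Sum>\<beta>\<in>UNIV. a k j \<alpha> \<beta> z * Du z $ j $ \<beta> * Dx \<alpha> (\<lambda>z. P z *\<^sub>R axis i 1 :: real^'m) z $ k))
          = - (hU i z * tfd et P z) + (\<Sum>\<alpha>\<in>UNIV. F \<alpha> z * tfd (ex \<alpha>) P z + hf i \<alpha> z * tfd (ex \<alpha>) P z)"
          using AE_all
        proof eventually_elim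
          case (elim z)
          show ?case
          proof (cases "z \<in> S")
            case True
            have s: "(\<Sum>k\<in>UNIV. \<Sum>j\<in>UNIV. \<Sum>\<alpha>\<in>UNIV. \<Sum>\<beta>\<in>UNIV. a k j \<alpha> \<beta> z * Du z $ j $ \<beta> * (tfd (ex \<alpha>) P z *\<^sub>R axis i 1 :: real^'m) $ k)
              = (\<Sum>j\<in>UNIV. \<Sum>\<alpha>\<in>UNIV. \<Sum>\<beta>\<in>UNIV. a i j \<alpha> \<beta> z * Du z $ j $ \<beta> * tfd (ex \<alpha>) P z)"
            proof -
              have "(\<Sum>j\<in>UNIV. \<Sum>\<alpha>\<in>UNIV. \<Sum>\<beta>\<in>UNIV. a k j \<alpha> \<beta> z * Du z $ j $ \<beta> * (tfd (ex \<alpha>) P z *\<^sub>R axis i 1 :: real^'m) $ k)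
                = (if k = i then (\<Sum>j\<in>UNIV. \<Sum>\<alpha>\<in>UNIV. \<Sum>\<beta>\<in>UNIV. a i j \<alpha> \<beta> z * Du z $ j $ \<beta> * tfd (ex \<alpha>) P z) else 0)" for k
                by (simp add: axis_def)
              then show ?thesis by simp
            qed
            have "(\<Sum>j\<in>UNIV. \<Sum>\<alpha>\<in>UNIV. \<Sum>\<beta>\<in>UNIV. a i j \<alpha> \<beta> z * Du z $ j $ \<beta> * tfd (ex \<alpha>) P z)
              = (\<Sum>\<alpha>\<in>UNIV. (\<Sum>j\<in>UNIV. \<Sum>\<beta>\<in>UNIV. a i j \<alpha> \<beta> z * Du z $ j $ \<beta>) * tfd (ex \<alpha>) P z)"
              by (subst sum.swap) (simp add: sum_distrib_right)
            also have "\<dots> = (\<Sum>\<alpha>\<in>UNIV. F \<alpha> z * tfd (ex \<alpha>) P z + hf i \<alpha> z * tfd (ex \<alpha>) P z)"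
            proof (intro sum.cong refl)
              fix \<alpha>
              have d: "Du z $ j $ \<beta> = hD j \<beta> z" "f z $ j $ \<beta> = hf j \<beta> z" "g j \<beta> z = hg j \<beta> z" for j \<beta>
                using elim True by blast+
              have "hg i \<alpha> z = hf i \<alpha> z + (\<Sum>j\<in>UNIV. \<Sum>\<beta>\<in>UNIV. (A0 i j \<alpha> \<beta> - a i j \<alpha> \<beta> z) * hD j \<beta> z)"
                using d(3)[of i \<alpha>, symmetric] unfolding g_def d(1,2) .
              then have "F \<alpha> z + hf i \<alpha> z = (\<Sum>j\<in>UNIV. \<Sum>\<beta>\<in>UNIV. a i j \<alpha> \<beta> z * hD j \<beta> z)"
                unfolding F_def flux_def by (simp add: left_diff_distrib sum_subtractf)
              then show "(\<Sum>j\<in>UNIV. \<Sum>\<beta>\<in>UNIV. a i j \<alpha> \<beta> z * Du z $ j $ \<beta>) * tfd (ex \<alpha>) P z = F \<alpha> z * tfd (ex \<alpha>) P z + hf i \<alpha> z * tfd (ex \<alpha>) P z"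
                unfolding d by (simp add: distrib_right[symmetric])
            qed
            finally show ?thesis using elim True SQ unfolding tx(2,3) s sum_axis by auto
          next
            case False
            then show ?thesis using z0[OF False] F0[OF False] hU(3)[OF False] unfolding tx(2,3) by simp
          qed
        qed
        show "(\<lambda>z. - (hU i z * tfd et P z) + (\<Sum>\<alpha>\<in>UNIV. F \<alpha> z * tfd (ex \<alpha>) P z + hf i \<alpha> z * tfd (ex \<alpha>) P z)) \<in> borel_measurable borel"
          by (intro borel_measurable_add borel_measurable_uminus borel_measurable_times borel_measurable_sum hU(1) hf(1) cc_measurable[OF ccP(2)] l2_measurable[OF lF])
      qed
      moreover have "(LINT z:QT \<Omega> T|lebesgue. \<Sum>k\<in>UNIV. \<Sum>\<alpha>\<in>UNIV. f z $ k $ \<alpha> * Dx \<alpha> (\<lambda>z. P z *\<^sub>R axis i 1 :: real^'m) z $ k)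
        = (LINT z|lborel. (\<Sum>\<alpha>\<in>UNIV. hf i \<alpha> z * tfd (ex \<alpha>) P z))"
        unfolding set_lebesgue_integral_def
      proof (rule integral_lebesgue_eq(1))
        show "AE z in lborel. indicator (QT \<Omega> T) z *\<^sub>R (\<Sum>k\<in>UNIV. \<Sum>\<alpha>\<in>UNIV. f z $ k $ \<alpha> * Dx \<alpha> (\<lambda>z. P z *\<^sub>R axis i 1 :: real^'m) z $ k)
          = (\<Sum>\<alpha>\<in>UNIV. hf i \<alpha> z * tfd (ex \<alpha>) P z)"
          using AE_all
        proof eventually_elim
          case (elim z)
          show ?case
          proof (cases "z \<in> S")
            case True
            have "(\<Sum>k\<in>UNIV. \<Sum>\<alpha>\<in>UNIV. f z $ k $ \<alpha> * (tfd (ex \<alpha>) P z *\<^sub>R axis i 1 :: real^'m) $ k)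
              = (\<Sum>\<alpha>\<in>UNIV. f z $ i $ \<alpha> * tfd (ex \<alpha>) P z)"
              by (subst sum.swap) (simp only: sum_axis)
            then show ?thesis using elim True SQ unfolding tx(2,3) by auto
          next
            case False
            then show ?thesis using z0[OF False] hf(3)[OF False] unfolding tx(2,3) by simp
          qed
        qed
        show "(\<lambda>z. \<Sum>\<alpha>\<in>UNIV. hf i \<alpha> z * tfd (ex \<alpha>) P z) \<in> borel_measurable borel"
          by (intro borel_measurable_times borel_measurable_sum hf(1) cc_measurable[OF ccP(2)])
      qed
      ultimately have "(LINT z|lborel. - (hU i z * tfd et P z) + (\<Sum>\<alpha>\<in>UNIV. F \<alpha> z * tfd (ex \<alpha>) P z + hf i \<alpha> z * tfd (ex \<alpha>) P z))
        = (LINT z|lborel. (\<Sum>\<alpha>\<in>UNIV. hf i \<alpha> z * tfd (ex \<alpha>) P z))" by simp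
      then have "(LINT z|lborel. hU i z * tfd et P z) = (\<Sum>\<alpha>\<in>UNIV. LINT z|lborel. F \<alpha> z * tfd (ex \<alpha>) P z)"
        using integrable_mult_cc[OF iU[of i] ccP(2)] integrable_mult_cc[OF iF ccP(2)] integrable_mult_cc[OF ihf ccP(2)]
        by (simp add: sum.distrib)
      then have "c * (LINT y|lborel. hU i (Phi x0 t1 r y) * tfd et P (Phi x0 t1 r y)) = (\<Sum>\<alpha>\<in>UNIV. c * (LINT y|lborel. F \<alpha> (Phi x0 t1 r y) * tfd (ex \<alpha>) P (Phi x0 t1 r y)))"
        using c(2)[of "\<lambda>z. hU i z * tfd et P z"] c(2)[of "\<lambda>z. F _ z * tfd (ex _) P z"] hU(1) l2_measurable[OF lF] cc_measurable[OF ccP(2)]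
        by simp
      then have e: "c * (LINT y|lborel. hU i (Phi x0 t1 r y) * ((1 / r\<^sup>2) * tfd et \<psi> y)) = (\<Sum>\<alpha>\<in>UNIV. c * (LINT y|lborel. F \<alpha> (Phi x0 t1 r y) * ((1 / r) * tfd (ex \<alpha>) \<psi> y)))"
        unfolding Px Pt .
      have e1: "(LINT y|lborel. hU i (Phi x0 t1 r y) * ((1 / r\<^sup>2) * tfd et \<psi> y)) = (1 / r) * (LINT y|lborel. hU i (Phi x0 t1 r y) / r * tfd et \<psi> y)"
        unfolding integral_mult_right_zero[symmetric]
        by (rule Bochner_Integration.integral_cong) (simp_all add: power2_eq_square)
      have e2: "(LINT y|lborel. F \<alpha> (Phi x0 t1 r y) * ((1 / r) * tfd (ex \<alpha>) \<psi> y)) = (1 / r) * (LINT y|lborel. F \<alpha> (Phi x0 t1 r y) * tfd (ex \<alpha>) \<psi> y)" for \<alpha>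
        unfolding integral_mult_right_zero[symmetric]
        by (rule Bochner_Integration.integral_cong) simp_all
      have "c * ((1 / r) * (LINT y|lborel. hU i (Phi x0 t1 r y) / r * tfd et \<psi> y)) = c * ((1 / r) * (\<Sum>\<alpha>\<in>UNIV. LINT y|lborel. F \<alpha> (Phi x0 t1 r y) * tfd (ex \<alpha>) \<psi> y))"
        using e unfolding e1 e2 sum_distrib_left .
      then show "(LINT y|lborel. hU i (Phi x0 t1 r y) / r * tfd et \<psi> y) = (\<Sum>\<alpha>\<in>UNIV. LINT y|lborel.
          flux A0 (\<lambda>j \<beta>. hD j \<beta> (Phi x0 t1 r y)) (\<lambda>i \<alpha>. hg i \<alpha> (Phi x0 t1 r y)) i \<alpha> * tfd (ex \<alpha>) \<psi> y)"
      proof -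
        assume e: "c * ((1 / r) * (LINT y|lborel. hU i (Phi x0 t1 r y) / r * tfd et \<psi> y)) = c * ((1 / r) * (\<Sum>\<alpha>\<in>UNIV. LINT y|lborel. F \<alpha> (Phi x0 t1 r y) * tfd (ex \<alpha>) \<psi> y))"
        have "c \<noteq> 0" "1 / r \<noteq> 0" using c(1) r by auto
        then show ?thesis using e unfolding F_def by (simp only: mult_cancel_left simp_thms)
      qed
    }
  qed
  from D(2)[OF this]
  have est: "SP (qcyl \<tau>) (\<lambda>i \<alpha> y. hD i \<alpha> (Phi x0 t1 r y)) \<le> D1 * SP UNIV (\<lambda>i \<alpha> y. hD i \<alpha> (Phi x0 t1 r y)) + D2 * SP UNIV (\<lambda>i \<alpha> y. hg i \<alpha> (Phi x0 t1 r y))" .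
  have eqU: "c * SP UNIV (\<lambda>i \<alpha> y. h i \<alpha> (Phi x0 t1 r y)) = SP UNIV h" if "\<And>i \<alpha>. l2 (h i \<alpha>)" for h :: "'m \<Rightarrow> 'n \<Rightarrow> (real^'n) \<times> real \<Rightarrow> real"
  proof -
    have "c * sqn UNIV (\<lambda>y. h i \<alpha> (Phi x0 t1 r y)) = sqn UNIV (h i \<alpha>)" for i \<alpha>
      using c(2)[of "\<lambda>z. (h i \<alpha> z)\<^sup>2"] l2_measurable[OF that, of i \<alpha>] by (simp add: sqn_def)
    then show ?thesis unfolding SP_def sum_distrib_left by simp
  qed
  \<comment> \<open>\<open>qcyl \<tau>\<close> contains the slice at time 0 and the open cylinder
    does not; the rescaled \<open>hD\<close> vanishes on that slice, so the integrands agree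
    everywhere.\<close>
  have eqS: "c * SP (qcyl \<tau>) (\<lambda>i \<alpha> y. hD i \<alpha> (Phi x0 t1 r y)) = SP (ocyl (x0, t1) (\<tau> * r)) hD"
  proof -
    have "c * sqn (qcyl \<tau>) (\<lambda>y. hD i \<alpha> (Phi x0 t1 r y)) = sqn (ocyl (x0, t1) (\<tau> * r)) (hD i \<alpha>)" for i \<alpha>
    proof -
      have "sqn (ocyl (x0, t1) (\<tau> * r)) (hD i \<alpha>) = c * (LINT y|lborel. indicator (ocyl (x0, t1) (\<tau> * r)) (Phi x0 t1 r y) * (hD i \<alpha> (Phi x0 t1 r y))\<^sup>2)"
        unfolding sqn_def by (rule c(2)) (use hD(1) in \<open>simp\<close>)
      also have "(\<lambda>y. indicator (ocyl (x0, t1) (\<tau> * r)) (Phi x0 t1 r y) * (hD i \<alpha> (Phi x0 t1 r y))\<^sup>2) = (\<lambda>y. indicator (qcyl \<tau>) y * (hD i \<alpha> (Phi x0 t1 r y))\<^sup>2)"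
      proof
        fix y
        show "indicator (ocyl (x0, t1) (\<tau> * r)) (Phi x0 t1 r y) * (hD i \<alpha> (Phi x0 t1 r y))\<^sup>2 = indicator (qcyl \<tau>) y * (hD i \<alpha> (Phi x0 t1 r y))\<^sup>2"
          using Phi_ocyl[OF r \<tau>, of x0 t1 y] sup[of "hD i \<alpha>" y, OF hD(3)] by (cases "y \<in> unit_cyl") (auto simp: indicator_def)
      qed
      finally show ?thesis unfolding sqn_def by simp
    qed
    then show ?thesis unfolding SP_def sum_distrib_left by simp
  qed
  have I: "(LINT z:S'|lebesgue. (norm (F z))\<^sup>2) = SP S' h"
    if S': "S' \<in> sets borel" "S' \<subseteq> S" and h: "\<And>i \<alpha>. l2 (h i \<alpha>)" "AE z in lborel. z \<in> S \<longrightarrow> (\<forall>i \<alpha>. F z $ i $ \<alpha> = h i \<alpha> z)"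
    for F :: "(real^'n) \<times> real \<Rightarrow> real^'n^'m" and h :: "'m \<Rightarrow> 'n \<Rightarrow> (real^'n) \<times> real \<Rightarrow> real" and S'
  proof -
    have "(LINT z:S'|lebesgue. (norm (F z))\<^sup>2) = (LINT z|lborel. indicator S' z * nsq (\<lambda>i \<alpha>. h i \<alpha> z))"
      unfolding set_lebesgue_integral_def
    proof (rule integral_lebesgue_eq(1))
      show "AE z in lborel. indicator S' z *\<^sub>R (norm (F z))\<^sup>2 = indicator S' z * nsq (\<lambda>i \<alpha>. h i \<alpha> z)"
        using h(2)
      proof eventually_elim
        case (elim z)
        then show ?case using S'(2) by (cases "z \<in> S'") (auto simp: norm_sq_matrix nsq_def)
      qed
      show "(\<lambda>z. indicator S' z * nsq (\<lambda>i \<alpha>. h i \<alpha> z)) \<in> borel_measurable borel"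
        using borel_measurable_integrable[OF SP_integral(2)[of h S', OF h(1) S'(1)]] by simp
    qed
    also have "\<dots> = SP S' h" by (rule SP_integral(1)[OF h(1) S'(1)])
    finally show ?thesis .
  qed
  have aeD: "AE z in lborel. z \<in> S \<longrightarrow> (\<forall>i \<alpha>. Du z $ i $ \<alpha> = hD i \<alpha> z)" using AE_all by eventually_elim auto
  have aef: "AE z in lborel. z \<in> S \<longrightarrow> (\<forall>i \<alpha>. f z $ i $ \<alpha> = hf i \<alpha> z)" using AE_all by eventually_elim auto
  have UNIV_S: "SP UNIV h = SP S h" if "\<And>i \<alpha> z. z \<notin> S \<Longrightarrow> h i \<alpha> z = 0" for h :: "'m \<Rightarrow> 'n \<Rightarrow> (real^'n) \<times> real \<Rightarrow> real"
    unfolding SP_def sqn_def using that by (intro sum.cong refl Bochner_Integration.integral_cong) (auto simp: indicator_def)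
  have sub: "ocyl (x0, t1) (\<tau> * r) \<subseteq> S"
  proof -
    have "\<tau> * r \<le> 1 * r" using \<tau> r by (intro mult_right_mono) auto
    moreover from this have "(\<tau> * r)\<^sup>2 \<le> r\<^sup>2" using \<tau> r by (intro power_mono) auto
    ultimately show ?thesis unfolding S_def ocyl_def by auto
  qed
  have "SP (ocyl (x0, t1) (\<tau> * r)) hD \<le> c * (D1 * SP UNIV (\<lambda>i \<alpha> y. hD i \<alpha> (Phi x0 t1 r y)) + D2 * SP UNIV (\<lambda>i \<alpha> y. hg i \<alpha> (Phi x0 t1 r y)))"
    unfolding eqS[symmetric] using c(1) est by (intro mult_left_mono) auto
  also have "\<dots> = D1 * SP UNIV hD + D2 * SP UNIV hg"
    unfolding eqU[of hD, OF lD, symmetric] eqU[of hg, OF lg, symmetric] by (simp add: algebra_simps)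
  also have "\<dots> \<le> D1 * SP UNIV hD + D2 * (2 * N * (\<omega> * N)\<^sup>2 * SP UNIV hD + 2 * SP UNIV hf)"
    using SPg D(1) by (intro add_left_mono mult_left_mono)
  also have "\<dots> = (D1 + D2 * (2 * N * (\<omega> * N)\<^sup>2)) * SP S hD + 2 * D2 * SP S hf"
    using UNIV_S[of hD] UNIV_S[of hf] hD(3) hf(3) by (simp add: algebra_simps)
  finally show ?thesis
    using I[of "ocyl (x0, t1) (\<tau> * r)" hD Du, OF _ sub lD aeD] I[of S hD Du, OF S _ lD aeD] I[of S hf f, OF S _ lf aef]
    by (simp add: S_def)
qed

subsection \<open>Decay on a parabolic cylinder\<close>

definition energy :: "((real^'n::finite) \<times> real) set \<Rightarrow> ((real^'n) \<times> real \<Rightarrow> 'b::euclidean_space) \<Rightarrow> real" where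
  "energy S F = (LINT z:S|lebesgue. (norm (F z))\<^sup>2)"

lemma L2_integrable:
  assumes "F \<in> L2 Q" "S \<in> sets lebesgue" "S \<subseteq> Q"
  shows "integrable lebesgue (\<lambda>z. indicator S z * (norm (F z))\<^sup>2)"
  using set_integrable_subset[of lebesgue Q "\<lambda>z. (norm (F z))\<^sup>2" S] assms
  unfolding L2_def set_integrable_def by simp

lemma energy_eq: "energy S F = (LINT z|lebesgue. indicator S z * (norm (F z))\<^sup>2)"
  by (simp add: energy_def set_lebesgue_integral_def)

lemma energy_nonneg: "0 \<le> energy S F"
  unfolding energy_eq by (intro integral_nonneg_AE) auto

lemma energy_mono:
  assumes "F \<in> L2 Q" "S \<in> sets lebesgue" "S' \<in> sets lebesgue" "S \<subseteq> S'" "S' \<subseteq> Q"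
  shows "energy S F \<le> energy S' F"
  unfolding energy_eq using assms
  by (intro integral_mono L2_integrable[OF assms(1)]) (auto simp: indicator_def)

lemma cyl_lebesgue [simp]: "cyl z0 R \<in> sets lebesgue"
proof -
  have "cyl z0 R \<in> sets borel" unfolding cyl_def by (intro borel_Times) auto
  then show ?thesis by simp
qed

lemma ocyl_lebesgue [simp]: "ocyl z0 R \<in> sets lebesgue"
  using ocyl_borel[of z0 R] by (simp del: ocyl_borel)

lemma ocyl_cyl: "ocyl z0 R \<subseteq> cyl z0 R"
  by (auto simp: ocyl_def cyl_def)

lemma cyl_mono: assumes "0 \<le> r" "r \<le> R" shows "cyl z0 r \<subseteq> cyl z0 R"
proof -
  have "r\<^sup>2 \<le> R\<^sup>2" using assms by (intro power_mono)
  show ?thesis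
  proof
    fix z assume "z \<in> cyl z0 r"
    then have "dist (fst z0) (fst z) < r" "snd z0 - r\<^sup>2 < snd z" "snd z \<le> snd z0" by (auto simp: cyl_def)
    then have "dist (fst z0) (fst z) < R" "snd z0 - R\<^sup>2 < snd z" "snd z \<le> snd z0" using assms \<open>r\<^sup>2 \<le> R\<^sup>2\<close> by linarith+
    then show "z \<in> cyl z0 R" by (cases z) (auto simp: cyl_def)
  qed
qed

text \<open>The two cylinders differ by a piece of the hyperplane at the top time, which is a null
  set.\<close>

lemma energy_cyl_ocyl: "energy (cyl z0 R) F = energy (ocyl z0 R) F" if F: "F \<in> L2 Q" "cyl z0 R \<subseteq> Q"
proof -
  have "negligible {z :: (real^'n) \<times> real. (0, 1) \<bullet> z = snd z0}" by (rule negligible_hyperplane) (auto simp: zero_prod_def)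
  then have "AE z :: (real^'n) \<times> real in lebesgue. z \<notin> {z. (0, 1) \<bullet> z = snd z0}"
    unfolding negligible_iff_null_sets by (rule AE_not_in)
  then have ae: "AE z :: (real^'n) \<times> real in lebesgue. snd z \<noteq> snd z0"
    by eventually_elim (auto simp: inner_prod_def)
  show ?thesis
    unfolding energy_eq
  proof (rule integral_cong_AE)
    show "(\<lambda>z. indicator (cyl z0 R) z * (norm (F z))\<^sup>2) \<in> borel_measurable lebesgue"
      using L2_integrable[OF F(1) _ F(2)] by (intro borel_measurable_integrable) auto
    show "(\<lambda>z. indicator (ocyl z0 R) z * (norm (F z))\<^sup>2) \<in> borel_measurable lebesgue"
      using L2_integrable[OF F(1), of "ocyl z0 R"] F(2) ocyl_cyl[of z0 R] by (intro borel_measurable_integrable) auto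
    show "AE z in lebesgue. indicator (cyl z0 R) z * (norm (F z))\<^sup>2 = indicator (ocyl z0 R) z * (norm (F z))\<^sup>2"
      using ae by eventually_elim (auto simp: cyl_def ocyl_def indicator_def)
  qed
qed

text \<open>The cylinder may touch the lateral boundary, the initial time or the final time, where
  \<open>u\<close> is not known to be integrable. It is exhausted from inside by cylinders with
  compact closure in the open domain, whose estimates have a common right-hand side, and the
  left-hand side follows by dominated convergence.\<close>

lemma one_step:
  fixes Du f :: "(real^'n::finite) \<times> real \<Rightarrow> real^'n^'m::finite" and u :: "(real^'n) \<times> real \<Rightarrow> real^'m"
  assumes R: "0 < R" and \<tau>: "0 < \<tau>" "\<tau> \<le> 1" and Q: "cyl z0 R \<subseteq> QT \<Omega> T"
    and wg: "weak_spatial_gradient \<Omega> T u Du" and L2D: "Du \<in> L2 (QT \<Omega> T)" and L2f: "f \<in> L2 (QT \<Omega> T)"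
    and ws: "weak_solution \<Omega> T a f u Du"
    and a: "\<And>i j \<alpha> \<beta>. continuous_on (QT \<Omega> T) (a i j \<alpha> \<beta>)"
    and \<omega>: "\<And>i j \<alpha> \<beta> z. z \<in> cyl z0 R \<Longrightarrow> \<bar>a i j \<alpha> \<beta> z - A0 i j \<alpha> \<beta>\<bar> \<le> \<omega>"
    and D: "0 \<le> D1" "0 \<le> D2" "\<And>u Du g. unit_sol A0 u Du g \<Longrightarrow> SP (qcyl \<tau>) Du \<le> D1 * SP UNIV Du + D2 * SP UNIV g"
    and N: "N = real (CARD('m) * CARD('n))"
  shows "energy (cyl z0 (\<tau> * R)) Du \<le> (D1 + D2 * (2 * N * (\<omega> * N)\<^sup>2)) * energy (cyl z0 R) Du + 2 * D2 * energy (cyl z0 R) f"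
proof -
  obtain x0 t0 where z0: "z0 = (x0, t0)" by (cases z0)
  define B where "B = (D1 + D2 * (2 * N * (\<omega> * N)\<^sup>2)) * energy (cyl z0 R) Du + 2 * D2 * energy (cyl z0 R) f"
  have N0: "0 \<le> N" by (simp add: N)
  define r where "r k = R * (1 - inverse (real (Suc k)) / 2)" for k
  \<comment> \<open>Lowering the vertex by half of the loss \<open>R\<^sup>2 - (r k)\<^sup>2\<close>
    leaves equal positive margins above and below the inner cylinder.\<close>
  define t where "t k = t0 - (R\<^sup>2 - (r k)\<^sup>2) / 2" for k
  have r: "0 < r k" "r k < R" for k
  proof -
    have i: "0 < inverse (real (Suc k))" "inverse (real (Suc k)) \<le> 1" by (auto simp: inverse_le_1_iff)
    show "0 < r k" unfolding r_def using R i by (intro mult_pos_pos) auto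
    have "R * (1 - inverse (real (Suc k)) / 2) < R * 1" using R i by (intro mult_strict_left_mono) auto
    then show "r k < R" by (simp add: r_def)
  qed
  have r2: "(r k)\<^sup>2 < R\<^sup>2" for k using r[of k] by (intro power_strict_mono) auto
  have limr: "r \<longlonglongrightarrow> R"
  proof -
    have "(\<lambda>k. R * (1 - inverse (real (Suc k)) / 2)) \<longlonglongrightarrow> R * (1 - 0 / 2)"
      by (intro tendsto_intros LIMSEQ_inverse_real_of_nat) auto
    then show ?thesis by (simp add: r_def[abs_def])
  qed
  have limt: "t \<longlonglongrightarrow> t0"
  proof -
    have "(\<lambda>k. t0 - (R\<^sup>2 - (r k)\<^sup>2) / 2) \<longlonglongrightarrow> t0 - (R\<^sup>2 - R\<^sup>2) / 2" by (intro tendsto_intros limr) auto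
    then show ?thesis by (simp add: t_def[abs_def])
  qed
  have z0Q: "z0 \<in> cyl z0 R" using R by (simp add: cyl_def mem_Times_iff)
  then have t0T: "t0 \<le> T" using Q z0 by (auto simp: QT_def)
  have sub: "cball x0 (r k) \<times> {t k - (r k)\<^sup>2..t k} \<subseteq> {z \<in> cyl z0 R. snd z < t0}" for k
  proof
    fix z assume "z \<in> cball x0 (r k) \<times> {t k - (r k)\<^sup>2..t k}"
    then have "dist x0 (fst z) \<le> r k" "t k - (r k)\<^sup>2 \<le> snd z" "snd z \<le> t k" by auto
    then show "z \<in> {z \<in> cyl z0 R. snd z < t0}" using r(2)[of k] r2[of k] by (cases z) (auto simp: cyl_def z0 t_def field_simps)
  qed
  have K: "cball x0 (r k) \<times> {t k - (r k)\<^sup>2..t k} \<subseteq> \<Omega> \<times> {0<..<T}" for k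
    using sub[of k] Q t0T by (force simp: QT_def)
  have oc: "ocyl (x0, t k) (r k) \<subseteq> cyl z0 R" for k
  proof -
    have "ocyl (x0, t k) (r k) \<subseteq> cball x0 (r k) \<times> {t k - (r k)\<^sup>2..t k}" by (auto simp: ocyl_def)
    then show ?thesis using sub[of k] by blast
  qed
  have ocs: "ocyl (x0, t k) (\<tau> * r k) \<subseteq> ocyl (x0, t k) (r k)" for k
  proof -
    have "\<tau> * r k \<le> 1 * r k" using \<tau> r(1)[of k] by (intro mult_right_mono) auto
    moreover from this have "(\<tau> * r k)\<^sup>2 \<le> (r k)\<^sup>2" using \<tau> r(1)[of k] by (intro power_mono) auto
    ultimately show ?thesis unfolding ocyl_def by auto
  qed
  have est: "energy (ocyl (x0, t k) (\<tau> * r k)) Du \<le> B" for k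
  proof -
    have "energy (ocyl (x0, t k) (\<tau> * r k)) Du \<le> (D1 + D2 * (2 * N * (\<omega> * N)\<^sup>2)) * energy (ocyl (x0, t k) (r k)) Du
       + 2 * D2 * energy (ocyl (x0, t k) (r k)) f"
      unfolding energy_def
    proof (rule one_cylinder[OF r(1) \<tau> K wg L2D L2f ws _ _ D(2,3) N])
      show "continuous_on (ocyl (x0, t k) (r k)) (a i j \<alpha> \<beta>)" for i j \<alpha> \<beta>
        by (rule continuous_on_subset[OF a]) (use oc Q in blast)
      show "\<bar>a i j \<alpha> \<beta> z - A0 i j \<alpha> \<beta>\<bar> \<le> \<omega>" if "z \<in> ocyl (x0, t k) (r k)" for i j \<alpha> \<beta> z
        using \<omega> oc that by blast
    qed
    also have "\<dots> \<le> B" unfolding B_def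
      using oc Q D N0 by (intro add_mono mult_left_mono energy_mono[OF L2D] energy_mono[OF L2f]) auto
    finally show ?thesis .
  qed
  \<comment> \<open>The shrunken cylinders do not increase monotonically; intersecting them with the
    limit set supplies the dominating function.\<close>
  define X where "X k = ocyl (x0, t k) (\<tau> * r k) \<inter> ocyl z0 (\<tau> * R)" for k
  have XQ: "ocyl (x0, t k) (\<tau> * r k) \<subseteq> QT \<Omega> T" for k using ocs oc Q by blast
  have mX: "X k \<in> sets lebesgue" for k unfolding X_def by (intro sets.Int ocyl_lebesgue)
  have X: "energy (X k) Du \<le> B" for k
  proof -
    have "energy (X k) Du \<le> energy (ocyl (x0, t k) (\<tau> * r k)) Du"
      by (rule energy_mono[OF L2D mX _ _ XQ[of k]]) (auto simp: X_def)
    then show ?thesis using est by (rule order_trans)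
  qed
  have tR: "\<tau> * R \<le> R" "0 < \<tau> * R" using \<tau> R by auto
  have cQ: "cyl z0 (\<tau> * R) \<subseteq> QT \<Omega> T" using cyl_mono[of "\<tau> * R" R z0] tR Q by auto
  have oQ: "ocyl z0 (\<tau> * R) \<subseteq> QT \<Omega> T" using cQ ocyl_cyl[of z0 "\<tau> * R"] by blast
  have "(\<lambda>k. LINT z|lebesgue. indicator (X k) z * (norm (Du z))\<^sup>2) \<longlonglongrightarrow> (LINT z|lebesgue. indicator (ocyl z0 (\<tau> * R)) z * (norm (Du z))\<^sup>2)"
  proof (rule integral_dominated_convergence[where w = "\<lambda>z. indicator (ocyl z0 (\<tau> * R)) z * (norm (Du z))\<^sup>2"])
    show i: "integrable lebesgue (\<lambda>z. indicator (ocyl z0 (\<tau> * R)) z * (norm (Du z))\<^sup>2)"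
      by (rule L2_integrable[OF L2D _ oQ]) simp
    then show "(\<lambda>z. indicator (ocyl z0 (\<tau> * R)) z * (norm (Du z))\<^sup>2) \<in> borel_measurable lebesgue" by (rule borel_measurable_integrable)
    show "(\<lambda>z. indicator (X k) z * (norm (Du z))\<^sup>2) \<in> borel_measurable lebesgue" for k
      by (rule borel_measurable_integrable[OF L2_integrable[OF L2D mX]]) (use oQ in \<open>auto simp: X_def\<close>)
    show "AE z in lebesgue. norm (indicator (X k) z * (norm (Du z))\<^sup>2) \<le> indicator (ocyl z0 (\<tau> * R)) z * (norm (Du z))\<^sup>2" for k
      by (auto simp: X_def indicator_def)
    show "AE z in lebesgue. (\<lambda>k. indicator (X k) z * (norm (Du z))\<^sup>2) \<longlonglongrightarrow> indicator (ocyl z0 (\<tau> * R)) z * (norm (Du z))\<^sup>2"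
    proof (rule AE_I2)
      fix z
      show "(\<lambda>k. indicator (X k) z * (norm (Du z))\<^sup>2) \<longlonglongrightarrow> indicator (ocyl z0 (\<tau> * R)) z * (norm (Du z))\<^sup>2"
      proof (cases "z \<in> ocyl z0 (\<tau> * R)")
        case True
        then have z: "dist x0 (fst z) < \<tau> * R" "t0 - (\<tau> * R)\<^sup>2 < snd z" "snd z < t0" by (auto simp: ocyl_def z0)
        have l1: "(\<lambda>k. \<tau> * r k) \<longlonglongrightarrow> \<tau> * R" by (intro tendsto_intros limr)
        have l2: "(\<lambda>k. t k - (\<tau> * r k)\<^sup>2) \<longlonglongrightarrow> t0 - (\<tau> * R)\<^sup>2" by (intro tendsto_intros limr limt)
        have "\<forall>\<^sub>F k in sequentially. dist x0 (fst z) < \<tau> * r k \<and> t k - (\<tau> * r k)\<^sup>2 < snd z \<and> snd z < t k"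
          by (intro eventually_conj order_tendstoD(1)[OF l1 z(1)] order_tendstoD(2)[OF l2 z(2)] order_tendstoD(1)[OF limt z(3)])
        then have "\<forall>\<^sub>F k in sequentially. indicator (X k) z * (norm (Du z))\<^sup>2 = indicator (ocyl z0 (\<tau> * R)) z * (norm (Du z))\<^sup>2"
          by eventually_elim (use True in \<open>cases z, auto simp: X_def ocyl_def indicator_def\<close>)
        then show ?thesis by (rule tendsto_eventually)
      next
        case False
        then show ?thesis by (simp add: X_def)
      qed
    qed
  qed
  then have "(\<lambda>k. energy (X k) Du) \<longlonglongrightarrow> energy (ocyl z0 (\<tau> * R)) Du" by (simp add: energy_eq)
  then have "energy (ocyl z0 (\<tau> * R)) Du \<le> B" by (rule LIMSEQ_le_const2) (use X in auto)
  then show ?thesis using energy_cyl_ocyl[OF L2D cQ] by (simp add: B_def)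
qed

subsection \<open>Iteration\<close>

text \<open>Along the radii \<open>\<tau>^k R\<close> the inhomogeneous terms form a geometric
  series with ratio \<open>q / p < 1\<close>, once the weights at different radii are compared
  through the almost monotonicity of \<open>s powr \<gamma> / \<psi> s\<close>.\<close>

lemma iterate_decay:
  fixes \<Phi> \<psi> :: "real \<Rightarrow> real"
  assumes R: "0 < R" and \<tau>: "0 < \<tau>" "\<tau> < 1" and p: "p = \<tau> powr \<gamma>" and q: "0 < q" "q < p" and K: "1 \<le> K" and B: "0 \<le> B"
    and \<gamma>: "0 < \<gamma>"
    and \<psi>: "\<And>s. 0 < s \<Longrightarrow> s \<le> R \<Longrightarrow> 0 < \<psi> s"
    and inc: "\<And>s t. 0 < s \<Longrightarrow> s \<le> t \<Longrightarrow> t \<le> R \<Longrightarrow> \<psi> t * s powr \<gamma> \<le> K * t powr \<gamma> * \<psi> s"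
    and \<Phi>: "\<And>s. 0 \<le> \<Phi> s" "\<And>s t. 0 < s \<Longrightarrow> s \<le> t \<Longrightarrow> t \<le> R \<Longrightarrow> \<Phi> s \<le> \<Phi> t"
    and step: "\<And>r. 0 < r \<Longrightarrow> r \<le> R \<Longrightarrow> \<Phi> (\<tau> * r) \<le> q * \<Phi> r + B * \<psi> r"
    and \<rho>: "0 < \<rho>" "\<rho> \<le> R"
  shows "\<Phi> \<rho> \<le> K * K / p * (\<psi> \<rho> * (\<Phi> R / \<psi> R + B / (p - q)))"
proof -
  have p0: "0 < p" using \<tau> by (simp add: p)
  have tk: "0 < \<tau> ^ k * R" "\<tau> ^ k * R \<le> R" for k
    using \<tau> R by (auto simp: mult_le_cancel_right1 power_le_one)
  have tp: "(\<tau> ^ k * R) powr \<gamma> = p ^ k * R powr \<gamma>" for k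
  proof -
    have "(\<tau> ^ k) powr \<gamma> = p ^ k" using \<tau> unfolding p by (simp add: powr_realpow[symmetric] powr_powr mult.commute)
    then show ?thesis using \<tau> R by (simp add: powr_mult)
  qed
  \<comment> \<open>Almost monotonicity between any two of the radii directly. Chaining neighbouring
    radii would accumulate powers of \<open>K\<close>.\<close>
  have cmp: "\<psi> (\<tau> ^ j * R) * p ^ (k - j) \<le> K * \<psi> (\<tau> ^ k * R)" if "j \<le> k" for j k
  proof -
    have le: "\<tau> ^ k * R \<le> \<tau> ^ j * R" using that \<tau> R by (intro mult_right_mono power_decreasing) auto
    have "\<psi> (\<tau> ^ j * R) * (p ^ k * R powr \<gamma>) \<le> K * (p ^ j * R powr \<gamma>) * \<psi> (\<tau> ^ k * R)"
      using inc[OF tk(1) le tk(2)] unfolding tp .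
    also have "p ^ k = p ^ j * p ^ (k - j)" using that by (simp add: power_add[symmetric])
    finally have "(p ^ j * R powr \<gamma>) * (\<psi> (\<tau> ^ j * R) * p ^ (k - j)) \<le> (p ^ j * R powr \<gamma>) * (K * \<psi> (\<tau> ^ k * R))"
      by (simp add: mult_ac)
    then show ?thesis using p0 R by (subst (asm) mult_le_cancel_left_pos) auto
  qed
  \<comment> \<open>The recursion is unrolled before any weights are compared, so that
    \<open>K\<close> enters each term once and not once per step.\<close>
  have sum_bound: "\<Phi> (\<tau> ^ k * R) \<le> q ^ k * \<Phi> R + B * (\<Sum>j<k. q ^ (k - Suc j) * \<psi> (\<tau> ^ j * R))" for k
  proof (induction k)
    case (Suc k)
    have "\<Phi> (\<tau> ^ Suc k * R) \<le> q * \<Phi> (\<tau> ^ k * R) + B * \<psi> (\<tau> ^ k * R)"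
      using step[OF tk, of k] by (simp add: mult.assoc)
    also have "\<dots> \<le> q * (q ^ k * \<Phi> R + B * (\<Sum>j<k. q ^ (k - Suc j) * \<psi> (\<tau> ^ j * R))) + B * \<psi> (\<tau> ^ k * R)"
      using Suc q by (intro add_right_mono mult_left_mono) auto
    also have "\<dots> = q ^ Suc k * \<Phi> R + B * ((\<Sum>j<k. q * (q ^ (k - Suc j) * \<psi> (\<tau> ^ j * R))) + \<psi> (\<tau> ^ k * R))"
      by (simp add: algebra_simps sum_distrib_left)
    also have "(\<Sum>j<k. q * (q ^ (k - Suc j) * \<psi> (\<tau> ^ j * R))) = (\<Sum>j<k. q ^ (Suc k - Suc j) * \<psi> (\<tau> ^ j * R))"
      by (intro sum.cong refl) (auto simp: Suc_diff_le mult.assoc[symmetric] power_Suc[symmetric] Suc_diff_Suc)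
    finally show ?case by simp
  qed simp
  have main: "\<Phi> (\<tau> ^ k * R) \<le> K * \<psi> (\<tau> ^ k * R) * (\<Phi> R / \<psi> R + B / (p - q))" for k
  proof -
    define V where "V = K * \<psi> (\<tau> ^ k * R)"
    have V: "0 \<le> V" unfolding V_def using K \<psi>[OF tk] by (simp add: less_imp_le)
    have 1: "q ^ k * \<Phi> R \<le> V * (\<Phi> R / \<psi> R)"
    proof -
      have "\<psi> R * q ^ k \<le> \<psi> R * p ^ k" using q \<psi>[of R] R by (intro mult_left_mono power_mono) auto
      also have "\<dots> \<le> V" using cmp[of 0 k] by (simp add: V_def)
      finally have "q ^ k \<le> V / \<psi> R" using \<psi>[of R] R by (simp add: pos_le_divide_eq mult.commute)
      then have "q ^ k * \<Phi> R \<le> V / \<psi> R * \<Phi> R" using \<Phi>(1) by (intro mult_right_mono)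
      then show ?thesis by simp
    qed
    have 2: "(\<Sum>j<k. q ^ (k - Suc j) * \<psi> (\<tau> ^ j * R)) \<le> V / (p - q)"
    proof -
      have "(\<Sum>j<k. q ^ (k - Suc j) * \<psi> (\<tau> ^ j * R)) \<le> (\<Sum>j<k. V / p * (q / p) ^ (k - Suc j))"
      proof (intro sum_mono)
        fix j assume "j \<in> {..<k}"
        then have j: "j \<le> k" "k - j = Suc (k - Suc j)" by auto
        have "\<psi> (\<tau> ^ j * R) \<le> V / p ^ (k - j)" using cmp[OF j(1)] p0 by (simp add: V_def pos_le_divide_eq)
        then have "q ^ (k - Suc j) * \<psi> (\<tau> ^ j * R) \<le> q ^ (k - Suc j) * (V / p ^ (k - j))" using q by (intro mult_left_mono) auto
        then show "q ^ (k - Suc j) * \<psi> (\<tau> ^ j * R) \<le> V / p * (q / p) ^ (k - Suc j)"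
          unfolding j(2) by (simp add: power_divide mult.commute)
      qed
      also have "\<dots> = V / p * (\<Sum>j<k. (q / p) ^ (k - Suc j))" by (simp add: sum_distrib_left)
      also have "(\<Sum>j<k. (q / p) ^ (k - Suc j)) = (\<Sum>j<k. (q / p) ^ j)" by (rule sum.nat_diff_reindex)
      also have "V / p * (\<Sum>j<k. (q / p) ^ j) \<le> V / p * (1 / (1 - q / p))"
      proof (intro mult_left_mono)
        have "(\<Sum>j<k. (q / p) ^ j) = (1 - (q / p) ^ k) / (1 - q / p)" using q p0 by (subst sum_gp_strict) auto
        also have "\<dots> \<le> 1 / (1 - q / p)" using q p0 by (intro divide_right_mono) auto
        finally show "(\<Sum>j<k. (q / p) ^ j) \<le> 1 / (1 - q / p)" .
      qed (use V p0 in auto)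
      also have "\<dots> = V / (p - q)" using p0 q by (simp add: field_simps)
      finally show ?thesis .
    qed
    have "\<Phi> (\<tau> ^ k * R) \<le> V * (\<Phi> R / \<psi> R) + B * (V / (p - q))"
      using sum_bound[of k] 1 mult_left_mono[OF 2 B] by linarith
    then show ?thesis by (simp add: V_def algebra_simps)
  qed
  \<comment> \<open>The first power below \<open>\<rho> / R\<close>; its predecessor
    \<open>k\<close> satisfies \<open>\<tau> * (\<tau>^k R) \<le> \<rho> \<le> \<tau>^k R\<close>,
    and passing from that radius to \<rho> costs the factor \<open>K / p\<close>.\<close>
  define n where "n = (LEAST n. \<tau> ^ n < \<rho> / R)"
  have "\<exists>n. \<tau> ^ n < \<rho> / R" using real_arch_pow_inv[of "\<rho> / R" \<tau>] \<tau> \<rho> R by auto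
  then have n: "\<tau> ^ n < \<rho> / R" "\<And>m. m < n \<Longrightarrow> \<not> \<tau> ^ m < \<rho> / R"
    unfolding n_def by (rule LeastI_ex) (auto dest: not_less_Least)
  have "n \<noteq> 0" using n(1) \<rho> R by (cases n) (auto simp: less_divide_eq)
  then obtain k where k: "n = Suc k" by (cases n) auto
  have r1: "\<rho> \<le> \<tau> ^ k * R" using n(2)[of k] k R by (simp add: not_less divide_le_eq)
  have r2: "\<tau> * (\<tau> ^ k * R) \<le> \<rho>" using n(1) k R by (simp add: less_divide_eq mult.assoc)
  have "\<psi> (\<tau> ^ k * R) * \<rho> powr \<gamma> \<le> K * (\<tau> ^ k * R) powr \<gamma> * \<psi> \<rho>" by (rule inc[OF \<rho>(1) r1 tk(2)])
  also have "\<dots> \<le> K * (\<rho> powr \<gamma> / p) * \<psi> \<rho>"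
  proof (intro mult_right_mono mult_left_mono)
    have "p * (\<tau> ^ k * R) powr \<gamma> = (\<tau> * (\<tau> ^ k * R)) powr \<gamma>" unfolding p by (rule powr_mult[symmetric])
    also have "\<dots> \<le> \<rho> powr \<gamma>" using r2 tk[of k] \<tau> \<gamma> by (intro powr_mono2) auto
    finally show "(\<tau> ^ k * R) powr \<gamma> \<le> \<rho> powr \<gamma> / p" using p0 by (simp add: pos_le_divide_eq mult.commute)
  qed (use K \<psi>[OF \<rho>] in auto)
  finally have "\<rho> powr \<gamma> * \<psi> (\<tau> ^ k * R) \<le> \<rho> powr \<gamma> * (K / p * \<psi> \<rho>)" by (simp add: mult_ac)
  then have \<psi>k: "\<psi> (\<tau> ^ k * R) \<le> K / p * \<psi> \<rho>" using \<rho> by (subst (asm) mult_le_cancel_left_pos) auto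
  have E: "0 \<le> \<Phi> R / \<psi> R + B / (p - q)" using \<Phi>(1)[of R] \<psi>[of R] R B q by (intro add_nonneg_nonneg divide_nonneg_nonneg) auto
  have "\<Phi> \<rho> \<le> \<Phi> (\<tau> ^ k * R)" by (rule \<Phi>(2)[OF \<rho>(1) r1 tk(2)])
  also have "\<dots> \<le> K * \<psi> (\<tau> ^ k * R) * (\<Phi> R / \<psi> R + B / (p - q))" by (rule main)
  also have "\<dots> \<le> K * (K / p * \<psi> \<rho>) * (\<Phi> R / \<psi> R + B / (p - q))"
    using \<psi>k K E by (intro mult_right_mono mult_left_mono) auto
  finally show ?thesis by (simp add: mult_ac)
qed

subsection \<open>Morrey norms\<close>

definition wgt :: "real \<Rightarrow> (real \<Rightarrow> real) \<Rightarrow> real \<Rightarrow> real" where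
  "wgt lam \<phi> r = r powr lam * (\<phi> r)\<^sup>2"

lemma morrey_quotient_sq:
  assumes "0 < \<rho>" "0 < \<phi> \<rho>"
  shows "0 \<le> morrey_quotient lam \<phi> Q g z0 \<rho>"
    "(morrey_quotient lam \<phi> Q g z0 \<rho>)\<^sup>2 = energy (Q \<inter> cyl z0 \<rho>) g / wgt lam \<phi> \<rho>"
proof -
  have E: "0 \<le> \<rho> powr (- lam) * energy (Q \<inter> cyl z0 \<rho>) g" by (simp add: energy_nonneg)
  have eq: "morrey_quotient lam \<phi> Q g z0 \<rho> = 1 / \<phi> \<rho> * sqrt (\<rho> powr (- lam) * energy (Q \<inter> cyl z0 \<rho>) g)"
    by (simp add: morrey_quotient_def energy_def)
  show "0 \<le> morrey_quotient lam \<phi> Q g z0 \<rho>" unfolding eq using E assms by (intro mult_nonneg_nonneg) auto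
  have "(morrey_quotient lam \<phi> Q g z0 \<rho>)\<^sup>2 = (1 / \<phi> \<rho>)\<^sup>2 * (\<rho> powr (- lam) * energy (Q \<inter> cyl z0 \<rho>) g)"
    unfolding eq using E by (simp only: power_mult_distrib real_sqrt_pow2)
  then show "(morrey_quotient lam \<phi> Q g z0 \<rho>)\<^sup>2 = energy (Q \<inter> cyl z0 \<rho>) g / wgt lam \<phi> \<rho>"
    using assms by (simp add: wgt_def powr_minus power_divide field_simps)
qed

lemma morrey_energy_le:
  assumes g: "bdd_above {morrey_quotient lam \<phi> Q g z0 \<rho> | z0 \<rho>. z0 \<in> Q \<and> 0 < \<rho> \<and> \<rho> \<le> d}"
    and z: "z0 \<in> Q" "0 < \<rho>" "\<rho> \<le> d" "0 < \<phi> \<rho>"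
  shows "energy (Q \<inter> cyl z0 \<rho>) g \<le> (morrey_norm d lam \<phi> Q g)\<^sup>2 * wgt lam \<phi> \<rho>"
proof -
  have "morrey_quotient lam \<phi> Q g z0 \<rho> \<le> morrey_norm d lam \<phi> Q g"
    unfolding morrey_norm_def by (rule cSup_upper[OF _ g]) (use z in blast)
  then have "(morrey_quotient lam \<phi> Q g z0 \<rho>)\<^sup>2 \<le> (morrey_norm d lam \<phi> Q g)\<^sup>2"
    by (rule power_mono) (rule morrey_quotient_sq(1)[of \<rho> \<phi>, OF z(2,4)])
  moreover have "0 < wgt lam \<phi> \<rho>" using z by (simp add: wgt_def)
  ultimately show ?thesis unfolding morrey_quotient_sq(2)[of \<rho> \<phi>, OF z(2,4)] by (simp add: pos_divide_le_eq)
qed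

lemma morrey_bddI:
  assumes "\<And>z0 \<rho>. z0 \<in> Q \<Longrightarrow> 0 < \<rho> \<Longrightarrow> \<rho> \<le> d \<Longrightarrow> energy (Q \<inter> cyl z0 \<rho>) g \<le> B * wgt lam \<phi> \<rho>"
    and \<phi>: "\<And>r. 0 < r \<Longrightarrow> r \<le> d \<Longrightarrow> 0 < \<phi> r"
  shows "bdd_above {morrey_quotient lam \<phi> Q g z0 \<rho> | z0 \<rho>. z0 \<in> Q \<and> 0 < \<rho> \<and> \<rho> \<le> d}"
proof (rule bdd_aboveI[of _ "sqrt B"])
  fix x assume "x \<in> {morrey_quotient lam \<phi> Q g z0 \<rho> | z0 \<rho>. z0 \<in> Q \<and> 0 < \<rho> \<and> \<rho> \<le> d}"
  then obtain z0 \<rho> where z: "z0 \<in> Q" "0 < \<rho>" "\<rho> \<le> d" and x: "x = morrey_quotient lam \<phi> Q g z0 \<rho>" by blast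
  have "0 < \<phi> \<rho>" using \<phi> z by blast
  moreover from this have "0 < wgt lam \<phi> \<rho>" using z by (simp add: wgt_def)
  ultimately have "x\<^sup>2 \<le> B" unfolding x morrey_quotient_sq(2)[of \<rho> \<phi>, OF z(2) \<open>0 < \<phi> \<rho>\<close>]
    using assms(1)[OF z] by (simp add: pos_divide_le_eq)
  then show "x \<le> sqrt B" by (rule real_le_rsqrt)
qed

text \<open>The data are assumed in the Morrey space row by row, while the estimate contains the
  norm of the whole family; squared Euclidean norms add over the rows.\<close>

lemma L2_rows:
  fixes f :: "(real^'n::finite) \<times> real \<Rightarrow> real^'n^'m::finite"
  assumes f: "\<And>i. (\<lambda>z. f z $ i) \<in> L2 Q"
  shows "f \<in> L2 Q"
    "S \<in> sets lebesgue \<Longrightarrow> S \<subseteq> Q \<Longrightarrow> energy S f = (\<Sum>i\<in>UNIV. energy S (\<lambda>z. f z $ i))"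
proof -
  have ns: "(norm (f z))\<^sup>2 = (\<Sum>i\<in>UNIV. (norm (f z $ i))\<^sup>2)" for z
    by (simp add: power2_norm_eq_inner inner_vec_def[of "f z"])
  have "(\<lambda>z. indicator Q z *\<^sub>R f z) \<in> borel_measurable lebesgue"
  proof (rule borel_measurable_euclidean_space[THEN iffD2], rule ballI)
    fix b :: "real^'n^'m" assume "b \<in> Basis"
    then obtain i b' where b: "b = axis i b'" "b' \<in> Basis" unfolding Basis_vec_def by auto
    have "(\<lambda>z. indicator Q z *\<^sub>R f z $ i) \<in> borel_measurable lebesgue"
      using f[of i] by (simp add: L2_def set_borel_measurable_def)
    then have "(\<lambda>z. (indicator Q z *\<^sub>R f z $ i) \<bullet> b') \<in> borel_measurable lebesgue" by (intro borel_measurable_inner) auto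
    then show "(\<lambda>z. (indicator Q z *\<^sub>R f z) \<bullet> b) \<in> borel_measurable lebesgue" by (simp add: b inner_axis)
  qed
  moreover have "set_integrable lebesgue Q (\<lambda>z. (norm (f z))\<^sup>2)"
    unfolding ns set_integrable_def scaleR_sum_right using f
    by (intro Bochner_Integration.integrable_sum) (auto simp: L2_def set_integrable_def)
  ultimately show "f \<in> L2 Q" by (simp add: L2_def set_borel_measurable_def)
  assume S: "S \<in> sets lebesgue" "S \<subseteq> Q"
  show "energy S f = (\<Sum>i\<in>UNIV. energy S (\<lambda>z. f z $ i))"
    unfolding energy_eq ns sum_distrib_left
    by (rule Bochner_Integration.integral_sum) (rule L2_integrable[OF f S])
qed

lemma L2_subset:
  assumes F: "F \<in> L2 Q" and S: "S \<in> sets lebesgue" "S \<subseteq> Q"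
  shows "F \<in> L2 S"
proof -
  have "(\<lambda>z. indicator S z *\<^sub>R (indicator Q z *\<^sub>R F z)) \<in> borel_measurable lebesgue"
    by (rule borel_measurable_scaleR[OF borel_measurable_indicator[OF S(1)]])
      (use F in \<open>simp add: L2_def set_borel_measurable_def\<close>)
  moreover have "(\<lambda>z. indicator S z *\<^sub>R (indicator Q z *\<^sub>R F z)) = (\<lambda>z. indicator S z *\<^sub>R F z)"
  proof
    fix z show "indicator S z *\<^sub>R (indicator Q z *\<^sub>R F z) = indicator S z *\<^sub>R F z"
      using S by (cases "z \<in> S") auto
  qed
  moreover have "set_integrable lebesgue S (\<lambda>z. (norm (F z))\<^sup>2)"
    by (rule set_integrable_subset[OF _ S]) (use F in \<open>simp add: L2_def\<close>)
  ultimately show ?thesis by (simp add: L2_def set_borel_measurable_def)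
qed

section \<open>Cylinders inside the domain\<close>

text \<open>A cylinder extends only into the past, so its vertex may lie at the final time
  \<open>T\<close>. What limits the radius is the distance \<open>e\<close> to the lateral boundary
  and the earliest time \<open>s\<close>, both positive by compactness.\<close>

lemma QT_cyl_uniform:
  assumes \<Omega>: "open \<Omega>" and Q: "compact (closure Q')" "closure Q' \<subseteq> QT \<Omega> T"
  shows "\<exists>R>0. \<forall>z0\<in>Q'. cyl z0 R \<subseteq> QT \<Omega> T"
proof (cases "Q' = {}")
  case True then show ?thesis by (intro exI[of _ 1]) auto
next
  case False
  define X where "X = closure Q'"
  have X: "X \<noteq> {}" "compact X" "X \<subseteq> QT \<Omega> T" "Q' \<subseteq> X" using False Q closure_subset by (auto simp: X_def)
  have "compact (fst ` X)" by (intro compact_continuous_image continuous_intros X)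
  moreover have "fst ` X \<subseteq> \<Omega>" using X by (auto simp: QT_def)
  ultimately obtain e where e: "0 < e" "\<And>x. x \<in> fst ` X \<Longrightarrow> ball x e \<subseteq> \<Omega>"
    using compact_subset_open_imp_ball_epsilon_subset[of "fst ` X" \<Omega>] \<Omega> by (metis UN_subset_iff)
  have "compact (snd ` X)" by (intro compact_continuous_image continuous_intros X)
  then obtain s where s: "s \<in> snd ` X" "\<And>t. t \<in> snd ` X \<Longrightarrow> s \<le> t" using compact_attains_inf[of "snd ` X"] X(1) by auto
  have s0: "0 < s" using s(1) X by (auto simp: QT_def)
  define R where "R = min e (sqrt s)"
  have R: "0 < R" "R \<le> e" "R\<^sup>2 \<le> s"
  proof -
    show "0 < R" "R \<le> e" using e s0 by (auto simp: R_def)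
    have "R\<^sup>2 \<le> (sqrt s)\<^sup>2" using \<open>0 < R\<close> by (intro power_mono) (auto simp: R_def)
    then show "R\<^sup>2 \<le> s" using s0 by simp
  qed
  have "cyl z0 R \<subseteq> QT \<Omega> T" if z0: "z0 \<in> Q'" for z0
  proof
    fix z assume "z \<in> cyl z0 R"
    then have "fst z \<in> ball (fst z0) e" "snd z0 - R\<^sup>2 < snd z" "snd z \<le> snd z0" using R(2) by (auto simp: cyl_def)
    moreover have "ball (fst z0) e \<subseteq> \<Omega>" "s \<le> snd z0" using z0 X(4) e(2) s(2) by blast+
    moreover have "snd z0 \<le> T" using z0 X by (auto simp: QT_def)
    ultimately show "z \<in> QT \<Omega> T" using R(3) by (cases z) (auto simp: QT_def)
  qed
  then show ?thesis using R by blast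
qed

lemma bounded_QT: "bounded \<Omega> \<Longrightarrow> bounded (QT \<Omega> T)"
  unfolding QT_def by (intro bounded_Times bounded_subset[OF bounded_closed_interval[of 0 T]]) auto

text \<open>The weight is controlled on \<open>(0, d]\<close> only, so admissible radii must not
  exceed \<open>d\<close>. The cylinder contains points at every distance below \<open>R\<close>
  from its vertex, on the slice at the vertex time.\<close>

lemma cyl_le_diameter:
  fixes \<Omega> :: "(real^'n::finite) set"
  assumes "bounded \<Omega>" "0 < R" "cyl z0 R \<subseteq> QT \<Omega> T"
  shows "R \<le> diameter (QT \<Omega> T)"
proof (rule dense_le_bounded[OF assms(2)])
  fix s assume s: "0 < s" "s < R"
  define z where "z = (fst z0 + s *\<^sub>R axis undefined 1, snd z0)"
  have "z0 \<in> cyl z0 R" "z \<in> cyl z0 R" using s assms(2) by (auto simp: cyl_def mem_Times_iff z_def dist_norm)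
  then have "dist z0 z \<le> diameter (QT \<Omega> T)"
    using assms(3) by (intro diameter_bounded_bound bounded_QT assms(1)) auto
  moreover have "dist z0 z = s" using s by (simp add: z_def dist_prod_def dist_norm)
  ultimately show "s \<le> diameter (QT \<Omega> T)" by simp
qed

lemma elliptic_at:
  fixes a :: "'m::finite \<Rightarrow> 'm \<Rightarrow> 'n::finite \<Rightarrow> 'n \<Rightarrow> (real^'n) \<times> real \<Rightarrow> real"
  assumes "uniformly_elliptic \<Lambda> Q a" "z \<in> Q" "\<And>i j \<alpha> \<beta>. \<bar>a i j \<alpha> \<beta> z\<bar> \<le> M"
  shows "elliptic (inverse \<Lambda>) M (\<lambda>i j \<alpha> \<beta>. a i j \<alpha> \<beta> z)"
  unfolding elliptic_def
proof (intro conjI allI)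
  fix \<xi> :: "'m \<Rightarrow> 'n \<Rightarrow> real"
  define X :: "real^'n^'m" where "X = (\<chi> i \<alpha>. \<xi> i \<alpha>)"
  have "inverse \<Lambda> * (norm X)\<^sup>2 \<le> (\<Sum>i\<in>UNIV. \<Sum>j\<in>UNIV. \<Sum>\<alpha>\<in>UNIV. \<Sum>\<beta>\<in>UNIV. a i j \<alpha> \<beta> z * X $ i $ \<alpha> * X $ j $ \<beta>)"
    using assms(1,2) unfolding uniformly_elliptic_def by blast
  also have "\<dots> = (\<Sum>i\<in>UNIV. \<Sum>\<alpha>\<in>UNIV. \<Sum>j\<in>UNIV. \<Sum>\<beta>\<in>UNIV. a i j \<alpha> \<beta> z * \<xi> i \<alpha> * \<xi> j \<beta>)"
    unfolding X_def by (intro sum.cong refl) (simp, rule sum.swap)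
  also have "\<dots> = (\<Sum>i\<in>UNIV. \<Sum>\<alpha>\<in>UNIV. \<xi> i \<alpha> * (\<Sum>j\<in>UNIV. \<Sum>\<beta>\<in>UNIV. a i j \<alpha> \<beta> z * \<xi> j \<beta>))"
    by (simp add: sum_distrib_left mult_ac)
  finally show "inverse \<Lambda> * nsq \<xi> \<le> (\<Sum>i\<in>UNIV. \<Sum>\<alpha>\<in>UNIV. \<xi> i \<alpha> * (\<Sum>j\<in>UNIV. \<Sum>\<beta>\<in>UNIV. a i j \<alpha> \<beta> z * \<xi> j \<beta>))"
    by (simp add: norm_sq_matrix X_def)
qed (rule assms(3))

subsection \<open>Interior estimate\<close>

text \<open>The quotient in the hypothesis equals \<open>r powr \<gamma> / wgt lam \<phi> r\<close>;
  clearing denominators gives the form in which the iteration consumes it.\<close>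

lemma almost_increasing_wgt:
  assumes "almost_increasing_on {0<..d} (\<lambda>r. r powr (\<gamma> - lam) / (\<phi> r)\<^sup>2)" and \<phi>: "\<And>r. 0 < r \<Longrightarrow> r \<le> d \<Longrightarrow> 0 < \<phi> r"
  shows "\<exists>K\<ge>1. \<forall>s t. 0 < s \<longrightarrow> s \<le> t \<longrightarrow> t \<le> d \<longrightarrow> wgt lam \<phi> t * s powr \<gamma> \<le> K * t powr \<gamma> * wgt lam \<phi> s"
proof -
  obtain K where K: "1 \<le> K" "\<And>s t. s \<in> {0<..d} \<Longrightarrow> t \<in> {0<..d} \<Longrightarrow> s \<le> t \<Longrightarrow> s powr (\<gamma> - lam) / (\<phi> s)\<^sup>2 \<le> K * (t powr (\<gamma> - lam) / (\<phi> t)\<^sup>2)"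
    using assms(1) unfolding almost_increasing_on_def by blast
  have "wgt lam \<phi> t * s powr \<gamma> \<le> K * t powr \<gamma> * wgt lam \<phi> s" if st: "0 < s" "s \<le> t" "t \<le> d" for s t
  proof -
    have p: "0 < \<phi> s" "0 < \<phi> t" using \<phi> st by auto
    have w: "0 < wgt lam \<phi> s" "0 < wgt lam \<phi> t" using st p by (auto simp: wgt_def)
    have e: "r powr (\<gamma> - lam) / (\<phi> r)\<^sup>2 = r powr \<gamma> / wgt lam \<phi> r" for r by (simp add: wgt_def powr_diff)
    have "s powr \<gamma> / wgt lam \<phi> s \<le> K * (t powr \<gamma> / wgt lam \<phi> t)" using K(2)[of s t] st unfolding e by auto
    then show ?thesis using w by (simp add: field_simps)
  qed
  with K(1) show ?thesis by blast
qed

lemma exists_ratio: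
  fixes C m :: real
  assumes "0 < C" "0 < m" "\<gamma>' < real n + 2"
  shows "\<exists>\<tau>. 0 < \<tau> \<and> \<tau> < 1 \<and> \<tau> \<le> m \<and> C * \<tau> ^ (n + 2) \<le> 1/2 * \<tau> powr \<gamma>'"
proof -
  define \<delta> where "\<delta> = real n + 2 - \<gamma>'"
  have \<delta>: "0 < \<delta>" using assms by (simp add: \<delta>_def)
  \<comment> \<open>The last entry of the minimum solves
    \<open>C * \<tau> powr \<delta> = 1/2\<close>.\<close>
  define \<tau> where "\<tau> = min (1/2) (min m ((1 / (2 * C)) powr (1 / \<delta>)))"
  have \<tau>: "0 < \<tau>" "\<tau> < 1" "\<tau> \<le> m" using assms by (auto simp: \<tau>_def)
  have "\<tau> powr \<delta> \<le> ((1 / (2 * C)) powr (1 / \<delta>)) powr \<delta>" using \<delta> \<tau> by (intro powr_mono2) (auto simp: \<tau>_def)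
  also have "\<dots> = 1 / (2 * C)" using \<delta> assms by (simp add: powr_powr)
  finally have "C * \<tau> powr \<delta> \<le> 1/2" using assms by (simp add: field_simps)
  then have "C * \<tau> powr \<delta> * \<tau> powr \<gamma>' \<le> 1/2 * \<tau> powr \<gamma>'" by (intro mult_right_mono) auto
  moreover have "\<tau> powr \<delta> * \<tau> powr \<gamma>' = \<tau> ^ (n + 2)"
  proof -
    have "\<tau> powr \<delta> * \<tau> powr \<gamma>' = \<tau> powr (real (n + 2))" by (simp add: powr_add[symmetric] \<delta>_def add.commute)
    also have "\<dots> = \<tau> ^ (n + 2)" by (rule powr_realpow[OF \<tau>(1)])
    finally show ?thesis .
  qed
  ultimately show ?thesis using \<tau> by (metis mult.assoc)
qed

lemma coefficients_bounded:
  fixes a :: "'m::finite \<Rightarrow> 'm \<Rightarrow> 'n::finite \<Rightarrow> 'n \<Rightarrow> (real^'n) \<times> real \<Rightarrow> real"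
  assumes a: "\<And>i j \<alpha> \<beta>. continuous_on (closure Q) (a i j \<alpha> \<beta>)" and Q: "bounded Q"
  obtains M where "\<And>i j \<alpha> \<beta> z. z \<in> Q \<Longrightarrow> \<bar>a i j \<alpha> \<beta> z\<bar> \<le> M"
proof -
  have "\<exists>B. \<forall>z\<in>Q. \<bar>a i j \<alpha> \<beta> z\<bar> \<le> B" for i j \<alpha> \<beta>
  proof -
    have "compact (a i j \<alpha> \<beta> ` closure Q)" using Q by (intro compact_continuous_image a) (simp add: compact_closure)
    then have "bounded (a i j \<alpha> \<beta> ` closure Q)" by (rule compact_imp_bounded)
    then obtain B where "\<And>y. y \<in> a i j \<alpha> \<beta> ` closure Q \<Longrightarrow> norm y \<le> B" unfolding bounded_iff by blast
    then have "\<bar>a i j \<alpha> \<beta> z\<bar> \<le> B" if "z \<in> Q" for z using that closure_subset[of Q] by force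
    then show ?thesis by blast
  qed
  then obtain B where B: "\<And>i j \<alpha> \<beta> z. z \<in> Q \<Longrightarrow> \<bar>a i j \<alpha> \<beta> z\<bar> \<le> B i j \<alpha> \<beta>" by metis
  define M where "M = Max (range (\<lambda>(i, j, \<alpha>, \<beta>). B i j \<alpha> \<beta>))"
  have "B i j \<alpha> \<beta> \<le> M" for i j \<alpha> \<beta> unfolding M_def by (rule Max_ge) (auto intro!: image_eqI[of _ _ "(i, j, \<alpha>, \<beta>)"])
  then show thesis using B that by (meson order_trans)
qed

lemma coefficients_oscillation:
  fixes a :: "'m::finite \<Rightarrow> 'm \<Rightarrow> 'n::finite \<Rightarrow> 'n \<Rightarrow> (real^'n) \<times> real \<Rightarrow> real"
  assumes a: "\<And>i j \<alpha> \<beta>. continuous_on (closure Q) (a i j \<alpha> \<beta>)" and Q: "bounded Q" and \<omega>: "0 < \<omega>"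
  obtains R0 where "0 < R0" "\<And>i j \<alpha> \<beta> z0 R z. 0 < R \<Longrightarrow> R \<le> R0 \<Longrightarrow> cyl z0 R \<subseteq> Q \<Longrightarrow> z \<in> cyl z0 R \<Longrightarrow> \<bar>a i j \<alpha> \<beta> z - a i j \<alpha> \<beta> z0\<bar> \<le> \<omega>"
proof -
  have "\<exists>d>0. \<forall>z\<in>Q. \<forall>z'\<in>Q. dist z' z < d \<longrightarrow> \<bar>a i j \<alpha> \<beta> z' - a i j \<alpha> \<beta> z\<bar> \<le> \<omega>" for i j \<alpha> \<beta>
  proof -
    have "uniformly_continuous_on (closure Q) (a i j \<alpha> \<beta>)"
      using Q by (intro compact_uniformly_continuous a) (simp add: compact_closure)
    then obtain d where d: "0 < d" "\<And>z z'. z \<in> closure Q \<Longrightarrow> z' \<in> closure Q \<Longrightarrow> dist z' z < d \<Longrightarrow> dist (a i j \<alpha> \<beta> z') (a i j \<alpha> \<beta> z) < \<omega>"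
      using \<omega> unfolding uniformly_continuous_on_def by metis
    show ?thesis
    proof (intro exI[of _ d] conjI d(1) ballI impI)
      fix z z' assume "z \<in> Q" "z' \<in> Q" "dist z' z < d"
      then have "dist (a i j \<alpha> \<beta> z') (a i j \<alpha> \<beta> z) < \<omega>" using closure_subset[of Q] by (intro d(2)) auto
      then show "\<bar>a i j \<alpha> \<beta> z' - a i j \<alpha> \<beta> z\<bar> \<le> \<omega>" by (simp add: dist_real_def)
    qed
  qed
  then obtain D where D: "\<And>i j \<alpha> \<beta>. 0 < D i j \<alpha> \<beta>"
    "\<And>i j \<alpha> \<beta> z z'. z \<in> Q \<Longrightarrow> z' \<in> Q \<Longrightarrow> dist z' z < D i j \<alpha> \<beta> \<Longrightarrow> \<bar>a i j \<alpha> \<beta> z' - a i j \<alpha> \<beta> z\<bar> \<le> \<omega>" by metis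
  define m where "m = Min (range (\<lambda>(i, j, \<alpha>, \<beta>). D i j \<alpha> \<beta>))"
  have m: "0 < m" "m \<le> D i j \<alpha> \<beta>" for i j \<alpha> \<beta>
  proof -
    show "0 < m" unfolding m_def using D(1) by (subst Min_gr_iff) auto
    show "m \<le> D i j \<alpha> \<beta>" unfolding m_def by (rule Min_le) (auto intro!: image_eqI[of _ _ "(i, j, \<alpha>, \<beta>)"])
  qed
  \<comment> \<open>\<open>R \<le> 1\<close> gives \<open>R\<^sup>2 \<le> R\<close>, so points of
    the cylinder are less than \<open>2 * R \<le> m\<close> from its vertex.\<close>
  show thesis
  proof (rule that[of "min 1 (m / 2)"])
    show "0 < min 1 (m / 2)" using m by simp
    fix i j \<alpha> \<beta> R and z0 z :: "(real^'n) \<times> real"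
    assume R: "0 < R" "R \<le> min 1 (m / 2)" and c: "cyl z0 R \<subseteq> Q" and z: "z \<in> cyl z0 R"
    have z0: "z0 \<in> cyl z0 R" using R by (simp add: cyl_def mem_Times_iff)
    have R2: "R\<^sup>2 \<le> R" using R by (simp add: power2_eq_square mult_left_le)
    have "dist z z0 \<le> dist (fst z) (fst z0) + dist (snd z) (snd z0)"
      unfolding dist_prod_def by (rule sqrt_sum_squares_le_sum) auto
    also have "\<dots> < R + R"
      using z R2 R by (intro add_less_le_mono) (auto simp: cyl_def dist_commute dist_real_def)
    also have "\<dots> \<le> m" using R by simp
    finally have "dist z z0 < D i j \<alpha> \<beta>" using m(2)[of i j \<alpha> \<beta>] by linarith
    then show "\<bar>a i j \<alpha> \<beta> z - a i j \<alpha> \<beta> z0\<bar> \<le> \<omega>" using c z z0 by (intro D(2)) auto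
  qed
qed

text \<open>Decay for frozen coefficients, absorption of the oscillation and iteration combined.
  \<open>R0\<close> is fixed by the modulus of continuity of the coefficients, and neither
  \<open>R0\<close> nor \<open>C\<close> depends on the solution, the data or the vertex.\<close>

lemma small_cylinder_estimate:
  fixes \<Omega> :: "(real^'n::finite) set"
    and a :: "'m::finite \<Rightarrow> 'm \<Rightarrow> 'n \<Rightarrow> 'n \<Rightarrow> (real^'n) \<times> real \<Rightarrow> real"
  assumes \<Omega>: "bounded \<Omega>" and d: "d = diameter (QT \<Omega> T)" and pos: "\<forall>r. 0 < r \<longrightarrow> r \<le> d \<longrightarrow> 0 < \<phi> r"
    and a: "\<And>i j \<alpha> \<beta>. continuous_on (closure (QT \<Omega> T)) (a i j \<alpha> \<beta>)" and \<Lambda>: "0 < \<Lambda>" and ell: "uniformly_elliptic \<Lambda> (QT \<Omega> T) a"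
    and \<gamma>: "0 < \<gamma>" "\<gamma> < real CARD('n) + 2"
    and K: "1 \<le> K" "\<forall>s t. 0 < s \<longrightarrow> s \<le> t \<longrightarrow> t \<le> d \<longrightarrow> wgt lam \<phi> t * s powr \<gamma> \<le> K * t powr \<gamma> * wgt lam \<phi> s"
  shows "\<exists>R0>0. \<exists>C>0. \<forall>(u :: (real^'n) \<times> real \<Rightarrow> real^'m) Du (f :: (real^'n) \<times> real \<Rightarrow> real^'n^'m) F z0 R \<rho>.
     weak_spatial_gradient \<Omega> T u Du \<longrightarrow> Du \<in> L2 (QT \<Omega> T) \<longrightarrow> f \<in> L2 (QT \<Omega> T) \<longrightarrow> weak_solution \<Omega> T a f u Du \<longrightarrow>
     (\<forall>z0 r. 0 < r \<longrightarrow> cyl z0 r \<subseteq> QT \<Omega> T \<longrightarrow> energy (cyl z0 r) f \<le> F * wgt lam \<phi> r) \<longrightarrow> 0 \<le> F \<longrightarrow>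
     R \<le> R0 \<longrightarrow> cyl z0 R \<subseteq> QT \<Omega> T \<longrightarrow> 0 < \<rho> \<longrightarrow> \<rho> \<le> R \<longrightarrow>
     energy (cyl z0 \<rho>) Du \<le> C * (wgt lam \<phi> \<rho> / wgt lam \<phi> R * energy (cyl z0 R) Du) + C * (wgt lam \<phi> \<rho> * F)"
proof -
  let ?n = "CARD('n)"
  define N where "N = real (CARD('m) * ?n)"
  have N: "0 < N" by (simp add: N_def)
  obtain M where M: "\<And>i j \<alpha> \<beta> z. z \<in> QT \<Omega> T \<Longrightarrow> \<bar>a i j \<alpha> \<beta> z\<bar> \<le> M"
    by (rule coefficients_bounded[where a = a and Q = "QT \<Omega> T", OF a bounded_QT[OF \<Omega>]]) (rule that; assumption)
  have l: "0 < inverse \<Lambda>" using \<Lambda> by simp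
  obtain C0 where C0: "0 < C0" "\<And>\<tau>. 0 < \<tau> \<Longrightarrow> \<tau> \<le> 1 / (8 * real ?n) \<Longrightarrow> (\<exists>C'>0. \<forall>(A :: 'm::finite \<Rightarrow> 'm \<Rightarrow> 'n::finite \<Rightarrow> 'n \<Rightarrow> real) u Du g.
    elliptic (inverse \<Lambda>) M A \<longrightarrow> unit_sol A u Du g \<longrightarrow>
    SP (qcyl \<tau>) Du \<le> C0 * \<tau> ^ (?n + 2) * SP UNIV Du + C' * SP UNIV g)"
    using decay_weak[OF l, of M, where 'm = 'm and 'n = 'n] by (elim exE conjE) blast
  \<comment> \<open>An exponent strictly between: below \<open>n + 2\<close>, so that a small \<tau>
    beats the constant \<open>C0\<close>, and above \<gamma>, so that
    \<open>q = \<tau> powr \<gamma>'\<close> is strictly below \<open>p\<close> and the geometric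
    series converges.\<close>
  define \<gamma>' where "\<gamma>' = (\<gamma> + (real ?n + 2)) / 2"
  have \<gamma>': "\<gamma> < \<gamma>'" "\<gamma>' < real ?n + 2" using \<gamma> by (auto simp: \<gamma>'_def)
  obtain \<tau> where \<tau>: "0 < \<tau>" "\<tau> < 1" "\<tau> \<le> 1 / (8 * real ?n)" "C0 * \<tau> ^ (?n + 2) \<le> 1/2 * \<tau> powr \<gamma>'"
    using exists_ratio[OF C0(1) _ \<gamma>'(2), of "1 / (8 * real ?n)"] by auto
  obtain D2 where D2: "0 < D2" "\<And>(A :: 'm::finite \<Rightarrow> 'm \<Rightarrow> 'n::finite \<Rightarrow> 'n \<Rightarrow> real) u Du g.
    elliptic (inverse \<Lambda>) M A \<Longrightarrow> unit_sol A u Du g \<Longrightarrow>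
    SP (qcyl \<tau>) Du \<le> C0 * \<tau> ^ (?n + 2) * SP UNIV Du + D2 * SP UNIV g"
    using C0(2)[OF \<tau>(1,3)] by (elim exE conjE) blast
  define q where "q = \<tau> powr \<gamma>'"
  define p where "p = \<tau> powr \<gamma>"
  have q: "0 < q" "q < p" unfolding q_def p_def using \<tau> \<gamma>' by (auto intro: powr_less_mono')
  \<comment> \<open>The oscillation whose contribution to the energy factor is exactly
    \<open>q / 2\<close>; the other half is taken by \<open>C0 * \<tau> ^ (n + 2)\<close>.\<close>
  define \<omega> where "\<omega> = sqrt (q / (4 * N ^ 3 * D2))"
  have \<omega>: "0 < \<omega>" "D2 * (2 * N * (\<omega> * N)\<^sup>2) = q / 2"
  proof -
    show "0 < \<omega>" unfolding \<omega>_def using q N D2 by simp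
    have "\<omega>\<^sup>2 = q / (4 * N ^ 3 * D2)" unfolding \<omega>_def using q N D2 by simp
    then have "(\<omega> * N)\<^sup>2 = q / (4 * N * D2)"
      unfolding power_mult_distrib using N(1) by (simp add: power3_eq_cube power2_eq_square)
    then show "D2 * (2 * N * (\<omega> * N)\<^sup>2) = q / 2" using N(1) D2(1) by simp
  qed
  obtain R0 where R0: "0 < R0" "\<And>i j \<alpha> \<beta> z0 R z. 0 < R \<Longrightarrow> R \<le> R0 \<Longrightarrow> cyl z0 R \<subseteq> QT \<Omega> T \<Longrightarrow> z \<in> cyl z0 R \<Longrightarrow> \<bar>a i j \<alpha> \<beta> z - a i j \<alpha> \<beta> z0\<bar> \<le> \<omega>"
    by (rule coefficients_oscillation[where a = a and Q = "QT \<Omega> T", OF a bounded_QT[OF \<Omega>] \<omega>(1)]) (rule that; assumption)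
  define C where "C = K * K / p * (1 + 2 * D2 / (p - q))"
  have C: "0 < C" unfolding C_def using K q D2 by (intro mult_pos_pos add_pos_pos divide_pos_pos) auto
  show ?thesis
  proof (rule exI[of _ R0], rule conjI[OF R0(1)], rule exI[of _ C], rule conjI[OF C], intro allI impI)
    fix u :: "(real^'n) \<times> real \<Rightarrow> real^'m" and Du f :: "(real^'n) \<times> real \<Rightarrow> real^'n^'m" and F z0 R \<rho>
    assume wg: "weak_spatial_gradient \<Omega> T u Du" and L2: "Du \<in> L2 (QT \<Omega> T)" "f \<in> L2 (QT \<Omega> T)" and ws: "weak_solution \<Omega> T a f u Du"
      and F: "\<forall>z0 r. 0 < r \<longrightarrow> cyl z0 r \<subseteq> QT \<Omega> T \<longrightarrow> energy (cyl z0 r) f \<le> F * wgt lam \<phi> r" "0 \<le> F"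
      and R: "R \<le> R0" "cyl z0 R \<subseteq> QT \<Omega> T" and \<rho>: "0 < \<rho>" "\<rho> \<le> R"
    have R_pos: "0 < R" using \<rho> by simp
    have Rd: "R \<le> d" unfolding d by (rule cyl_le_diameter[OF \<Omega> R_pos R(2)])
    have z0: "z0 \<in> QT \<Omega> T" using R(2) R_pos by (auto simp: cyl_def mem_Times_iff)
    have w: "0 < wgt lam \<phi> s" if "0 < s" "s \<le> R" for s using spec[OF pos, of s] that Rd by (auto simp: wgt_def)
    have E: "elliptic (inverse \<Lambda>) M (\<lambda>i j \<alpha> \<beta>. a i j \<alpha> \<beta> z0)" by (rule elliptic_at[OF ell z0 M[OF z0]])
    have "energy (cyl z0 \<rho>) Du \<le> K * K / p * (wgt lam \<phi> \<rho> * (energy (cyl z0 R) Du / wgt lam \<phi> R + 2 * D2 * F / (p - q)))"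
    proof (rule iterate_decay[where \<Phi> = "\<lambda>s. energy (cyl z0 s) Du" and \<psi> = "wgt lam \<phi>" and R = R and \<tau> = \<tau> and \<gamma> = \<gamma>])
      show "energy (cyl z0 s) Du \<le> energy (cyl z0 t) Du" if "0 < s" "s \<le> t" "t \<le> R" for s t
        using cyl_mono[of s t z0] cyl_mono[of t R z0] that R(2) by (intro energy_mono[OF L2(1)]) auto
      show "wgt lam \<phi> t * s powr \<gamma> \<le> K * t powr \<gamma> * wgt lam \<phi> s" if "0 < s" "s \<le> t" "t \<le> R" for s t
        using K(2) that Rd by auto
      fix r assume r: "0 < r" "r \<le> R"
      have rQ: "cyl z0 r \<subseteq> QT \<Omega> T" using cyl_mono[of r R z0] r R(2) by auto
      have "energy (cyl z0 (\<tau> * r)) Du \<le> (C0 * \<tau> ^ (?n + 2) + D2 * (2 * N * (\<omega> * N)\<^sup>2)) * energy (cyl z0 r) Du + 2 * D2 * energy (cyl z0 r) f"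
      proof (rule one_step[OF r(1) \<tau>(1) _ rQ wg L2 ws])
        show "continuous_on (QT \<Omega> T) (a i j \<alpha> \<beta>)" for i j \<alpha> \<beta> by (rule continuous_on_subset[OF a closure_subset])
        show "\<bar>a i j \<alpha> \<beta> z - a i j \<alpha> \<beta> z0\<bar> \<le> \<omega>" if "z \<in> cyl z0 r" for i j \<alpha> \<beta> z
          by (rule R0(2)[OF r(1) _ rQ that]) (use r R in auto)
        show "SP (qcyl \<tau>) Du \<le> C0 * \<tau> ^ (?n + 2) * SP UNIV Du + D2 * SP UNIV g" if "unit_sol (\<lambda>i j \<alpha> \<beta>. a i j \<alpha> \<beta> z0) u Du g" for u Du g
          by (rule D2(2)[OF E that])
      qed (use \<tau> C0 D2 in \<open>auto simp: N_def\<close>)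
      also have "\<dots> \<le> q * energy (cyl z0 r) Du + 2 * D2 * (F * wgt lam \<phi> r)"
      proof (intro add_mono mult_right_mono mult_left_mono energy_nonneg)
        show "C0 * \<tau> ^ (?n + 2) + D2 * (2 * N * (\<omega> * N)\<^sup>2) \<le> q" unfolding \<omega>(2) using \<tau>(4) by (simp add: q_def)
        show "energy (cyl z0 r) f \<le> F * wgt lam \<phi> r" using F(1) r(1) rQ by blast
      qed (use D2(1) in simp)
      finally show "energy (cyl z0 (\<tau> * r)) Du \<le> q * energy (cyl z0 r) Du + 2 * D2 * F * wgt lam \<phi> r" by (simp add: mult.assoc)
    qed (use R_pos \<tau> q K D2 F \<gamma> w \<rho> in \<open>auto simp: p_def energy_nonneg\<close>)
    also have "\<dots> = K * K / p * (wgt lam \<phi> \<rho> / wgt lam \<phi> R * energy (cyl z0 R) Du) + K * K / p * (2 * D2 / (p - q)) * (wgt lam \<phi> \<rho> * F)"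
      by (simp add: algebra_simps)
    also have "\<dots> \<le> C * (wgt lam \<phi> \<rho> / wgt lam \<phi> R * energy (cyl z0 R) Du) + C * (wgt lam \<phi> \<rho> * F)"
    proof (intro add_mono mult_right_mono)
      have e: "0 \<le> K * K / p" "0 \<le> 2 * D2 / (p - q)" using K q D2 by auto
      show "K * K / p \<le> C" unfolding C_def using mult_left_mono[of 1 "1 + 2 * D2 / (p - q)" "K * K / p"] e by simp
      show "K * K / p * (2 * D2 / (p - q)) \<le> C" unfolding C_def using e by (intro mult_left_mono) auto
    qed (use w[OF \<rho>] w[OF R_pos] F(2) energy_nonneg[of "cyl z0 R" Du] in auto)
    finally show "energy (cyl z0 \<rho>) Du \<le> C * (wgt lam \<phi> \<rho> / wgt lam \<phi> R * energy (cyl z0 R) Du) + C * (wgt lam \<phi> \<rho> * F)" .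
  qed
qed

theorem theorem3p1:
  fixes \<Omega> :: "(real^'n) set" and T d lam \<gamma> \<Lambda> :: real
    and \<phi> :: "real \<Rightarrow> real"
    and a :: "'m::finite \<Rightarrow> 'm \<Rightarrow> 'n \<Rightarrow> 'n \<Rightarrow> (real^'n) \<times> real \<Rightarrow> real"
  assumes "open \<Omega>" and "connected \<Omega>" and "\<Omega> \<noteq> {}" and "bounded \<Omega>"
    and "0 < T"
    and "d = diameter (QT \<Omega> T)"
    and "continuous_on {0..d} \<phi>" and "\<And>r. 0 < r \<Longrightarrow> r \<le> d \<Longrightarrow> 0 < \<phi> r"
    and "0 \<le> lam" and "lam \<le> real CARD('n) + 2"
    and "\<And>i j \<alpha> \<beta>. continuous_on (closure (QT \<Omega> T)) (a i j \<alpha> \<beta>)"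
    and "0 < \<Lambda>" and "uniformly_elliptic \<Lambda> (QT \<Omega> T) a"
    and "lam < \<gamma>" and "\<gamma> < real CARD('n) + 2"
    and "almost_increasing_on {0<..d} (\<lambda>r. r powr (\<gamma> - lam) / (\<phi> r)\<^sup>2)"
  shows "\<exists>C>0. \<forall>(u :: (real^'n) \<times> real \<Rightarrow> real^'m) Du (f :: (real^'n) \<times> real \<Rightarrow> real^'n^'m).
    V2 \<Omega> T u Du \<and> (\<forall>i. (\<lambda>z. f z $ i) \<in> morrey_space d lam \<phi> (QT \<Omega> T)) \<and>
    weak_solution \<Omega> T a f u Du \<longrightarrow>
      (\<forall>Q'. Q' \<in> sets lebesgue \<and> compact (closure Q') \<and> closure Q' \<subseteq> QT \<Omega> T \<longrightarrow>
         Du \<in> morrey_space d lam \<phi> Q') \<and>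
      (\<forall>z0 \<rho> R. cyl z0 R \<subseteq> QT \<Omega> T \<and> 0 < \<rho> \<and> \<rho> \<le> R \<longrightarrow>
         (LINT z:cyl z0 \<rho>|lebesgue. (norm (Du z))\<^sup>2)
           \<le> C * ((\<rho> powr lam * (\<phi> \<rho>)\<^sup>2) / (R powr lam * (\<phi> R)\<^sup>2))
               * (LINT z:cyl z0 R|lebesgue. (norm (Du z))\<^sup>2)
             + C * (\<phi> \<rho>)\<^sup>2 * \<rho> powr lam * (morrey_norm d lam \<phi> (QT \<Omega> T) f)\<^sup>2)"
proof -
  note \<Omega> = assms(1,4) and d = assms(6) and \<phi> = assms(8)
  let ?Q = "QT \<Omega> T"
  have \<gamma>: "0 < \<gamma>" using assms(9,14) by linarith
  obtain K where K1: "1 \<le> K" and Kle: "\<forall>s t. 0 < s \<longrightarrow> s \<le> t \<longrightarrow> t \<le> d \<longrightarrow> wgt lam \<phi> t * s powr \<gamma> \<le> K * t powr \<gamma> * wgt lam \<phi> s"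
    using almost_increasing_wgt[OF assms(16) \<phi>] by blast
  note K = K1 Kle[rule_format]
  have pos: "\<forall>r. 0 < r \<longrightarrow> r \<le> d \<longrightarrow> 0 < \<phi> r" using \<phi> by blast
  have w: "0 < wgt lam \<phi> r" if "0 < r" "r \<le> d" for r using \<phi>[OF that] that by (simp add: wgt_def)
  obtain R0 C where R0: "0 < R0" and C: "0 < C" and
    small: "\<forall>(u :: (real^'n) \<times> real \<Rightarrow> real^'m) Du (f :: (real^'n) \<times> real \<Rightarrow> real^'n^'m) F z0 R \<rho>.
     weak_spatial_gradient \<Omega> T u Du \<longrightarrow> Du \<in> L2 ?Q \<longrightarrow> f \<in> L2 ?Q \<longrightarrow> weak_solution \<Omega> T a f u Du \<longrightarrow>
     (\<forall>z0 r. 0 < r \<longrightarrow> cyl z0 r \<subseteq> ?Q \<longrightarrow> energy (cyl z0 r) f \<le> F * wgt lam \<phi> r) \<longrightarrow> 0 \<le> F \<longrightarrow>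
     R \<le> R0 \<longrightarrow> cyl z0 R \<subseteq> ?Q \<longrightarrow> 0 < \<rho> \<longrightarrow> \<rho> \<le> R \<longrightarrow>
     energy (cyl z0 \<rho>) Du \<le> C * (wgt lam \<phi> \<rho> / wgt lam \<phi> R * energy (cyl z0 R) Du) + C * (wgt lam \<phi> \<rho> * F)"
    using small_cylinder_estimate[OF \<Omega>(2) d pos assms(11,12,13) \<gamma> assms(15) K1 Kle]
    by (elim exE conjE) (rule that; assumption)
  \<comment> \<open>Bounds the ratio of the weights at radii between \<open>R0\<close> and
    \<open>d\<close>; the summand 1 also covers equal radii.\<close>
  define K2 where "K2 = K * (1 + (d / R0) powr \<gamma>)"
  have K2: "1 \<le> K2" unfolding K2_def using K(1) mult_mono[of 1 K 1 "1 + (d / R0) powr \<gamma>"] by simp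
  have w_cmp: "wgt lam \<phi> R \<le> K2 * wgt lam \<phi> s" if s: "0 < s" "s \<le> R" "R \<le> d" "s = R \<or> R0 \<le> s" for s R
  proof -
    have ws: "0 < wgt lam \<phi> s" using w s by auto
    have K1: "K \<le> K2" unfolding K2_def using K(1) mult_left_mono[of 1 "1 + (d / R0) powr \<gamma>" K] by simp
    show ?thesis
    proof (cases "s = R")
      case True
      then show ?thesis using mult_right_mono[OF K2, of "wgt lam \<phi> s"] ws by simp
    next
      case False
      then have R0s: "R0 \<le> s" using s by auto
      have "wgt lam \<phi> R * s powr \<gamma> \<le> K * R powr \<gamma> * wgt lam \<phi> s" by (rule K(2)[OF s(1-3)])
      then have "wgt lam \<phi> R \<le> K * R powr \<gamma> * wgt lam \<phi> s / s powr \<gamma>" using s by (simp add: pos_le_divide_eq)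
      also have "\<dots> = K * (R / s) powr \<gamma> * wgt lam \<phi> s" using s by (simp add: powr_divide)
      also have "\<dots> \<le> K * (1 + (d / R0) powr \<gamma>) * wgt lam \<phi> s"
      proof (intro mult_right_mono mult_left_mono)
        have "(R / s) powr \<gamma> \<le> (d / R0) powr \<gamma>" using s R0s R0 \<gamma> by (intro powr_mono2 frac_le) auto
        then show "(R / s) powr \<gamma> \<le> 1 + (d / R0) powr \<gamma>" by simp
      qed (use K ws in auto)
      finally show ?thesis by (simp add: K2_def)
    qed
  qed
  \<comment> \<open>Collects \<open>C * K2\<close> (radii up to \<open>R0\<close>, weight
    transferred from \<open>R1\<close> to \<open>R\<close>), \<open>K2\<close> (larger radii) and
    \<open>C\<close> (the data term).\<close>
  define C' where "C' = C * K2 + K2 + C"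
  have C': "0 < C'" unfolding C'_def using C K2 by (intro add_pos_pos mult_pos_pos) auto
  show ?thesis
  proof (rule exI[of _ C'], rule conjI[OF C'], intro allI impI)
    fix u :: "(real^'n) \<times> real \<Rightarrow> real^'m" and Du f :: "(real^'n) \<times> real \<Rightarrow> real^'n^'m"
    assume hyp: "V2 \<Omega> T u Du \<and> (\<forall>i. (\<lambda>z. f z $ i) \<in> morrey_space d lam \<phi> ?Q) \<and> weak_solution \<Omega> T a f u Du"
    then have wg: "weak_spatial_gradient \<Omega> T u Du" and L2D: "Du \<in> L2 ?Q" and ws: "weak_solution \<Omega> T a f u Du"
      by (auto simp: V2_def)
    have fi: "(\<lambda>z. f z $ i) \<in> L2 ?Q"
      "bdd_above {morrey_quotient lam \<phi> ?Q (\<lambda>z. f z $ i) z0 \<rho> | z0 \<rho>. z0 \<in> ?Q \<and> 0 < \<rho> \<and> \<rho> \<le> d}" for i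
      using hyp by (auto simp: morrey_space_def)
    note L2f = L2_rows[OF fi(1)]
    define F where "F = (morrey_norm d lam \<phi> ?Q f)\<^sup>2"
    have mQ: "?Q \<in> sets lebesgue"
    proof -
      have "?Q \<in> sets borel" unfolding QT_def using \<Omega>(1) by (intro borel_Times) auto
      then show ?thesis by simp
    qed
    \<comment> \<open>The norm of \<open>f\<close> is a supremum and bounds its quotients only if
      they are bounded above, which the rows guarantee.\<close>
    have bdd: "bdd_above {morrey_quotient lam \<phi> ?Q f z0 \<rho> | z0 \<rho>. z0 \<in> ?Q \<and> 0 < \<rho> \<and> \<rho> \<le> d}"
    proof (rule morrey_bddI[OF _ \<phi>])
      fix z0 and \<rho> :: real assume z: "z0 \<in> ?Q" "0 < \<rho>" "\<rho> \<le> d"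
      have "energy (?Q \<inter> cyl z0 \<rho>) f = (\<Sum>i\<in>UNIV. energy (?Q \<inter> cyl z0 \<rho>) (\<lambda>z. f z $ i))"
        using mQ by (intro L2f(2) sets.Int) auto
      also have "\<dots> \<le> (\<Sum>i\<in>UNIV. (morrey_norm d lam \<phi> ?Q (\<lambda>z. f z $ i))\<^sup>2 * wgt lam \<phi> \<rho>)"
        by (intro sum_mono morrey_energy_le fi z \<phi>)
      finally show "energy (?Q \<inter> cyl z0 \<rho>) f \<le> (\<Sum>i\<in>UNIV. (morrey_norm d lam \<phi> ?Q (\<lambda>z. f z $ i))\<^sup>2) * wgt lam \<phi> \<rho>"
        by (simp add: sum_distrib_right)
    qed
    have F: "\<forall>z0 r. 0 < r \<longrightarrow> cyl z0 r \<subseteq> ?Q \<longrightarrow> energy (cyl z0 r) f \<le> F * wgt lam \<phi> r"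
    proof (intro allI impI)
      fix z0 and r :: real assume r: "0 < r" "cyl z0 r \<subseteq> ?Q"
      have rd: "r \<le> d" unfolding d by (rule cyl_le_diameter[OF \<Omega>(2) r])
      have "z0 \<in> ?Q" using r by (auto simp: cyl_def mem_Times_iff)
      from morrey_energy_le[OF bdd this r(1) rd \<phi>[OF r(1) rd]] show "energy (cyl z0 r) f \<le> F * wgt lam \<phi> r"
        using r(2) by (simp add: F_def Int_absorb1)
    qed
    have F0: "0 \<le> F" by (simp add: F_def)
    have main: "energy (cyl z0 \<rho>) Du \<le> C' * (wgt lam \<phi> \<rho> / wgt lam \<phi> R * energy (cyl z0 R) Du) + C' * (wgt lam \<phi> \<rho> * F)"
      if R: "cyl z0 R \<subseteq> ?Q" "0 < \<rho>" "\<rho> \<le> R" for z0 \<rho> R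
    proof -
      have Rp: "0 < R" using R by simp
      have Rd: "R \<le> d" unfolding d by (rule cyl_le_diameter[OF \<Omega>(2) Rp R(1)])
      have wR: "0 < wgt lam \<phi> R" and w\<rho>: "0 < wgt lam \<phi> \<rho>" using w R Rp Rd by auto
      define E where "E = wgt lam \<phi> \<rho> / wgt lam \<phi> R * energy (cyl z0 R) Du"
      have E: "0 \<le> E" unfolding E_def using wR w\<rho> energy_nonneg by (intro mult_nonneg_nonneg) auto
      have wF: "0 \<le> wgt lam \<phi> \<rho> * F" using w\<rho> F0 by simp
      \<comment> \<open>The small-radius estimate is applied on \<open>R1\<close>, after which
        \<open>w_cmp\<close> trades its weight for the one at \<open>R\<close>.\<close>
      define R1 where "R1 = min R R0"
      have R1: "0 < R1" "R1 \<le> R" "R1 \<le> R0" "R1 = R \<or> R0 \<le> R1" using Rp R0 by (auto simp: R1_def)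
      have "energy (cyl z0 \<rho>) Du \<le> C * K2 * E + K2 * E + C * (wgt lam \<phi> \<rho> * F)"
      proof (cases "\<rho> \<le> R1")
        case True
        have R1Q: "cyl z0 R1 \<subseteq> cyl z0 R" "cyl z0 R1 \<subseteq> ?Q" using cyl_mono[of R1 R z0] R1 R(1) by auto
        have w1: "0 < wgt lam \<phi> R1" using w R1 Rd by auto
        have "energy (cyl z0 \<rho>) Du \<le> C * (wgt lam \<phi> \<rho> / wgt lam \<phi> R1 * energy (cyl z0 R1) Du) + C * (wgt lam \<phi> \<rho> * F)"
          by (rule small[rule_format, OF wg L2D L2f(1) ws _ F0 R1(3) R1Q(2) R(2) True]) (use F in blast)
        also have "wgt lam \<phi> \<rho> / wgt lam \<phi> R1 * energy (cyl z0 R1) Du \<le> K2 * wgt lam \<phi> \<rho> / wgt lam \<phi> R * energy (cyl z0 R) Du"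
        proof (intro mult_mono)
          have "wgt lam \<phi> \<rho> * wgt lam \<phi> R \<le> wgt lam \<phi> \<rho> * (K2 * wgt lam \<phi> R1)"
            using w_cmp[OF R1(1,2) Rd R1(4)] w\<rho> by (intro mult_left_mono) auto
          then show "wgt lam \<phi> \<rho> / wgt lam \<phi> R1 \<le> K2 * wgt lam \<phi> \<rho> / wgt lam \<phi> R"
            using w1 wR by (simp add: divide_le_eq le_divide_eq mult_ac)
          show "energy (cyl z0 R1) Du \<le> energy (cyl z0 R) Du" by (rule energy_mono[OF L2D _ _ R1Q(1) R(1)]) auto
        qed (use K2 w\<rho> wR energy_nonneg in auto)
        also have "K2 * wgt lam \<phi> \<rho> / wgt lam \<phi> R * energy (cyl z0 R) Du = K2 * E" by (simp add: E_def)
        finally have "energy (cyl z0 \<rho>) Du \<le> C * (K2 * E) + C * (wgt lam \<phi> \<rho> * F)" using C by simp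
        then show ?thesis using mult_right_mono[OF K2 E] E by (simp add: mult.assoc)
      next
        case False
        \<comment> \<open>Both radii lie between \<open>R0\<close> and \<open>d\<close>, so the
          weights are comparable and monotonicity of the energy is enough.\<close>
        then have "R0 \<le> \<rho>" using R by (auto simp: R1_def min_def split: if_splits)
        then have "wgt lam \<phi> R \<le> K2 * wgt lam \<phi> \<rho>" using R(2,3) Rd by (intro w_cmp) auto
        then have "1 \<le> K2 * (wgt lam \<phi> \<rho> / wgt lam \<phi> R)" using wR by (simp add: le_divide_eq)
        then have "1 * energy (cyl z0 R) Du \<le> K2 * (wgt lam \<phi> \<rho> / wgt lam \<phi> R) * energy (cyl z0 R) Du"
          by (intro mult_right_mono energy_nonneg)
        then have "energy (cyl z0 R) Du \<le> K2 * E" by (simp add: E_def mult.assoc)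
        moreover have "energy (cyl z0 \<rho>) Du \<le> energy (cyl z0 R) Du"
          using cyl_mono[of \<rho> R z0] R by (intro energy_mono[OF L2D]) auto
        moreover have "0 \<le> C * K2 * E" using C K2 E by auto
        moreover have "0 \<le> C * (wgt lam \<phi> \<rho> * F)" using C wF by auto
        ultimately show ?thesis by linarith
      qed
      also have "\<dots> \<le> C' * E + C' * (wgt lam \<phi> \<rho> * F)"
        unfolding C'_def using C K2 E wF mult_nonneg_nonneg[of C E] mult_nonneg_nonneg[of "C * K2 + K2" "wgt lam \<phi> \<rho> * F"]
        by (simp add: algebra_simps)
      finally show ?thesis by (simp add: E_def)
    qed
    show "(\<forall>Q'. Q' \<in> sets lebesgue \<and> compact (closure Q') \<and> closure Q' \<subseteq> ?Q \<longrightarrow> Du \<in> morrey_space d lam \<phi> Q') \<and>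
      (\<forall>z0 \<rho> R. cyl z0 R \<subseteq> ?Q \<and> 0 < \<rho> \<and> \<rho> \<le> R \<longrightarrow>
         (LINT z:cyl z0 \<rho>|lebesgue. (norm (Du z))\<^sup>2)
           \<le> C' * ((\<rho> powr lam * (\<phi> \<rho>)\<^sup>2) / (R powr lam * (\<phi> R)\<^sup>2))
               * (LINT z:cyl z0 R|lebesgue. (norm (Du z))\<^sup>2)
             + C' * (\<phi> \<rho>)\<^sup>2 * \<rho> powr lam * (morrey_norm d lam \<phi> ?Q f)\<^sup>2)"
    proof (intro conjI allI impI)
      fix z0 \<rho> R assume "cyl z0 R \<subseteq> ?Q \<and> 0 < \<rho> \<and> \<rho> \<le> R"
      then have "energy (cyl z0 \<rho>) Du \<le> C' * (wgt lam \<phi> \<rho> / wgt lam \<phi> R * energy (cyl z0 R) Du) + C' * (wgt lam \<phi> \<rho> * F)"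
        by (intro main) auto
      then show "(LINT z:cyl z0 \<rho>|lebesgue. (norm (Du z))\<^sup>2)
           \<le> C' * ((\<rho> powr lam * (\<phi> \<rho>)\<^sup>2) / (R powr lam * (\<phi> R)\<^sup>2))
               * (LINT z:cyl z0 R|lebesgue. (norm (Du z))\<^sup>2)
             + C' * (\<phi> \<rho>)\<^sup>2 * \<rho> powr lam * (morrey_norm d lam \<phi> ?Q f)\<^sup>2"
        by (simp add: energy_def wgt_def F_def mult_ac)
    next
      fix Q' assume Q': "Q' \<in> sets lebesgue \<and> compact (closure Q') \<and> closure Q' \<subseteq> ?Q"
      then have Q'Q: "Q' \<subseteq> ?Q" using closure_subset by blast
      obtain R where R: "0 < R" "\<And>z0. z0 \<in> Q' \<Longrightarrow> cyl z0 R \<subseteq> ?Q"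
        using QT_cyl_uniform[OF \<Omega>(1)] Q' by blast
      define J where "J = energy ?Q Du"
      have J: "0 \<le> J" by (simp add: J_def energy_nonneg)
      have sub: "energy (Q' \<inter> cyl z0 \<rho>) Du \<le> J" for z0 \<rho>
        unfolding J_def using Q' Q'Q mQ by (intro energy_mono[OF L2D]) auto
      have "bdd_above {morrey_quotient lam \<phi> Q' Du z0 \<rho> | z0 \<rho>. z0 \<in> Q' \<and> 0 < \<rho> \<and> \<rho> \<le> d}"
      proof (rule morrey_bddI[OF _ \<phi>])
        fix z0 and \<rho> :: real assume z: "z0 \<in> Q'" "0 < \<rho>" "\<rho> \<le> d"
        have RQ: "cyl z0 R \<subseteq> ?Q" by (rule R(2)[OF z(1)])
        have Rd: "R \<le> d" unfolding d by (rule cyl_le_diameter[OF \<Omega>(2) R(1) RQ])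
        have wR: "0 < wgt lam \<phi> R" and w\<rho>: "0 < wgt lam \<phi> \<rho>" and wd: "0 < wgt lam \<phi> d" using w R Rd z by auto
        \<comment> \<open>Radii up to \<open>R\<close> are governed by the local estimate; since
          \<open>R\<close> serves all points of \<open>Q'\<close>, this bound is independent of
          \<open>z0\<close>.\<close>
        define B1 where "B1 = C' / wgt lam \<phi> R * J + C' * F"
        \<comment> \<open>For radii above \<open>R\<close> the total energy \<open>J\<close>
          suffices: the weight there is bounded below by comparison with its value at
          \<open>d\<close>.\<close>
        define B2 where "B2 = J * K * (d / R) powr \<gamma> / wgt lam \<phi> d"
        have B: "0 \<le> B1" "0 \<le> B2" unfolding B1_def B2_def using C' wR wd J F0 K by auto
        have "energy (Q' \<inter> cyl z0 \<rho>) Du \<le> B1 * wgt lam \<phi> \<rho> + B2 * wgt lam \<phi> \<rho>"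
        proof (cases "\<rho> \<le> R")
          case True
          have cQ: "cyl z0 \<rho> \<subseteq> ?Q" using cyl_mono[of \<rho> R z0] z True RQ by auto
          have "energy (Q' \<inter> cyl z0 \<rho>) Du \<le> energy (cyl z0 \<rho>) Du"
            using Q' cQ by (intro energy_mono[OF L2D]) auto
          also have "\<dots> \<le> C' * (wgt lam \<phi> \<rho> / wgt lam \<phi> R * energy (cyl z0 R) Du) + C' * (wgt lam \<phi> \<rho> * F)"
            by (rule main[OF RQ z(2) True])
          also have "\<dots> \<le> C' * (wgt lam \<phi> \<rho> / wgt lam \<phi> R * J) + C' * (wgt lam \<phi> \<rho> * F)"
            unfolding J_def using C' wR w\<rho> mQ RQ
            by (intro add_right_mono mult_left_mono energy_mono[OF L2D]) auto
          also have "\<dots> = B1 * wgt lam \<phi> \<rho>" by (simp add: B1_def algebra_simps)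
          finally show ?thesis using B(2) w\<rho> by (simp add: add_increasing2)
        next
          case False
          have "wgt lam \<phi> d * \<rho> powr \<gamma> \<le> K * d powr \<gamma> * wgt lam \<phi> \<rho>" using K(2)[OF z(2,3)] by simp
          then have "wgt lam \<phi> d \<le> K * d powr \<gamma> * wgt lam \<phi> \<rho> / \<rho> powr \<gamma>" using z by (simp add: pos_le_divide_eq)
          also have "\<dots> = K * (d / \<rho>) powr \<gamma> * wgt lam \<phi> \<rho>" using z by (simp add: powr_divide)
          also have "\<dots> \<le> K * (d / R) powr \<gamma> * wgt lam \<phi> \<rho>"
            using z False R(1) \<gamma> K w\<rho> by (intro mult_right_mono mult_left_mono powr_mono2 divide_left_mono) auto
          finally have "J * wgt lam \<phi> d \<le> J * (K * (d / R) powr \<gamma> * wgt lam \<phi> \<rho>)" using J by (intro mult_left_mono)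
          then have "J \<le> B2 * wgt lam \<phi> \<rho>" unfolding B2_def using wd by (simp add: pos_le_divide_eq mult_ac)
          then show ?thesis using sub[of z0 \<rho>] B(1) w\<rho> by (simp add: add_increasing)
        qed
        also have "\<dots> \<le> (C' / wgt lam \<phi> R * J + C' * F + J * K * (d / R) powr \<gamma> / wgt lam \<phi> d) * wgt lam \<phi> \<rho>"
          unfolding B1_def B2_def by (simp add: algebra_simps)
        finally show "energy (Q' \<inter> cyl z0 \<rho>) Du \<le> (C' / wgt lam \<phi> R * J + C' * F + J * K * (d / R) powr \<gamma> / wgt lam \<phi> d) * wgt lam \<phi> \<rho>" .
      qed
      moreover have "Du \<in> L2 Q'" using L2_subset[OF L2D] Q' Q'Q by blast
      ultimately show "Du \<in> morrey_space d lam \<phi> Q'" by (simp add: morrey_space_def)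
    qed
  qed
qed

end
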